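(* Let $\mathfrak M$ be a countable principal model of $\mathsf{RCA}_0+\Sigma^0_2\text{-}\mathrm{WPHP}$. If $T$ is a regular $\Delta^0_2(\mathfrak M)$ tree with $\mu([T])\ge 1/2+\epsilon$, where $\epsilon\in\mathbb Q$ with $0<\epsilon<1/2$, then there exists $X\in[T]$ such that $\mathfrak M[X]$ is also a model of $\mathsf{RCA}_0+\Sigma^0_2\text{-}\mathrm{WPHP}$.
   Context: $\mathsf{RCA}_0$ is the usual base system of second-order arithmetic; models are $\mathfrak M=(M,\mathcal S)$ with $\mathcal S$ a collection of subsets of $M$. $\mathfrak M$-finite sets are those coded by an element of $M$ via binary expansion; $|F|$ is cardinality in $\mathfrak M$; numbers $x$ are identified with $\{v:v<x\}$. $\Sigma^0_2\text{-}\mathrm{WPHP}$: for no $x\ge1$ is there a $\Sigma^0_2$-definable (with parameters) injection from $2x$ into $x$. For $X,Y\subseteq M$, $X\le_{\mathrm T} Y$ means the function $n\mapsto X\upharpoonright n$ (the code of the first $n$ bits of $X$) is $\Delta^0_1$-definable in $M$ from $Y$. $\mathfrak M$ is principal if $\mathcal S=\{Y\subseteq M: Y\le_{\mathrm T}Z\}$ for some $Z\subseteq M$. For $X\subseteq M$, $\mathfrak M[X]=(M,\{Y\subseteq M: Y\le_{\mathrm T} Z\oplus X$ for some $Z\in\mathcal S\})$. A tree is a set of finite binary strings closed under initial segments; a $\Delta^0_2(\mathfrak M)$ tree is one definable over $\mathfrak M$ by both a $\Sigma^0_2$ and a $\Pi^0_2$ formula with parameters; it is regular if $(T\cap2^i:i<n)$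 is $\mathfrak M$-finite for every $n\in M$. $[T]$ is the set of $X\subseteq M$ all of whose finite initial segments are in $T$. "$\mu([T])\ge r$" means for each $n\in M$ there is an $\mathfrak M$-finite $S\subseteq T\cap2^n$ with $|S|\ge r2^n$. *)

theory Defs
  imports Main "HOL-Library.Countable_Set"
begin

text \<open>A model M = (M, S) of second-order arithmetic: the first-order part is a
structure on the type 'm (the whole type is the universe M), S is the
collection of second-order objects.\<close>

record 'm struc =
  szero :: 'm
  sone  :: 'm
  sadd  :: "'m \<Rightarrow> 'm \<Rightarrow> 'm"
  smul  :: "'m \<Rightarrow> 'm \<Rightarrow> 'm"
  sless :: "'m \<Rightarrow> 'm \<Rightarrow> bool"

datatype trm = Var nat | Zero | One | Plus trm trm | Times trm trm

datatype fm =
    Eq trm trm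
  | Less trm trm
  | Mem trm nat
  | Neg fm
  | Conj fm fm
  | Disj fm fm
  | Imp fm fm
  | Ex nat fm
  | All nat fm
  | BEx nat trm fm
  | BAll nat trm fm

fun ev :: "'m struc \<Rightarrow> (nat \<Rightarrow> 'm) \<Rightarrow> trm \<Rightarrow> 'm" where
  "ev A e (Var i) = e i"
| "ev A e Zero = szero A"
| "ev A e One = sone A"
| "ev A e (Plus s t) = sadd A (ev A e s) (ev A e t)"
| "ev A e (Times s t) = smul A (ev A e s) (ev A e t)"

fun sat :: "'m struc \<Rightarrow> (nat \<Rightarrow> 'm set) \<Rightarrow> (nat \<Rightarrow> 'm) \<Rightarrow> fm \<Rightarrow> bool" where
  "sat A V e (Eq s t) = (ev A e s = ev A e t)"
| "sat A V e (Less s t) = sless A (ev A e s) (ev A e t)"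
| "sat A V e (Mem t X) = (ev A e t \<in> V X)"
| "sat A V e (Neg \<phi>) = (\<not> sat A V e \<phi>)"
| "sat A V e (Conj \<phi> \<psi>) = (sat A V e \<phi> \<and> sat A V e \<psi>)"
| "sat A V e (Disj \<phi> \<psi>) = (sat A V e \<phi> \<or> sat A V e \<psi>)"
| "sat A V e (Imp \<phi> \<psi>) = (sat A V e \<phi> \<longrightarrow> sat A V e \<psi>)"
| "sat A V e (Ex x \<phi>) = (\<exists>a. sat A V (e(x := a)) \<phi>)"
| "sat A V e (All x \<phi>) = (\<forall>a. sat A V (e(x := a)) \<phi>)"
| "sat A V e (BEx x t \<phi>) = (\<exists>a. sless A a (ev A e t) \<and> sat A V (e(x := a)) \<phi>)"
| "sat A V e (BAll x t \<phi>) = (\<forall>a. sless A a (ev A e t) \<longrightarrow> sat A V (e(x := a)) \<phi>)"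

fun bounded :: "fm \<Rightarrow> bool" where
  "bounded (Eq s t) = True"
| "bounded (Less s t) = True"
| "bounded (Mem t X) = True"
| "bounded (Neg \<phi>) = bounded \<phi>"
| "bounded (Conj \<phi> \<psi>) = (bounded \<phi> \<and> bounded \<psi>)"
| "bounded (Disj \<phi> \<psi>) = (bounded \<phi> \<and> bounded \<psi>)"
| "bounded (Imp \<phi> \<psi>) = (bounded \<phi> \<and> bounded \<psi>)"
| "bounded (Ex x \<phi>) = False"
| "bounded (All x \<phi>) = False"
| "bounded (BEx x t \<phi>) = bounded \<phi>"
| "bounded (BAll x t \<phi>) = bounded \<phi>"

inductive Sigma :: "nat \<Rightarrow> fm \<Rightarrow> bool" and Pi :: "nat \<Rightarrow> fm \<Rightarrow> bool" where
  Sigma0: "bounded \<phi> \<Longrightarrow> Sigma 0 \<phi>"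
| Pi0: "bounded \<phi> \<Longrightarrow> Pi 0 \<phi>"
| SigmaPi: "Pi n \<phi> \<Longrightarrow> Sigma (Suc n) \<phi>"
| SigmaEx: "Sigma (Suc n) \<phi> \<Longrightarrow> Sigma (Suc n) (Ex x \<phi>)"
| PiSigma: "Sigma n \<phi> \<Longrightarrow> Pi (Suc n) \<phi>"
| PiAll: "Pi (Suc n) \<phi> \<Longrightarrow> Pi (Suc n) (All x \<phi>)"

definition le :: "'m struc \<Rightarrow> 'm \<Rightarrow> 'm \<Rightarrow> bool" where
  "le A a b \<longleftrightarrow> sless A a b \<or> a = b"

definition basic_axioms :: "'m struc \<Rightarrow> bool" where
  "basic_axioms A \<longleftrightarrow>
     (\<forall>n. sadd A n (sone A) \<noteq> szero A) \<and>
     (\<forall>m n. sadd A m (sone A) = sadd A n (sone A) \<longrightarrow> m = n) \<and>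
     (\<forall>m. sadd A m (szero A) = m) \<and>
     (\<forall>m n. sadd A m (sadd A n (sone A)) = sadd A (sadd A m n) (sone A)) \<and>
     (\<forall>m. smul A m (szero A) = szero A) \<and>
     (\<forall>m n. smul A m (sadd A n (sone A)) = sadd A (smul A m n) m) \<and>
     (\<forall>m. \<not> sless A m (szero A)) \<and>
     (\<forall>m n. sless A m (sadd A n (sone A)) \<longleftrightarrow> sless A m n \<or> m = n)"

definition sigma1_induction :: "'m struc \<Rightarrow> 'm set set \<Rightarrow> bool" where
  "sigma1_induction A S \<longleftrightarrow>
     (\<forall>\<phi> V e x. Sigma 1 \<phi> \<longrightarrow> (\<forall>i. V i \<in> S) \<longrightarrow>
        (sat A V (e(x := szero A)) \<phi> \<and>
         (\<forall>n. sat A V (e(x := n)) \<phi> \<longrightarrow> sat A V (e(x := sadd A n (sone A))) \<phi>))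
        \<longrightarrow> (\<forall>n. sat A V (e(x := n)) \<phi>))"

definition delta1_comprehension :: "'m struc \<Rightarrow> 'm set set \<Rightarrow> bool" where
  "delta1_comprehension A S \<longleftrightarrow>
     (\<forall>\<phi> \<psi> V e x. Sigma 1 \<phi> \<longrightarrow> Pi 1 \<psi> \<longrightarrow> (\<forall>i. V i \<in> S) \<longrightarrow>
        (\<forall>n. sat A V (e(x := n)) \<phi> \<longleftrightarrow> sat A V (e(x := n)) \<psi>)
        \<longrightarrow> {n. sat A V (e(x := n)) \<phi>} \<in> S)"

definition rca0 :: "'m struc \<Rightarrow> 'm set set \<Rightarrow> bool" where
  "rca0 A S \<longleftrightarrow> basic_axioms A \<and> sigma1_induction A S \<and> delta1_comprehension A S"

definition wphp2 :: "'m struc \<Rightarrow> 'm set set \<Rightarrow> bool" where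
  "wphp2 A S \<longleftrightarrow>
     \<not> (\<exists>\<phi> V e i j x. Sigma 2 \<phi> \<and> i \<noteq> j \<and> (\<forall>k. V k \<in> S) \<and> le A (sone A) x \<and>
          (let R = (\<lambda>a b. sat A V (e(i := a, j := b)) \<phi>); x2 = sadd A x x in
            (\<forall>a. sless A a x2 \<longrightarrow> (\<exists>b. sless A b x \<and> R a b)) \<and>
            (\<forall>a b b'. sless A a x2 \<longrightarrow> R a b \<longrightarrow> R a b' \<longrightarrow> b = b') \<and>
            (\<forall>a a' b. sless A a x2 \<longrightarrow> sless A a' x2 \<longrightarrow> R a b \<longrightarrow> R a' b \<longrightarrow> a = a')))"

text \<open>Goedel's beta function: beta(a,b,i) = a mod (1 + (i+1) b), as a relation.\<close>
definition beta :: "'m struc \<Rightarrow> 'm \<Rightarrow> 'm \<Rightarrow> 'm \<Rightarrow> 'm \<Rightarrow> bool" where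
  "beta A a b i r \<longleftrightarrow>
     (let m = sadd A (sone A) (smul A (sadd A i (sone A)) b) in
       sless A r m \<and> (\<exists>q. a = sadd A (smul A q m) r))"

text \<open>y = 2^v (Sigma_1 definition via beta-coded sequences; correct in models of I Sigma_1).\<close>
definition pow2 :: "'m struc \<Rightarrow> 'm \<Rightarrow> 'm \<Rightarrow> bool" where
  "pow2 A v y \<longleftrightarrow> (\<exists>a b. beta A a b (szero A) (sone A) \<and>
      (\<forall>i r. sless A i v \<longrightarrow> beta A a b i r \<longrightarrow> beta A a b (sadd A i (sone A)) (sadd A r r)) \<and>
      beta A a b v y)"

definition bit :: "'m struc \<Rightarrow> 'm \<Rightarrow> 'm \<Rightarrow> bool" where
  "bit A c v \<longleftrightarrow> (\<exists>y q r. pow2 A v y \<and> c = sadd A (smul A q y) r \<and> sless A r y \<and>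
      (\<exists>k. q = sadd A (sadd A k k) (sone A)))"

definition coded :: "'m struc \<Rightarrow> 'm \<Rightarrow> 'm set" where
  "coded A c = {v. bit A c v}"

definition mfinite :: "'m struc \<Rightarrow> 'm set \<Rightarrow> bool" where
  "mfinite A F \<longleftrightarrow> (\<exists>c. F = coded A c)"

text \<open>k is the number of elements (in M) of the finite set coded by c: count the
digits below c (all digits of c are below c).\<close>
definition mcard :: "'m struc \<Rightarrow> 'm \<Rightarrow> 'm \<Rightarrow> bool" where
  "mcard A c k \<longleftrightarrow> (\<exists>a b. beta A a b (szero A) (szero A) \<and>
      (\<forall>i r. sless A i c \<longrightarrow> beta A a b i r \<longrightarrow>
          beta A a b (sadd A i (sone A)) (if bit A c i then sadd A r (sone A) else r)) \<and>
      beta A a b c k)"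

text \<open>A binary string sigma of length n is coded by 2^n + sum_{i<n, sigma(i)=1} 2^i;
s codes a string of length n iff 2^n \<le> s < 2^(n+1); its i-th bit is bit s i.\<close>
definition strlen :: "'m struc \<Rightarrow> 'm \<Rightarrow> 'm \<Rightarrow> bool" where
  "strlen A s n \<longleftrightarrow> (\<exists>y. pow2 A n y \<and> le A y s \<and> sless A s (sadd A y y))"

definition prefix_of :: "'m struc \<Rightarrow> 'm \<Rightarrow> 'm \<Rightarrow> bool" where
  "prefix_of A \<tau> \<sigma> \<longleftrightarrow> (\<exists>m n. strlen A \<tau> m \<and> strlen A \<sigma> n \<and> le A m n \<and>
      (\<forall>i. sless A i m \<longrightarrow> (bit A \<tau> i \<longleftrightarrow> bit A \<sigma> i)))"

definition is_tree :: "'m struc \<Rightarrow> 'm set \<Rightarrow> bool" where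
  "is_tree A T \<longleftrightarrow> (\<forall>s\<in>T. \<exists>n. strlen A s n) \<and>
      (\<forall>\<sigma>\<in>T. \<forall>\<tau>. prefix_of A \<tau> \<sigma> \<longrightarrow> \<tau> \<in> T)"

definition delta02 :: "'m struc \<Rightarrow> 'm set set \<Rightarrow> 'm set \<Rightarrow> bool" where
  "delta02 A S T \<longleftrightarrow> (\<exists>\<phi> \<psi> V e x. Sigma 2 \<phi> \<and> Pi 2 \<psi> \<and> (\<forall>i. V i \<in> S) \<and>
      (\<forall>s. s \<in> T \<longleftrightarrow> sat A V (e(x := s)) \<phi>) \<and>
      (\<forall>s. s \<in> T \<longleftrightarrow> sat A V (e(x := s)) \<psi>))"

text \<open>Regular: (T \<inter> 2^i : i < n) is M-finite for all n; the sequence is coded by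
the M-finite set of all strings of T of length < n (each string carries its length).\<close>
definition regular :: "'m struc \<Rightarrow> 'm set \<Rightarrow> bool" where
  "regular A T \<longleftrightarrow> (\<forall>n. mfinite A {s \<in> T. \<exists>m. strlen A s m \<and> sless A m n})"

definition in_paths :: "'m struc \<Rightarrow> 'm set \<Rightarrow> 'm set \<Rightarrow> bool" where
  "in_paths A T X \<longleftrightarrow> (\<forall>n. \<exists>s\<in>T. strlen A s n \<and>
      (\<forall>i. sless A i n \<longrightarrow> (bit A s i \<longleftrightarrow> i \<in> X)))"

text \<open>mu([T]) \<ge> a/b (a, b \<in> M, b > 0): for each n there is an M-finite S \<subseteq> T \<inter> 2^n
with |S| \<ge> (a/b) 2^n, i.e. b |S| \<ge> a 2^n.\<close>
definition mu_ge :: "'m struc \<Rightarrow> 'm set \<Rightarrow> 'm \<Rightarrow> 'm \<Rightarrow> bool" where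
  "mu_ge A T a b \<longleftrightarrow> (\<forall>n. \<exists>c k y. coded A c \<subseteq> {s \<in> T. strlen A s n} \<and> mcard A c k \<and>
      pow2 A n y \<and> le A (smul A a y) (smul A k b))"

definition restr_code :: "'m struc \<Rightarrow> 'm set \<Rightarrow> 'm \<Rightarrow> 'm \<Rightarrow> bool" where
  "restr_code A X n c \<longleftrightarrow> (\<forall>v. bit A c v \<longleftrightarrow> sless A v n \<and> v \<in> X)"

text \<open>X \<le>_T Y: n \<mapsto> X|n is a (total) function on M whose graph is Delta^0_1-definable
in M from Y (Y the only set parameter; number parameters allowed).\<close>
definition turing_le :: "'m struc \<Rightarrow> 'm set \<Rightarrow> 'm set \<Rightarrow> bool" where
  "turing_le A X Y \<longleftrightarrow> (\<forall>n. \<exists>c. restr_code A X n c) \<and>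
     (\<exists>\<phi> \<psi> e x y. x \<noteq> y \<and> Sigma 1 \<phi> \<and> Pi 1 \<psi> \<and>
        (\<forall>n c. sat A (\<lambda>_. Y) (e(x := n, y := c)) \<phi> \<longleftrightarrow> restr_code A X n c) \<and>
        (\<forall>n c. sat A (\<lambda>_. Y) (e(x := n, y := c)) \<psi> \<longleftrightarrow> restr_code A X n c))"

definition principal :: "'m struc \<Rightarrow> 'm set set \<Rightarrow> bool" where
  "principal A S \<longleftrightarrow> (\<exists>Z. S = {Y. turing_le A Y Z})"

definition join :: "'m struc \<Rightarrow> 'm set \<Rightarrow> 'm set \<Rightarrow> 'm set" where
  "join A Z X = {sadd A n n | n. n \<in> Z} \<union> {sadd A (sadd A n n) (sone A) | n. n \<in> X}"

definition extend :: "'m struc \<Rightarrow> 'm set set \<Rightarrow> 'm set \<Rightarrow> 'm set set" where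
  "extend A S X = {Y. \<exists>Z\<in>S. turing_le A Y (join A Z X)}"

end

theory Submission
  imports Defs
begin

text \<open>A path through \<open>T\<close> is built by forcing with trees of positive measure that are \<open>\<Delta>\<^sup>0\<^sub>2\<close> in some member
of \<open>S\<close> and have coded initial segments. The \<open>\<Sigma>\<^sup>0\<^sub>2\<close> weak pigeonhole principle enters through one
counting fact: an increasing \<open>\<Delta>\<^sup>0\<^sub>2\<close> sequence of coded sets which exhausts a coded set \<open>F\<close> contains all
but an arbitrarily small fraction of \<open>F\<close> at some stage. It yields a density theorem, since a tree of
density below \<open>3/4\<close> above each of its nodes would have measure zero. Inside a tree of density \<open>3/4\<close> one
decides a \<open>\<Sigma>\<^sup>0\<^sub>1\<close> formula on an initial segment by fixing a stage that nearly maximises the expected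
number of instances already verified; this preserves \<open>\<Sigma>\<^sup>0\<^sub>1\<close> induction. A \<open>\<Sigma>\<^sup>0\<^sub>2\<close> injection from
\<open>2x\<close> into \<open>x\<close> is defeated because the events \<open>f(a) = b\<close>, for fixed \<open>b\<close>, are disjoint: some \<open>f(a)\<close> is
defined with probability at most about one half and can be made undefined on a tree of positive measure. A generic
path meets these countably many requirements.\<close>

section \<open>Discretely ordered semirings\<close>

text \<open>The base model need not satisfy Sigma_2 induction or Sigma_2 bounding, so a Delta_2
  object cannot be treated by induction directly. Every Delta_2 function in use therefore carries
  codes for its initial segments (\<open>z2\<close>), and inductions inside the model are about
  codes; only iterations of standard length take place outside. The two densities come from a
  balance. Starting from \<open>3/4\<close>, the step for induction deletes at most
  \<open>1/16\<close> and the step against an injection at most \<open>5/8 + 1/32 = 42/64\<close>,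
  so at least \<open>6/64\<close> remain and \<open>1/16\<close> is a safe bound for a condition; a
  density point then restores \<open>3/4\<close>. The bound \<open>5/8\<close> is chosen so that
  failure to stay below it is contradictory: if \<open>7/8\<close> of the \<open>2x\<close> disjoint
  events had measure \<open>5/8\<close> each, they would fill \<open>35/32 x\<close> of a space of
  size \<open>x\<close>. The model is a type of an ordered semiring class, which makes algebra in it
  ordinary algebra; the price is the transport from a given structure to one fixed type at the
  end.\<close>

class parith = linordered_semidom + countable +
  assumes parith_nonneg: "0 \<le> x"
    and parith_discrete: "x < y \<Longrightarrow> x + 1 \<le> y"

text \<open>Differences of elements form a linearly ordered ring, which makes the decision
procedures for linear arithmetic available for the semiring itself.\<close>

quotient_type (overloaded) 'a dif = "('a::linordered_semidom) \<times> 'a" / "\<lambda>(a, b) (c, d). a + d = c + b"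
  morphisms rep_Dif Abs_Dif
proof (rule equivpI)
  show "reflp (\<lambda>(a::'a, b) (c, d). a + d = c + b)" by (auto simp: reflp_def)
  show "symp (\<lambda>(a::'a, b) (c, d). a + d = c + b)" by (auto simp: symp_def)
  show "transp (\<lambda>(a::'a, b) (c, d). a + d = c + b)"
  proof (rule transpI, clarify)
    fix a b c d e f :: 'a
    assume 1: "a + d = c + b" and 2: "c + f = e + d"
    have "(a + f) + d = (e + b) + d" using 1 2 by (metis add.assoc add.commute)
    then show "a + f = e + b" by simp
  qed
qed

instantiation dif :: (linordered_semidom) linordered_idom
begin

lift_definition zero_dif :: "'a dif" is "(0, 0)" .
lift_definition one_dif :: "'a dif" is "(1, 0)" .
lift_definition plus_dif :: "'a dif \<Rightarrow> 'a dif \<Rightarrow> 'a dif" is "\<lambda>(a, b) (c, d). (a + c, b + d)"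
proof (clarify)
  fix a b s t c d u v :: 'a
  assume "a + t = s + b" "c + v = u + d"
  then have "(a + t) + (c + v) = (s + b) + (u + d)" by simp
  then show "a + c + (t + v) = s + u + (b + d)" by (simp add: ac_simps)
qed
lift_definition uminus_dif :: "'a dif \<Rightarrow> 'a dif" is "\<lambda>(a, b). (b, a)"
  by (clarsimp simp: add.commute)
lift_definition minus_dif :: "'a dif \<Rightarrow> 'a dif \<Rightarrow> 'a dif" is "\<lambda>(a, b) (c, d). (a + d, b + c)"
proof (clarify)
  fix a b s t c d u v :: 'a
  assume "a + t = s + b" "c + v = u + d"
  then have "(a + t) + (u + d) = (s + b) + (c + v)" by simp
  then show "a + d + (t + u) = s + v + (b + c)" by (simp add: ac_simps)
qed

lift_definition times_dif :: "'a dif \<Rightarrow> 'a dif \<Rightarrow> 'a dif"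
  is "\<lambda>(a, b) (c, d). (a * c + b * d, a * d + b * c)"
proof (clarify)
  fix s t u v w x y z :: 'a
  assume 1: "s + v = u + t" and 2: "w + z = y + x"
  let ?k = "v * w + u * x + u * w + v * x"
  have "(s * w + t * x) + (u * z + v * y) + ?k
    = (s + v) * w + (u + t) * x + u * (w + z) + v * (y + x)"
    by (simp add: algebra_simps)
  also have "\<dots> = (u + t) * w + (s + v) * x + u * (y + x) + v * (w + z)"
    using 1 2 by simp
  also have "\<dots> = (u * y + v * z) + (s * x + t * w) + ?k"
    by (simp add: algebra_simps)
  finally show "(s * w + t * x) + (u * z + v * y) = (u * y + v * z) + (s * x + t * w)"
    by (rule add_right_imp_eq)
qed

lift_definition less_eq_dif :: "'a dif \<Rightarrow> 'a dif \<Rightarrow> bool" is "\<lambda>(a, b) (c, d). a + d \<le> c + b"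
proof (clarify, rule iffI)
  fix a b s t c d u v :: 'a
  assume 1: "a + t = s + b" and 2: "c + v = u + d"
  { assume "a + d \<le> c + b"
    then have "(a + d) + (t + v) \<le> (c + b) + (t + v)" by simp
    then have "(a + t) + (d + v) \<le> (c + v) + (b + t)" by (simp add: ac_simps)
    then have "(s + v) + (b + d) \<le> (u + t) + (b + d)" unfolding 1 2 by (simp add: ac_simps)
    then show "s + v \<le> u + t" by simp }
  { assume "s + v \<le> u + t"
    then have "(s + v) + (b + d) \<le> (u + t) + (b + d)" by simp
    then have "(s + b) + (v + d) \<le> (u + d) + (b + t)" by (simp add: ac_simps)
    then have "(a + d) + (t + v) \<le> (c + b) + (t + v)" unfolding 1[symmetric] 2[symmetric] by (simp add: ac_simps)
    then show "a + d \<le> c + b" by simp }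
qed

definition less_dif :: "'a dif \<Rightarrow> 'a dif \<Rightarrow> bool" where "less_dif x y \<longleftrightarrow> x \<le> y \<and> \<not> y \<le> x"
definition "abs (x :: 'a dif) = (if x < 0 then - x else x)"
definition "sgn (x :: 'a dif) = (if x = 0 then 0 else if 0 < x then 1 else - 1)"

lemma linear_dif: "x \<le> y \<or> y \<le> (x :: 'a dif)"
  by transfer (clarsimp, metis linear)

instance
proof
  fix x y z :: "'a dif"
  show "x + y + z = x + (y + z)" "x + y = y + x" "0 + x = x" "- x + x = 0" "x - y = x + - y"
    by (transfer; clarsimp simp: ac_simps)+
  show "x * y * z = x * (y * z)" "x * y = y * x" "1 * x = x" "(x + y) * z = x * z + y * z"
    by (transfer; clarsimp simp: algebra_simps)+
  show "(0 :: 'a dif) \<noteq> 1" by transfer simp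
  show "x < y \<longleftrightarrow> x \<le> y \<and> \<not> y \<le> x" by (simp add: less_dif_def)
  show "x \<le> x" by transfer clarsimp
  show "x \<le> y \<or> y \<le> x" by (rule linear_dif)
  show "x \<le> y \<Longrightarrow> y \<le> x \<Longrightarrow> x = y" by transfer (clarsimp simp: eq_iff)
  show "x \<le> y \<Longrightarrow> y \<le> z \<Longrightarrow> x \<le> z"
  proof (transfer, clarify)
    fix a b c d e f :: 'a
    assume "a + d \<le> c + b" "c + f \<le> e + d"
    then have "(a + d) + (c + f) \<le> (c + b) + (e + d)" by (rule add_mono)
    then have "(a + f) + (c + d) \<le> (e + b) + (c + d)" by (simp add: ac_simps)
    then show "a + f \<le> e + b" by simp
  qed
  show "x \<le> y \<Longrightarrow> z + x \<le> z + y"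
  proof (transfer, clarsimp)
    fix a b c d e f :: 'a
    assume "a + d \<le> c + b"
    then have "(a + d) + (e + f) \<le> (c + b) + (e + f)" by simp
    then show "e + a + (f + d) \<le> e + c + (f + b)" by (simp add: ac_simps)
  qed
  show "z * x < z * y" if "x < y" "0 < z"
  proof -
    have "\<not> z * y \<le> z * x" using that unfolding less_dif_def
    proof (transfer, elim conjE, clarify)
      fix a b c d e f :: 'a
      assume 2: "\<not> c + b \<le> a + d" and 4: "\<not> f + 0 \<le> 0 + e"
        and 5: "f * c + e * d + (f * b + e * a) \<le> f * a + e * b + (f * d + e * c)"
      define g where "g = f - e"
      have e: "f = e + g" using 4 by (simp add: g_def)
      have g: "0 < g" using 4 unfolding e by simp
      have "g * (a + d) < g * (c + b)" using 2 g by (simp add: mult_strict_left_mono)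
      then have "g * (a + d) + (e * a + e * b + e * c + e * d) < g * (c + b) + (e * a + e * b + e * c + e * d)" by simp
      also have "\<dots> \<le> g * (a + d) + (e * a + e * b + e * c + e * d)"
        using 5 unfolding e by (simp add: algebra_simps)
      finally show False by simp
    qed
    then show ?thesis unfolding less_dif_def using linear_dif by blast
  qed
qed (auto simp: abs_dif_def sgn_dif_def, (transfer; clarsimp simp: algebra_simps)+)

end

lift_definition emb :: "'a::linordered_semidom \<Rightarrow> 'a dif" is "\<lambda>a. (a, 0)" .

lemma emb_add: "emb (x + y) = emb x + emb y" by transfer simp
lemma emb_mult: "emb (x * y) = emb x * emb y" by transfer simp
lemma emb_0: "emb 0 = 0" by transfer simp
lemma emb_1: "emb 1 = 1" by transfer simp
lemma emb_numeral: "emb (numeral n) = numeral n"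
  by (induction n) (simp_all only: numeral.simps emb_add emb_1)
lemma emb_le: "x \<le> y \<longleftrightarrow> emb x \<le> emb y" by transfer simp
lemma emb_less: "x < y \<longleftrightarrow> emb x < emb y" using emb_le by (metis not_le)
lemma emb_eq: "x = y \<longleftrightarrow> emb x = emb y" by transfer simp
lemma emb_nonneg: "0 \<le> emb (x :: 'a::parith)" using emb_le emb_0 parith_nonneg by metis

definition SM :: "'a::parith struc" where
  "SM = \<lparr>szero = 0, sone = 1, sadd = (+), smul = (*), sless = (<)\<rparr>"

lemma SM_simps [simp]:
  "szero SM = 0" "sone SM = 1" "sadd SM = (+)" "smul SM = (*)" "sless SM = (<)"
  by (simp_all add: SM_def)

section \<open>Definability\<close>

text \<open>Predicates on environments with de Bruijn indices: \<open>case_nat a e\<close> binds index \<open>0\<close> to \<open>a\<close>. All elements of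
the model are admitted as parameters. \<open>d0 Z\<close>, \<open>s1 Z\<close>, \<open>d1 Z\<close>, \<open>s2 Z\<close> are the classes \<open>\<Delta>\<^sup>0\<^sub>0\<close>, \<open>\<Sigma>\<^sup>0\<^sub>1\<close>,
\<open>\<Delta>\<^sup>0\<^sub>1\<close>, \<open>\<Sigma>\<^sup>0\<^sub>2\<close> in \<open>Z\<close>; \<open>d1f Z\<close> are the functions with a \<open>\<Sigma>\<^sup>0\<^sub>1\<close> graph.\<close>

inductive tm :: "((nat \<Rightarrow> 'a::parith) \<Rightarrow> 'a) \<Rightarrow> bool" where
  tm_var: "tm (\<lambda>e. e i)"
| tm_const: "tm (\<lambda>e. c)"
| tm_add: "tm s \<Longrightarrow> tm t \<Longrightarrow> tm (\<lambda>e. s e + t e)"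
| tm_mult: "tm s \<Longrightarrow> tm t \<Longrightarrow> tm (\<lambda>e. s e * t e)"

inductive d0 :: "'a::parith set \<Rightarrow> ((nat \<Rightarrow> 'a) \<Rightarrow> bool) \<Rightarrow> bool" for Z where
  d0_eq: "tm s \<Longrightarrow> tm t \<Longrightarrow> d0 Z (\<lambda>e. s e = t e)"
| d0_less: "tm s \<Longrightarrow> tm t \<Longrightarrow> d0 Z (\<lambda>e. s e < t e)"
| d0_mem: "tm t \<Longrightarrow> d0 Z (\<lambda>e. t e \<in> Z)"
| d0_neg: "d0 Z P \<Longrightarrow> d0 Z (\<lambda>e. \<not> P e)"
| d0_conj: "d0 Z P \<Longrightarrow> d0 Z Q \<Longrightarrow> d0 Z (\<lambda>e. P e \<and> Q e)"
| d0_bex0: "tm t \<Longrightarrow> d0 Z P \<Longrightarrow> d0 Z (\<lambda>e. \<exists>a<t e. P (case_nat a e))"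

text \<open>One substitution principle covers renaming, shifting and instantiation of de Bruijn
  variables; the classes of predicates below inherit it.\<close>

lemma tm_subst: "tm t \<Longrightarrow> (\<And>i. tm (\<lambda>e. \<sigma> e i)) \<Longrightarrow> tm (\<lambda>e. t (\<sigma> e))"
  by (induction rule: tm.induct) (auto intro: tm.intros)

lemma tm_shift: "tm t \<Longrightarrow> tm (\<lambda>e. t (\<lambda>i. e (Suc i)))"
  by (rule tm_subst) (auto intro: tm.intros)

lemma d0_subst: "d0 Z P \<Longrightarrow> (\<And>i. tm (\<lambda>e. \<sigma> e i)) \<Longrightarrow> d0 Z (\<lambda>e. P (\<sigma> e))"
proof (induction arbitrary: \<sigma> rule: d0.induct)
  case (d0_bex0 t P)
  let ?s = "\<lambda>e. case_nat (e 0) (\<sigma> (\<lambda>i. e (Suc i)))"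
  have "tm (\<lambda>e. ?s e i)" for i
    by (cases i) (auto intro: tm.intros tm_subst[OF d0_bex0.prems])
  then have "d0 Z (\<lambda>e. P (?s e))" by (rule d0_bex0.IH)
  from d0.d0_bex0[OF tm_subst[OF d0_bex0.hyps(1) d0_bex0.prems] this]
  show ?case by simp
next
  case (d0_eq s t) show ?case by (rule d0.d0_eq[OF tm_subst[OF d0_eq(1) d0_eq(3)] tm_subst[OF d0_eq(2) d0_eq(3)]])
next
  case (d0_less s t) show ?case by (rule d0.d0_less[OF tm_subst[OF d0_less(1) d0_less(3)] tm_subst[OF d0_less(2) d0_less(3)]])
next
  case (d0_mem t) show ?case by (rule d0.d0_mem[OF tm_subst[OF d0_mem(1) d0_mem(2)]])
next
  case (d0_neg P) show ?case by (intro d0.d0_neg d0_neg.IH d0_neg.prems)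
next
  case (d0_conj P Q) show ?case by (intro d0.d0_conj d0_conj.IH d0_conj.prems)
qed

lemma case_nat_shift [simp]: "case_nat (e 0) (\<lambda>i. e (Suc i)) = e"
  by (rule ext) (simp split: nat.split)

text \<open>This shape lets a bound variable be written as a HOL variable: \<open>e 0\<close> is the
  bound element and \<open>\<lambda>i. e (Suc i)\<close> the outer environment. The other closure
  rules for quantifiers follow the same pattern.\<close>

lemma d0_bex: "tm t \<Longrightarrow> d0 Z (\<lambda>e. P (\<lambda>i. e (Suc i)) (e 0)) \<Longrightarrow> d0 Z (\<lambda>e. \<exists>a<t e. P e a)"
  by (drule (1) d0_bex0) simp

lemma d0_disj: "d0 Z P \<Longrightarrow> d0 Z Q \<Longrightarrow> d0 Z (\<lambda>e. P e \<or> Q e)"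
  using d0_neg[OF d0_conj[OF d0_neg d0_neg]] by simp

lemma d0_ball: "tm t \<Longrightarrow> d0 Z (\<lambda>e. P (\<lambda>i. e (Suc i)) (e 0)) \<Longrightarrow> d0 Z (\<lambda>e. \<forall>a<t e. P e a)"
  using d0_neg[OF d0_bex[OF _ d0_neg, of t Z P]] by simp

lemma parith_less_Suc: "x < y + 1 \<longleftrightarrow> x \<le> (y::'a::parith)"
proof
  assume "x < y + 1" then show "x \<le> y"
    using parith_discrete[of y x] by (rule_tac ccontr) (auto simp: not_le)
next
  assume "x \<le> y" then show "x < y + 1" using less_add_one[of y] by (rule order_le_less_trans)
qed

lemma d0_le: "tm s \<Longrightarrow> tm t \<Longrightarrow> d0 Z (\<lambda>e. s e \<le> t e)"
  using d0_less[of s "\<lambda>e. t e + 1"] by (simp add: parith_less_Suc tm.intros)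

section \<open>Sigma_1 and Delta_1 predicates and their closure properties\<close>

definition s1 :: "'a::parith set \<Rightarrow> ((nat \<Rightarrow> 'a) \<Rightarrow> bool) \<Rightarrow> bool" where
  "s1 Z P \<longleftrightarrow> (\<exists>Q. d0 Z Q \<and> P = (\<lambda>e. \<exists>a. Q (case_nat a e)))"

lemma s1E:
  assumes "s1 Z P" obtains Q where "d0 Z Q" "P = (\<lambda>e. \<exists>a. Q (case_nat a e))"
  using assms unfolding s1_def by blast

lemma s1I: "d0 Z (\<lambda>e. P (\<lambda>i. e (Suc i)) (e 0)) \<Longrightarrow> s1 Z (\<lambda>e. \<exists>a. P e a)"
  unfolding s1_def by (rule exI[of _ "\<lambda>e. P (\<lambda>i. e (Suc i)) (e 0)"]) simp

lemma s1_subst: "s1 Z P \<Longrightarrow> (\<And>i. tm (\<lambda>e. \<sigma> e i)) \<Longrightarrow> s1 Z (\<lambda>e. P (\<sigma> e))"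
proof -
  assume "s1 Z P" and *: "\<And>i. tm (\<lambda>e. \<sigma> e i)"
  then obtain Q where Q: "d0 Z Q" "P = (\<lambda>e. \<exists>a. Q (case_nat a e))" by (auto elim: s1E)
  have "tm (\<lambda>e. case_nat (e 0) (\<sigma> (\<lambda>i. e (Suc i))) i)" for i
    by (cases i) (auto intro: tm.intros tm_subst[OF *])
  from d0_subst[OF Q(1) this]
  show "s1 Z (\<lambda>e. P (\<sigma> e))" unfolding Q by (rule s1I)
qed

lemma s1_d0: "d0 Z P \<Longrightarrow> s1 Z P"
  using s1I[of Z "\<lambda>e a. P e"] d0_subst[of Z P "\<lambda>e i. e (Suc i)"] by (simp add: tm.intros)

lemma tm_case_nat: "tm (\<lambda>e. f e) \<Longrightarrow> (\<And>i. tm (\<lambda>e. g e i)) \<Longrightarrow> tm (\<lambda>e. case_nat (f e) (g e) i)"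
  by (cases i) auto

text \<open>Two existential quantifiers are merged by a common bound \<open>c\<close> and not by
  pairing, so the fact is available before any induction.\<close>

lemma s1_ex: assumes "s1 Z (\<lambda>e. P (\<lambda>i. e (Suc i)) (e 0))" shows "s1 Z (\<lambda>e. \<exists>a. P e a)"
proof -
  from assms obtain Q where Q: "d0 Z Q" "(\<lambda>e. P (\<lambda>i. e (Suc i)) (e 0)) = (\<lambda>e. \<exists>a. Q (case_nat a e))"
    by (rule s1E)
  have P: "P e a \<longleftrightarrow> (\<exists>b. Q (case_nat b (case_nat a e)))" for e a
    using fun_cong[OF Q(2), of "case_nat a e"] by simp
  have "(\<lambda>e. \<exists>a. P e a) = (\<lambda>e. \<exists>c. \<exists>a<c+1. \<exists>b<c+1. Q (case_nat b (case_nat a e)))"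
    unfolding P
  proof (intro ext iffI)
    fix e assume "\<exists>a b. Q (case_nat b (case_nat a e))"
    then obtain a b where "Q (case_nat b (case_nat a e))" by blast
    moreover have "a < max a b + 1" "b < max a b + 1" by (simp_all add: parith_less_Suc)
    ultimately show "\<exists>c. \<exists>a<c+1. \<exists>b<c+1. Q (case_nat b (case_nat a e))" by blast
  qed blast
  moreover have "s1 Z (\<lambda>e. \<exists>c. \<exists>a<c+1. \<exists>b<c+1. Q (case_nat b (case_nat a e)))"
    by (intro s1I d0_bex tm.intros d0_subst[OF Q(1)] tm_case_nat)
  ultimately show ?thesis by simp
qed

lemma s1_conj: assumes "s1 Z P" "s1 Z Q" shows "s1 Z (\<lambda>e. P e \<and> Q e)"
proof -
  obtain P' Q' where *: "d0 Z P'" "P = (\<lambda>e. \<exists>a. P' (case_nat a e))" "d0 Z Q'" "Q = (\<lambda>e. \<exists>a. Q' (case_nat a e))"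
    using assms by (auto elim!: s1E)
  have "s1 Z (\<lambda>e. \<exists>a b. P' (case_nat a e) \<and> Q' (case_nat b e))"
    by (intro s1_ex s1_d0 d0_conj d0_subst[OF *(1)] d0_subst[OF *(3)] tm_case_nat tm.intros)
  then show ?thesis unfolding * by simp
qed

lemma s1_disj: assumes "s1 Z P" "s1 Z Q" shows "s1 Z (\<lambda>e. P e \<or> Q e)"
proof -
  obtain P' Q' where *: "d0 Z P'" "P = (\<lambda>e. \<exists>a. P' (case_nat a e))" "d0 Z Q'" "Q = (\<lambda>e. \<exists>a. Q' (case_nat a e))"
    using assms by (auto elim!: s1E)
  have "s1 Z (\<lambda>e. \<exists>a. P' (case_nat a e) \<or> Q' (case_nat a e))"
    by (intro s1_ex s1_d0 d0_disj d0_subst[OF *(1)] d0_subst[OF *(3)] tm_case_nat tm.intros)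
  then show ?thesis unfolding * by (simp add: ex_disj_distrib)
qed

definition d1 :: "'a::parith set \<Rightarrow> ((nat \<Rightarrow> 'a) \<Rightarrow> bool) \<Rightarrow> bool" where
  "d1 Z P \<longleftrightarrow> s1 Z P \<and> s1 Z (\<lambda>e. \<not> P e)"

definition d1f :: "'a::parith set \<Rightarrow> ((nat \<Rightarrow> 'a) \<Rightarrow> 'a) \<Rightarrow> bool" where
  "d1f Z f \<longleftrightarrow> s1 Z (\<lambda>e. e 0 = f (\<lambda>i. e (Suc i)))"

lemma d1_s1: "d1 Z P \<Longrightarrow> s1 Z P" and d1_s1_neg: "d1 Z P \<Longrightarrow> s1 Z (\<lambda>e. \<not> P e)"
  by (auto simp: d1_def)

lemma d1_d0: "d0 Z P \<Longrightarrow> d1 Z P"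
  by (auto simp: d1_def intro: s1_d0 d0_neg)

lemma d1f_tm: "tm f \<Longrightarrow> d1f Z f"
  unfolding d1f_def by (rule s1_d0[OF d0_eq[OF tm_var tm_shift]])

lemma s1_let: assumes "s1 Z (\<lambda>e. P (\<lambda>i. e (Suc i)) (e 0))" "d1f Z f" shows "s1 Z (\<lambda>e. P e (f e))"
proof -
  have "s1 Z (\<lambda>e. \<exists>y. y = f e \<and> P e y)"
    by (intro s1_ex s1_conj assms assms(2)[unfolded d1f_def])
  then show ?thesis by simp
qed

lemma d1_subst: assumes "d1 Z P" "\<And>i. tm (\<lambda>e. \<sigma> e i)" shows "d1 Z (\<lambda>e. P (\<sigma> e))"
  using s1_subst[OF d1_s1[OF assms(1)] assms(2)] s1_subst[OF d1_s1_neg[OF assms(1)] assms(2)]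
  by (simp add: d1_def)

lemma d1f_subst: assumes "d1f Z f" "\<And>i. tm (\<lambda>e. \<sigma> e i)" shows "d1f Z (\<lambda>e. f (\<sigma> e))"
proof -
  have "tm (\<lambda>e. case_nat (e 0) (\<sigma> (\<lambda>i. e (Suc i))) i)" for i
    by (rule tm_case_nat[OF tm_var tm_shift[OF assms(2)]])
  from s1_subst[OF assms(1)[unfolded d1f_def], of "\<lambda>e. case_nat (e 0) (\<sigma> (\<lambda>i. e (Suc i)))", OF this]
  show ?thesis unfolding d1f_def by simp
qed

lemma d1f_graph: assumes "d1f Z f" "tm t" "\<And>i. tm (\<lambda>e. \<sigma> e i)" shows "s1 Z (\<lambda>e. t e = f (\<sigma> e))"
  using s1_subst[OF assms(1)[unfolded d1f_def], of "\<lambda>e. case_nat (t e) (\<sigma> e)"] assms(2,3)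
  by (simp add: tm_case_nat)

lemma s1_tm1: "s1 Z (\<lambda>e. R (e 0)) \<Longrightarrow> tm a \<Longrightarrow> s1 Z (\<lambda>e. R (a e))"
  using s1_subst[of Z "\<lambda>e. R (e 0)" "\<lambda>e i. a e"] by simp

lemma s1_tm2: "s1 Z (\<lambda>e. R (e 0) (e (Suc 0))) \<Longrightarrow> tm a \<Longrightarrow> tm b \<Longrightarrow> s1 Z (\<lambda>e. R (a e) (b e))"
  using s1_subst[of Z "\<lambda>e. R (e 0) (e (Suc 0))" "\<lambda>e. case_nat (a e) (\<lambda>i. b e)"]
  by (simp add: tm_case_nat)

lemma s1_tm3: "s1 Z (\<lambda>e. R (e 0) (e (Suc 0)) (e (Suc (Suc 0)))) \<Longrightarrow> tm a \<Longrightarrow> tm b \<Longrightarrow> tm c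
  \<Longrightarrow> s1 Z (\<lambda>e. R (a e) (b e) (c e))"
  using s1_subst[of Z "\<lambda>e. R (e 0) (e (Suc 0)) (e (Suc (Suc 0)))" "\<lambda>e. case_nat (a e) (case_nat (b e) (\<lambda>i. c e))"]
  by (simp add: tm_case_nat)

lemma s1_tm4: "s1 Z (\<lambda>e. R (e 0) (e (Suc 0)) (e (Suc (Suc 0))) (e (Suc (Suc (Suc 0))))) \<Longrightarrow> tm a \<Longrightarrow> tm b \<Longrightarrow> tm c
  \<Longrightarrow> tm d \<Longrightarrow> s1 Z (\<lambda>e. R (a e) (b e) (c e) (d e))"
  using s1_subst[of Z "\<lambda>e. R (e 0) (e (Suc 0)) (e (Suc (Suc 0))) (e (Suc (Suc (Suc 0))))"
    "\<lambda>e. case_nat (a e) (case_nat (b e) (case_nat (c e) (\<lambda>i. d e)))"]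
  by (simp add: tm_case_nat)

lemma s1_tm5: "s1 Z (\<lambda>e. R (e 0) (e (Suc 0)) (e (Suc (Suc 0))) (e (Suc (Suc (Suc 0)))) (e (Suc (Suc (Suc (Suc 0)))))) \<Longrightarrow> tm a \<Longrightarrow> tm b \<Longrightarrow> tm c
  \<Longrightarrow> tm d \<Longrightarrow> tm k \<Longrightarrow> s1 Z (\<lambda>e. R (a e) (b e) (c e) (d e) (k e))"
  using s1_subst[of Z "\<lambda>e. R (e 0) (e (Suc 0)) (e (Suc (Suc 0))) (e (Suc (Suc (Suc 0)))) (e (Suc (Suc (Suc (Suc 0)))))"
    "\<lambda>e. case_nat (a e) (case_nat (b e) (case_nat (c e) (case_nat (d e) (\<lambda>i. k e))))"]
  by (simp add: tm_case_nat)

lemma s1_rel1: assumes "s1 Z (\<lambda>e. R (e 0))" "d1f Z f" shows "s1 Z (\<lambda>e. R (f e))"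
proof -
  have "s1 Z (\<lambda>e. \<exists>a. a = f e \<and> R a)"
    by (intro s1_ex s1_conj d1f_graph[OF assms(2)] s1_tm1[OF assms(1)] tm.intros)
  then show ?thesis by simp
qed

lemma s1_rel2:
  assumes "s1 Z (\<lambda>e. R (e 0) (e (Suc 0)))" "d1f Z f" "d1f Z g" shows "s1 Z (\<lambda>e. R (f e) (g e))"
proof -
  have "s1 Z (\<lambda>e. \<exists>a b. a = f e \<and> b = g e \<and> R a b)"
    by (intro s1_ex s1_conj d1f_graph[OF assms(2)] d1f_graph[OF assms(3)] s1_tm2[OF assms(1)] tm.intros)
  then show ?thesis by simp
qed

lemma s1_rel3:
  assumes "s1 Z (\<lambda>e. R (e 0) (e (Suc 0)) (e (Suc (Suc 0))))" "d1f Z f" "d1f Z g" "d1f Z h"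
  shows "s1 Z (\<lambda>e. R (f e) (g e) (h e))"
proof -
  have "s1 Z (\<lambda>e. \<exists>a b c. a = f e \<and> b = g e \<and> c = h e \<and> R a b c)"
    by (intro s1_ex s1_conj d1f_graph[OF assms(2)] d1f_graph[OF assms(3)] d1f_graph[OF assms(4)]
        s1_tm3[OF assms(1)] tm.intros)
  then show ?thesis by simp
qed

lemma s1_rel4:
  assumes "s1 Z (\<lambda>e. R (e 0) (e (Suc 0)) (e (Suc (Suc 0))) (e (Suc (Suc (Suc 0)))))"
    "d1f Z f" "d1f Z g" "d1f Z h" "d1f Z k"
  shows "s1 Z (\<lambda>e. R (f e) (g e) (h e) (k e))"
proof -
  have "s1 Z (\<lambda>e. \<exists>a b c d. a = f e \<and> b = g e \<and> c = h e \<and> d = k e \<and> R a b c d)"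
    by (intro s1_ex s1_conj d1f_graph[OF assms(2)] d1f_graph[OF assms(3)] d1f_graph[OF assms(4)] d1f_graph[OF assms(5)]
        s1_tm4[OF assms(1)] tm.intros)
  then show ?thesis by simp
qed

lemma s1_rel5:
  assumes "s1 Z (\<lambda>e. R (e 0) (e (Suc 0)) (e (Suc (Suc 0))) (e (Suc (Suc (Suc 0)))) (e (Suc (Suc (Suc (Suc 0))))))"
    "d1f Z f" "d1f Z g" "d1f Z h" "d1f Z k" "d1f Z l"
  shows "s1 Z (\<lambda>e. R (f e) (g e) (h e) (k e) (l e))"
proof -
  have "s1 Z (\<lambda>e. \<exists>a b c d r. a = f e \<and> b = g e \<and> c = h e \<and> d = k e \<and> r = l e \<and> R a b c d r)"
    by (intro s1_ex s1_conj d1f_graph[OF assms(2)] d1f_graph[OF assms(3)] d1f_graph[OF assms(4)] d1f_graph[OF assms(5)]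
        d1f_graph[OF assms(6)] s1_tm5[OF assms(1)] tm.intros)
  then show ?thesis by simp
qed

lemma d1_rel1: "d1 Z (\<lambda>e. R (e 0)) \<Longrightarrow> d1f Z f \<Longrightarrow> d1 Z (\<lambda>e. R (f e))"
  using s1_rel1[of Z R] s1_rel1[of Z "\<lambda>a. \<not> R a"] by (simp add: d1_def)

lemma d1_rel2: "d1 Z (\<lambda>e. R (e 0) (e (Suc 0))) \<Longrightarrow> d1f Z f \<Longrightarrow> d1f Z g \<Longrightarrow> d1 Z (\<lambda>e. R (f e) (g e))"
  using s1_rel2[of Z R] s1_rel2[of Z "\<lambda>a b. \<not> R a b"] by (simp add: d1_def)

lemma d1_rel3: "d1 Z (\<lambda>e. R (e 0) (e (Suc 0)) (e (Suc (Suc 0)))) \<Longrightarrow> d1f Z f \<Longrightarrow> d1f Z g \<Longrightarrow> d1f Z h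
  \<Longrightarrow> d1 Z (\<lambda>e. R (f e) (g e) (h e))"
  using s1_rel3[of Z R] s1_rel3[of Z "\<lambda>a b c. \<not> R a b c"] by (simp add: d1_def)

lemma d1_rel4: "d1 Z (\<lambda>e. R (e 0) (e (Suc 0)) (e (Suc (Suc 0))) (e (Suc (Suc (Suc 0))))) \<Longrightarrow> d1f Z f \<Longrightarrow> d1f Z g
  \<Longrightarrow> d1f Z h \<Longrightarrow> d1f Z k \<Longrightarrow> d1 Z (\<lambda>e. R (f e) (g e) (h e) (k e))"
  using s1_rel4[of Z R] s1_rel4[of Z "\<lambda>a b c d. \<not> R a b c d"] by (simp add: d1_def)

lemma d1_rel5: "d1 Z (\<lambda>e. R (e 0) (e (Suc 0)) (e (Suc (Suc 0))) (e (Suc (Suc (Suc 0)))) (e (Suc (Suc (Suc (Suc 0))))))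
  \<Longrightarrow> d1f Z f \<Longrightarrow> d1f Z g \<Longrightarrow> d1f Z h \<Longrightarrow> d1f Z k \<Longrightarrow> d1f Z l \<Longrightarrow> d1 Z (\<lambda>e. R (f e) (g e) (h e) (k e) (l e))"
  using s1_rel5[of Z R] s1_rel5[of Z "\<lambda>a b c d r. \<not> R a b c d r"] by (simp add: d1_def)

lemma d1f_sh: "d1f Z f \<Longrightarrow> d1f Z (\<lambda>e. f (\<lambda>i. e (Suc i)))"
  by (rule d1f_subst) (auto intro: tm.intros)

lemma d1f_v: "d1f Z (\<lambda>e. e i)" and d1f_c: "d1f Z (\<lambda>e. c)"
  by (auto intro!: d1f_tm tm.intros)

lemma d1f_fun1: "d1f Z (\<lambda>e. F (e 0)) \<Longrightarrow> d1f Z f \<Longrightarrow> d1f Z (\<lambda>e. F (f e))"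
  unfolding d1f_def[of Z "\<lambda>e. F (f e)"] unfolding d1f_def[of Z "\<lambda>e. F (e 0)"]
  by (rule s1_rel2[of Z "\<lambda>a b. a = F b"]) (auto intro: d1f_sh d1f_v)

lemma d1f_fun2: "d1f Z (\<lambda>e. F (e 0) (e (Suc 0))) \<Longrightarrow> d1f Z f \<Longrightarrow> d1f Z g \<Longrightarrow> d1f Z (\<lambda>e. F (f e) (g e))"
  unfolding d1f_def[of Z "\<lambda>e. F (f e) (g e)"] unfolding d1f_def[of Z "\<lambda>e. F (e 0) (e (Suc 0))"]
  by (rule s1_rel3[of Z "\<lambda>a b c. a = F b c"]) (auto intro: d1f_sh d1f_v)

lemma d1f_fun3: "d1f Z (\<lambda>e. F (e 0) (e (Suc 0)) (e (Suc (Suc 0)))) \<Longrightarrow> d1f Z f \<Longrightarrow> d1f Z g \<Longrightarrow> d1f Z h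
  \<Longrightarrow> d1f Z (\<lambda>e. F (f e) (g e) (h e))"
  unfolding d1f_def[of Z "\<lambda>e. F (f e) (g e) (h e)"] unfolding d1f_def[of Z "\<lambda>e. F (e 0) (e (Suc 0)) (e (Suc (Suc 0)))"]
  by (rule s1_rel4[of Z "\<lambda>a b c d. a = F b c d"]) (auto intro: d1f_sh d1f_v)

lemma d1_eq: "d1f Z f \<Longrightarrow> d1f Z g \<Longrightarrow> d1 Z (\<lambda>e. f e = g e)"
  by (rule d1_rel2[of Z "(=)"]) (auto intro!: d1_d0 d0_eq tm.intros)
lemma d1_less: "d1f Z f \<Longrightarrow> d1f Z g \<Longrightarrow> d1 Z (\<lambda>e. f e < g e)"
  by (rule d1_rel2[of Z "(<)"]) (auto intro!: d1_d0 d0_less tm.intros)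
lemma d1_le: "d1f Z f \<Longrightarrow> d1f Z g \<Longrightarrow> d1 Z (\<lambda>e. f e \<le> g e)"
  by (rule d1_rel2[of Z "(\<le>)"]) (auto intro!: d1_d0 d0_le tm.intros)
lemma d1_mem: "d1f Z f \<Longrightarrow> d1 Z (\<lambda>e. f e \<in> Z)"
  by (rule d1_rel1[of Z "\<lambda>a. a \<in> Z"]) (auto intro!: d1_d0 d0_mem tm.intros)
lemma d1f_add: "d1f Z f \<Longrightarrow> d1f Z g \<Longrightarrow> d1f Z (\<lambda>e. f e + g e)"
  by (rule d1f_fun2[of Z "(+)"]) (auto intro!: d1f_tm tm.intros)
lemma d1f_mult: "d1f Z f \<Longrightarrow> d1f Z g \<Longrightarrow> d1f Z (\<lambda>e. f e * g e)"
  by (rule d1f_fun2[of Z "(*)"]) (auto intro!: d1f_tm tm.intros)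
lemma d1_neg: "d1 Z P \<Longrightarrow> d1 Z (\<lambda>e. \<not> P e)"
  by (simp add: d1_def)
lemma d1_conj: assumes "d1 Z P" "d1 Z Q" shows "d1 Z (\<lambda>e. P e \<and> Q e)"
  unfolding d1_def de_Morgan_conj
  by (rule conjI[OF s1_conj[OF d1_s1[OF assms(1)] d1_s1[OF assms(2)]] s1_disj[OF d1_s1_neg[OF assms(1)] d1_s1_neg[OF assms(2)]]])
lemma d1_disj: assumes "d1 Z P" "d1 Z Q" shows "d1 Z (\<lambda>e. P e \<or> Q e)"
  unfolding d1_def de_Morgan_disj
  by (rule conjI[OF s1_disj[OF d1_s1[OF assms(1)] d1_s1[OF assms(2)]] s1_conj[OF d1_s1_neg[OF assms(1)] d1_s1_neg[OF assms(2)]]])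
lemma d1_imp: assumes "d1 Z P" "d1 Z Q" shows "d1 Z (\<lambda>e. P e \<longrightarrow> Q e)"
  unfolding imp_conv_disj by (rule d1_disj[OF d1_neg[OF assms(1)] assms(2)])
lemma d1_iff: assumes "d1 Z P" "d1 Z Q" shows "d1 Z (\<lambda>e. P e \<longleftrightarrow> Q e)"
  unfolding iff_conv_conj_imp by (rule d1_conj[OF d1_imp[OF assms] d1_imp[OF assms(2,1)]])
lemma s1_imp: assumes "s1 Z (\<lambda>e. \<not> P e)" "s1 Z Q" shows "s1 Z (\<lambda>e. P e \<longrightarrow> Q e)"
  unfolding imp_conv_disj by (rule s1_disj[OF assms])
lemma d1_c: "d1 Z (\<lambda>e. P)"
proof -
  have "d0 Z (\<lambda>e. P)"
  proof (cases P)
    case True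
    then show ?thesis using d0_eq[OF tm_const tm_const, of Z 0 0] by simp
  next
    case False
    then show ?thesis using d0_less[OF tm_const tm_const, of Z 0 0] by simp
  qed
  then show ?thesis by (rule d1_d0)
qed
lemma d1f_if: assumes "d1 Z P" "d1f Z f" "d1f Z g" shows "d1f Z (\<lambda>e. if P e then f e else g e)"
proof -
  have sh: "tm (\<lambda>e. e (Suc i))" for i by (rule tm_var)
  have "s1 Z (\<lambda>e. P (\<lambda>i. e (Suc i)) \<and> e 0 = f (\<lambda>i. e (Suc i)) \<or> \<not> P (\<lambda>i. e (Suc i)) \<and> e 0 = g (\<lambda>i. e (Suc i)))"
    using s1_subst[OF d1_s1[OF assms(1)] sh] s1_subst[OF d1_s1_neg[OF assms(1)] sh]
      assms(2)[unfolded d1f_def] assms(3)[unfolded d1f_def]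
    by (intro s1_disj s1_conj)
  also have "(\<lambda>e. P (\<lambda>i. e (Suc i)) \<and> e 0 = f (\<lambda>i. e (Suc i)) \<or> \<not> P (\<lambda>i. e (Suc i)) \<and> e 0 = g (\<lambda>i. e (Suc i)))
    = (\<lambda>e. e 0 = (if P (\<lambda>i. e (Suc i)) then f (\<lambda>i. e (Suc i)) else g (\<lambda>i. e (Suc i))))"
    by (rule ext) simp
  finally show ?thesis unfolding d1f_def .
qed

declare case_nat_shift [simp del]

lemma parith_pos_cases: "(x::'a::parith) = 0 \<or> (\<exists>y. x = y + 1)"
proof (cases "x = 0")
  case False
  then have "0 < x" using parith_nonneg[of x] by simp
  then have "0 + 1 \<le> x" by (rule parith_discrete)
  then have "x = (x - 1) + 1" by simp
  then show ?thesis by blast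
qed simp

lemma parith_not_neg [simp]: "\<not> (x::'a::parith) < 0" "0 \<le> x" "x \<le> 0 \<longleftrightarrow> x = 0" "0 < x \<longleftrightarrow> x \<noteq> 0"
  using parith_nonneg[of x] by auto

lemma parith_Suc_neq_0 [simp]: "(x::'a::parith) + 1 \<noteq> 0" "1 + (x::'a::parith) \<noteq> 0"
  by (simp_all add: add_nonneg_eq_0_iff)

lemma parith_Suc_le: "x + 1 \<le> y \<longleftrightarrow> x < (y::'a::parith)"
  using parith_discrete[of x y] order.strict_trans2[OF less_add_one[of x], of y] by auto

lemma parith_le_ex: "x \<le> y \<Longrightarrow> \<exists>z. y = x + (z::'a::parith)"
  by (rule exI[of _ "y - x"]) simp

lemma ex_emb: "0 \<le> k \<Longrightarrow> \<exists>q. k = emb q"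
proof (transfer, clarify)
  fix a b :: 'a assume "0 + b \<le> a + 0"
  then have "a + 0 = (a - b) + b" by simp
  then show "\<exists>q. a + 0 = q + b" by blast
qed

text \<open>Linear arithmetic is decided in the ordered ring of differences: facts of the semiring
  are rewritten to it with these rules, and nonnegativity, which the ring does not have, is added
  through \<open>emb_nonneg\<close>.\<close>

lemmas emb_simps = emb_le[where 'a="'a::parith"] emb_less[where 'a="'a::parith"]
  emb_eq[where 'a="'a::parith"] emb_add emb_mult emb_0 emb_1 emb_numeral

section \<open>Consequences of first-order induction\<close>

text \<open>Existence of quotient and remainder needs induction, so both are defined by description
  and become meaningful with \<open>dvmd\<close>; the values for \<open>m = 0\<close> only make them
  total.\<close>

definition dv :: "'a::parith \<Rightarrow> 'a \<Rightarrow> 'a" where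
  "dv a m = (if m = 0 then 0 else THE q. \<exists>r<m. a = q * m + r)"
definition md :: "'a::parith \<Rightarrow> 'a \<Rightarrow> 'a" where
  "md a m = (if m = 0 then a else THE r. r < m \<and> (\<exists>q. a = q * m + r))"

lemma divmod_unique_le:
  fixes m :: "'a::parith"
  assumes "q * m + r = q' * m + r'" "r < m" "r' < m" shows "q' \<le> q"
proof (rule ccontr)
  assume "\<not> q' \<le> q"
  then have "q + 1 \<le> q'" by (simp add: parith_Suc_le)
  then have "(q + 1) * m \<le> q' * m" by (simp add: mult_right_mono)
  then have "q * m + m \<le> q' * m" by (simp add: algebra_simps)
  then show False using assms(1,2) emb_nonneg[of r'] unfolding emb_simps by linarith
qed

lemma divmod_unique:
  fixes m :: "'a::parith"
  assumes "q * m + r = q' * m + r'" "r < m" "r' < m" shows "q = q'" "r = r'"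
proof -
  show "q = q'" using divmod_unique_le[OF assms] divmod_unique_le[OF assms(1)[symmetric] assms(3,2)] by simp
  then show "r = r'" using assms(1) by simp
qed

lemma dv_eqI: "a = q * m + r \<Longrightarrow> r < m \<Longrightarrow> dv a m = q"
proof -
  assume a: "a = q * m + r" "r < m"
  have "(THE q'. \<exists>r'<m. a = q' * m + r') = q"
    by (rule the_equality) (use a divmod_unique[of _ m _ q r] in \<open>auto\<close>)
  then show ?thesis using a by (auto simp: dv_def)
qed

lemma md_eqI: "a = q * m + r \<Longrightarrow> r < m \<Longrightarrow> md a m = r"
proof -
  assume a: "a = q * m + r" "r < m"
  have "(THE r'. r' < m \<and> (\<exists>q'. a = q' * m + r')) = r"
    by (rule the_equality) (use a divmod_unique[of _ m _ q r] in \<open>auto\<close>)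
  then show ?thesis using a by (auto simp: md_def)
qed

lemma collect_step:
  fixes m b c :: "'a::parith"
  assumes "\<forall>a<m. \<exists>b<c. R a b" "R m b"
  shows "\<forall>a<m + 1. \<exists>d<max c (b + 1). R a d"
proof (intro allI impI)
  fix a assume "a < m + 1"
  then consider "a < m" | "a = m" by (auto simp: parith_less_Suc le_less)
  then show "\<exists>d<max c (b + 1). R a d"
  proof cases
    case 1
    then obtain d where "d < c" "R a d" using assms(1) by blast
    then show ?thesis using less_le_trans[OF _ max.cobounded1, of d c "b + 1"] by (intro exI[of _ d]) simp
  next
    case 2
    then show ?thesis using assms(2) less_le_trans[OF less_add_one max.cobounded2, of b c] by (intro exI[of _ b]) simp
  qed
qed

text \<open>Induction relative to a single oracle. One set is enough because finitely many sets will
  be dominated by a common oracle, and elements of the model are always allowed as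
  parameters.\<close>

locale ind1 =
  fixes Z :: "'a::parith set"
  assumes s1_induct: "s1 Z (\<lambda>e. P (e 0)) \<Longrightarrow> P 0 \<Longrightarrow> (\<And>n. P n \<Longrightarrow> P (n + 1)) \<Longrightarrow> P n"
begin

text \<open>Collection, obtained from Sigma_1 induction on the length of the segment, bounds all
  witnesses at once; the bound then moves in front of the universal quantifier.\<close>

lemma s1_ball_tm:
  assumes "s1 Z (\<lambda>e. P (\<lambda>i. e (Suc i)) (e 0))" "tm t" shows "s1 Z (\<lambda>e. \<forall>a<t e. P e a)"
proof -
  from assms(1) obtain Q where Q: "d0 Z Q" "(\<lambda>e. P (\<lambda>i. e (Suc i)) (e 0)) = (\<lambda>e. \<exists>a. Q (case_nat a e))"
    by (rule s1E)
  have P: "P e a \<longleftrightarrow> (\<exists>b. Q (case_nat b (case_nat a e)))" for e a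
    using fun_cong[OF Q(2), of "case_nat a e"] by simp
  have coll: "\<exists>c. \<forall>a<n. \<exists>b<c. Q (case_nat b (case_nat a e))" if *: "\<forall>a<n. P e a" for e n
  proof -
    \<comment> \<open>The guard \<open>m \<le> n\<close> is needed because \<open>P e a\<close> is
      known only below \<open>n\<close>.\<close>
    have "\<exists>c. m \<le> n \<longrightarrow> (\<forall>a<m. \<exists>b<c. Q (case_nat b (case_nat a e)))" for m
    proof (induction m rule: s1_induct)
      case 1
      show ?case
        by (intro s1_ex s1_imp s1_d0 d0_neg d0_le d0_ball d0_bex d0_subst[OF Q(1)] tm_case_nat tm.intros)
    next
      case 2 show ?case by simp
    next
      case (3 m)
      then obtain c where c: "m \<le> n \<longrightarrow> (\<forall>a<m. \<exists>b<c. Q (case_nat b (case_nat a e)))" by blast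
      show ?case
      proof (cases "m < n")
        case True
        then obtain b where b: "Q (case_nat b (case_nat m e))" using * P by blast
        have "\<forall>a<m. \<exists>b<c. Q (case_nat b (case_nat a e))" using c True by (simp add: less_imp_le)
        from collect_step[of m c "\<lambda>a b. Q (case_nat b (case_nat a e))" b, OF this b] show ?thesis by blast
      next
        case False
        then have "\<not> m + 1 \<le> n" by (simp add: parith_Suc_le)
        then show ?thesis by blast
      qed
    qed
    then show ?thesis using order_refl by blast
  qed
  have "(\<lambda>e. \<forall>a<t e. P e a) = (\<lambda>e. \<exists>c. \<forall>a<t e. \<exists>b<c. Q (case_nat b (case_nat a e)))"
    using coll P by (intro ext) blast
  moreover have "s1 Z (\<lambda>e. \<exists>c. \<forall>a<t e. \<exists>b<c. Q (case_nat b (case_nat a e)))"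
    by (intro s1_ex s1_d0 d0_ball d0_bex d0_subst[OF Q(1)] tm_case_nat tm_shift[OF assms(2)] tm.intros)
  ultimately show ?thesis by simp
qed

lemma s1_ball:
  assumes "d1f Z t" "s1 Z (\<lambda>e. P (\<lambda>i. e (Suc i)) (e 0))" shows "s1 Z (\<lambda>e. \<forall>a<t e. P e a)"
proof -
  have "tm (\<lambda>e. case_nat (e 0) (\<lambda>i. e (Suc (Suc i))) j)" for j by (intro tm_case_nat tm.intros)
  from s1_subst[OF assms(2), of "\<lambda>e. case_nat (e 0) (\<lambda>i. e (Suc (Suc i)))", OF this]
  have "s1 Z (\<lambda>e. P (\<lambda>i. e (Suc (Suc i))) (e 0))" by simp
  then have "s1 Z (\<lambda>e. \<forall>a<e 0. P (\<lambda>i. e (Suc i)) a)"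
    by (rule s1_ball_tm[where P="\<lambda>e. P (\<lambda>i. e (Suc i))"]) (rule tm_var)
  from s1_let[of Z "\<lambda>e y. \<forall>a<y. P e a", OF this assms(1)] show ?thesis .
qed

lemma s1_bex:
  assumes "d1f Z t" "s1 Z (\<lambda>e. P (\<lambda>i. e (Suc i)) (e 0))" shows "s1 Z (\<lambda>e. \<exists>a<t e. P e a)"
  by (intro s1_ex s1_conj assms(2) d1_s1 d1_less d1f_sh assms(1) d1f_v)

lemma d1_ball:
  assumes "d1f Z t" "d1 Z (\<lambda>e. P (\<lambda>i. e (Suc i)) (e 0))" shows "d1 Z (\<lambda>e. \<forall>a<t e. P e a)"
  unfolding d1_def not_all not_imp
  using s1_ball[OF assms(1) d1_s1[OF assms(2)]] s1_bex[OF assms(1) d1_s1_neg[OF assms(2)]] by (rule conjI)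

lemma d1_bex:
  assumes "d1f Z t" "d1 Z (\<lambda>e. P (\<lambda>i. e (Suc i)) (e 0))" shows "d1 Z (\<lambda>e. \<exists>a<t e. P e a)"
  using d1_neg[OF d1_ball[OF assms(1) d1_neg[OF assms(2)]]] by simp

lemma s1_ball_le:
  assumes "d1f Z t" "s1 Z (\<lambda>e. P (\<lambda>i. e (Suc i)) (e 0))" shows "s1 Z (\<lambda>e. \<forall>a\<le>t e. P e a)"
  using s1_ball[OF d1f_add[OF assms(1) d1f_c[of Z 1]] assms(2)] by (simp add: parith_less_Suc)
lemma d1_ball_le:
  assumes "d1f Z t" "d1 Z (\<lambda>e. P (\<lambda>i. e (Suc i)) (e 0))" shows "d1 Z (\<lambda>e. \<forall>a\<le>t e. P e a)"
  using d1_ball[OF d1f_add[OF assms(1) d1f_c[of Z 1]] assms(2)] by (simp add: parith_less_Suc)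
lemma d1_bex_le:
  assumes "d1f Z t" "d1 Z (\<lambda>e. P (\<lambda>i. e (Suc i)) (e 0))" shows "d1 Z (\<lambda>e. \<exists>a\<le>t e. P e a)"
  using d1_bex[OF d1f_add[OF assms(1) d1f_c[of Z 1]] assms(2)] by (simp add: parith_less_Suc)

lemmas d1_intros = d1f_v d1f_c d1_c d1_eq d1_less d1_le d1_mem d1f_add d1f_mult d1_neg d1_conj d1_disj d1_imp
  d1_iff d1_ball d1_bex d1_ball_le d1_bex_le d1f_if

text \<open>A counterexample \<open>n\<close> is pushed downwards: the induction runs on the
  distance \<open>m\<close> with the Sigma_1 statement that \<open>P\<close> fails at
  \<open>n - m\<close>, and it ends at \<open>0\<close>.\<close>

lemma p1_induct:
  assumes "s1 Z (\<lambda>e. \<not> P (e 0))" "P 0" "\<And>n. P n \<Longrightarrow> P (n + 1)" shows "P n"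
proof (rule ccontr)
  assume "\<not> P n"
  have "m \<le> n \<longrightarrow> (\<exists>k. k + m = n \<and> \<not> P k)" for m
  proof (induction m rule: s1_induct)
    case 1
    show ?case by (intro s1_imp s1_ex s1_conj s1_rel1[OF assms(1)] d1_s1 d1_intros)
  next
    case 2 show ?case using \<open>\<not> P n\<close> by simp
  next
    case (3 m)
    show ?case
    proof
      assume m: "m + 1 \<le> n"
      then have "m \<le> n" "m < n" using less_add_one[of m] by (auto dest: less_le_trans simp: less_imp_le parith_Suc_le)
      then obtain k where k: "k + m = n" "\<not> P k" using 3 by blast
      then have "k \<noteq> 0" using \<open>m < n\<close> by auto
      then obtain k' where k': "k = k' + 1" using parith_pos_cases by blast
      then have "\<not> P k'" using assms(3) k by blast
      moreover have "k' + (m + 1) = n" using k k' by (simp add: ac_simps)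
      ultimately show "\<exists>k. k + (m + 1) = n \<and> \<not> P k" by blast
    qed
  qed
  from this[of n] show False using assms(2) by simp
qed

lemma d1_induct:
  assumes "d1 Z (\<lambda>e. P (e 0))" "P 0" "\<And>n. P n \<Longrightarrow> P (n + 1)" shows "P n"
  by (rule s1_induct[OF d1_s1[OF assms(1)] assms(2,3)])

lemma least_s1:
  assumes "s1 Z (\<lambda>e. P (e 0))" "P n" shows "\<exists>m. P m \<and> (\<forall>k<m. \<not> P k)"
proof (rule ccontr)
  assume *: "\<not> ?thesis"
  have "\<forall>k<m. \<not> P k" for m
  proof (induction m rule: p1_induct)
    case 1
    have "s1 Z (\<lambda>e. \<exists>k<e 0. P k)" by (intro s1_bex s1_rel1[OF assms(1)] d1_intros)
    then show ?case by simp
  next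
    case (3 m)
    then have "\<not> P m" using * by blast
    then show ?case using 3 by (auto simp: parith_less_Suc le_less)
  qed simp
  then show False using assms(2) less_add_one by blast
qed

text \<open>A maximum below \<open>B\<close> is a least distance from \<open>B\<close>.\<close>

lemma max_s1:
  assumes "s1 Z (\<lambda>e. P (e 0))" "P n" "\<And>m. P m \<Longrightarrow> m \<le> B" shows "\<exists>m. P m \<and> (\<forall>k. P k \<longrightarrow> k \<le> m)"
proof -
  obtain z where z: "B = n + z" using parith_le_ex[OF assms(3)[OF assms(2)]] by blast
  have "s1 Z (\<lambda>e. \<exists>k. k + e 0 = B \<and> P k)"
    by (intro s1_ex s1_conj s1_rel1[OF assms(1)] d1_s1 d1_intros)
  from least_s1[OF this, of z] z assms(2)
  obtain j where j: "\<exists>k. k + j = B \<and> P k" "\<forall>i<j. \<not> (\<exists>k. k + i = B \<and> P k)" by auto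
  then obtain m where m: "m + j = B" "P m" by blast
  have "k \<le> m" if Pk: "P k" for k
  proof (rule ccontr)
    assume "\<not> k \<le> m"
    then have km: "m < k" by simp
    obtain i where i: "B = k + i" using parith_le_ex[OF assms(3)[OF Pk]] by blast
    then have "m + j = k + i" using m by simp
    then have "i < j" using km unfolding emb_simps by linarith
    then show False using j(2) i Pk by (auto simp: ac_simps)
  qed
  then show ?thesis using m by blast
qed

lemma divmod_ex: "0 < (m::'a) \<Longrightarrow> \<exists>q r. a = q * m + r \<and> r < m"
proof (induction a rule: s1_induct)
  case 1
  show ?case by (intro s1_imp s1_ex s1_conj; intro d1_s1 d1_intros)
next
  case 2
  then show ?case by (intro exI[of _ 0]) simp
next
  case (3 a)
  then obtain q r where *: "a = q * m + r" "r < m" by blast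
  show ?case
  proof (cases "r + 1 = m")
    case True
    have "a + 1 = q * m + (r + 1)" using *(1) by (simp add: add.assoc)
    then have "a + 1 = (q + 1) * m + 0" unfolding True by (simp add: algebra_simps)
    then show ?thesis using 3 by blast
  next
    case False
    then have "r + 1 < m" using *(2) by (simp add: parith_discrete order_le_neq_trans)
    moreover have "a + 1 = q * m + (r + 1)" using * by (simp add: algebra_simps)
    ultimately show ?thesis by blast
  qed
qed

lemma dvmd: "0 < (m::'a) \<Longrightarrow> a = dv a m * m + md a m" "0 < (m::'a) \<Longrightarrow> md a m < m"
proof -
  assume "0 < m"
  then obtain q r where *: "a = q * m + r" "r < m" using divmod_ex by blast
  show "a = dv a m * m + md a m" "md a m < m" using dv_eqI[OF *] md_eqI[OF *] * by simp_all
qed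

lemma d1f_dv0: "d1f Z (\<lambda>e. dv (e 0) (e (Suc 0)))"
proof -
  have "s1 Z (\<lambda>e. if e (Suc (Suc 0)) = 0 then e 0 = 0 else \<exists>r<e (Suc (Suc 0)). e (Suc 0) = e 0 * e (Suc (Suc 0)) + r)"
    unfolding if_bool_eq_conj by (intro d1_s1 d1_intros)
  moreover have "(if m = 0 then q = 0 else \<exists>r<m. a = q * m + r) \<longleftrightarrow> q = dv a m" for a m q :: 'a
    using dvmd[of m a] dv_eqI[of a q m] by (auto simp: dv_def)
  ultimately show ?thesis unfolding d1f_def by simp
qed

lemma d1f_md0: "d1f Z (\<lambda>e. md (e 0) (e (Suc 0)))"
proof -
  have "s1 Z (\<lambda>e. if e (Suc (Suc 0)) = 0 then e 0 = e (Suc 0) else e 0 < e (Suc (Suc 0)) \<and> (\<exists>q\<le>e (Suc 0). e (Suc 0) = q * e (Suc (Suc 0)) + e 0))"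
    unfolding if_bool_eq_conj by (intro d1_s1 d1_intros)
  moreover have "(if m = 0 then r = a else r < m \<and> (\<exists>q\<le>a. a = q * m + r)) \<longleftrightarrow> r = md a m" for a m r :: 'a
  proof (cases "m = 0")
    case False
    then have "0 < m" by simp
    have "dv a m * 1 \<le> dv a m * m" using parith_discrete[OF \<open>0 < m\<close>] by (intro mult_left_mono) simp_all
    then have "dv a m \<le> a" using dvmd(1)[OF \<open>0 < m\<close>, of a] by (metis add_increasing2 mult.right_neutral parith_nonneg)
    then show ?thesis using dvmd[OF \<open>0 < m\<close>, of a] md_eqI[of a _ m r] False by auto
  qed (simp add: md_def)
  ultimately show ?thesis unfolding d1f_def by simp
qed

lemmas d1f_dv = d1f_fun2[of Z dv, OF d1f_dv0]
lemmas d1f_md = d1f_fun2[of Z md, OF d1f_md0]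

end

section \<open>Sequences and primitive recursion\<close>

definition bf :: "'a::parith \<Rightarrow> 'a \<Rightarrow> 'a \<Rightarrow> 'a" where
  "bf a b i = md a (1 + (i + 1) * b)"

context ind1
begin

lemmas s1_struct = s1_ex s1_conj s1_disj s1_imp s1_ball s1_ball_le

lemma md_cong_le:
  fixes m :: 'a
  assumes "0 < m" "emb m dvd emb a - emb b" "b \<le> a" shows "md a m = md b m"
proof -
  obtain k where k: "emb a - emb b = emb m * k" using assms(2) by (elim dvdE)
  have "0 \<le> emb m * k" using assms(3) k unfolding emb_simps by linarith
  moreover have "0 < emb m" using assms(1) unfolding emb_simps .
  ultimately have "0 \<le> k" by (simp add: zero_le_mult_iff)
  then obtain q where q: "k = emb q" using ex_emb by blast
  have "emb a = emb b + emb m * emb q" using k q by simp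
  then have "a = b + m * q" unfolding emb_simps .
  then have "a = (dv b m + q) * m + md b m" using dvmd(1)[OF assms(1), of b] by (simp add: algebra_simps)
  then show ?thesis using md_eqI dvmd(2)[OF assms(1)] by blast
qed

lemma md_cong: "0 < (m::'a) \<Longrightarrow> emb m dvd emb a - emb b \<Longrightarrow> md a m = md b m"
  using md_cong_le[of m a b] md_cong_le[of m b a] by (metis dvd_minus_iff linear minus_diff_eq)

lemma md_dvd: "0 < (m::'a) \<Longrightarrow> emb m dvd emb a - emb (md a m)"
proof -
  assume "0 < m"
  then have "emb a = emb (dv a m) * emb m + emb (md a m)"
    using dvmd(1)[of m a] unfolding emb_simps by simp
  then show ?thesis by simp
qed

lemma md_small: "a < (m::'a) \<Longrightarrow> md a m = a"
  by (rule md_eqI[of a 0]) simp_all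

text \<open>Modulo \<open>mi\<close> one has \<open>(i + 1) * b = -1\<close> and
  \<open>mj = -(d + 1) * b\<close>, where \<open>i = j + (d + 1)\<close> and
  \<open>b = (d + 1) * g\<close>. Multiplying \<open>mj\<close> by
  \<open>s0 = (i + 1) * (i + 1) * g\<close> therefore gives \<open>-1\<close>, and
  \<open>s0 * s0 * mj\<close> inverts \<open>mj\<close>.\<close>

lemma beta_moduli_inverse:
  fixes b :: 'a
  assumes ji: "j < i" and b: "\<And>k. k < n \<Longrightarrow> \<exists>g. b = (k + 1) * g" and i: "i < n"
  shows "\<exists>s. emb (1 + (i + 1) * b) dvd emb s * emb (1 + (j + 1) * b) - 1"
proof -
  obtain d where d: "i = j + (d + 1)"
    using parith_le_ex[of "j + 1" i] ji unfolding parith_Suc_le by (metis add.assoc add.commute)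
  have "d < n" using d i parith_nonneg[of j] unfolding emb_simps by linarith
  then obtain g where g: "b = (d + 1) * g" using b by blast
  define mi where "mi = emb (1 + (i + 1) * b)"
  define mj where "mj = emb (1 + (j + 1) * b)"
  define s0 where "s0 = (i + 1) * (i + 1) * g"
  have mi: "mi = 1 + (emb i + 1) * ((emb d + 1) * emb g)" unfolding mi_def g by (simp add: emb_add emb_mult emb_1)
  have mj: "mj = 1 + (emb j + 1) * ((emb d + 1) * emb g)" unfolding mj_def g by (simp add: emb_add emb_mult emb_1)
  have i': "emb i = emb j + (emb d + 1)" unfolding d by (simp add: emb_add emb_1)
  have s0: "emb s0 = (emb i + 1) * (emb i + 1) * emb g" unfolding s0_def by (simp add: emb_add emb_mult emb_1)
  have "emb s0 * mj + 1 = mi * (1 + (emb i + 1) * (emb j + 1) * emb g)"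
    unfolding s0 mi mj i' by (simp add: algebra_simps)
  then have "mi dvd emb s0 * mj + 1" by simp
  moreover have "emb (s0 * (s0 * (1 + (j + 1) * b))) * mj - 1 = (emb s0 * mj + 1) * (emb s0 * mj - 1)"
    unfolding mj_def by (simp only: emb_mult) (simp add: algebra_simps)
  ultimately have "mi dvd emb (s0 * (s0 * (1 + (j + 1) * b))) * mj - 1" by simp
  then show ?thesis unfolding mi_def mj_def by blast
qed

text \<open>The Chinese remainder theorem as a single Sigma_1 induction. In place of divisor theory
  the invariant carries what is needed: \<open>a\<close> solves the first \<open>j\<close>
  congruences, \<open>c\<close> vanishes modulo the first \<open>j\<close> moduli and is invertible
  modulo every later one.\<close>

lemma beta_seq:
  assumes f: "d1f Z (\<lambda>e. f (e 0))"
  shows "\<exists>a b. \<forall>i<n. bf a b i = f i"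
proof -
  note f' = d1f_fun1[OF f]
  have "\<exists>B. \<forall>i<n. f i < B"
  proof (induction n rule: s1_induct)
    case 1 show ?case by (intro s1_ex d1_s1 d1_intros f')
  next
    case 2 show ?case by simp
  next
    case (3 n)
    then obtain B where B: "\<forall>i<n. f i < B" by blast
    have "f i < B + f n + 1" if "i < n + 1" for i
    proof (cases "i = n")
      case True
      have "f n < B + f n + 1" using emb_nonneg[of B] unfolding emb_simps by linarith
      then show ?thesis using True by simp
    next
      case False
      then have "f i < B" using that B by (auto simp: parith_less_Suc le_less)
      then show ?thesis using emb_nonneg[of "f n"] unfolding emb_simps by linarith
    qed
    then show ?case by blast
  qed
  then obtain B where B: "\<And>i. i < n \<Longrightarrow> f i < B" by blast
  \<comment> \<open>A substitute for a factorial: \<open>b\<close> bounds all values and is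
    divisible by every \<open>i + 1\<close> with \<open>i < n\<close>.\<close>
  have "\<exists>b. 0 < b \<and> B \<le> b \<and> (\<forall>i<n. \<exists>g. b = (i + 1) * g)"
  proof (induction n rule: s1_induct)
    case 1 show ?case by (intro s1_struct d1_intros; intro d1_s1 d1_intros)
  next
    case 2 show ?case by (rule exI[of _ "B + 1"]) (simp add: less_imp_le)
  next
    case (3 n)
    then obtain b where b: "0 < b" "B \<le> b" "\<forall>i<n. \<exists>g. b = (i + 1) * g" by blast
    have "b * 1 \<le> b * (n + 1)" by (rule mult_left_mono) simp_all
    then have "B \<le> b * (n + 1)" using b(2) by simp
    moreover have "0 < b * (n + 1)" using \<open>b * 1 \<le> b * (n + 1)\<close> b(1) by (metis less_le_trans mult.right_neutral)
    moreover have "\<exists>g. b * (n + 1) = (i + 1) * g" if "i < n + 1" for i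
    proof (cases "i = n")
      case True then show ?thesis by (metis mult.commute)
    next
      case False
      then have "i < n" using that by (auto simp: parith_less_Suc le_less)
      then obtain g where "b = (i + 1) * g" using b(3) by blast
      then show ?thesis by (metis mult.assoc)
    qed
    ultimately show ?case by blast
  qed
  then obtain b where b: "0 < b" "B \<le> b" "\<And>i. i < n \<Longrightarrow> \<exists>g. b = (i + 1) * g" by blast
  define M where "M i = 1 + (i + 1) * b" for i
  have Mpos: "0 < M i" for i unfolding M_def by (simp add: add_nonneg_eq_0_iff)
  have Mb: "b < M i" for i
  proof -
    have "1 * b \<le> (i + 1) * b" by (rule mult_right_mono) simp_all
    then show ?thesis unfolding M_def using less_add_one[of b] unfolding emb_simps by simp
  qed
  have dM: "d1f Z (\<lambda>e. M (e 0))" unfolding M_def by (intro d1_intros)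
  note dM' = d1f_fun1[OF dM]
  have "j \<le> n \<longrightarrow> (\<exists>a c. (\<forall>i<j. md a (M i) = f i) \<and> (\<forall>i<j. md c (M i) = 0) \<and>
      (\<forall>i<n. j \<le> i \<longrightarrow> (\<exists>s. md (s * c) (M i) = 1)))" for j
  proof (induction j rule: s1_induct)
    case 1
    show ?case by (intro s1_struct d1_intros; intro d1_s1 d1_intros f' d1f_md dM')
  next
    case 2
    have "\<exists>s. md (s * 1) (M i) = 1" for i
    proof
      have "1 < M i" using b(1) Mb[of i] by (metis add_0 parith_Suc_le le_less_trans)
      then show "md (1 * 1) (M i) = 1" by (simp add: md_small)
    qed
    then show ?case by (auto intro: exI[of _ 0] exI[of _ 1])
  next
    case (3 j)
    show ?case
    proof
      assume jn: "j + 1 \<le> n"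
      then have jn': "j < n" "j \<le> n" by (simp_all add: parith_Suc_le)
      from 3 jn' obtain a c where a: "\<And>i. i < j \<Longrightarrow> md a (M i) = f i" and c: "\<And>i. i < j \<Longrightarrow> md c (M i) = 0"
        and s: "\<And>i. i < n \<Longrightarrow> j \<le> i \<Longrightarrow> \<exists>s. md (s * c) (M i) = 1" by blast
      obtain s where s1: "md (s * c) (M j) = 1" using s jn' by blast
      obtain r where r: "M j = md a (M j) + r" using parith_le_ex[OF less_imp_le[OF dvmd(2)[OF Mpos[of j], of a]]] by blast
      \<comment> \<open>\<open>r\<close> represents \<open>- a\<close> modulo \<open>M j\<close>, so
        the correction changes the residue there from that of \<open>a\<close> to
        \<open>f j\<close>; being a multiple of \<open>c\<close>, it is invisible modulo the earlier
        moduli.\<close>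
      define a' where "a' = a + c * (s * (f j + r))"
      have 1: "emb (M j) dvd emb s * emb c - 1" using md_dvd[OF Mpos, of j "s * c"] s1 by (simp add: emb_mult emb_1)
      have 2: "emb (M j) dvd emb a - emb (md a (M j))" by (rule md_dvd[OF Mpos])
      define u where "u = md a (M j)"
      have rM: "emb (M j) = emb u + emb r" using arg_cong[OF r, of emb] unfolding emb_add u_def .
      have "emb a' - emb (f j) = (emb a - emb u) + (emb s * emb c - 1) * (emb (f j) + emb r) + emb (M j)"
        unfolding a'_def rM by (simp add: emb_add emb_mult algebra_simps)
      then have "emb (M j) dvd emb a' - emb (f j)" using 1 2 unfolding u_def by simp
      then have "md a' (M j) = md (f j) (M j)" by (rule md_cong[OF Mpos])
      also have "\<dots> = f j" by (rule md_small[OF less_trans[OF less_le_trans[OF B[OF jn'(1)] b(2)] Mb]])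
      finally have aj: "md a' (M j) = f j" .
      have ai: "md a' (M i) = f i" if "i < j" for i
      proof -
        have "emb (M i) dvd emb c" using md_dvd[OF Mpos, of i c] c[OF that] by (simp add: emb_0)
        then have "emb (M i) dvd emb a' - emb a" unfolding a'_def by (simp add: emb_add emb_mult)
        then show ?thesis using md_cong[OF Mpos] a[OF that] by metis
      qed
      have ci: "md (c * M j) (M i) = 0" if "i < j + 1" for i
      proof -
        have "emb (M i) dvd emb (c * M j)"
        proof (cases "i = j")
          case True then show ?thesis by (simp add: emb_mult)
        next
          case False
          then have "i < j" using that by (auto simp: parith_less_Suc le_less)
          then show ?thesis using md_dvd[OF Mpos, of i c] c by (simp add: emb_0 emb_mult)
        qed
        then have "emb (M i) dvd emb (c * M j) - emb 0" by (simp add: emb_0)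
        then show ?thesis using md_cong[OF Mpos] md_small[OF Mpos] by metis
      qed
      have si: "\<exists>s. md (s * (c * M j)) (M i) = 1" if i: "i < n" "j + 1 \<le> i" for i
      proof -
        have ji: "j < i" using i by (simp add: parith_Suc_le)
        obtain s where s: "md (s * c) (M i) = 1" using s[OF i(1) less_imp_le[OF ji]] by blast
        then have 1: "emb (M i) dvd emb s * emb c - 1" using md_dvd[OF Mpos, of i "s * c"] by (simp add: emb_mult emb_1)
        obtain t where 2: "emb (M i) dvd emb t * emb (M j) - 1"
          using beta_moduli_inverse[OF ji b(3) i(1)] unfolding M_def by blast
        have "emb ((s * t) * (c * M j)) - emb 1 = (emb s * emb c - 1) * (emb t * emb (M j)) + (emb t * emb (M j) - 1)"
          by (simp add: emb_mult emb_1 algebra_simps)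
        then have "emb (M i) dvd emb ((s * t) * (c * M j)) - emb 1" using 1 2 by simp
        moreover have "1 < M i" using b(1) Mb[of i] by (metis add_0 parith_Suc_le le_less_trans)
        ultimately have "md ((s * t) * (c * M j)) (M i) = 1" using md_cong[OF Mpos] md_small by metis
        then show ?thesis by blast
      qed
      have "\<forall>i<j + 1. md a' (M i) = f i" using aj ai by (auto simp: parith_less_Suc le_less)
      then show "\<exists>a c. (\<forall>i<j + 1. md a (M i) = f i) \<and> (\<forall>i<j + 1. md c (M i) = 0) \<and>
        (\<forall>i<n. j + 1 \<le> i \<longrightarrow> (\<exists>s. md (s * c) (M i) = 1))"
        using ci si by blast
    qed
  qed
  from this[of n] show ?thesis unfolding bf_def M_def by auto
qed

lemma d1f_bf0: "d1f Z (\<lambda>e. bf (e 0) (e (Suc 0)) (e (Suc (Suc 0))))"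
  unfolding bf_def by (intro d1f_md d1_intros)
lemmas d1f_bf = d1f_fun3[of Z bf, OF d1f_bf0]

end

text \<open>Iterates \<open>G\<close> from \<open>z\<close>; the description is unique only if \<open>G\<close> is definable in a model of induction.\<close>

definition prec :: "'a::parith \<Rightarrow> ('a \<Rightarrow> 'a \<Rightarrow> 'a) \<Rightarrow> 'a \<Rightarrow> 'a" where
  "prec z G n = (THE y. \<exists>a b. bf a b 0 = z \<and> (\<forall>i<n. bf a b (i + 1) = G i (bf a b i)) \<and> bf a b n = y)"

context ind1
begin

text \<open>A beta code cannot be extended in place; the sequence with one more value is coded
  afresh by \<open>beta_seq\<close>.\<close>

lemma prec_ex:
  assumes "d1f Z (\<lambda>e. G (e 0) (e (Suc 0)))"
  shows "\<exists>a b. bf a b 0 = z \<and> (\<forall>i<n. bf a b (i + 1) = G i (bf a b i))"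
proof (induction n rule: s1_induct)
  case 1
  show ?case by (intro s1_struct d1_intros; intro d1_s1 d1_intros d1f_bf d1f_fun2[OF assms])
next
  case 2
  have "d1f Z (\<lambda>e. z)" by (rule d1f_c)
  from beta_seq[of "\<lambda>_. z" 1, OF this] obtain a b where "\<forall>i<1. bf a b i = z" by blast
  moreover have "(0::'a) < 1" by (rule zero_less_one)
  ultimately have "bf a b 0 = z" by blast
  then show ?case by auto
next
  case (3 n)
  then obtain a b where ab: "bf a b 0 = z" "\<forall>i<n. bf a b (i + 1) = G i (bf a b i)" by blast
  define f where "f i = (if i \<le> n then bf a b i else G n (bf a b n))" for i
  have "d1f Z (\<lambda>e. f (e 0))" unfolding f_def by (intro d1_intros d1f_bf)
  from beta_seq[OF this, of "n + 1 + 1"] obtain a' b' where f: "\<And>i. i < n + 1 + 1 \<Longrightarrow> bf a' b' i = f i" by blast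
  have "bf a' b' 0 = z" using f[of 0] ab by (simp add: f_def add_pos_pos)
  moreover have "bf a' b' (i + 1) = G i (bf a' b' i)" if "i < n + 1" for i
  proof -
    have "i \<le> n" using that by (simp add: parith_less_Suc)
    then have 1: "bf a' b' i = bf a b i" using f[of i] that less_add_one[of "n + 1"] by (simp add: f_def parith_less_Suc less_imp_le)
    have 2: "bf a' b' (i + 1) = f (i + 1)" using f that by simp
    show ?thesis
    proof (cases "i = n")
      case True
      then show ?thesis using 1 2 by (simp add: f_def parith_Suc_le)
    next
      case False
      then have "i < n" using \<open>i \<le> n\<close> by simp
      then show ?thesis using 1 2 ab(2) by (simp add: f_def parith_Suc_le)
    qed
  qed
  ultimately show ?case by blast
qed

lemma prec_unique:
  fixes n :: 'a
  assumes "bf a b 0 = z" "\<forall>i<n. bf a b (i + 1) = G i (bf a b i)"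
    "bf a' b' 0 = z" "\<forall>i<n. bf a' b' (i + 1) = G i (bf a' b' i)"
  shows "bf a b n = bf a' b' n"
proof -
  have "i \<le> n \<longrightarrow> bf a b i = bf a' b' i" for i :: 'a
  proof (induction i rule: d1_induct)
    case 1 show ?case by (intro d1_intros d1f_bf)
  next
    case 2 show ?case using assms by simp
  next
    case (3 i)
    show ?case using 3 assms(2,4) by (auto simp: parith_Suc_le)
  qed
  then show ?thesis by simp
qed

lemma prec_eqI:
  fixes n :: 'a
  assumes "bf a b 0 = z" "\<forall>i<n. bf a b (i + 1) = G i (bf a b i)" shows "prec z G n = bf a b n"
  unfolding prec_def by (rule the_equality) (use assms prec_unique[of _ _ z n G] in blast)+

lemma prec_rec:
  assumes "d1f Z (\<lambda>e. G (e 0) (e (Suc 0)))"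
  shows "prec z G 0 = z" "prec z G (n + 1) = G n (prec z G n)"
proof -
  obtain a b where ab: "bf a b 0 = z" "\<forall>i<n+1. bf a b (i + 1) = G i (bf a b i)"
    using prec_ex[OF assms, of z "n + 1"] by blast
  show "prec z G 0 = z" using prec_eqI[of a b z 0 G] ab(1) by simp
  have "prec z G n = bf a b n" using ab by (intro prec_eqI) (auto simp: parith_less_Suc less_imp_le)
  then show "prec z G (n + 1) = G n (prec z G n)" using prec_eqI[of a b z "n + 1" G, OF ab] ab(2) less_add_one[of n] by simp
qed

text \<open>The first argument of \<open>G\<close> is a parameter that stays variable, which makes
  functions such as \<open>cn\<close> definable in all arguments. The graph is Sigma_1 because it
  asserts that a code of the computation exists.\<close>

lemma d1f_prec0:
  assumes "d1f Z (\<lambda>e. G (e 0) (e (Suc 0)) (e (Suc (Suc 0))))"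
  shows "d1f Z (\<lambda>e. prec z (G (e 0)) (e (Suc 0)))"
proof -
  have G: "d1f Z (\<lambda>e. G p (e 0) (e (Suc 0)))" for p by (intro d1f_fun3[OF assms] d1_intros)
  have "y = prec z (G p) n \<longleftrightarrow> (\<exists>a b. bf a b 0 = z \<and> (\<forall>i<n. bf a b (i + 1) = G p i (bf a b i)) \<and> y = bf a b n)" for y p n
    using prec_ex[OF G, of z n p] prec_eqI[of _ _ z n "G p"] by metis
  moreover have "s1 Z (\<lambda>e. \<exists>a b. bf a b 0 = z \<and> (\<forall>i<e (Suc (Suc 0)). bf a b (i + 1) = G (e (Suc 0)) i (bf a b i)) \<and> e 0 = bf a b (e (Suc (Suc 0))))"
    by (intro s1_struct d1_intros; intro d1_s1 d1_intros d1f_bf d1f_fun3[OF assms])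
  ultimately show ?thesis unfolding d1f_def by simp
qed

end

section \<open>Binary codes and cardinalities\<close>

text \<open>\<open>pw n\<close> is \<open>2\<close> to the \<open>n\<close>, \<open>bt c v\<close> the \<open>v\<close>-th binary digit of \<open>c\<close>, \<open>cn c n\<close> the number of digits \<open>1\<close> below
\<open>n\<close>. The code \<open>mk n P\<close> of \<open>P\<close> below \<open>n\<close> and the cardinality \<open>cnt n P\<close> are meaningful only if \<open>cod P\<close>.\<close>

definition pw :: "'a::parith \<Rightarrow> 'a" where "pw = prec 1 (\<lambda>i r. r + r)"
definition od :: "'a::parith \<Rightarrow> bool" where "od q \<longleftrightarrow> (\<exists>k. q = k + k + 1)"
definition bt :: "'a::parith \<Rightarrow> 'a \<Rightarrow> bool" where "bt c v \<longleftrightarrow> od (dv c (pw v))"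
definition cn :: "'a::parith \<Rightarrow> 'a \<Rightarrow> 'a" where "cn c = prec 0 (\<lambda>i r. if bt c i then r + 1 else r)"
definition mk :: "'a::parith \<Rightarrow> ('a \<Rightarrow> bool) \<Rightarrow> 'a" where
  "mk n P = (THE c. \<forall>v. bt c v \<longleftrightarrow> v < n \<and> P v)"
definition cod :: "('a::parith \<Rightarrow> bool) \<Rightarrow> bool" where
  "cod P \<longleftrightarrow> (\<forall>n. \<exists>c. \<forall>v. bt c v \<longleftrightarrow> v < n \<and> P v)"
definition cnt :: "'a::parith \<Rightarrow> ('a \<Rightarrow> bool) \<Rightarrow> 'a" where "cnt n P = cn (mk n P) n"

context ind1
begin

section \<open>Powers of two and binary digits\<close>

lemma pw_0 [simp]: "pw (0::'a) = 1" and pw_Suc: "pw (n + 1) = pw n + pw (n::'a)"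
proof -
  have "d1f Z (\<lambda>e. e (Suc 0) + e (Suc 0))" by (intro d1_intros)
  from prec_rec[where G="\<lambda>i r. r + r" and z=1, OF this]
  show "pw (0::'a) = 1" "pw (n + 1) = pw n + pw n" by (simp_all add: pw_def)
qed

lemma d1f_pw0: "d1f Z (\<lambda>e. pw (e 0))"
  unfolding pw_def
  by (rule d1f_fun2[OF d1f_prec0[where G="\<lambda>p i r. r + r"], where f="\<lambda>e. 0" and g="\<lambda>e. e 0"]) (intro d1_intros)+
lemmas d1f_pw = d1f_fun1[of Z pw, OF d1f_pw0]

lemma pw_pos [simp]: "0 < pw (n::'a)"
proof (induction n rule: d1_induct)
  case 1 show ?case by (intro d1_intros d1f_pw)
qed (simp_all add: pw_Suc add_nonneg_eq_0_iff)

lemma pw_neq_0 [simp]: "pw (n::'a) \<noteq> 0" using pw_pos[of n] by simp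

lemma pw_ge1: "1 \<le> pw (n::'a)"
  using parith_Suc_le[of 0 "pw n"] by simp

lemma pw_add: "pw (m + n) = pw m * pw (n::'a)"
proof (induction n rule: d1_induct)
  case 1 show ?case by (intro d1_intros d1f_pw)
next
  case (3 n)
  then show ?case using pw_Suc[of "m + n"] pw_Suc[of n] by (simp add: algebra_simps)
qed simp

lemma pw_less: "n < pw (n::'a)"
proof (induction n rule: d1_induct)
  case 1 show ?case by (intro d1_intros d1f_pw)
next
  case (3 n)
  then show ?case using pw_ge1[of n] pw_Suc[of n] unfolding emb_simps by linarith
qed simp

lemma pw_mono: "m \<le> n \<Longrightarrow> pw m \<le> pw (n::'a)"
proof -
  assume "m \<le> n"
  then obtain d where d: "n = m + d" using parith_le_ex by blast
  have "pw m * 1 \<le> pw m * pw d" by (intro mult_left_mono pw_ge1) simp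
  then show ?thesis by (simp add: d pw_add)
qed

lemma even_or_odd: "\<exists>k::'a. q = k + k \<or> q = k + k + 1"
proof (induction q rule: s1_induct)
  case 1 show ?case by (intro s1_ex d1_s1 d1_intros)
next
  case 2 show ?case by (intro exI[of _ 0]) simp
next
  case (3 q)
  then obtain k where "q = k + k \<or> q = k + k + 1" by blast
  then have "q + 1 = k + k + 1 \<or> q + 1 = (k + 1) + (k + 1)" by (auto simp: ac_simps)
  then show ?case by blast
qed

lemma even_neq_odd: "k + k \<noteq> l + l + (1::'a)"
proof
  assume "k + k = l + l + 1"
  then have "k * 2 + 0 = l * 2 + 1" by (simp add: mult_2_right)
  from divmod_unique(2)[OF this] show False by simp
qed

lemma not_od: "\<not> od q \<longleftrightarrow> (\<exists>k::'a. q = k + k)"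
  using even_or_odd[of q] even_neq_odd unfolding od_def by metis

lemma od_add: "od (q + (k + k)) \<longleftrightarrow> od (q::'a)"
proof
  assume "od (q + (k + k))"
  show "od q"
  proof (rule ccontr)
    assume "\<not> od q"
    then obtain l where "q = l + l" unfolding not_od by blast
    then have "q + (k + k) = (l + k) + (l + k)" by (simp add: ac_simps)
    then show False using \<open>od (q + (k + k))\<close> not_od by blast
  qed
next
  assume "od q"
  then obtain l where "q = l + l + 1" unfolding od_def by blast
  then have "q + (k + k) = (l + k) + (l + k) + 1" by (simp add: ac_simps)
  then show "od (q + (k + k))" unfolding od_def by blast
qed

lemma od_0_1 [simp]: "\<not> od (0::'a)" "od (1::'a)"
  unfolding not_od by (auto intro: exI[of _ 0] simp: od_def)

lemma d1_od: "d1f Z f \<Longrightarrow> d1 Z (\<lambda>e. od (f e))"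
proof (rule d1_rel1)
  have "d1 Z (\<lambda>e. \<exists>k\<le>e 0. e 0 = k + k + 1)" by (intro d1_intros)
  moreover have "(\<exists>k\<le>q. q = k + k + 1) \<longleftrightarrow> od q" for q :: 'a
  proof -
    have "k \<le> k + k + 1" for k :: 'a using emb_nonneg[of k] unfolding emb_simps by linarith
    then show ?thesis unfolding od_def by blast
  qed
  ultimately show "d1 Z (\<lambda>e. od (e 0))" by simp
qed

lemma d1_bt: "d1f Z f \<Longrightarrow> d1f Z g \<Longrightarrow> d1 Z (\<lambda>e. bt (f e) (g e))"
  unfolding bt_def by (intro d1_od d1f_dv d1f_pw)

lemma d1f_cn: "d1f Z f \<Longrightarrow> d1f Z g \<Longrightarrow> d1f Z (\<lambda>e. cn (f e) (g e))"
  unfolding cn_def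
  by (rule d1f_fun2[OF d1f_prec0[where G="\<lambda>p i r. if bt p i then r + 1 else r"]]) (intro d1_intros d1_bt)+

lemma cn_0 [simp]: "cn c (0::'a) = 0"
  and cn_Suc: "cn c (n + 1) = (if bt c n then cn c n + 1 else cn c (n::'a))"
proof -
  have "d1f Z (\<lambda>e. if bt c (e 0) then e (Suc 0) + 1 else e (Suc 0))" by (intro d1_intros d1_bt)
  from prec_rec[of "\<lambda>i r. if bt c i then r + 1 else r", OF this]
  show "cn c 0 = 0" "cn c (n + 1) = (if bt c n then cn c n + 1 else cn c n)" by (simp_all add: cn_def)
qed

lemma dv_pw_less: "r < pw m \<Longrightarrow> dv r (pw (m::'a)) = 0"
  by (rule dv_eqI[of r 0]) simp_all

text \<open>Below \<open>n\<close> the summand \<open>q * pw n\<close> alters the quotient by an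
  even number; from \<open>n\<close> on, \<open>r\<close> disappears into the remainder.\<close>

lemma bt_split:
  assumes r: "r < pw (n::'a)"
  shows "bt (q * pw n + r) v \<longleftrightarrow> (if v < n then bt r v else bt q (v - n))"
proof (cases "v < n")
  case True
  then obtain d where d: "n = v + (d + 1)"
    using parith_le_ex[of "v + 1" n] unfolding parith_Suc_le by (metis add.assoc add.commute)
  have pn: "pw n = (pw d + pw d) * pw v" using pw_add[of v "d + 1"] pw_Suc[of d] unfolding d by (simp add: ac_simps)
  have "q * pw n + r = (dv r (pw v) + (q * pw d + q * pw d)) * pw v + md r (pw v)"
    using dvmd(1)[OF pw_pos, of r v] unfolding pn emb_simps by (simp add: algebra_simps)
  then have "dv (q * pw n + r) (pw v) = dv r (pw v) + (q * pw d + q * pw d)"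
    using dvmd(2)[of "pw v" r] by (intro dv_eqI) simp_all
  then show ?thesis using True by (simp add: bt_def od_add)
next
  case False
  then have "n \<le> v" by simp
  then obtain d where d: "v = n + d" using parith_le_ex by blast
  have 1: "q * pw n + r = dv q (pw d) * pw v + (md q (pw d) * pw n + r)"
    by (subst dvmd(1)[of "pw d" q]) (simp_all add: d pw_add algebra_simps)
  have "md q (pw d) + 1 \<le> pw d" using dvmd(2)[of "pw d" q] by (simp add: parith_Suc_le)
  then have "(md q (pw d) + 1) * pw n \<le> pw d * pw n" by (rule mult_right_mono) simp
  then have "md q (pw d) * pw n + r < pw v" using r unfolding d pw_add emb_simps by (simp add: algebra_simps)
  from dv_eqI[OF 1 this] show ?thesis using False by (simp add: bt_def d)
qed

lemma bt_0 [simp]: "\<not> bt (0::'a) v" unfolding bt_def by (simp add: dv_pw_less)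

lemma bt_bound: "c < pw n \<Longrightarrow> bt c v \<Longrightarrow> v < (n::'a)"
  using dv_pw_less[of c v] less_le_trans[OF _ pw_mono, of c n v] by (cases "v < n") (auto simp: bt_def)

lemma bt_less: "bt c v \<Longrightarrow> v < (c::'a)"
  using bt_bound[OF pw_less] by blast

text \<open>The bounds \<open>pw n\<close> keep the statement Delta_1, so that induction on
  \<open>n\<close> applies; the step splits off the top digit.\<close>

lemma bt_ext0: "\<forall>c<pw n. \<forall>d<pw n. (\<forall>v<n. bt c v = bt d v) \<longrightarrow> c = (d::'a)"
proof (induction n rule: d1_induct)
  case 1 show ?case by (intro d1_intros d1f_pw d1_bt)
next
  case 2 show ?case using parith_less_Suc[of _ "0::'a"] by simp
next
  case (3 n)
  have q: "dv c (pw n) = (if bt c n then 1 else 0)" "c = dv c (pw n) * pw n + md c (pw n)" "md c (pw n) < pw n"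
    "\<And>v. v < n \<Longrightarrow> bt (md c (pw n)) v = bt c v" if "c < pw (n + 1)" for c
  proof -
    show 1: "c = dv c (pw n) * pw n + md c (pw n)" and 2: "md c (pw n) < pw n" using dvmd[of "pw n" c] by simp_all
    show "bt (md c (pw n)) v = bt c v" if "v < n" for v
      using bt_split[OF 2, of "dv c (pw n)" v] 1[symmetric] that by simp
    have "dv c (pw n) < 1 + 1"
    proof (rule ccontr)
      assume "\<not> dv c (pw n) < 1 + 1"
      then have "(1 + 1) * pw n \<le> dv c (pw n) * pw n" by (intro mult_right_mono) simp_all
      then have "(1 + 1) * pw n \<le> c" by (subst 1) (simp add: add_increasing2)
      then show False using that pw_Suc[of n] by (simp add: mult_2)
    qed
    then have "dv c (pw n) = 0 \<or> dv c (pw n) = 1" unfolding parith_less_Suc le_less using parith_less_Suc[of _ "0::'a"] by auto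
    then show "dv c (pw n) = (if bt c n then 1 else 0)" unfolding bt_def by auto
  qed
  show ?case
  proof (intro allI impI)
    fix c d assume c: "c < pw (n + 1)" and d: "d < pw (n + 1)" and *: "\<forall>v<n + 1. bt c v = bt d v"
    have "md c (pw n) = md d (pw n)"
      using 3 q(3,4)[OF c] q(3,4)[OF d] * by (auto simp: parith_less_Suc)
    moreover have "bt c n = bt d n" using * less_add_one by blast
    ultimately show "c = d" using q(1,2)[OF c] q(1,2)[OF d] by metis
  qed
qed

lemma bt_ext: "(\<And>v. bt c v = bt d v) \<Longrightarrow> c = (d::'a)"
proof -
  assume *: "\<And>v. bt c v = bt d v"
  have "c < pw (max c d)" "d < pw (max c d)"
    using pw_less[of c] pw_less[of d] pw_mono[of c "max c d"] pw_mono[of d "max c d"] by (auto intro: less_le_trans)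
  then show "c = d" using bt_ext0 * by blast
qed

lemma bt_md: "bt (md c (pw n)) v \<longleftrightarrow> v < n \<and> bt c (v::'a)"
proof -
  have 1: "c = dv c (pw n) * pw n + md c (pw n)" and 2: "md c (pw n) < pw n" using dvmd[of "pw n" c] by simp_all
  show ?thesis using bt_split[OF 2, of "dv c (pw n)" v] 1[symmetric] bt_bound[OF 2, of v] by auto
qed

lemma less_pwI: "(\<And>v. bt c v \<Longrightarrow> v < n) \<Longrightarrow> c < pw (n::'a)"
proof -
  assume *: "\<And>v. bt c v \<Longrightarrow> v < n"
  have "bt c v = bt (md c (pw n)) v" for v using * by (auto simp: bt_md)
  then have "c = md c (pw n)" by (rule bt_ext)
  then show ?thesis using dvmd(2)[of "pw n" c] by simp
qed

lemma bt_set: "\<not> bt c v \<Longrightarrow> bt (c + pw v) w \<longleftrightarrow> w = v \<or> bt c (w::'a)"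
proof -
  assume *: "\<not> bt c v"
  let ?m = "v + 1"
  let ?r = "md c (pw ?m)"
  have c: "c = dv c (pw ?m) * pw ?m + ?r" and r: "?r < pw ?m" using dvmd[of "pw ?m" c] by simp_all
  have r': "?r < pw v"
  proof (rule less_pwI)
    fix w assume "bt ?r w"
    then have "w < v + 1" "bt c w" by (auto simp: bt_md)
    then show "w < v" using * by (auto simp: parith_less_Suc le_less)
  qed
  have 1: "bt (1 * pw v + ?r) w \<longleftrightarrow> w = v \<or> bt ?r w" for w
  proof (cases "w < v")
    case True then show ?thesis using bt_split[OF r', of 1 w] by auto
  next
    case False
    have "bt 1 (w - v) \<longleftrightarrow> w - v = 0"
      using bt_less[of 1 "w - v"] by (auto simp: bt_def dv_eqI[of 1 1 1 0] parith_less_Suc[of _ 0, simplified])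
    moreover have "\<not> bt ?r w" using bt_bound[OF r'] False by blast
    moreover from False have "v \<le> w" by simp
    then obtain d where d: "w = v + d" using parith_le_ex by blast
    ultimately show ?thesis using bt_split[OF r', of 1 w] False by (auto simp: d)
  qed
  have "1 * pw v + ?r < pw ?m" using r' pw_Suc[of v] by simp
  from bt_split[OF this, of "dv c (pw ?m)" w]
  have "bt (c + pw v) w \<longleftrightarrow> (if w < ?m then bt (1 * pw v + ?r) w else bt (dv c (pw ?m)) (w - ?m))"
    by (subst c) (simp add: ac_simps)
  also have "\<dots> \<longleftrightarrow> w = v \<or> bt c w"
    unfolding 1 using bt_split[OF r, of "dv c (pw ?m)" w] c[symmetric] bt_md[of c ?m w] by (auto simp: less_add_one)
  finally show ?thesis .
qed

text \<open>Bounded Sigma_1 comprehension. Among the codes of subsets of \<open>P\<close> below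
  \<open>n\<close> a numerically largest one exists by \<open>max_s1\<close>; a missing element
  could be added as a digit and would give a larger code.\<close>

lemma s1_cod: assumes "s1 Z (\<lambda>e. P (e 0))" shows "cod P"
  unfolding cod_def
proof
  fix n :: 'a
  let ?Q = "\<lambda>c. c < pw n \<and> (\<forall>v<n. bt c v \<longrightarrow> P v)"
  have "s1 Z (\<lambda>e. ?Q (e 0))"
    by (intro s1_conj s1_ball s1_imp s1_rel1[OF assms] d1f_c d1f_v; intro d1_s1 d1_intros d1f_pw d1_bt)
  from max_s1[of ?Q 0 "pw n", OF this] obtain c where c: "?Q c" "\<And>d. ?Q d \<Longrightarrow> d \<le> c"
    by (auto simp: less_imp_le)
  have "bt c v" if "v < n" "P v" for v
  proof (rule ccontr)
    assume *: "\<not> bt c v"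
    have "c + pw v < pw n" using bt_set[OF *] bt_bound[of c n] c(1) that(1) by (intro less_pwI) auto
    then have "?Q (c + pw v)" using c(1) that bt_set[OF *] by auto
    from c(2)[OF this] show False using add_le_cancel_left[of c "pw v" 0] by simp
  qed
  then have "\<forall>v. bt c v \<longleftrightarrow> v < n \<and> P v" using c(1) bt_bound[of c n] by blast
  then show "\<exists>c. \<forall>v. bt c v \<longleftrightarrow> v < n \<and> P v" by blast
qed

lemma mk_eqI: "(\<And>v. bt c v \<longleftrightarrow> v < n \<and> P v) \<Longrightarrow> mk n P = (c::'a)"
  unfolding mk_def by (rule the_equality) (auto intro: bt_ext)

lemma bt_mk: "cod P \<Longrightarrow> bt (mk n P) v \<longleftrightarrow> v < n \<and> P (v::'a)"
  unfolding cod_def using mk_eqI by metis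

lemma mk_cong: "(\<And>v. v < n \<Longrightarrow> P v = Q v) \<Longrightarrow> mk n P = mk (n::'a) Q"
  unfolding mk_def by (rule arg_cong[of _ _ The]) auto

lemma d1_cod: "d1 Z (\<lambda>e. P (e 0)) \<Longrightarrow> cod P"
  by (rule s1_cod[OF d1_s1])

lemma cod_bt: "cod (bt (c::'a))"
  by (rule d1_cod) (intro d1_bt d1_intros)

text \<open>Only initial segments matter for \<open>cod\<close>. This permits the method used below:
  replace a coded predicate by the digits of a code, for which induction is Delta_1, and transfer
  the result back.\<close>

lemma cod_local: "(\<And>n. \<exists>Q. cod Q \<and> (\<forall>v<n. P v = Q v)) \<Longrightarrow> cod (P :: 'a \<Rightarrow> bool)"
  unfolding cod_def by metis

lemma cod_code: "cod P \<Longrightarrow> \<exists>c. \<forall>v<n. P v \<longleftrightarrow> bt c (v::'a)"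
  unfolding cod_def by metis

lemma cod_comb2:
  fixes P Q :: "'a \<Rightarrow> bool"
  assumes "cod P" "cod Q" "\<And>c d :: 'a. cod (\<lambda>v. F (bt c v) (bt d v))" shows "cod (\<lambda>v. F (P v) (Q v))"
proof (rule cod_local)
  fix n :: 'a
  obtain c d where "\<forall>v<n. P v \<longleftrightarrow> bt c v" "\<forall>v<n. Q v \<longleftrightarrow> bt d v" using cod_code assms(1,2) by metis
  then show "\<exists>R. cod R \<and> (\<forall>v<n. F (P v) (Q v) = R v)" using assms(3)[of c d] by (intro exI conjI) auto
qed

lemma cod_conj: "cod P \<Longrightarrow> cod Q \<Longrightarrow> cod (\<lambda>v::'a. P v \<and> Q v)"
  by (rule cod_comb2[where F="(\<and>)"]) (assumption | rule d1_cod | intro d1_bt d1_intros)+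
lemma cod_disj: "cod P \<Longrightarrow> cod Q \<Longrightarrow> cod (\<lambda>v::'a. P v \<or> Q v)"
  by (rule cod_comb2[where F="(\<or>)"]) (assumption | rule d1_cod | intro d1_bt d1_intros)+
lemma cod_neg: "cod P \<Longrightarrow> cod (\<lambda>v::'a. \<not> P v)"
  by (rule cod_comb2[where F="\<lambda>p q. \<not> p"]) (assumption | rule d1_cod | intro d1_bt d1_intros)+

lemma d1f_mk:
  assumes n: "d1f Z n" and P: "d1 Z (\<lambda>e. P (\<lambda>i. e (Suc i)) (e 0))"
  shows "d1f Z (\<lambda>e. mk (n e) (P e))"
proof -
  have "tm (\<lambda>e'. case_nat (e' 0) e i)" for e :: "nat \<Rightarrow> 'a" and i by (intro tm_case_nat tm.intros)
  from d1_subst[OF P, of "\<lambda>e'. case_nat (e' 0) e" for e, OF this] have "d1 Z (\<lambda>e'. P e (e' 0))" for e by simp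
  then have cod: "cod (P e)" for e by (rule d1_cod)
  \<comment> \<open>Digits of \<open>c\<close> lie below \<open>c\<close>, and \<open>P\<close>
    matters only below \<open>n e\<close>, so testing up to \<open>c + n e\<close> identifies the
    code and makes the graph Delta_1.\<close>
  have *: "c = mk (n e) (P e) \<longleftrightarrow> (\<forall>v<c + n e. bt c v \<longleftrightarrow> v < n e \<and> P e v)" for c e
  proof
    show "\<forall>v<c + n e. bt c v \<longleftrightarrow> v < n e \<and> P e v" if "c = mk (n e) (P e)" using that bt_mk[OF cod] by blast
    assume *: "\<forall>v<c + n e. bt c v \<longleftrightarrow> v < n e \<and> P e v"
    have "bt c v \<longleftrightarrow> v < n e \<and> P e v" for v
    proof (cases "v < c + n e")
      case False
      then have "\<not> v < c" "\<not> v < n e" using emb_nonneg[of c] emb_nonneg[of "n e"] unfolding emb_simps by linarith+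
      then show ?thesis using bt_less by blast
    qed (use * in blast)
    then show "c = mk (n e) (P e)" using mk_eqI by metis
  qed
  have "tm (\<lambda>e. case_nat (e 0) (\<lambda>i. e (Suc (Suc i))) j)" for j by (intro tm_case_nat tm.intros)
  from d1_subst[OF P, of "\<lambda>e. case_nat (e 0) (\<lambda>i. e (Suc (Suc i)))", OF this] have P': "d1 Z (\<lambda>e. P (\<lambda>i. e (Suc (Suc i))) (e 0))" by simp
  show ?thesis unfolding d1f_def *
    by (intro d1_s1 d1_intros d1_bt P' d1f_sh n)
qed

section \<open>Counting the elements of coded sets\<close>

lemma cn_cong: "(\<And>v. v < n \<Longrightarrow> bt c v = bt d v) \<Longrightarrow> cn c n = cn d (n::'a)"
proof -
  assume *: "\<And>v. v < n \<Longrightarrow> bt c v = bt d v"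
  have "m \<le> n \<longrightarrow> cn c m = cn d m" for m
  proof (induction m rule: d1_induct)
    case 1 show ?case by (intro d1_intros d1f_cn)
  next
    case (3 m) then show ?case using *[of m] by (simp add: cn_Suc parith_Suc_le less_imp_le)
  qed simp
  then show ?thesis by simp
qed

lemma cnt_code: fixes n :: 'a assumes "\<And>v. v < n \<Longrightarrow> P v \<longleftrightarrow> bt c v" shows "cnt n P = cn c n"
proof -
  have "mk n P = mk n (bt c)" by (rule mk_cong) (rule assms)
  then have "cnt n P = cn (mk n (bt c)) n" unfolding cnt_def by simp
  also have "\<dots> = cn c n" by (rule cn_cong) (simp add: bt_mk[OF cod_bt])
  finally show ?thesis .
qed

lemma cnt_0 [simp]: "cnt 0 P = (0::'a)" by (simp add: cnt_def)

lemma cnt_Suc: "cod P \<Longrightarrow> cnt (n + 1) P = (if P n then cnt n P + 1 else cnt (n::'a) P)"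
proof -
  assume "cod P"
  then obtain c where c: "\<forall>v<n+1. P v \<longleftrightarrow> bt c v" using cod_code by blast
  then have "cnt (n + 1) P = cn c (n + 1)" "cnt n P = cn c n" "P n \<longleftrightarrow> bt c n"
    by (auto intro!: cnt_code simp: parith_less_Suc less_imp_le)
  then show ?thesis by (simp add: cn_Suc)
qed

lemma cnt_cong: "(\<And>v. v < n \<Longrightarrow> P v = Q v) \<Longrightarrow> cnt n P = cnt (n::'a) Q"
  unfolding cnt_def using mk_cong by metis

lemma d1f_cnt:
  assumes n: "d1f Z n" and P: "d1 Z (\<lambda>e. P (\<lambda>i. e (Suc i)) (e 0))"
  shows "d1f Z (\<lambda>e. cnt (n e) (P e))"
  unfolding cnt_def by (intro d1f_cn d1f_mk assms)

lemma d1f_bound: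
  assumes "d1f Z (\<lambda>e. f (e 0))" shows "\<exists>B. \<forall>i<n. f i < B"
proof (induction n rule: s1_induct)
  case 1 show ?case by (intro s1_ex d1_s1 d1_intros d1f_fun1[OF assms])
next
  case 2 show ?case by simp
next
  case (3 n)
  then obtain B where B: "\<forall>i<n. f i < B" by blast
  have "f i < B + f n + 1" if "i < n + 1" for i
  proof (cases "i = n")
    case True
    have "f n < B + f n + 1" using emb_nonneg[of B] unfolding emb_simps by linarith
    then show ?thesis using True by simp
  next
    case False
    then have "f i < B" using that B by (auto simp: parith_less_Suc le_less)
    then show ?thesis using emb_nonneg[of "f n"] unfolding emb_simps by linarith
  qed
  then show ?case by blast
qed

lemma cod_comp:
  assumes "cod P" "d1f Z (\<lambda>e. f (e 0))" shows "cod (\<lambda>w. P (f w))"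
proof (rule cod_local)
  fix n :: 'a
  obtain B where B: "\<forall>i<n. f i < B" using d1f_bound[OF assms(2)] by blast
  obtain c where c: "\<forall>v<B. P v \<longleftrightarrow> bt c v" using cod_code[OF assms(1)] by blast
  have "cod (\<lambda>w. bt c (f w))" by (rule d1_cod) (intro d1_bt d1_intros assms(2))
  then show "\<exists>Q. cod Q \<and> (\<forall>v<n. P (f v) = Q v)" using B c by (intro exI[of _ "\<lambda>w. bt c (f w)"]) auto
qed

lemmas cod_simps = cod_conj cod_disj cod_neg cod_bt

lemma cod_eq: "cod (\<lambda>w::'a. w = x)" by (rule d1_cod) (intro d1_intros)
lemma cod_const: "cod (\<lambda>w::'a. p)" by (rule d1_cod) (intro d1_intros)

lemma cnt_mono0: "cnt n (\<lambda>v. bt c v \<and> bt d v) \<le> cnt n (bt (d::'a))"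
proof (induction n rule: d1_induct)
  case 1 show ?case by (intro d1_intros d1_bt d1f_cnt)
next
  case (3 n)
  then show ?case using cnt_Suc[OF cod_bt, of n d] cnt_Suc[OF cod_conj[OF cod_bt cod_bt], of n c d]
    by (auto intro: order_trans less_imp_le)
qed simp

lemma cnt_mono:
  fixes n :: 'a
  assumes "cod P" "cod Q" "\<And>v. v < n \<Longrightarrow> P v \<Longrightarrow> Q v" shows "cnt n P \<le> cnt n Q"
proof -
  obtain c d where cd: "\<forall>v<n. P v \<longleftrightarrow> bt c v" "\<forall>v<n. Q v \<longleftrightarrow> bt d v" using cod_code assms(1,2) by metis
  have "cnt n P = cnt n (\<lambda>v. bt c v \<and> bt d v)" using cd assms(3) by (intro cnt_cong) blast
  moreover have "cnt n Q = cnt n (bt d)" using cd by (intro cnt_cong) blast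
  ultimately show ?thesis using cnt_mono0 by simp
qed

lemma cnt_disj_conj:
  fixes n :: 'a
  assumes "cod P" "cod Q"
  shows "cnt n (\<lambda>v. P v \<or> Q v) + cnt n (\<lambda>v. P v \<and> Q v) = cnt n P + cnt n Q"
proof -
  obtain c d where cd: "\<forall>v<n. P v \<longleftrightarrow> bt c v" "\<forall>v<n. Q v \<longleftrightarrow> bt d v" using cod_code assms(1,2) by metis
  have "cnt m (\<lambda>v. bt c v \<or> bt d v) + cnt m (\<lambda>v. bt c v \<and> bt d v) = cnt m (bt c) + cnt m (bt d)" for m
  proof (induction m rule: d1_induct)
    case 1 show ?case by (intro d1_intros d1_bt d1f_cnt)
  next
    case (3 m)
    show ?case
      using 3 cnt_Suc[OF cod_bt, of m d] cnt_Suc[OF cod_bt, of m c] cnt_Suc[OF cod_conj[OF cod_bt cod_bt], of m c d]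
        cnt_Suc[OF cod_disj[OF cod_bt cod_bt], of m c d]
      by (cases "bt c m"; cases "bt d m") (simp_all add: ac_simps)
  qed simp
  moreover have "cnt n P = cnt n (bt c)" "cnt n Q = cnt n (bt d)"
    "cnt n (\<lambda>v. P v \<or> Q v) = cnt n (\<lambda>v. bt c v \<or> bt d v)" "cnt n (\<lambda>v. P v \<and> Q v) = cnt n (\<lambda>v. bt c v \<and> bt d v)"
    using cd by (auto intro!: cnt_cong)
  ultimately show ?thesis by simp
qed

lemma cnt_False [simp]: "cnt n (\<lambda>v. False) = (0::'a)"
proof (induction n rule: d1_induct)
  case 1 show ?case by (intro d1_intros d1f_cnt)
qed (simp_all add: cnt_Suc[OF cod_const])

lemma cnt_True [simp]: "cnt n (\<lambda>v. True) = (n::'a)"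
proof (induction n rule: d1_induct)
  case 1 show ?case by (intro d1_intros d1f_cnt)
qed (simp_all add: cnt_Suc[OF cod_const])

lemma cnt_disjoint:
  fixes n :: 'a
  assumes "cod P" "cod Q" "\<And>v. v < n \<Longrightarrow> P v \<Longrightarrow> Q v \<Longrightarrow> False"
  shows "cnt n (\<lambda>v. P v \<or> Q v) = cnt n P + cnt n Q"
proof -
  have "cnt n (\<lambda>v. P v \<and> Q v) = cnt n (\<lambda>v. False)" using assms(3) by (intro cnt_cong) blast
  then show ?thesis using cnt_disj_conj[OF assms(1,2), of n] by simp
qed

lemma cnt_disj_le: "cod P \<Longrightarrow> cod Q \<Longrightarrow> cnt n (\<lambda>v. P v \<or> Q v) \<le> cnt n P + cnt (n::'a) Q"
  using cnt_disj_conj[of P Q n] by (metis add_increasing2 order_refl parith_nonneg)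

lemma cnt_single: "cnt n (\<lambda>v. v = x) = (if x < n then 1 else (0::'a))"
proof (induction n rule: d1_induct)
  case 1 show ?case by (intro d1_intros d1f_cnt)
next
  case (3 n)
  then show ?case by (auto simp: cnt_Suc[OF cod_eq] parith_less_Suc le_less)
qed simp

lemma cnt_split:
  assumes "cod P" "cod Q" shows "cnt n P = cnt n (\<lambda>v. P v \<and> Q v) + cnt (n::'a) (\<lambda>v. P v \<and> \<not> Q v)"
proof -
  have "cnt n P = cnt n (\<lambda>v. P v \<and> Q v \<or> P v \<and> \<not> Q v)" by (rule cnt_cong) blast
  also have "\<dots> = cnt n (\<lambda>v. P v \<and> Q v) + cnt n (\<lambda>v. P v \<and> \<not> Q v)"
    by (intro cnt_disjoint cod_simps assms) blast
  finally show ?thesis .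
qed

lemma cnt_strict:
  fixes n :: 'a
  assumes "cod P" "cod Q" "\<And>v. v < n \<Longrightarrow> P v \<Longrightarrow> Q v" "x < n" "Q x" "\<not> P x"
  shows "cnt n P + 1 \<le> cnt n Q"
proof -
  have c: "cod (\<lambda>v. v = x)" by (rule d1_cod) (intro d1_intros)
  have "cnt n (\<lambda>v. P v \<or> v = x) = cnt n P + cnt n (\<lambda>v. v = x)"
    by (rule cnt_disjoint[OF assms(1) c]) (use assms(6) in blast)
  moreover have "cnt n (\<lambda>v. P v \<or> v = x) \<le> cnt n Q"
    by (rule cnt_mono[OF cod_disj[OF assms(1) c] assms(2)]) (use assms(3,5) in blast)
  ultimately show ?thesis using cnt_single assms(4) by simp
qed

lemma cnt_insert:
  fixes n :: 'a
  assumes "cod P" shows "cnt n (\<lambda>v. P v \<or> v = x) \<le> cnt n P + 1"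
    "x < n \<Longrightarrow> \<not> P x \<Longrightarrow> cnt n (\<lambda>v. P v \<or> v = x) = cnt n P + 1"
proof -
  have "cnt n P + cnt n (\<lambda>v. v = x) \<le> cnt n P + 1" by (simp add: cnt_single)
  then show "cnt n (\<lambda>v. P v \<or> v = x) \<le> cnt n P + 1" using cnt_disj_le[OF assms cod_eq, of n x] by (rule order_trans[rotated])
  show "cnt n (\<lambda>v. P v \<or> v = x) = cnt n P + 1" if "x < n" "\<not> P x"
    using cnt_disjoint[OF assms cod_eq, of n x] that by (auto simp: cnt_single)
qed

lemma cnt_pos: "cod P \<Longrightarrow> v < n \<Longrightarrow> P v \<Longrightarrow> 1 \<le> cnt (n::'a) P"
  using cnt_mono[of "\<lambda>w. w = v" P n] by (auto simp: cnt_single cod_eq)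

lemma cnt_posD: "cnt (n::'a) P \<noteq> 0 \<Longrightarrow> \<exists>v<n. P v"
  using cnt_cong[of n P "\<lambda>v. False"] by auto

lemma cnt_le: "cod P \<Longrightarrow> cnt n P \<le> (n::'a)"
  using cnt_mono[of P "\<lambda>v. True" n] by (simp add: cod_const)

lemma cnt_add:
  fixes a :: 'a
  assumes "cod P" shows "cnt (a + b) P = cnt a P + cnt b (\<lambda>v. P (a + v))"
proof -
  obtain c where c: "\<forall>v<a + b. P v \<longleftrightarrow> bt c v" using cod_code[OF assms] by blast
  have "cnt (a + i) (bt c) = cnt a (bt c) + cnt i (\<lambda>v. bt c (a + v))" for i
  proof (induction i rule: d1_induct)
    case 1 show ?case by (intro d1_intros d1_bt d1f_cnt)
  next
    case (3 i)
    have "cod (\<lambda>v. bt c (a + v))" by (rule d1_cod) (intro d1_intros d1_bt)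
    from cnt_Suc[OF this, of i] cnt_Suc[OF cod_bt, of "a + i" c] 3 show ?case by (simp add: add.assoc)
  qed simp
  moreover have "v < a + b" if "v < a" for v using that emb_nonneg[of b] unfolding emb_simps by linarith
  then have "cnt a P = cnt a (bt c)" using c by (intro cnt_cong) blast
  moreover have "cnt (a + b) P = cnt (a + b) (bt c)" "cnt b (\<lambda>v. P (a + v)) = cnt b (\<lambda>v. bt c (a + v))"
    using c by (auto intro!: cnt_cong)
  ultimately show ?thesis by simp
qed

lemma cnt_periodic:
  fixes k :: 'a
  assumes "cod P" "0 < m" shows "cnt (k * m) (\<lambda>v. P (md v m)) = k * cnt m P"
proof -
  obtain c where c: "\<forall>v<m. P v \<longleftrightarrow> bt c v" using cod_code[OF assms(1)] by blast
  have cod: "cod (\<lambda>v. bt c (md v m))" by (rule d1_cod) (intro d1_intros d1_bt d1f_md)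
  have "cnt (k * m) (\<lambda>v. bt c (md v m)) = k * cnt m (bt c)"
  proof (induction k rule: d1_induct)
    case 1 show ?case by (intro d1_intros d1_bt d1f_cnt d1f_md)
  next
    case (3 k)
    have "cnt m (\<lambda>v. bt c (md (k * m + v) m)) = cnt m (bt c)"
      by (rule cnt_cong) (simp add: md_eqI[OF refl])
    then show ?case using cnt_add[OF cod, of "k * m" m] 3 by (simp add: distrib_right)
  qed simp
  moreover have "cnt (k * m) (\<lambda>v. P (md v m)) = cnt (k * m) (\<lambda>v. bt c (md v m))"
    using c dvmd(2)[OF assms(2)] by (intro cnt_cong) blast
  moreover have "cnt m P = cnt m (bt c)" using c by (intro cnt_cong) blast
  ultimately show ?thesis by simp
qed

text \<open>Induction on the domain: each further point of \<open>P\<close> adds at most one image.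
  Since \<open>f\<close> may identify points, projections can be used.\<close>

lemma cnt_image:
  fixes n m :: 'a
  assumes f: "d1f Z (\<lambda>e. f (e 0))" and "cod P" "cod Q"
    and im: "\<And>w. w < m \<Longrightarrow> Q w \<Longrightarrow> \<exists>v<n. P v \<and> f v = w"
  shows "cnt m Q \<le> cnt n P"
proof -
  obtain c where c: "\<forall>v<n. P v \<longleftrightarrow> bt c v" using cod_code[OF assms(2)] by blast
  have cod: "cod (\<lambda>w. \<exists>v<i. bt c v \<and> f v = w)" for i by (rule d1_cod) (intro d1_intros d1_bt d1f_fun1[OF f])
  have "cnt m (\<lambda>w. \<exists>v<i. bt c v \<and> f v = w) \<le> cnt i (bt c)" for i
  proof (induction i rule: d1_induct)
    case 1 show ?case by (intro d1_intros d1_bt d1f_cnt d1f_fun1[OF f])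
  next
    case (3 i)
    show ?case
    proof (cases "bt c i")
      case True
      have "cnt m (\<lambda>w. \<exists>v<i+1. bt c v \<and> f v = w) \<le> cnt m (\<lambda>w. (\<exists>v<i. bt c v \<and> f v = w) \<or> w = f i)"
        by (intro cnt_mono cod cod_disj cod_eq) (auto simp: parith_less_Suc le_less)
      also have "\<dots> \<le> cnt m (\<lambda>w. \<exists>v<i. bt c v \<and> f v = w) + 1" by (rule cnt_insert(1)[OF cod])
      also have "\<dots> \<le> cnt (i + 1) (bt c)" using 3 True by (simp add: cnt_Suc[OF cod_bt])
      finally show ?thesis .
    next
      case False
      have "cnt m (\<lambda>w. \<exists>v<i+1. bt c v \<and> f v = w) \<le> cnt m (\<lambda>w. (\<exists>v<i. bt c v \<and> f v = w))"
        using False by (intro cnt_mono cod) (auto simp: parith_less_Suc le_less)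
      then show ?thesis using 3 False by (simp add: cnt_Suc[OF cod_bt])
    qed
  qed simp
  from this[of n] have "cnt m (\<lambda>w. \<exists>v<n. bt c v \<and> f v = w) \<le> cnt n P"
    using c cnt_cong[of n P "bt c"] by simp
  moreover have "cnt m Q \<le> cnt m (\<lambda>w. \<exists>v<n. bt c v \<and> f v = w)"
    using im c by (intro cnt_mono assms cod) blast
  ultimately show ?thesis by simp
qed

text \<open>Both inequalities come from \<open>cnt_image\<close>, with \<open>i + a * w\<close> and
  division by \<open>a\<close> as the maps. For \<open>a = pw n\<close> the fibre consists of the
  strings that extend \<open>i\<close>.\<close>

lemma cnt_fiber:
  fixes a b :: 'a
  assumes P: "cod P" and i: "i < a"
  shows "cnt (a * b) (\<lambda>v. P v \<and> md v a = i) = cnt b (\<lambda>w. P (i + a * w))"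
proof -
  have c1: "cod (\<lambda>v. P v \<and> md v a = i)" by (rule cod_conj[OF P d1_cod]) (intro d1_intros d1f_md)
  have f: "d1f Z (\<lambda>e. i + a * e 0)" by (intro d1_intros)
  have c2: "cod (\<lambda>w. P (i + a * w))" by (rule cod_comp[OF P f])
  have a0: "0 < a" using i by (metis le_less_trans parith_nonneg)
  have bd: "i + a * w < a * b \<longleftrightarrow> w < b" for w
  proof
    assume "w < b"
    then have "a * (w + 1) \<le> a * b" by (intro mult_left_mono) (simp_all add: parith_Suc_le)
    then show "i + a * w < a * b" using i unfolding emb_simps by (simp add: algebra_simps)
  next
    assume *: "i + a * w < a * b"
    show "w < b"
    proof (rule ccontr)
      assume "\<not> w < b"
      then have "a * b \<le> a * w" by (intro mult_left_mono) simp_all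
      then show False using * emb_nonneg[of i] unfolding emb_simps by linarith
    qed
  qed
  have md: "md (i + a * w) a = i" "dv (i + a * w) a = w" for w
    using md_eqI[of "i + a * w" w a i] dv_eqI[of "i + a * w" w a i] i by (simp_all add: ac_simps)
  have "cnt (a * b) (\<lambda>v. P v \<and> md v a = i) \<le> cnt b (\<lambda>w. P (i + a * w))"
  proof (rule cnt_image[OF f c2 c1])
    fix v assume v: "v < a * b" "P v \<and> md v a = i"
    then have "v = i + a * dv v a" using dvmd(1)[OF a0, of v] by (simp add: ac_simps)
    then show "\<exists>w<b. P (i + a * w) \<and> i + a * w = v" using v bd by metis
  qed
  moreover have "cnt b (\<lambda>w. P (i + a * w)) \<le> cnt (a * b) (\<lambda>v. P v \<and> md v a = i)"
  proof (rule cnt_image[OF _ c1 c2])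
    show "d1f Z (\<lambda>e. dv (e 0) a)" by (intro d1f_dv d1_intros)
    fix w assume w: "w < b" "P (i + a * w)"
    then show "\<exists>v<a * b. (P v \<and> md v a = i) \<and> dv v a = w" using bd md by (intro exI[of _ "i + a * w"]) simp
  qed
  ultimately show ?thesis by simp
qed

lemma s1_bounded_code2:
  assumes "s1 Z (\<lambda>e. R (e 0) (e (Suc 0)))"
  shows "\<exists>R'. d1 Z (\<lambda>e. R' (e 0) (e (Suc 0))) \<and> (\<forall>x<n. \<forall>y<n. R x y \<longleftrightarrow> R' x y)"
proof -
  have "s1 Z (\<lambda>e. R (dv (e 0) n) (md (e 0) n))" by (intro s1_rel2[OF assms] d1f_dv d1f_md d1_intros)
  from s1_cod[OF this] obtain c where c: "\<forall>v<n * n. R (dv v n) (md v n) \<longleftrightarrow> bt c v" using cod_code by blast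
  have "R x y \<longleftrightarrow> bt c (x * n + y)" if "x < n" "y < n" for x y
  proof -
    have "(x + 1) * n \<le> n * n" using that by (intro mult_right_mono) (simp_all add: parith_Suc_le)
    then have "x * n + y < n * n" using that(2) unfolding emb_simps by (simp add: algebra_simps)
    then show ?thesis using c[rule_format, of "x * n + y"] that dv_eqI[of "x * n + y" x n y] md_eqI[of "x * n + y" x n y]
      by metis
  qed
  moreover have "d1 Z (\<lambda>e. bt c (e 0 * n + e (Suc 0)))" by (intro d1_bt d1_intros)
  ultimately show ?thesis by (intro exI[of _ "\<lambda>x y. bt c (x * n + y)"]) blast
qed

end

section \<open>The weak pigeonhole principle\<close>

definition s2 :: "'a::parith set \<Rightarrow> ((nat \<Rightarrow> 'a) \<Rightarrow> bool) \<Rightarrow> bool" where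
  "s2 Z P \<longleftrightarrow> (\<exists>Q. s1 Z Q \<and> P = (\<lambda>e. \<exists>a. \<not> Q (case_nat a e)))"

text \<open>The second clause says that the initial segments of \<open>f\<close> are coded; without \<open>\<Sigma>\<^sup>0\<^sub>2\<close> bounding it does
not follow from the first.\<close>

definition z2 :: "'a::parith set \<Rightarrow> ('a \<Rightarrow> 'a) \<Rightarrow> bool" where
  "z2 Z f \<longleftrightarrow> s2 Z (\<lambda>e. e 0 = f (e (Suc 0))) \<and>
     (\<forall>n. \<exists>g. d1f Z (\<lambda>e. g (e 0)) \<and> (\<forall>t<n. f t = g t))"

lemma s2I: "s1 Z (\<lambda>e. \<not> P (\<lambda>i. e (Suc i)) (e 0)) \<Longrightarrow> s2 Z (\<lambda>e. \<exists>a. P e a)"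
  unfolding s2_def by (rule exI[of _ "\<lambda>e. \<not> P (\<lambda>i. e (Suc i)) (e 0)"]) simp

lemma s2E: assumes "s2 Z P" obtains Q where "s1 Z Q" "P = (\<lambda>e. \<exists>a. \<not> Q (case_nat a e))"
  using assms unfolding s2_def by blast

lemma s2_subst: assumes "s2 Z P" "\<And>i. tm (\<lambda>e. \<sigma> e i)" shows "s2 Z (\<lambda>e. P (\<sigma> e))"
proof -
  obtain Q where Q: "s1 Z Q" "P = (\<lambda>e. \<exists>a. \<not> Q (case_nat a e))" using assms(1) by (rule s2E)
  have "tm (\<lambda>e. case_nat (e 0) (\<sigma> (\<lambda>i. e (Suc i))) i)" for i by (rule tm_case_nat[OF tm_var tm_shift[OF assms(2)]])
  from s1_subst[OF Q(1), of "\<lambda>e. case_nat (e 0) (\<sigma> (\<lambda>i. e (Suc i)))", OF this]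
  show ?thesis unfolding Q(2) by (intro s2I) simp
qed

lemma s2_tm2: "s2 Z (\<lambda>e. R (e 0) (e (Suc 0))) \<Longrightarrow> tm a \<Longrightarrow> tm b \<Longrightarrow> s2 Z (\<lambda>e. R (a e) (b e))"
  using s2_subst[of Z "\<lambda>e. R (e 0) (e (Suc 0))" "\<lambda>e. case_nat (a e) (\<lambda>i. b e)"]
  by (simp add: tm_case_nat)

lemma s2_p1: assumes "s1 Z (\<lambda>e. \<not> P e)" shows "s2 Z P"
  using s2I[of Z "\<lambda>e a. P e"] s1_subst[OF assms tm_var, of "\<lambda>i. Suc i"] by simp

lemma s2_s1: assumes "s1 Z P" shows "s2 Z P"
proof -
  obtain Q where Q: "d0 Z Q" "P = (\<lambda>e. \<exists>a. Q (case_nat a e))" using assms by (rule s1E)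
  have "s1 Z (\<lambda>e. \<not> Q e)" by (rule s1_d0[OF d0_neg[OF Q(1)]])
  then show ?thesis unfolding Q(2) by (intro s2I) (simp add: case_nat_shift)
qed

context ind1
begin

text \<open>Merging two quantifiers by a common bound puts bounded universal quantifiers in front of
  a Sigma_1 matrix; collection is what keeps it Sigma_1.\<close>

lemma s2_ex: assumes "s2 Z (\<lambda>e. P (\<lambda>i. e (Suc i)) (e 0))" shows "s2 Z (\<lambda>e. \<exists>a. P e a)"
proof -
  from assms obtain Q where Q: "s1 Z Q" "(\<lambda>e. P (\<lambda>i. e (Suc i)) (e 0)) = (\<lambda>e. \<exists>a. \<not> Q (case_nat a e))"
    by (rule s2E)
  have P: "P e a \<longleftrightarrow> (\<exists>b. \<not> Q (case_nat b (case_nat a e)))" for e a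
    using fun_cong[OF Q(2), of "case_nat a e"] by simp
  have "(\<lambda>e. \<exists>a. P e a) = (\<lambda>e. \<exists>c. \<not> (\<forall>a\<le>c. \<forall>b\<le>c. Q (case_nat b (case_nat a e))))"
    unfolding P
  proof (intro ext iffI)
    fix e assume "\<exists>a b. \<not> Q (case_nat b (case_nat a e))"
    then obtain a b where "\<not> Q (case_nat b (case_nat a e))" by blast
    moreover have "a \<le> max a b" "b \<le> max a b" by simp_all
    ultimately show "\<exists>c. \<not> (\<forall>a\<le>c. \<forall>b\<le>c. Q (case_nat b (case_nat a e)))" by blast
  qed blast
  moreover have "tm (\<lambda>e. case_nat (e 0) (case_nat (e (Suc 0)) (\<lambda>i. e (Suc (Suc (Suc i))))) i)" for i
    by (intro tm_case_nat tm.intros)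
  from s1_subst[OF Q(1) this]
  have "s1 Z (\<lambda>e. \<forall>a\<le>e 0. \<forall>b\<le>e 0. Q (case_nat b (case_nat a (\<lambda>i. e (Suc i)))))"
    by (intro s1_ball_le d1_intros)
  then have "s2 Z (\<lambda>e. \<exists>c. \<not> (\<forall>a\<le>c. \<forall>b\<le>c. Q (case_nat b (case_nat a e))))"
    by (intro s2I) simp
  ultimately show ?thesis by simp
qed

lemma s2_conj: assumes "s2 Z P" "s2 Z Q" shows "s2 Z (\<lambda>e. P e \<and> Q e)"
proof -
  obtain P' where P': "s1 Z P'" "P = (\<lambda>e. \<exists>a. \<not> P' (case_nat a e))" using assms(1) by (rule s2E)
  obtain Q' where Q': "s1 Z Q'" "Q = (\<lambda>e. \<exists>a. \<not> Q' (case_nat a e))" using assms(2) by (rule s2E)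
  note * = P' Q'
  have t: "tm (\<lambda>e. case_nat (e (Suc 0)) (\<lambda>i. e (Suc (Suc i))) i)" "tm (\<lambda>e. case_nat (e 0) (\<lambda>i. e (Suc (Suc i))) i)" for i
    by (intro tm_case_nat tm.intros)+
  have "s2 Z (\<lambda>e. \<exists>a b. \<not> (P' (case_nat a e) \<or> Q' (case_nat b e)))"
    by (intro s2_ex s2_p1) (simp add: s1_disj[OF s1_subst[OF *(1) t(1)] s1_subst[OF *(3) t(2)]])
  then show ?thesis unfolding * by simp
qed

lemma s2_disj: assumes "s2 Z P" "s2 Z Q" shows "s2 Z (\<lambda>e. P e \<or> Q e)"
proof -
  obtain P' where P': "s1 Z P'" "P = (\<lambda>e. \<exists>a. \<not> P' (case_nat a e))" using assms(1) by (rule s2E)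
  obtain Q' where Q': "s1 Z Q'" "Q = (\<lambda>e. \<exists>a. \<not> Q' (case_nat a e))" using assms(2) by (rule s2E)
  note * = P' Q'
  have "s2 Z (\<lambda>e. \<exists>a. \<not> P' (case_nat a e) \<or> \<not> Q' (case_nat a e))"
    by (rule s2I) (unfold de_Morgan_conj[symmetric] not_not case_nat_shift, rule s1_conj[OF *(1,3)])
  then show ?thesis unfolding * ex_disj_distrib .
qed

lemma mk_iff: "cod P \<Longrightarrow> c = mk n P \<longleftrightarrow> (\<forall>v<c + n. bt c v \<longleftrightarrow> v < n \<and> P (v::'a))"
proof
  assume cod: "cod P"
  { assume "c = mk n P" then show "\<forall>v<c + n. bt c v \<longleftrightarrow> v < n \<and> P v" using bt_mk[OF cod] by blast }
  assume *: "\<forall>v<c + n. bt c v \<longleftrightarrow> v < n \<and> P v"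
  have "bt c v \<longleftrightarrow> v < n \<and> P v" for v
  proof (cases "v < c + n")
    case False
    then have "\<not> v < c" "\<not> v < n" using emb_nonneg[of c] emb_nonneg[of n] unfolding emb_simps by linarith+
    then show ?thesis using bt_less by blast
  qed (use * in blast)
  then show "c = mk n P" using mk_eqI by metis
qed

lemma z2_tame: "z2 Z f \<Longrightarrow> \<exists>g. d1f Z (\<lambda>e. g (e 0)) \<and> (\<forall>t\<le>n. f t = g t)"
  unfolding z2_def parith_less_Suc[symmetric] by blast

text \<open>The source of Delta_2 functions. A segment of a Sigma_1 set has a code, correctness of
  the code is a conjunction of a Sigma_1 and a Pi_1 statement, and a Delta_1 function may then be
  applied to it.\<close>

lemma z2_code:
  assumes W: "s1 Z (\<lambda>e. W (e 0))" and b: "d1f Z (\<lambda>e. \<beta> (e 0))" and G: "d1f Z (\<lambda>e. G (e 0) (e (Suc 0)))"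
  shows "z2 Z (\<lambda>n. G n (mk (\<beta> n) W))"
  unfolding z2_def
proof (intro conjI allI)
  note cod = s1_cod[OF W]
  have "y = G n (mk (\<beta> n) W) \<longleftrightarrow> (\<exists>c. ((\<forall>v<c + \<beta> n. bt c v \<longrightarrow> v < \<beta> n \<and> W v) \<and>
     (\<forall>v<c + \<beta> n. v < \<beta> n \<and> W v \<longrightarrow> bt c v)) \<and> y = G n c)" for y n
  proof -
    have "((\<forall>v<c + \<beta> n. bt c v \<longrightarrow> v < \<beta> n \<and> W v) \<and> (\<forall>v<c + \<beta> n. v < \<beta> n \<and> W v \<longrightarrow> bt c v)) \<longleftrightarrow> c = mk (\<beta> n) W" for c
      unfolding mk_iff[OF cod] by blast
    then show ?thesis by auto
  qed
  moreover have "s2 Z (\<lambda>e. \<exists>c. ((\<forall>v<c + \<beta> (e (Suc 0)). bt c v \<longrightarrow> v < \<beta> (e (Suc 0)) \<and> W v) \<and>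
     (\<forall>v<c + \<beta> (e (Suc 0)). v < \<beta> (e (Suc 0)) \<and> W v \<longrightarrow> bt c v)) \<and> e 0 = G (e (Suc 0)) c)"
  proof (intro s2_ex s2_conj)
    show "s2 Z (\<lambda>e. \<forall>v<e 0 + \<beta> (e (Suc (Suc 0))). bt (e 0) v \<longrightarrow> v < \<beta> (e (Suc (Suc 0))) \<and> W v)"
      by (intro s2_s1 s1_ball s1_imp s1_conj s1_rel1[OF W] d1_intros d1f_fun1[OF b]; intro d1_s1 d1_intros d1_bt d1f_fun1[OF b])
    have "s1 Z (\<lambda>e. \<exists>v<e 0 + \<beta> (e (Suc (Suc 0))). (v < \<beta> (e (Suc (Suc 0))) \<and> W v) \<and> \<not> bt (e 0) v)"
      by (intro s1_bex s1_conj s1_rel1[OF W] d1_intros d1f_fun1[OF b]; intro d1_s1 d1_intros d1_bt d1f_fun1[OF b])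
    then show "s2 Z (\<lambda>e. \<forall>v<e 0 + \<beta> (e (Suc (Suc 0))). v < \<beta> (e (Suc (Suc 0))) \<and> W v \<longrightarrow> bt (e 0) v)"
      by (intro s2_p1) simp
    show "s2 Z (\<lambda>e. e (Suc 0) = G (e (Suc (Suc 0))) (e 0))"
      by (intro s2_s1 d1_s1 d1_intros d1f_fun2[OF G])
  qed
  ultimately show "s2 Z (\<lambda>e. e 0 = G (e (Suc 0)) (mk (\<beta> (e (Suc 0))) W))" by simp
  fix n
  \<comment> \<open>All segments requested before \<open>n\<close> lie below one bound
    \<open>B\<close>, so a single code of \<open>W\<close> below \<open>B\<close> replaces
    \<open>W\<close>.\<close>
  obtain B where B: "\<forall>t<n. \<beta> t < B" using d1f_bound[OF b] by blast
  obtain c where c: "\<forall>v<B. W v \<longleftrightarrow> bt c v" using cod_code[OF cod] by blast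
  have "G t (mk (\<beta> t) W) = G t (mk (\<beta> t) (bt c))" if "t < n" for t
    using mk_cong[of "\<beta> t" W "bt c"] c B that by (metis less_trans)
  moreover have "d1f Z (\<lambda>e. G (e 0) (mk (\<beta> (e 0)) (bt c)))"
    by (intro d1f_fun2[OF G] d1f_mk d1_intros d1f_fun1[OF b] d1_bt)
  ultimately show "\<exists>g. d1f Z (\<lambda>e. g (e 0)) \<and> (\<forall>t<n. G t (mk (\<beta> t) W) = g t)"
    by (intro exI[of _ "\<lambda>t. G t (mk (\<beta> t) (bt c))"]) blast
qed

lemma z2_comp2:
  assumes f: "z2 Z f" and g: "z2 Z g" and G: "d1f Z (\<lambda>e. G (e 0) (e (Suc 0)) (e (Suc (Suc 0))))"
  shows "z2 Z (\<lambda>n. G n (f n) (g n))"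
  unfolding z2_def
proof (intro conjI allI)
  have "s2 Z (\<lambda>e. \<exists>a b. (a = f (e (Suc 0)) \<and> b = g (e (Suc 0))) \<and> e 0 = G (e (Suc 0)) a b)"
    by (intro s2_ex s2_conj s2_tm2[OF f[unfolded z2_def, THEN conjunct1]] s2_tm2[OF g[unfolded z2_def, THEN conjunct1]] tm.intros
        s2_s1 d1_s1 d1_eq d1_intros d1f_fun3[OF G])
  then show "s2 Z (\<lambda>e. e 0 = G (e (Suc 0)) (f (e (Suc 0))) (g (e (Suc 0))))" by simp
  fix n
  obtain f' where f': "d1f Z (\<lambda>e. f' (e 0))" "\<forall>t<n. f t = f' t" using f unfolding z2_def by blast
  obtain g' where g': "d1f Z (\<lambda>e. g' (e 0))" "\<forall>t<n. g t = g' t" using g unfolding z2_def by blast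
  note * = f' g'
  have "d1f Z (\<lambda>e. G (e 0) (f' (e 0)) (g' (e 0)))" by (intro d1f_fun3[OF G] * d1_intros)
  then show "\<exists>h. d1f Z (\<lambda>e. h (e 0)) \<and> (\<forall>t<n. G t (f t) (g t) = h t)"
    using *(2,4) by (intro exI[of _ "\<lambda>t. G t (f' t) (g' t)"]) simp
qed

lemma z2_comp1:
  assumes f: "z2 Z f" and G: "d1f Z (\<lambda>e. G (e 0) (e (Suc 0)))" shows "z2 Z (\<lambda>n. G n (f n))"
  by (rule z2_comp2[OF f f, where G="\<lambda>n x y. G n x"]) (intro d1f_fun2[OF G] d1_intros)

lemma z2_shift:
  assumes f: "z2 Z f" shows "z2 Z (\<lambda>n. f (j + n))"
  unfolding z2_def
proof (intro conjI allI)
  show "s2 Z (\<lambda>e. e 0 = f (j + e (Suc 0)))"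
    by (intro s2_tm2[OF f[unfolded z2_def, THEN conjunct1]] tm.intros)
  fix n
  obtain g where g: "d1f Z (\<lambda>e. g (e 0))" "\<forall>t<j + n. f t = g t" using f unfolding z2_def by blast
  have "d1f Z (\<lambda>e. g (j + e 0))" by (intro d1f_fun1[OF g(1)] d1_intros)
  then show "\<exists>g. d1f Z (\<lambda>e. g (e 0)) \<and> (\<forall>t<n. f (j + t) = g t)" using g(2) by auto
qed

text \<open>A least number principle for Delta_2 sequences: up to \<open>t\<close> the sequence
  agrees with a function to which Sigma_1 induction applies.\<close>

lemma z2_least:
  assumes "z2 Z C" "bt (C t) s" shows "\<exists>u. bt (C u) s \<and> (\<forall>k<u. \<not> bt (C k) s)"
proof -
  obtain g where g: "d1f Z (\<lambda>e. g (e 0))" "\<forall>k\<le>t. C k = g k" using z2_tame[OF assms(1)] by blast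
  have "s1 Z (\<lambda>e. bt (g (e 0)) s)" by (intro d1_s1 d1_bt g(1) d1_intros)
  from least_s1[OF this, of t] obtain u where u: "bt (g u) s" "\<forall>k<u. \<not> bt (g k) s" using assms(2) g(2) by auto
  have "u \<le> t" using u(2) assms(2) g(2) by (metis not_le order_refl)
  then have "\<forall>k\<le>u. C k = g k" using g(2) by (meson order_trans)
  then show ?thesis using u by (metis less_imp_le order_refl)
qed

lemma cnt_nth: assumes "cod P" "i < cnt n P" shows "\<exists>s<n. P s \<and> cnt s P = (i::'a)"
proof -
  obtain c where c: "\<forall>v<n. P v \<longleftrightarrow> bt c v" using cod_code[OF assms(1)] by blast
  have cc: "cnt k P = cnt k (bt c)" if "k \<le> n" for k using c that by (intro cnt_cong) (auto dest: less_le_trans)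
  have "s1 Z (\<lambda>e. i < cnt (e 0) (bt c))" by (intro d1_s1 d1_intros d1f_cnt d1_bt)
  from least_s1[OF this, of n] obtain m where m: "i < cnt m (bt c)" "\<forall>k<m. \<not> i < cnt k (bt c)"
    using assms(2) cc[of n] by auto
  have "m \<noteq> 0" using m(1) by auto
  then obtain s where s: "m = s + 1" using parith_pos_cases by blast
  have "\<not> n < m" using m(2) assms(2) cc[of n] by auto
  then have sn: "s < n" using s by (simp add: parith_Suc_le not_less)
  have "\<not> i < cnt s (bt c)" using m(2) s less_add_one by blast
  then have "bt c s" "cnt s (bt c) = i" using m(1) unfolding s cnt_Suc[OF cod_bt]
    by (auto simp: parith_less_Suc split: if_splits)
  then show ?thesis using sn c cc[of s] by (auto simp: less_imp_le)
qed

lemma cnt_nth_unique: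
  assumes "cod P" "P s" "P s'" "cnt s P = cnt (s'::'a) P" shows "s = s'"
proof -
  have "cnt s P + 1 \<le> cnt s' P" if l: "s < s'" "P s" for s s'
  proof -
    obtain d where d: "s' = (s + 1) + d" using parith_le_ex[OF parith_discrete[OF l(1)]] by blast
    show ?thesis unfolding d using cnt_add[OF assms(1), of "s + 1" d] cnt_Suc[OF assms(1), of s] l(2) by (simp add: add_increasing2)
  qed
  from this[of s s'] this[of s' s] assms(2-4) show ?thesis by (metis less_add_one linorder_neqE not_le)
qed

end

locale wphp = ind1 +
  assumes no_inj: "s2 Z (\<lambda>e. R (e 0) (e (Suc 0))) \<Longrightarrow> 1 \<le> x \<Longrightarrow> (\<And>a. a < x + x \<Longrightarrow> \<exists>b<x. R a b) \<Longrightarrow>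
    (\<And>a b b'. a < x + x \<Longrightarrow> R a b \<Longrightarrow> R a b' \<Longrightarrow> b = b') \<Longrightarrow>
    (\<And>a a' b. a < x + x \<Longrightarrow> a' < x + x \<Longrightarrow> R a b \<Longrightarrow> R a' b \<Longrightarrow> a = a') \<Longrightarrow> False"
begin

text \<open>If every stage contained at most half of \<open>F\<close>, ranking the elements of \<open>F\<close> by the
stage at which they appear would inject \<open>F\<close> into half its size.\<close>

lemma exhaustion_half:
  assumes C: "z2 Z C" and mono: "\<And>t t' v. bt (C t) v \<Longrightarrow> t \<le> t' \<Longrightarrow> bt (C t') v"
    and F: "\<And>v. v < K \<Longrightarrow> bt F v \<Longrightarrow> \<exists>t. bt (C t) v" and ne: "cnt K (bt F) \<noteq> 0"
  shows "\<exists>t. cnt K (bt F) < 2 * cnt K (\<lambda>v. bt F v \<and> bt (C t) v)"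
proof (rule ccontr)
  assume "\<not> ?thesis"
  then have half: "2 * cnt K (\<lambda>v. bt F v \<and> bt (C t) v) \<le> cnt K (bt F)" for t by (simp add: not_less)
  \<comment> \<open>\<open>x\<close> is half of the size of \<open>F\<close>, rounded down. It is
    positive because a single element making up all of \<open>F\<close> would violate
    \<open>half\<close> as soon as it appears.\<close>
  obtain x where x: "cnt K (bt F) = x + x \<or> cnt K (bt F) = x + x + 1" using even_or_odd by blast
  have x1: "1 \<le> x"
  proof (rule ccontr)
    assume "\<not> 1 \<le> x"
    then have "x = 0" using parith_Suc_le[of 0 x] by simp
    then have f1: "cnt K (bt F) = 1" using x ne by auto
    obtain v where v: "v < K" "bt F v" using cnt_posD[OF ne] by blast
    obtain t where "bt (C t) v" using F v by blast
    then have "1 \<le> cnt K (\<lambda>v. bt F v \<and> bt (C t) v)" using v by (intro cnt_pos cod_simps) auto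
    then show False using half[of t] f1 unfolding emb_simps by linarith
  qed
  \<comment> \<open>With \<open>c = C t\<close> and \<open>c'\<close> the stage before,
    \<open>S c c' s\<close> consists of the elements of \<open>F\<close> that precede
    \<open>s\<close> when they are ordered by stage of appearance and then by size.\<close>
  define S where "S c c' s = (\<lambda>v. bt F v \<and> (bt c' v \<or> bt c v \<and> v < s))" for c c' s
  have codS: "cod (S c c' s)" for c c' s unfolding S_def by (rule d1_cod) (intro d1_intros d1_bt)
  \<comment> \<open>The \<open>i\<close>-th element of \<open>F\<close> is related to its rank
    \<open>j\<close> in that order. The stage before stage \<open>0\<close> is taken to be
    empty.\<close>
  define R where "R i j = (\<exists>s t c c'. (c = C t \<and> (t = 0 \<and> c' = 0 \<or> (\<exists>u. t = u + 1 \<and> c' = C u))) \<and>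
    (((s < K \<and> bt F s) \<and> cnt s (bt F) = i) \<and> bt c s \<and> \<not> bt c' s \<and> j = cnt K (S c c' s)))" for i j
  have s2C: "s2 Z (\<lambda>e. e 0 = C (e (Suc 0)))" using C unfolding z2_def by blast
  have s2R: "s2 Z (\<lambda>e. R (e 0) (e (Suc 0)))"
  proof -
    have A: "s2 Z (\<lambda>e. e (Suc 0) = C (e (Suc (Suc 0))) \<and> (e (Suc (Suc 0)) = 0 \<and> e 0 = 0 \<or> (\<exists>u. e (Suc (Suc 0)) = u + 1 \<and> e 0 = C u)))"
      by (intro s2_ex s2_conj s2_disj s2_tm2[OF s2C] tm.intros; intro s2_s1 d1_s1 d1_intros)
    have B: "s2 Z (\<lambda>e. ((e (Suc (Suc (Suc 0))) < K \<and> bt F (e (Suc (Suc (Suc 0))))) \<and> cnt (e (Suc (Suc (Suc 0)))) (bt F) = e (Suc (Suc (Suc (Suc 0))))) \<and>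
        bt (e (Suc 0)) (e (Suc (Suc (Suc 0)))) \<and> \<not> bt (e 0) (e (Suc (Suc (Suc 0)))) \<and>
        e (Suc (Suc (Suc (Suc (Suc 0))))) = cnt K (\<lambda>v. bt F v \<and> (bt (e 0) v \<or> bt (e (Suc 0)) v \<and> v < e (Suc (Suc (Suc 0))))))"
      by (intro s2_s1 d1_s1 d1_intros d1_bt d1f_cnt)
    show ?thesis unfolding R_def S_def by (rule s2_ex)+ (rule s2_conj[OF A B])
  qed
  have fin: "\<exists>b<x. R a b" if a: "a < x + x" for a
  proof -
    have "a < cnt K (bt F)" using a x by (auto intro: less_trans)
    then obtain s where s: "s < K" "bt F s" "cnt s (bt F) = a" using cnt_nth[OF cod_bt] by blast
    obtain t0 where "bt (C t0) s" using F s by blast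
    then obtain t where t: "bt (C t) s" "\<forall>k<t. \<not> bt (C k) s" using z2_least[OF C] by blast
    obtain c' where c': "t = 0 \<and> c' = 0 \<or> (\<exists>u. t = u + 1 \<and> c' = C u)" using parith_pos_cases by blast
    have nc: "\<not> bt c' s" using c' t(2) less_add_one by auto
    have sub: "bt (C t) v" if "bt c' v" for v using c' that mono[of _ v t] less_add_one by (auto simp: less_imp_le)
    \<comment> \<open>The element \<open>s\<close> is present at stage \<open>t\<close> but does not
      precede itself, so its rank is strictly below the number of elements present; that number is
      at most \<open>x\<close> in the odd case as well.\<close>
    have *: "cnt K (S (C t) c' s) + 1 \<le> cnt K (\<lambda>v. bt F v \<and> bt (C t) v)"
      by (rule cnt_strict[OF codS _ _ s(1)]) (use sub s t nc in \<open>auto simp: S_def intro: cod_simps\<close>)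
    have "cnt K (S (C t) c' s) < x"
    proof (rule ccontr)
      assume "\<not> ?thesis"
      then have "x \<le> cnt K (S (C t) c' s)" by simp
      then show False using * half[of t] x unfolding emb_simps by linarith
    qed
    moreover have "R a (cnt K (S (C t) c' s))" unfolding R_def using s t(1) c' nc by blast
    ultimately show ?thesis by blast
  qed
  \<comment> \<open>Rank determines stage and element: what precedes an element of a later stage
    includes the earlier element together with all its predecessors.\<close>
  have key: "s = s' \<and> t = t'"
    if 1: "t = 0 \<and> c' = 0 \<or> (\<exists>u. t = u + 1 \<and> c' = C u)" "bt (C t) s" "\<not> bt c' s" "s < K" "bt F s"
    and 2: "t' = 0 \<and> d' = 0 \<or> (\<exists>u. t' = u + 1 \<and> d' = C u)" "bt (C t') s'" "\<not> bt d' s'" "s' < K" "bt F s'"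
    and e: "s = s' \<or> cnt K (S (C t) c' s) = cnt K (S (C t') d' s')" for s t c' s' t' d'
  proof -
    have less: "cnt K (S (C t) c' s) + 1 \<le> cnt K (S (C t') d' s') \<and> s \<noteq> s'"
      if 1: "t = 0 \<and> c' = 0 \<or> (\<exists>u. t = u + 1 \<and> c' = C u)" "bt (C t) s" "\<not> bt c' s" "s < K" "bt F s"
      and 2: "t' = 0 \<and> d' = 0 \<or> (\<exists>u. t' = u + 1 \<and> d' = C u)" "bt (C t') s'" "\<not> bt d' s'"
      and l: "t < t'" for s t c' s' t' d'
    proof
      obtain u where u: "t' = u + 1" "d' = C u" using 2(1) l by auto
      have tu: "t \<le> u" using l u by (simp add: parith_less_Suc)
      have sub: "bt (C t) v" if "bt c' v" for v using 1(1) that mono[of _ v t] less_add_one by (auto simp: less_imp_le)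
      show "cnt K (S (C t) c' s) + 1 \<le> cnt K (S (C t') d' s')"
        by (rule cnt_strict[OF codS codS _ 1(4)]) (use sub mono[OF _ tu] u 1 in \<open>auto simp: S_def\<close>)
      show "s \<noteq> s'" using mono[OF 1(2) tu] u 2(3) by auto
    qed
    have tt: "t = t'"
      using less[OF 1 2(1-3)] less[OF 2 1(1-3)] e by (metis less_add_one linorder_neqE not_le)
    then have cd: "c' = d'" using 1(1) 2(1) by auto
    have less2: "cnt K (S (C t) c' s) + 1 \<le> cnt K (S (C t) c' s')" if "s < s'" "bt (C t) s" "\<not> bt c' s" "s < K" "bt F s" for s s'
      by (rule cnt_strict[OF codS codS _ that(4)]) (use that in \<open>auto simp: S_def\<close>)
    have "s = s'"
      using less2[of s s'] less2[of s' s] e 1 2 unfolding tt cd by (metis less_add_one linorder_neqE not_le)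
    with tt show ?thesis by blast
  qed
  show False
  proof (rule no_inj[OF s2R x1 fin])
    fix a b b' assume "R a b" "R a b'"
    then obtain s t c' s' t' d' where
      1: "t = 0 \<and> c' = 0 \<or> (\<exists>u. t = u + 1 \<and> c' = C u)" "bt (C t) s" "\<not> bt c' s" "s < K" "bt F s"
      and 2: "t' = 0 \<and> d' = 0 \<or> (\<exists>u. t' = u + 1 \<and> d' = C u)" "bt (C t') s'" "\<not> bt d' s'" "s' < K" "bt F s'"
      and 3: "cnt s (bt F) = a" "cnt s' (bt F) = a" "b = cnt K (S (C t) c' s)" "b' = cnt K (S (C t') d' s')"
      unfolding R_def by blast
    have "s = s'" using cnt_nth_unique[OF cod_bt] 1(5) 2(5) 3 by metis
    with key[OF 1 2] have "s = s'" "t = t'" by auto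
    then show "b = b'" using 1(1) 2(1) 3 by auto
  next
    fix a a' b assume "R a b" "R a' b"
    then obtain s t c' s' t' d' where
      1: "t = 0 \<and> c' = 0 \<or> (\<exists>u. t = u + 1 \<and> c' = C u)" "bt (C t) s" "\<not> bt c' s" "s < K" "bt F s"
      and 2: "t' = 0 \<and> d' = 0 \<or> (\<exists>u. t' = u + 1 \<and> d' = C u)" "bt (C t') s'" "\<not> bt d' s'" "s' < K" "bt F s'"
      and 3: "cnt s (bt F) = a" "cnt s' (bt F) = a'" "b = cnt K (S (C t) c' s)" "b = cnt K (S (C t') d' s')"
      unfolding R_def by blast
    have "s = s'" using key[OF 1 2] 3 by auto
    then show "a = a'" using 3 by simp
  qed
qed

text \<open>Each application of the halving lemma to the part of \<open>F\<close> not yet covered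
  halves the remainder. \<open>J\<close> is a standard number, so the iteration runs outside the
  model and needs no induction for Delta_2 statements.\<close>

lemma exhaustion:
  fixes J :: nat
  assumes C: "z2 Z C" and mono: "\<And>t t' v. bt (C t) v \<Longrightarrow> t \<le> t' \<Longrightarrow> bt (C t') v"
    and F: "\<And>v. v < K \<Longrightarrow> bt F v \<Longrightarrow> \<exists>t. bt (C t) v"
  shows "\<exists>t. 2 ^ J * cnt K (\<lambda>v. bt F v \<and> \<not> bt (C t) v) \<le> cnt K (bt F)"
proof (induction J)
  case 0
  have "cnt K (\<lambda>v. bt F v \<and> \<not> bt (C 0) v) \<le> cnt K (bt F)" by (intro cnt_mono cod_simps) blast
  then show ?case by (intro exI[of _ 0]) simp
next
  case (Suc J)
  then obtain t where t: "2 ^ J * cnt K (\<lambda>v. bt F v \<and> \<not> bt (C t) v) \<le> cnt K (bt F)" by blast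
  define F' where "F' = mk K (\<lambda>v. bt F v \<and> \<not> bt (C t) v)"
  have cod: "cod (\<lambda>v. bt F v \<and> \<not> bt (C t) v)" for t by (intro cod_simps)
  have F': "bt F' v \<longleftrightarrow> v < K \<and> bt F v \<and> \<not> bt (C t) v" for v unfolding F'_def using bt_mk[OF cod] by simp
  have cF': "cnt K (bt F') = cnt K (\<lambda>v. bt F v \<and> \<not> bt (C t) v)" by (rule cnt_cong) (simp add: F')
  show ?case
  proof (cases "cnt K (bt F') = 0")
    case True
    then show ?thesis using cF' by (intro exI[of _ t]) simp
  next
    case False
    have "\<exists>t. bt (C t) v" if "v < K" "bt F' v" for v using F that F' by simp
    from exhaustion_half[of C K F', OF C _ this False] mono obtain t' where
      t': "cnt K (bt F') < 2 * cnt K (\<lambda>v. bt F' v \<and> bt (C t') v)" by blast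
    have sp: "cnt K (bt F') = cnt K (\<lambda>v. bt F' v \<and> bt (C t') v) + cnt K (\<lambda>v. bt F' v \<and> \<not> bt (C t') v)"
      by (rule cnt_split[OF cod_bt cod_bt])
    have "cnt K (\<lambda>v. bt F v \<and> \<not> bt (C (max t t')) v) \<le> cnt K (\<lambda>v. bt F' v \<and> \<not> bt (C t') v)"
      by (intro cnt_mono cod_simps) (use mono[of t _ "max t t'"] mono[of t' _ "max t t'"] in \<open>auto simp: F'\<close>)
    then have "2 * cnt K (\<lambda>v. bt F v \<and> \<not> bt (C (max t t')) v) \<le> cnt K (bt F')"
      using t' sp unfolding emb_simps by linarith
    then have "2 ^ J * (2 * cnt K (\<lambda>v. bt F v \<and> \<not> bt (C (max t t')) v)) \<le> 2 ^ J * cnt K (bt F')"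
      by (rule mult_left_mono) simp
    also have "\<dots> \<le> cnt K (bt F)" using t unfolding cF' .
    finally show ?thesis by (intro exI[of _ "max t t'"]) (simp only: power_Suc mult.assoc mult.left_commute)
  qed
qed

end

section \<open>Trees and density\<close>

text \<open>A string of length \<open>n\<close> is a number below \<open>pw n\<close>, without the leading digit used by \<open>strlen\<close>; its first \<open>m\<close>
digits are \<open>md \<tau> (pw m)\<close>, and \<open>\<sigma> + pw m * \<rho>\<close> is \<open>\<sigma>\<close> followed by \<open>\<rho>\<close>. \<open>U n\<close> codes the \<open>n\<close>-th level of a tree.\<close>

definition tree :: "('a::parith \<Rightarrow> 'a) \<Rightarrow> bool" where
  "tree U \<longleftrightarrow> (\<forall>n \<tau>. bt (U n) \<tau> \<longrightarrow> \<tau> < pw n \<and> (\<forall>m\<le>n. bt (U m) (md \<tau> (pw m))))"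

definition dense :: "'a::parith \<Rightarrow> 'a \<Rightarrow> ('a \<Rightarrow> 'a) \<Rightarrow> bool" where
  "dense p q U \<longleftrightarrow> (\<forall>n. p * pw n \<le> q * cnt (pw n) (bt (U n)))"

definition sect :: "('a::parith \<Rightarrow> 'a) \<Rightarrow> 'a \<Rightarrow> 'a \<Rightarrow> 'a \<Rightarrow> 'a" where
  "sect U m \<sigma> n = mk (pw n) (\<lambda>\<rho>. bt (U (m + n)) (\<sigma> + pw m * \<rho>))"

context ind1
begin

lemma treeD: "tree U \<Longrightarrow> bt (U n) \<tau> \<Longrightarrow> \<tau> < pw n"
  "tree U \<Longrightarrow> bt (U n) \<tau> \<Longrightarrow> m \<le> n \<Longrightarrow> bt (U m) (md \<tau> (pw m))"
  unfolding tree_def by blast+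

lemma md_md: "m \<le> n \<Longrightarrow> md (md \<tau> (pw n)) (pw m) = md \<tau> (pw (m::'a))"
  by (rule bt_ext) (auto simp: bt_md)

lemma md_pw_less [simp]: "md \<tau> (pw n) < pw (n::'a)" by (rule dvmd(2)[OF pw_pos])

lemma md_sect:
  fixes m :: 'a
  assumes "\<sigma> < pw m" shows "md (\<sigma> + pw m * \<rho>) (pw (m + k)) = \<sigma> + pw m * md \<rho> (pw k)"
proof (rule md_eqI)
  show "\<sigma> + pw m * \<rho> = dv \<rho> (pw k) * pw (m + k) + (\<sigma> + pw m * md \<rho> (pw k))"
    using dvmd(1)[OF pw_pos, of \<rho> k] unfolding pw_add emb_simps
    by (subst (1) dvmd(1)[OF pw_pos, of \<rho> k]) (simp add: emb_simps algebra_simps)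
  have "pw m * (md \<rho> (pw k) + 1) \<le> pw m * pw k" by (rule mult_left_mono) (simp_all add: parith_Suc_le)
  then show "\<sigma> + pw m * md \<rho> (pw k) < pw (m + k)"
    using assms unfolding pw_add emb_simps by (simp add: algebra_simps)
qed

lemma dvmd_sect: "\<sigma> < pw m \<Longrightarrow> md (\<sigma> + pw m * \<rho>) (pw m) = \<sigma>" "\<sigma> < pw m \<Longrightarrow> dv (\<sigma> + pw m * \<rho>) (pw (m::'a)) = \<rho>"
  using md_eqI[of "\<sigma> + pw m * \<rho>" \<rho> "pw m" \<sigma>] dv_eqI[of "\<sigma> + pw m * \<rho>" \<rho> "pw m" \<sigma>] by (simp_all add: ac_simps)

lemma sect_less: "\<sigma> < pw m \<Longrightarrow> \<rho> < pw n \<Longrightarrow> \<sigma> + pw m * \<rho> < pw (m + (n::'a))"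
  using md_sect[of \<sigma> m \<rho> n] md_small[of \<rho> "pw n"] md_pw_less by metis

lemma cod_sect: "cod (\<lambda>\<rho>::'a. bt c (\<sigma> + p * \<rho>))" by (rule d1_cod) (intro d1_bt d1_intros)

lemma bt_sect: "bt (sect U m \<sigma> n) \<rho> \<longleftrightarrow> \<rho> < pw n \<and> bt (U (m + n)) (\<sigma> + pw m * (\<rho>::'a))"
  unfolding sect_def by (rule bt_mk[OF cod_sect])

lemma z2_sect: assumes "z2 Z U" shows "z2 Z (sect U m \<sigma>)"
proof -
  have "z2 Z (\<lambda>n. mk (pw n) (\<lambda>\<rho>. bt (U (m + n)) (\<sigma> + pw m * \<rho>)))"
    by (rule z2_comp1[OF z2_shift[OF assms, of m], where G="\<lambda>n c. mk (pw n) (\<lambda>\<rho>. bt c (\<sigma> + pw m * \<rho>))"])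
      (intro d1f_mk d1f_pw d1_bt d1_intros)
  then show ?thesis unfolding sect_def[abs_def] .
qed

lemma tree_sect: assumes "tree U" "\<sigma> < pw (m::'a)" shows "tree (sect U m \<sigma>)"
  unfolding tree_def bt_sect
proof (intro allI impI conjI)
  fix n \<tau> k assume *: "\<tau> < pw n \<and> bt (U (m + n)) (\<sigma> + pw m * \<tau>)" and k: "k \<le> n"
  show "bt (U (m + k)) (\<sigma> + pw m * md \<tau> (pw k))"
    using treeD(2)[OF assms(1) conjunct2[OF *], of "m + k"] k md_sect[OF assms(2)] by simp
qed auto

lemma cnt_lift:
  fixes n :: 'a
  assumes "cod P" shows "cnt (pw (n + d)) (\<lambda>\<tau>. P (md \<tau> (pw n))) = pw d * cnt (pw n) P"
  using cnt_periodic[OF assms pw_pos, of "pw d" n] by (simp add: pw_add mult.commute)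

lemma cod_md: "cod P \<Longrightarrow> cod (\<lambda>\<tau>. P (md \<tau> (pw (n::'a))))"
  by (rule cod_comp, assumption, intro d1f_md d1_intros)

lemma cnt_antimono_level:
  fixes n :: 'a
  assumes "cod (P n)" "cod (P (n + d))" "\<And>\<tau>. \<tau> < pw (n + d) \<Longrightarrow> P (n + d) \<tau> \<Longrightarrow> P n (md \<tau> (pw n))"
  shows "cnt (pw (n + d)) (P (n + d)) \<le> pw d * cnt (pw n) (P n)"
  unfolding cnt_lift[OF assms(1), symmetric] by (intro cnt_mono cod_md assms)

lemma cnt_tree_level: "tree U \<Longrightarrow> cnt (pw (n + d)) (bt (U (n + d))) \<le> pw d * cnt (pw (n::'a)) (bt (U n))"
  by (rule cnt_antimono_level[of "\<lambda>n. bt (U n)"]) (auto intro: cod_bt treeD)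

end

context wphp
begin

text \<open>Every node loses more than a quarter of its extensions at some level, and by exhaustion
  one level serves for at least \<open>7/8\<close> of the nodes. The others keep at most everything,
  which leaves a share of at most \<open>1/8 + 7/8 * 3/4 \<le> 7/8\<close>.\<close>

lemma density_decay:
  assumes U: "z2 Z U" and T: "tree U"
    and low: "\<And>\<sigma>. \<sigma> < pw n \<Longrightarrow> bt (U n) \<sigma> \<Longrightarrow> \<exists>d. 4 * cnt (pw d) (bt (sect U n \<sigma> d)) < 3 * pw d"
  shows "\<exists>d. 8 * cnt (pw (n + d)) (bt (U (n + d))) \<le> 7 * (pw d * cnt (pw n) (bt (U n)))"
proof -
  define Q where "Q d c \<sigma> \<longleftrightarrow> 4 * cnt (pw d) (\<lambda>\<rho>. bt c (\<sigma> + pw n * \<rho>)) < 3 * pw d" for d c \<sigma>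
  \<comment> \<open>\<open>C d\<close> collects the nodes whose density has fallen below
    \<open>3/4\<close> by relative level \<open>d\<close>; it grows with \<open>d\<close> because
    the relative density of a tree never increases.\<close>
  define C where "C d = mk (pw n) (Q d (U (n + d)))" for d
  have dQ: "d1 Z (\<lambda>e. Q (e (Suc 0)) (e (Suc (Suc 0))) (e 0))"
    unfolding Q_def by (intro d1_intros d1f_cnt d1f_pw d1_bt)
  have codQ: "cod (Q d c)" for d c
    unfolding Q_def by (rule d1_cod) (intro d1_intros d1f_cnt d1f_pw d1_bt)
  have C: "z2 Z C" unfolding C_def
    by (rule z2_comp1[OF z2_shift[OF U], where G="\<lambda>d c. mk (pw n) (Q d c)"]) (intro d1f_mk d1f_pw d1_intros dQ)
  have Qs: "Q d (U (n + d)) \<sigma> \<longleftrightarrow> 4 * cnt (pw d) (bt (sect U n \<sigma> d)) < 3 * pw d" for d \<sigma>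
  proof -
    have "cnt (pw d) (bt (sect U n \<sigma> d)) = cnt (pw d) (\<lambda>\<rho>. bt (U (n + d)) (\<sigma> + pw n * \<rho>))"
      by (rule cnt_cong) (simp add: bt_sect)
    then show ?thesis unfolding Q_def by simp
  qed
  have btC: "bt (C d) \<sigma> \<longleftrightarrow> \<sigma> < pw n \<and> Q d (U (n + d)) \<sigma>" for d \<sigma>
    unfolding C_def by (rule bt_mk[OF codQ])
  have mono: "bt (C d') \<sigma>" if dd: "bt (C d) \<sigma>" "d \<le> d'" for d d' \<sigma>
  proof -
    obtain k where k: "d' = d + k" using parith_le_ex[OF dd(2)] by blast
    have s: "\<sigma> < pw n" "4 * cnt (pw d) (bt (sect U n \<sigma> d)) < 3 * pw d" using dd(1) unfolding btC Qs by auto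
    have "cnt (pw d') (bt (sect U n \<sigma> d')) \<le> pw k * cnt (pw d) (bt (sect U n \<sigma> d))"
      unfolding k by (rule cnt_tree_level[OF tree_sect[OF T s(1)]])
    moreover have "pw k * (4 * cnt (pw d) (bt (sect U n \<sigma> d))) < pw k * (3 * pw d)"
      by (rule mult_strict_left_mono[OF s(2) pw_pos])
    ultimately have "4 * cnt (pw d') (bt (sect U n \<sigma> d')) < 3 * pw d'"
      unfolding k pw_add emb_simps by (simp add: algebra_simps)
    then show ?thesis unfolding btC Qs using s(1) by simp
  qed
  have F: "\<exists>d. bt (C d) \<sigma>" if "\<sigma> < pw n" "bt (U n) \<sigma>" for \<sigma>
    using low[OF that] that(1) unfolding btC Qs by blast
  from exhaustion[of C "pw n" "U n" 3, OF C _ F] mono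
  obtain d where d: "2 ^ 3 * cnt (pw n) (\<lambda>v. bt (U n) v \<and> \<not> bt (C d) v) \<le> cnt (pw n) (bt (U n))" by blast
  let ?A = "\<lambda>v. bt (U n) v \<and> \<not> bt (C d) v" and ?B = "\<lambda>v. bt (U n) v \<and> bt (C d) v"
  have cA: "cod ?A" and cB: "cod ?B" by (intro cod_simps)+
  \<comment> \<open>Counting node by node: a node in \<open>?A\<close> contributes at most all
    \<open>pw d\<close> extensions, one in \<open>?B\<close> at most three quarters of them, any
    other none.\<close>
  have "i \<le> pw n \<longrightarrow> 4 * cnt (pw (n + d)) (\<lambda>\<tau>. bt (U (n + d)) \<tau> \<and> md \<tau> (pw n) < i)
      \<le> pw d * (4 * cnt i ?A + 3 * cnt i ?B)" for i
  proof (induction i rule: d1_induct)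
    case 1 show ?case by (intro d1_intros d1f_cnt d1_bt d1f_md)
  next
    case 2 show ?case by simp
  next
    case (3 i)
    show ?case
    proof
      assume "i + 1 \<le> pw n"
      then have i: "i < pw n" "i \<le> pw n" by (auto simp: parith_Suc_le)
      have c1: "cod (\<lambda>\<tau>. bt (U (n + d)) \<tau> \<and> md \<tau> (pw n) < i)" "cod (\<lambda>\<tau>. bt (U (n + d)) \<tau> \<and> md \<tau> (pw n) = i)"
        by (rule d1_cod, intro d1_intros d1_bt d1f_md)+
      have "cnt (pw (n + d)) (\<lambda>\<tau>. bt (U (n + d)) \<tau> \<and> md \<tau> (pw n) < i + 1) =
        cnt (pw (n + d)) (\<lambda>\<tau>. (bt (U (n + d)) \<tau> \<and> md \<tau> (pw n) < i) \<or> (bt (U (n + d)) \<tau> \<and> md \<tau> (pw n) = i))"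
        by (rule cnt_cong) (auto simp: parith_less_Suc le_less)
      also have "\<dots> = cnt (pw (n + d)) (\<lambda>\<tau>. bt (U (n + d)) \<tau> \<and> md \<tau> (pw n) < i) +
        cnt (pw (n + d)) (\<lambda>\<tau>. bt (U (n + d)) \<tau> \<and> md \<tau> (pw n) = i)"
        by (rule cnt_disjoint[OF c1]) auto
      also have "cnt (pw (n + d)) (\<lambda>\<tau>. bt (U (n + d)) \<tau> \<and> md \<tau> (pw n) = i) = cnt (pw d) (bt (sect U n i d))"
        unfolding pw_add cnt_fiber[OF cod_bt i(1)] by (rule cnt_cong) (simp add: bt_sect)
      finally have s: "cnt (pw (n + d)) (\<lambda>\<tau>. bt (U (n + d)) \<tau> \<and> md \<tau> (pw n) < i + 1) =
        cnt (pw (n + d)) (\<lambda>\<tau>. bt (U (n + d)) \<tau> \<and> md \<tau> (pw n) < i) + cnt (pw d) (bt (sect U n i d))" .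
      have IH: "4 * cnt (pw (n + d)) (\<lambda>\<tau>. bt (U (n + d)) \<tau> \<and> md \<tau> (pw n) < i)
        \<le> pw d * (4 * cnt i ?A + 3 * cnt i ?B)" using 3 i by blast
      have "4 * cnt (pw d) (bt (sect U n i d)) \<le> pw d * (if ?A i then 4 else if ?B i then 3 else 0)"
      proof (cases "bt (U n) i")
        case True
        have "cnt (pw d) (bt (sect U n i d)) \<le> pw d" by (rule cnt_le[OF cod_bt])
        moreover have "4 * cnt (pw d) (bt (sect U n i d)) < 3 * pw d" if "bt (C d) i" using that unfolding btC Qs by simp
        ultimately show ?thesis using True unfolding emb_simps by (auto simp: emb_numeral)
      next
        case False
        have "cnt (pw d) (bt (sect U n i d)) = cnt (pw d) (\<lambda>_. False)"
        proof (rule cnt_cong)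
          fix v
          have "\<not> bt (U (n + d)) (i + pw n * v)"
            using treeD(2)[OF T, of "n + d" "i + pw n * v" n] dvmd_sect(1)[OF i(1)] False by auto
          then show "bt (sect U n i d) v = False" by (simp add: bt_sect)
        qed
        then show ?thesis using False by simp
      qed
      then show "4 * cnt (pw (n + d)) (\<lambda>\<tau>. bt (U (n + d)) \<tau> \<and> md \<tau> (pw n) < i + 1)
        \<le> pw d * (4 * cnt (i + 1) ?A + 3 * cnt (i + 1) ?B)"
        using IH unfolding s cnt_Suc[OF cA] cnt_Suc[OF cB]
        by (cases "bt (U n) i"; cases "bt (C d) i") (simp_all add: emb_simps algebra_simps)
    qed
  qed
  from this[of "pw n"] have "4 * cnt (pw (n + d)) (\<lambda>\<tau>. bt (U (n + d)) \<tau> \<and> md \<tau> (pw n) < pw n)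
      \<le> pw d * (4 * cnt (pw n) ?A + 3 * cnt (pw n) ?B)" by blast
  then have 1: "4 * cnt (pw (n + d)) (bt (U (n + d))) \<le> pw d * (4 * cnt (pw n) ?A + 3 * cnt (pw n) ?B)" by simp
  have 2: "cnt (pw n) (bt (U n)) = cnt (pw n) ?B + cnt (pw n) ?A" by (rule cnt_split[OF cod_bt cod_bt])
  have "8 * (4 * cnt (pw n) ?A + 3 * cnt (pw n) ?B) \<le> 28 * cnt (pw n) (bt (U n))"
    using 2 d emb_nonneg[of "cnt (pw n) ?B"] emb_nonneg[of "cnt (pw n) ?A"] unfolding emb_simps by (simp add: emb_simps)
  then have "pw d * (8 * (4 * cnt (pw n) ?A + 3 * cnt (pw n) ?B)) \<le> pw d * (28 * cnt (pw n) (bt (U n)))"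
    by (rule mult_left_mono) simp
  then have "8 * cnt (pw (n + d)) (bt (U (n + d))) \<le> 7 * (pw d * cnt (pw n) (bt (U n)))"
    using 1 unfolding emb_simps by (simp add: algebra_simps)
  then show ?thesis by blast
qed

text \<open>If no node from level \<open>m\<close> on had density \<open>3/4\<close>, the density of
  \<open>U\<close> would shrink by the factor \<open>7/8\<close> any standard number of
  times.\<close>

lemma density_point:
  assumes U: "z2 Z U" and T: "tree U" and big: "dense 1 16 U"
  shows "\<exists>n\<ge>m. \<exists>\<sigma><pw n. bt (U n) \<sigma> \<and> dense 3 4 (sect U n \<sigma>)"
proof (rule ccontr)
  assume neg: "\<not> ?thesis"
  have low: "\<exists>d. 4 * cnt (pw d) (bt (sect U n \<sigma> d)) < 3 * pw d" if "m \<le> n" "\<sigma> < pw n" "bt (U n) \<sigma>" for n \<sigma>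
    using neg that unfolding dense_def not_le[symmetric] by blast
  have "\<exists>n\<ge>m. 8 ^ J * cnt (pw n) (bt (U n)) \<le> 7 ^ J * pw n" for J :: nat
  proof (induction J)
    case 0
    show ?case using cnt_le[OF cod_bt, of "pw m"] by (intro exI[of _ m]) simp
  next
    case (Suc J)
    then obtain n where n: "m \<le> n" "8 ^ J * cnt (pw n) (bt (U n)) \<le> 7 ^ J * pw n" by blast
    obtain d where d: "8 * cnt (pw (n + d)) (bt (U (n + d))) \<le> 7 * (pw d * cnt (pw n) (bt (U n)))"
      using density_decay[OF U T low[OF n(1)]] by blast
    have "8 ^ J * (8 * cnt (pw (n + d)) (bt (U (n + d)))) \<le> 8 ^ J * (7 * (pw d * cnt (pw n) (bt (U n))))"
      by (rule mult_left_mono[OF d]) simp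
    also have "\<dots> = (7 * pw d) * (8 ^ J * cnt (pw n) (bt (U n)))" by (simp only: ac_simps)
    also have "\<dots> \<le> (7 * pw d) * (7 ^ J * pw n)" by (rule mult_left_mono[OF n(2)]) simp
    finally have "8 ^ Suc J * cnt (pw (n + d)) (bt (U (n + d))) \<le> 7 ^ Suc J * pw (n + d)"
      unfolding pw_add by (simp only: power_Suc ac_simps)
    moreover have "m \<le> n + d" using n(1) by (rule order_trans) simp
    ultimately show ?case by blast
  qed
  \<comment> \<open>\<open>21\<close> is the least exponent for which the power of
    \<open>7/8\<close> falls below \<open>1/16\<close>.\<close>
  from this[of 21] obtain n where n: "8 ^ 21 * cnt (pw n) (bt (U n)) \<le> 7 ^ 21 * pw n" by blast
  have "1 * pw n \<le> 16 * cnt (pw n) (bt (U n))" using big unfolding dense_def by blast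
  moreover have "0 < pw n" by (rule pw_pos)
  ultimately show False using n unfolding emb_simps by (simp add: emb_simps)
qed

end

context ind1
begin

section \<open>Thinning out a dense tree\<close>

text \<open>The stage \<open>s\<close> nearly maximises the number of pairs of a string and an index \<open>i\<close> with \<open>G\<close>, so that only few
strings acquire a new index later.\<close>

lemma decide_bounded_step:
  assumes G: "d1 Z (\<lambda>e. G (e 0) (e (Suc 0)) (e (Suc (Suc 0))))"
    and mono: "\<And>n m \<rho> i. m \<le> n \<Longrightarrow> G m (md \<rho> (pw m)) i \<Longrightarrow> G n \<rho> i"
    and U: "z2 Z U" "tree U" "dense 3 4 U" and a: "0 < a"
  shows "\<exists>U' s. z2 Z U' \<and> tree U' \<and> dense 1 16 U' \<and> (\<forall>n \<tau>. bt (U' n) \<tau> \<longrightarrow> bt (U n) \<tau>) \<and>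
    (\<forall>n\<ge>s. \<forall>\<tau>. bt (U' n) \<tau> \<longrightarrow> (\<forall>i<a. G n \<tau> i \<longrightarrow> G s (md \<tau> (pw s)) i))"
proof -
  note G' = d1_rel3[OF G]
  \<comment> \<open>\<open>N n / pw n\<close> is the expected number of indices verified by a random
    string of length \<open>n\<close>; by \<open>mono\<close> it does not decrease with
    \<open>n\<close>.\<close>
  define N where "N n = cnt (pw n * a) (\<lambda>v. G n (dv v a) (md v a))" for n
  have Nle: "N n \<le> pw n * a" for n unfolding N_def
    by (rule cnt_le, rule d1_cod) (intro G' d1_intros d1f_md d1f_dv)
  have s1N: "s1 Z (\<lambda>e. \<exists>n. e 0 * pw n \<le> 16 * N n)" unfolding N_def
    by (intro s1_ex d1_s1 d1_intros d1f_pw d1f_cnt G' d1f_md d1f_dv)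
  have bnd: "k \<le> 16 * a" if k: "\<exists>n. k * pw n \<le> 16 * N n" for k
  proof -
    obtain n where n: "k * pw n \<le> 16 * N n" using k by blast
    have "16 * N n \<le> 16 * (pw n * a)" by (rule mult_left_mono[OF Nle]) simp
    then have "k * pw n \<le> (16 * a) * pw n" using n by (simp add: ac_simps)
    then show ?thesis using pw_pos[of n] by (rule mult_right_le_imp_le)
  qed
  have "\<exists>n. 0 * pw n \<le> 16 * N n" by simp
  \<comment> \<open>\<open>j / 16\<close> approximates the supremum of these expectations to within
    \<open>1/16\<close>; a largest \<open>j\<close> exists because reaching \<open>j\<close> is a
    Sigma_1 event.\<close>
  from max_s1[of "\<lambda>j. \<exists>n. j * pw n \<le> 16 * N n", OF s1N this bnd]
  obtain j where j: "\<exists>n. j * pw n \<le> 16 * N n" "\<And>k. \<exists>n. k * pw n \<le> 16 * N n \<Longrightarrow> k \<le> j" by blast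
  from j(1) obtain s where s: "j * pw s \<le> 16 * N s" by blast
  define A where "A n c \<rho> \<longleftrightarrow> bt c \<rho> \<and> (s \<le> n \<longrightarrow> (\<forall>i<a. G n \<rho> i \<longrightarrow> G s (md \<rho> (pw s)) i))" for n c \<rho>
  define U' where "U' n = mk (pw n) (A n (U n))" for n
  have dA: "d1 Z (\<lambda>e. A (e (Suc 0)) (e (Suc (Suc 0))) (e 0))"
    unfolding A_def by (intro d1_intros d1_bt G' d1f_md d1f_pw)
  have codA: "cod (A n c)" for n c
    unfolding A_def by (rule d1_cod) (intro d1_intros d1_bt G' d1f_md d1f_pw)
  have btU': "bt (U' n) \<rho> \<longleftrightarrow> \<rho> < pw n \<and> A n (U n) \<rho>" for n \<rho> unfolding U'_def by (rule bt_mk[OF codA])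
  have "z2 Z U'" unfolding U'_def
    by (rule z2_comp1[OF U(1), where G="\<lambda>n c. mk (pw n) (A n c)"]) (intro d1f_mk d1f_pw d1_intros dA)
  moreover have "tree U'"
    unfolding tree_def
  proof (intro allI impI conjI)
    fix n \<rho> m assume b: "bt (U' n) \<rho>" and m: "m \<le> n"
    show "bt (U' m) (md \<rho> (pw m))" unfolding btU' A_def
    proof (intro conjI allI impI)
      show "bt (U m) (md \<rho> (pw m))" using b treeD(2)[OF U(2) _ m] unfolding btU' A_def by blast
      fix i assume sm: "s \<le> m" and i: "i < a" "G m (md \<rho> (pw m)) i"
      have "G s (md \<rho> (pw s)) i" using b mono[OF m i(2)] i(1) sm m unfolding btU' A_def by auto
      then show "G s (md (md \<rho> (pw m)) (pw s)) i" using md_md[OF sm] by simp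
    qed simp
  qed (auto simp: btU')
  moreover have "dense 1 16 U'"
    unfolding dense_def
  proof
    fix n
    have big: "3 * pw n \<le> 4 * cnt (pw n) (bt (U n))" using U(3) unfolding dense_def by blast
    show "1 * pw n \<le> 16 * cnt (pw n) (bt (U' n))"
    proof (cases "s \<le> n")
      case False
      have "cnt (pw n) (bt (U' n)) = cnt (pw n) (bt (U n))"
        by (rule cnt_cong) (simp add: btU' A_def False)
      then show ?thesis using big emb_nonneg[of "pw n"] unfolding emb_simps by (simp add: emb_simps)
    next
      case True
      then obtain d where d: "n = s + d" using parith_le_ex by blast
      define bad where "bad \<rho> \<longleftrightarrow> (\<exists>i<a. G n \<rho> i \<and> \<not> G s (md \<rho> (pw s)) i)" for \<rho>
      have cbad: "cod bad" unfolding bad_def by (rule d1_cod) (intro d1_intros G' d1f_md d1f_pw)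
      define Gp where "Gp v \<longleftrightarrow> G n (dv v a) (md v a)" for v
      define Q where "Q v \<longleftrightarrow> G s (dv v a) (md v a)" for v
      have cG: "cod Gp" and cQ: "cod Q" unfolding Gp_def Q_def
        by (rule d1_cod, intro d1_intros G' d1f_md d1f_pw d1f_dv)+
      \<comment> \<open>\<open>L\<close> holds of the pairs verified already by the first
        \<open>s\<close> digits; it repeats with period \<open>pw s * a\<close> and is therefore
        counted exactly.\<close>
      define L where "L v \<longleftrightarrow> Q (md v (pw s * a))" for v
      have cL: "cod L" unfolding L_def by (rule cod_comp[OF cQ]) (intro d1_intros d1f_md)
      have psa: "0 < pw s * a" using pw_pos[of s] a by (simp add: mult_pos_pos)
      have Leq: "L v \<longleftrightarrow> G s (md (dv v a) (pw s)) (md v a)" for v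
      proof -
        let ?r = "md (dv v a) (pw s) * a + md v a"
        have v: "v = dv v a * a + md v a" and mv: "md v a < a" by (rule dvmd[OF a])+
        have q: "dv v a = dv (dv v a) (pw s) * pw s + md (dv v a) (pw s)" by (rule dvmd(1)[OF pw_pos])
        have "v = (dv (dv v a) (pw s) * pw s + md (dv v a) (pw s)) * a + md v a" using v q by simp
        then have 1: "v = dv (dv v a) (pw s) * (pw s * a) + ?r" by (simp add: algebra_simps)
        have "(md (dv v a) (pw s) + 1) * a \<le> pw s * a" by (rule mult_right_mono) (simp_all add: parith_Suc_le)
        then have 2: "?r < pw s * a" using mv unfolding emb_simps by (simp add: algebra_simps)
        have "md v (pw s * a) = ?r" by (rule md_eqI[OF 1 2])
        then show ?thesis unfolding L_def Q_def using dv_eqI[OF refl mv] md_eqI[OF refl mv] by simp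
      qed
      have nN: "cnt (pw n * a) Gp = N n" unfolding N_def Gp_def ..
      have sN: "cnt (pw s * a) Q = N s" unfolding N_def Q_def ..
      have pn: "pw n * a = pw d * (pw s * a)" unfolding d pw_add by (simp add: ac_simps)
      have "cnt (pw n * a) L = pw d * N s"
        using cnt_periodic[OF cQ psa, of "pw d"] unfolding L_def pn sN .
      moreover have "cnt (pw n * a) (\<lambda>v. Gp v \<and> L v) = cnt (pw n * a) L"
        by (rule cnt_cong) (use mono[OF True] in \<open>auto simp: Leq Gp_def\<close>)
      moreover have "cnt (pw n * a) Gp = cnt (pw n * a) (\<lambda>v. Gp v \<and> L v) + cnt (pw n * a) (\<lambda>v. Gp v \<and> \<not> L v)"
        by (rule cnt_split[OF cG cL])
      ultimately have NN: "N n = pw d * N s + cnt (pw n * a) (\<lambda>v. Gp v \<and> \<not> L v)" using nN by simp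
      \<comment> \<open>Maximality of \<open>j\<close> leaves fewer than \<open>pw n / 16\<close>
        new pairs, and each bad string accounts for at least one of them.\<close>
      have "\<not> (j + 1) * pw n \<le> 16 * N n" using j(2)[of "j + 1"] less_add_one[of j] by (auto simp: not_le[symmetric] simp del: not_le)
      then have up: "16 * N n < j * pw n + pw n" by (simp add: not_le algebra_simps)
      have "pw d * (j * pw s) \<le> pw d * (16 * N s)" by (rule mult_left_mono[OF s]) simp
      then have lo: "j * pw n \<le> 16 * (pw d * N s)" unfolding d pw_add by (simp add: ac_simps)
      have "cnt (pw n) bad \<le> cnt (pw n * a) (\<lambda>v. Gp v \<and> \<not> L v)"
      proof (rule cnt_image[OF _ cod_conj[OF cG cod_neg[OF cL]] cbad])
        show "d1f Z (\<lambda>e. dv (e 0) a)" by (intro d1f_dv d1_intros)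
        fix \<rho> assume r: "\<rho> < pw n" "bad \<rho>"
        then obtain i where i: "i < a" "G n \<rho> i" "\<not> G s (md \<rho> (pw s)) i" unfolding bad_def by blast
        have *: "dv (\<rho> * a + i) a = \<rho>" "md (\<rho> * a + i) a = i" using dv_eqI[OF refl i(1)] md_eqI[OF refl i(1)] by auto
        have "(\<rho> + 1) * a \<le> pw n * a" using r(1) by (intro mult_right_mono) (simp_all add: parith_Suc_le)
        then have "\<rho> * a + i < pw n * a" using i(1) unfolding emb_simps by (simp add: algebra_simps)
        then show "\<exists>v<pw n * a. (Gp v \<and> \<not> L v) \<and> dv v a = \<rho>"
          using * i by (intro exI[of _ "\<rho> * a + i"]) (simp add: Gp_def Leq)
      qed
      then have b16: "16 * cnt (pw n) bad \<le> pw n" using NN up lo unfolding emb_simps by (simp add: emb_simps)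
      have "cnt (pw n) (bt (U n)) \<le> cnt (pw n) (\<lambda>\<rho>. bt (U' n) \<rho> \<or> bad \<rho>)"
        by (intro cnt_mono cod_disj cod_bt cbad) (auto simp: btU' A_def bad_def)
      also have "\<dots> \<le> cnt (pw n) (bt (U' n)) + cnt (pw n) bad" by (rule cnt_disj_le[OF cod_bt cbad])
      finally show ?thesis using big b16 emb_nonneg[of "pw n"] unfolding emb_simps by (simp add: emb_simps)
    qed
  qed
  moreover have "\<forall>n \<tau>. bt (U' n) \<tau> \<longrightarrow> bt (U n) \<tau>" by (simp add: btU' A_def)
  moreover have "\<forall>n\<ge>s. \<forall>\<tau>. bt (U' n) \<tau> \<longrightarrow> (\<forall>i<a. G n \<tau> i \<longrightarrow> G s (md \<tau> (pw s)) i)" by (simp add: btU' A_def)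
  ultimately show ?thesis by blast
qed

end

text \<open>A pairing without division: consecutive squares are further apart than the added
  \<open>w\<close>. It is injective but not onto.\<close>

definition pr :: "'a::parith \<Rightarrow> 'a \<Rightarrow> 'a" where "pr w s = (w + s) * (w + s) + w"

lemma pr_less: "w + s < w' + s' \<Longrightarrow> pr w s < pr w' (s'::'a::parith)"
proof -
  assume "w + s < w' + s'"
  then have "w + s + 1 \<le> w' + s'" by (rule parith_discrete)
  then have "(w + s + 1) * (w + s + 1) \<le> (w' + s') * (w' + s')" by (intro mult_mono) simp_all
  then show ?thesis unfolding pr_def using emb_nonneg[of w] emb_nonneg[of s] emb_nonneg[of w']
    unfolding emb_simps by (simp add: emb_simps algebra_simps)
qed

lemma pr_inj: "pr w s = pr w' s' \<longleftrightarrow> w = w' \<and> s = (s'::'a::parith)"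
proof
  assume *: "pr w s = pr w' s'"
  have "w + s = w' + s'" using pr_less[of w s w' s'] pr_less[of w' s' w s] * by (metis less_irrefl linorder_neqE)
  then show "w = w' \<and> s = s'" using * unfolding pr_def by simp
qed simp

lemma pr_mono: "w \<le> n \<Longrightarrow> s \<le> n \<Longrightarrow> pr w s < pr n n + (1::'a::parith)"
proof -
  assume "w \<le> n" "s \<le> n"
  then have "(w + s) * (w + s) \<le> (n + n) * (n + n)" by (intro mult_mono add_mono) simp_all
  then have "pr w s \<le> pr n n" unfolding pr_def using \<open>w \<le> n\<close> by (rule add_mono)
  then show ?thesis by (simp add: parith_less_Suc)
qed

context ind1
begin

lemma d1f_pr: "d1f Z f \<Longrightarrow> d1f Z g \<Longrightarrow> d1f Z (\<lambda>e. pr (f e) (g e))"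
  unfolding pr_def by (intro d1_intros)

text \<open>The weights \<open>1 / pw w\<close> allow the sets \<open>D w\<close> to be approximated from outside, one after
the other, while the union of all approximations stays barely larger than their supremum.\<close>

lemma avoid_step:
  assumes D: "d1 Z (\<lambda>e. D (e 0) (e (Suc 0)) (e (Suc (Suc 0))))"
    and anti: "\<And>w n m \<rho>. m \<le> n \<Longrightarrow> D w n \<rho> \<Longrightarrow> D w m (md \<rho> (pw m))"
    and incr: "\<And>w w' n \<rho>. w \<le> w' \<Longrightarrow> D w n \<rho> \<Longrightarrow> D w' n \<rho>"
    and small: "\<And>w. \<exists>n. 8 * cnt (pw n) (D w n) < 5 * pw n"
    and U: "z2 Z U" "tree U" "dense 3 4 U"
  shows "\<exists>U'. z2 Z U' \<and> tree U' \<and> dense 1 16 U' \<and> (\<forall>n \<tau>. bt (U' n) \<tau> \<longrightarrow> bt (U n) \<tau>) \<and>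
    (\<forall>w. \<exists>n. \<forall>\<tau>. bt (U' n) \<tau> \<longrightarrow> \<not> D w n \<tau>)"
proof -
  note D' = d1_rel3[OF D]
  have cD: "cod (D w n)" for w n by (rule d1_cod) (intro D' d1_intros)
  have lvl: "cnt (pw (n + d)) (D w (n + d)) \<le> pw d * cnt (pw n) (D w n)" for w n d
  proof (rule cnt_antimono_level[of "D w", OF cD cD])
    fix \<tau> assume "D w (n + d) \<tau>"
    then show "D w n (md \<tau> (pw n))" by (rule anti[rotated]) simp
  qed
  \<comment> \<open>At a good level the density of \<open>D w\<close> exceeds its density at every
    later level by at most \<open>1 / (64 * pw w)\<close>. This is a Pi_1 condition on
    \<open>w\<close> and \<open>s\<close>.\<close>
  define Good where "Good w s \<longleftrightarrow> (\<forall>d. 64 * pw w * (pw d * cnt (pw s) (D w s)) \<le> 64 * pw w * cnt (pw (s + d)) (D w (s + d)) + pw (s + d))" for w s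
  have sG: "s1 Z (\<lambda>e. \<not> Good (e 0) (e (Suc 0)))"
    unfolding Good_def not_all by (intro s1_ex d1_s1 d1_intros d1f_pw d1f_cnt D')
  have good: "\<exists>s. Good w s" for w
  proof -
    have "s1 Z (\<lambda>e. \<exists>s. 64 * pw w * cnt (pw s) (D w s) \<le> e 0 * pw s)" by (intro s1_ex d1_s1 d1_intros d1f_pw d1f_cnt D')
    moreover have "\<exists>s. 64 * pw w * cnt (pw s) (D w s) \<le> (64 * pw w) * pw s"
      by (intro exI[of _ 0] mult_left_mono cnt_le cD) simp
    \<comment> \<open>Density is measured in units of \<open>1 / (64 * pw w)\<close>. A level that
      reaches the least possible \<open>j\<close> is good, since no level has density
      \<open>j - 1\<close> or less.\<close>
    ultimately obtain j where j: "\<exists>s. 64 * pw w * cnt (pw s) (D w s) \<le> j * pw s"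
      "\<forall>k<j. \<not> (\<exists>s. 64 * pw w * cnt (pw s) (D w s) \<le> k * pw s)"
      using least_s1[of "\<lambda>j. \<exists>s. 64 * pw w * cnt (pw s) (D w s) \<le> j * pw s" "64 * pw w"] by blast
    then obtain s where s: "64 * pw w * cnt (pw s) (D w s) \<le> j * pw s" by blast
    have "Good w s" unfolding Good_def
    proof
      fix d
      have 1: "pw d * (64 * pw w * cnt (pw s) (D w s)) \<le> pw d * (j * pw s)" by (rule mult_left_mono[OF s]) simp
      consider "j = 0" | k where "j = k + 1" using parith_pos_cases by blast
      then show "64 * pw w * (pw d * cnt (pw s) (D w s)) \<le> 64 * pw w * cnt (pw (s + d)) (D w (s + d)) + pw (s + d)"
      proof cases
        case 1
        then show ?thesis using s by auto
      next
        case 2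
        then have "\<not> 64 * pw w * cnt (pw (s + d)) (D w (s + d)) \<le> k * pw (s + d)" using j(2) less_add_one by blast
        then show ?thesis using 1 unfolding 2 pw_add emb_simps by (simp add: emb_simps algebra_simps)
      qed
    qed
    then show ?thesis by blast
  qed
  \<comment> \<open>At level \<open>n\<close> only good levels \<open>s \<le> n\<close> count: a
    string is deleted as soon as it lies in a good approximation of some \<open>D w\<close> with
    \<open>w \<le> n\<close>.\<close>
  define bad where "bad n \<rho> \<longleftrightarrow> (\<exists>w\<le>n. \<exists>s\<le>n. Good w s \<and> D w s (md \<rho> (pw s)))" for n \<rho>
  \<comment> \<open>Failure of \<open>Good\<close> is Sigma_1, so its segments are coded;
    \<open>b n\<close> below reads the good pairs off such a code and is a \<open>z2\<close>
    function for this reason.\<close>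
  define W where "W v \<longleftrightarrow> (\<exists>w s. v = pr w s \<and> \<not> Good w s)" for v
  have sW: "s1 Z (\<lambda>e. W (e 0))" unfolding W_def by (intro s1_ex s1_conj s1_rel2[OF sG] d1_intros; intro d1_s1 d1_intros d1f_pr)
  have W: "W (pr w s) \<longleftrightarrow> \<not> Good w s" for w s unfolding W_def by (auto simp: pr_inj)
  define B where "B n c \<rho> \<longleftrightarrow> (\<exists>w\<le>n. \<exists>s\<le>n. \<not> bt c (pr w s) \<and> D w s (md \<rho> (pw s)))" for n c \<rho>
  define b where "b n = mk (pw n) (B n (mk (pr n n + 1) W))" for n
  have dB: "d1 Z (\<lambda>e. B (e (Suc 0)) (e (Suc (Suc 0))) (e 0))"
    unfolding B_def by (intro d1_intros d1_bt d1f_pr D' d1f_md d1f_pw)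
  have codB: "cod (B n c)" for n c
    unfolding B_def by (rule d1_cod) (intro d1_intros d1_bt d1f_pr D' d1f_md d1f_pw)
  have Bbad: "B n (mk (pr n n + 1) W) \<rho> \<longleftrightarrow> bad n \<rho>" for n \<rho>
    unfolding B_def bad_def bt_mk[OF s1_cod[OF sW]] using pr_mono[of _ n] W by auto
  have btb: "bt (b n) \<rho> \<longleftrightarrow> \<rho> < pw n \<and> bad n \<rho>" for n \<rho> unfolding b_def bt_mk[OF codB] Bbad ..
  have zb: "z2 Z b" unfolding b_def
    by (rule z2_code[OF sW, where \<beta>="\<lambda>n. pr n n + 1" and G="\<lambda>n c. mk (pw n) (B n c)"])
      (intro d1f_pr d1_intros d1f_mk d1f_pw dB)+
  have codbad: "cod (bad n)" for n using codB[of n "mk (pr n n + 1) W"] unfolding Bbad .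
  define U' where "U' n = mk (pw n) (\<lambda>\<rho>. bt (U n) \<rho> \<and> \<not> bt (b n) \<rho>)" for n
  have btU': "bt (U' n) \<rho> \<longleftrightarrow> \<rho> < pw n \<and> bt (U n) \<rho> \<and> \<not> bad n \<rho>" for n \<rho>
  proof -
    have "bt (U' n) \<rho> \<longleftrightarrow> \<rho> < pw n \<and> bt (U n) \<rho> \<and> \<not> bt (b n) \<rho>"
      unfolding U'_def by (rule bt_mk[OF cod_conj[OF cod_bt cod_neg[OF cod_bt]]])
    then show ?thesis using btb by auto
  qed
  have "z2 Z U'" unfolding U'_def
    by (rule z2_comp2[OF U(1) zb, where G="\<lambda>n c d. mk (pw n) (\<lambda>\<rho>. bt c \<rho> \<and> \<not> bt d \<rho>)"])
      (intro d1f_mk d1f_pw d1_intros d1_bt)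
  moreover have "tree U'"
    unfolding tree_def btU'
  proof (intro allI impI conjI)
    fix n \<rho> m assume *: "\<rho> < pw n \<and> bt (U n) \<rho> \<and> \<not> bad n \<rho>" and m: "m \<le> n"
    show "bt (U m) (md \<rho> (pw m))" using treeD(2)[OF U(2) _ m] * by blast
    show "\<not> bad m (md \<rho> (pw m))"
    proof
      assume "bad m (md \<rho> (pw m))"
      then obtain w s where ws: "w \<le> m" "s \<le> m" "Good w s" "D w s (md (md \<rho> (pw m)) (pw s))" unfolding bad_def by blast
      then have "bad n \<rho>" unfolding bad_def md_md[OF ws(2)] using m by (meson order_trans)
      then show False using * by blast
    qed
  qed auto
  moreover have "dense 1 16 U'"
    unfolding dense_def
  proof
    fix n
    have big: "3 * pw n \<le> 4 * cnt (pw n) (bt (U n))" using U(3) unfolding dense_def by blast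
    obtain n0 where n0: "8 * cnt (pw n0) (D n n0) < 5 * pw n0" using small by blast
    \<comment> \<open>A level \<open>N \<ge> n\<close> at which \<open>D n\<close> is already small;
      the deletions are counted there and scaled back to level \<open>n\<close>.\<close>
    obtain N where N: "n \<le> N" "8 * cnt (pw N) (D n N) < 5 * pw N"
    proof -
      obtain d where d: "max n n0 = n0 + d" using parith_le_ex[OF max.cobounded2] by blast
      have "8 * cnt (pw (n0 + d)) (D n (n0 + d)) \<le> 8 * (pw d * cnt (pw n0) (D n n0))" by (rule mult_left_mono[OF lvl]) simp
      moreover have "pw d * (8 * cnt (pw n0) (D n n0)) < pw d * (5 * pw n0)" by (rule mult_strict_left_mono[OF n0 pw_pos])
      ultimately have "8 * cnt (pw (n0 + d)) (D n (n0 + d)) < 5 * pw (n0 + d)"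
        unfolding pw_add emb_simps by (simp add: algebra_simps)
      then show thesis using that[of "n0 + d"] unfolding d[symmetric] by simp
    qed
    obtain R where R: "d1 Z (\<lambda>e. R (e 0) (e (Suc 0)))" "\<forall>w<n + 1. \<forall>s<n + 1. (\<not> Good w s) = R w s"
      using s1_bounded_code2[where R="\<lambda>w s. \<not> Good w s" and n="n + 1"] sG by auto
    note R' = d1_rel2[OF R(1)]
    have GR: "Good w s \<longleftrightarrow> \<not> R w s" if "w \<le> n" "s \<le> n" for w s using R(2) that by (auto simp: parith_less_Suc)
    \<comment> \<open>Strings that are deleted on account of some \<open>w < i\<close> although they
      lie outside \<open>D n\<close>.\<close>
    define E where "E i \<rho> \<longleftrightarrow> \<not> D n N \<rho> \<and> (\<exists>w<i. \<exists>s\<le>n. \<not> R w s \<and> D w s (md \<rho> (pw s)))" for i \<rho>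
    have cE: "cod (E i)" for i unfolding E_def by (rule d1_cod) (intro d1_intros R' D' d1f_md d1f_pw)
    \<comment> \<open>A geometric sum: the excess for \<open>w\<close> is at most
      \<open>1 / (64 * pw w)\<close>, and these terms for \<open>w < i\<close> add up to
      \<open>(2 - 2 / pw i) / 64\<close>.\<close>
    have "i \<le> n + 1 \<longrightarrow> 64 * pw i * cnt (pw N) (E i) + 2 * pw N \<le> 2 * pw i * pw N" for i
    proof (induction i rule: d1_induct)
      case 1 show ?case unfolding E_def by (intro d1_intros d1f_pw d1f_cnt R' D' d1f_md)
    next
      case 2
      have "cnt (pw N) (E 0) = cnt (pw N) (\<lambda>_. False)" by (rule cnt_cong) (simp add: E_def)
      then show ?case by simp
    next
      case (3 i)
      show ?case
      proof
        assume "i + 1 \<le> n + 1"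
        then have i: "i \<le> n" by simp
        then have IH: "64 * pw i * cnt (pw N) (E i) + 2 * pw N \<le> 2 * pw i * pw N"
          using 3 less_add_one[of n] by (auto intro: order_trans less_imp_le)
        define L where "L \<rho> \<longleftrightarrow> \<not> D i N \<rho> \<and> (\<exists>s\<le>n. \<not> R i s \<and> D i s (md \<rho> (pw s)))" for \<rho>
        have cL: "cod L" unfolding L_def by (rule d1_cod) (intro d1_intros R' D' d1f_md d1f_pw)
        have Lb: "64 * pw i * cnt (pw N) L \<le> pw N"
        proof (cases "\<exists>s. s \<le> n \<and> \<not> R i s")
          case False
          have "cnt (pw N) L = cnt (pw N) (\<lambda>_. False)" by (rule cnt_cong) (use False in \<open>auto simp: L_def\<close>)
          then show ?thesis by simp
        next
          case True
          then obtain s0 where s0: "s0 \<le> n \<and> \<not> R i s0" by blast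
          have "s1 Z (\<lambda>e. e 0 \<le> n \<and> \<not> R i (e 0))" by (intro d1_s1 d1_intros R')
          \<comment> \<open>The first good level gives the largest approximation of
            \<open>D i\<close>, which contains those of all later good levels.\<close>
          from least_s1[of "\<lambda>s. s \<le> n \<and> \<not> R i s", OF this s0]
          obtain s where s: "s \<le> n" "\<not> R i s" "\<forall>k<s. \<not> (k \<le> n \<and> \<not> R i k)" by blast
          obtain d where d: "N = s + d" using parith_le_ex[OF order_trans[OF s(1) N(1)]] by blast
          have Gs: "Good i s" using GR[OF i s(1)] s(2) by simp
          define P where "P \<rho> \<longleftrightarrow> D i s (md \<rho> (pw s))" for \<rho>
          have cP: "cod P" unfolding P_def by (rule cod_md[OF cD])
          have LP: "cnt (pw N) L \<le> cnt (pw N) (\<lambda>\<rho>. P \<rho> \<and> \<not> D i N \<rho>)"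
          proof (intro cnt_mono cL cod_conj cP cod_neg cD)
            fix \<rho> assume "L \<rho>"
            then obtain s' where s': "\<not> D i N \<rho>" "s' \<le> n" "\<not> R i s'" "D i s' (md \<rho> (pw s'))" unfolding L_def by blast
            have ss': "s \<le> s'" using s(3) s'(2,3) by (meson not_le)
            have "D i s (md (md \<rho> (pw s')) (pw s))" by (rule anti[OF ss' s'(4)])
            then show "P \<rho> \<and> \<not> D i N \<rho>" using s'(1) md_md[OF ss'] unfolding P_def by simp
          qed
          have "cnt (pw N) (\<lambda>\<rho>. P \<rho> \<and> D i N \<rho>) = cnt (pw N) (D i N)"
            by (rule cnt_cong) (use anti[OF order_trans[OF s(1) N(1)]] in \<open>auto simp: P_def\<close>)
          moreover have "cnt (pw N) P = cnt (pw N) (\<lambda>\<rho>. P \<rho> \<and> D i N \<rho>) + cnt (pw N) (\<lambda>\<rho>. P \<rho> \<and> \<not> D i N \<rho>)"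
            by (rule cnt_split[OF cP cD])
          moreover have "cnt (pw N) P = pw d * cnt (pw s) (D i s)" unfolding P_def d by (rule cnt_lift[OF cD])
          ultimately have eq: "pw d * cnt (pw s) (D i s) = cnt (pw N) (D i N) + cnt (pw N) (\<lambda>\<rho>. P \<rho> \<and> \<not> D i N \<rho>)" by simp
          have "64 * pw i * (pw d * cnt (pw s) (D i s)) \<le> 64 * pw i * cnt (pw N) (D i N) + pw N"
            using Gs unfolding Good_def d by blast
          then have "64 * pw i * cnt (pw N) (\<lambda>\<rho>. P \<rho> \<and> \<not> D i N \<rho>) \<le> pw N" unfolding eq by (simp add: distrib_left)
          moreover have "64 * pw i * cnt (pw N) L \<le> 64 * pw i * cnt (pw N) (\<lambda>\<rho>. P \<rho> \<and> \<not> D i N \<rho>)" by (rule mult_left_mono[OF LP]) simp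
          ultimately show ?thesis by simp
        qed
        have "cnt (pw N) (E (i + 1)) \<le> cnt (pw N) (\<lambda>\<rho>. E i \<rho> \<or> L \<rho>)"
        proof (intro cnt_mono cE cod_disj cL)
          fix \<rho> assume "E (i + 1) \<rho>"
          then obtain w s where ws: "\<not> D n N \<rho>" "w < i + 1" "s \<le> n" "\<not> R w s" "D w s (md \<rho> (pw s))" unfolding E_def by blast
          then have "\<not> D i N \<rho>" using incr[OF i] by blast
          then show "E i \<rho> \<or> L \<rho>" using ws unfolding E_def L_def by (auto simp: parith_less_Suc le_less)
        qed
        also have "\<dots> \<le> cnt (pw N) (E i) + cnt (pw N) L" by (rule cnt_disj_le[OF cE cL])
        finally have "64 * pw i * cnt (pw N) (E (i + 1)) \<le> 64 * pw i * (cnt (pw N) (E i) + cnt (pw N) L)"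
          by (rule mult_left_mono) simp
        then show "64 * pw (i + 1) * cnt (pw N) (E (i + 1)) + 2 * pw N \<le> 2 * pw (i + 1) * pw N"
          using IH Lb unfolding pw_Suc emb_simps by (simp add: emb_simps algebra_simps)
      qed
    qed
    from this[of "n + 1"] have "64 * pw (n + 1) * cnt (pw N) (E (n + 1)) + 2 * pw N \<le> 2 * pw (n + 1) * pw N" by simp
    then have "pw (n + 1) * (64 * cnt (pw N) (E (n + 1))) \<le> pw (n + 1) * (2 * pw N)"
      using emb_nonneg[of "pw N"] unfolding emb_simps by (simp add: emb_simps algebra_simps)
    then have E64: "64 * cnt (pw N) (E (n + 1)) \<le> 2 * pw N" using pw_pos[of "n + 1"] by (rule mult_left_le_imp_le)
    obtain d where d: "N = n + d" using parith_le_ex[OF N(1)] by blast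
    have "pw d * cnt (pw n) (bad n) = cnt (pw N) (\<lambda>\<rho>. bad n (md \<rho> (pw n)))" unfolding d by (rule cnt_lift[OF codbad, symmetric])
    also have "\<dots> \<le> cnt (pw N) (\<lambda>\<rho>. D n N \<rho> \<or> E (n + 1) \<rho>)"
    proof (intro cnt_mono cod_disj cD cE cod_md codbad)
      fix \<rho> assume "bad n (md \<rho> (pw n))"
      then obtain w s where ws: "w \<le> n" "s \<le> n" "Good w s" "D w s (md \<rho> (pw s))" unfolding bad_def using md_md by auto
      then show "D n N \<rho> \<or> E (n + 1) \<rho>" using GR[OF ws(1,2)] unfolding E_def parith_less_Suc by blast
    qed
    also have "\<dots> \<le> cnt (pw N) (D n N) + cnt (pw N) (E (n + 1))" by (rule cnt_disj_le[OF cD cE])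
    \<comment> \<open>\<open>42 = 40 + 2\<close>: density \<open>5/8\<close> for \<open>D n\<close>
      plus the excess \<open>2/64\<close>.\<close>
    finally have "pw d * (64 * cnt (pw n) (bad n)) \<le> pw d * (42 * pw n)"
      using E64 N(2) unfolding d pw_add emb_simps by (simp add: emb_simps algebra_simps)
    then have b64: "64 * cnt (pw n) (bad n) \<le> 42 * pw n" using pw_pos[of d] by (rule mult_left_le_imp_le)
    have "cnt (pw n) (bt (U n)) \<le> cnt (pw n) (\<lambda>\<rho>. bt (U' n) \<rho> \<or> bad n \<rho>)"
      by (intro cnt_mono cod_disj cod_bt codbad) (auto simp: btU')
    also have "\<dots> \<le> cnt (pw n) (bt (U' n)) + cnt (pw n) (bad n)" by (rule cnt_disj_le[OF cod_bt codbad])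
    finally show "1 * pw n \<le> 16 * cnt (pw n) (bt (U' n))"
      using big b64 emb_nonneg[of "pw n"] unfolding emb_simps by (simp add: emb_simps)
  qed
  moreover have "\<forall>n \<tau>. bt (U' n) \<tau> \<longrightarrow> bt (U n) \<tau>" by (simp add: btU')
  moreover have "\<exists>n. \<forall>\<tau>. bt (U' n) \<tau> \<longrightarrow> \<not> D w n \<tau>" for w
  proof -
    obtain s where s: "Good w s" using good by blast
    have "\<not> D w (max w s) \<tau>" if "bt (U' (max w s)) \<tau>" for \<tau>
      using that anti[of s "max w s" w \<tau>] s unfolding btU' bad_def by (metis max.cobounded1 max.cobounded2)
    then show ?thesis by blast
  qed
  ultimately show ?thesis by blast
qed

end

context wphp
begin

text \<open>\<open>f(a) = b\<close> means that \<open>G n \<tau> a b u\<close> fails for some \<open>u\<close> and all \<open>n\<close>. In \<open>E a b w\<close> it is required in addition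
that no other pair \<open>(u', a')\<close> with smaller \<open>u'\<close>, or with equal \<open>u'\<close> and smaller \<open>a'\<close>, does the same for \<open>b\<close>; this makes the events
disjoint for different \<open>a\<close>, whether or not \<open>f\<close> is injective.\<close>

lemma defeat_injection_step:
  assumes G: "d1 Z (\<lambda>e. G (e 0) (e (Suc 0)) (e (Suc (Suc 0))) (e (Suc (Suc (Suc 0)))) (e (Suc (Suc (Suc (Suc 0))))))"
    and mono: "\<And>n m \<rho> a b u. m \<le> n \<Longrightarrow> G m (md \<rho> (pw m)) a b u \<Longrightarrow> G n \<rho> a b u"
    and U: "z2 Z U" "tree U" "dense 3 4 U" and x: "1 \<le> x"
  defines "E \<equiv> \<lambda>a b w n \<tau>. \<exists>u<w. \<exists>s<w. \<not> G n \<tau> a b u \<and>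
      (\<forall>a'<x + x. \<forall>u'\<le>u. (u' < u \<or> a' < a) \<and> a' \<noteq> a \<longrightarrow> G s (md \<tau> (pw s)) a' b u')"
  shows "\<exists>U'. z2 Z U' \<and> tree U' \<and> dense 1 16 U' \<and> (\<forall>n \<tau>. bt (U' n) \<tau> \<longrightarrow> bt (U n) \<tau>) \<and>
    (\<exists>a<x + x. \<forall>w. \<exists>n\<ge>w. \<forall>\<tau>. bt (U' n) \<tau> \<longrightarrow> \<not> (\<exists>b<x. E a b w n \<tau>))"
proof -
  note G' = d1_rel5[OF G]
  \<comment> \<open>Short strings are put into \<open>D\<close> because \<open>E\<close> looks at
    prefixes of length \<open>s < w\<close> and is inherited by prefixes only down to length
    \<open>w\<close>.\<close>
  define D where "D a w n \<tau> \<longleftrightarrow> n < w \<or> (\<exists>b<x. E a b w n \<tau>)" for a w n \<tau>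
  have D: "d1 Z (\<lambda>e. D (e 0) (e (Suc 0)) (e (Suc (Suc 0))) (e (Suc (Suc (Suc 0)))))"
    unfolding D_def E_def by (intro d1_intros G' d1f_md d1f_pw)
  note D' = d1_rel4[OF D]
  have cD: "cod (D a w n)" for a w n by (rule d1_cod) (intro D' d1_intros)
  have E_anti: "E a b w m (md \<tau> (pw m))" if h: "m \<le> n" "w \<le> m" "E a b w n \<tau>" for a b w m n \<tau>
  proof -
    obtain u s where us: "u < w" "s < w" "\<not> G n \<tau> a b u"
      "\<forall>a'<x + x. \<forall>u'\<le>u. (u' < u \<or> a' < a) \<and> a' \<noteq> a \<longrightarrow> G s (md \<tau> (pw s)) a' b u'"
      using h(3) unfolding E_def by blast
    have "s \<le> m" using us(2) h(2) by simp
    then have "md (md \<tau> (pw m)) (pw s) = md \<tau> (pw s)" by (rule md_md)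
    moreover have "\<not> G m (md \<tau> (pw m)) a b u" using us(3) mono[OF h(1)] by blast
    ultimately have "\<not> G m (md \<tau> (pw m)) a b u \<and> (\<forall>a'<x + x. \<forall>u'\<le>u. (u' < u \<or> a' < a) \<and> a' \<noteq> a \<longrightarrow>
      G s (md (md \<tau> (pw m)) (pw s)) a' b u')" using us(4) by simp
    then show ?thesis unfolding E_def using us(1,2) by blast
  qed
  have anti: "D a w m (md \<rho> (pw m))" if "m \<le> n" "D a w n \<rho>" for a w n m \<rho>
    using that E_anti[OF that(1), of w a _ \<rho>] unfolding D_def by (cases "m < w") auto
  have incr: "D a w' n \<rho>" if ww: "w \<le> w'" "D a w n \<rho>" for a w w' n \<rho>
    using ww less_le_trans[OF _ ww(1)] unfolding D_def E_def by blast
  show ?thesis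
  proof (cases "\<exists>a<x + x. \<forall>w. \<exists>n. 8 * cnt (pw n) (D a w n) < 5 * pw n")
    case True
    then obtain a where a: "a < x + x" "\<And>w. \<exists>n. 8 * cnt (pw n) (D a w n) < 5 * pw n" by blast
    have "d1 Z (\<lambda>e. D a (e 0) (e (Suc 0)) (e (Suc (Suc 0))))" by (intro D' d1_intros)
    then have "\<exists>U'. z2 Z U' \<and> tree U' \<and> dense 1 16 U' \<and> (\<forall>n \<tau>. bt (U' n) \<tau> \<longrightarrow> bt (U n) \<tau>) \<and>
      (\<forall>w. \<exists>n. \<forall>\<tau>. bt (U' n) \<tau> \<longrightarrow> \<not> D a w n \<tau>)"
      by (rule avoid_step[of "D a", OF _ _ _ a(2) U]) (erule (1) anti incr)+
    then obtain U' where U': "z2 Z U'" "tree U'" "dense 1 16 U'" "\<forall>n \<tau>. bt (U' n) \<tau> \<longrightarrow> bt (U n) \<tau>"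
      "\<forall>w. \<exists>n. \<forall>\<tau>. bt (U' n) \<tau> \<longrightarrow> \<not> D a w n \<tau>" by blast
    have "\<exists>n\<ge>w. \<forall>\<tau>. bt (U' n) \<tau> \<longrightarrow> \<not> (\<exists>b<x. E a b w n \<tau>)" for w
    proof -
      obtain n where n: "\<forall>\<tau>. bt (U' n) \<tau> \<longrightarrow> \<not> D a w n \<tau>" using U'(5) by blast
      \<comment> \<open>A level of positive density has a node, so the clause \<open>n < w\<close>
        of \<open>D\<close> is ruled out.\<close>
      have "cnt (pw n) (bt (U' n)) \<noteq> 0" using U'(3) pw_pos[of n] unfolding dense_def by (metis mult_1 mult_zero_right parith_not_neg(3,4))
      then obtain \<tau> where "bt (U' n) \<tau>" using cnt_posD by blast
      then have "w \<le> n" using n unfolding D_def by auto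
      then show ?thesis using n unfolding D_def by blast
    qed
    then show ?thesis using U'(1-4) a(1) by blast
  next
    case False
    then have big: "\<exists>w. \<forall>n. 5 * pw n \<le> 8 * cnt (pw n) (D a w n)" if "a < x + x" for a
      using that unfolding not_less[symmetric] by blast
    \<comment> \<open>At stage \<open>w\<close> the event for \<open>a\<close> has density at least
      \<open>5/8\<close> on every level. If no \<open>a\<close> can be avoided, each
      \<open>a\<close> satisfies this at some stage, and exhaustion finds one stage \<open>t\<close>
      good for \<open>7/8\<close> of them.\<close>
    define P where "P a w \<longleftrightarrow> (\<forall>n. 5 * pw n \<le> 8 * cnt (pw n) (D a w n))" for a w
    have sP: "s1 Z (\<lambda>e. \<not> P (e 0) (e (Suc 0)))"
      unfolding P_def not_all by (intro s1_ex d1_s1 d1_intros d1f_pw d1f_cnt D')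
    define W where "W v \<longleftrightarrow> \<not> P (md v (x + x)) (dv v (x + x))" for v
    have sW: "s1 Z (\<lambda>e. W (e 0))" unfolding W_def by (intro s1_rel2[OF sP] d1f_md d1f_dv d1_intros)
    have x0: "0 < x + x" using x by (auto simp: add_nonneg_eq_0_iff)
    define C where "C w = mk (x + x) (\<lambda>a. \<not> bt (mk ((w + 1) * (x + x)) W) (w * (x + x) + a))" for w
    have C: "z2 Z C" unfolding C_def
      by (rule z2_code[OF sW, where \<beta>="\<lambda>w. (w + 1) * (x + x)" and G="\<lambda>w c. mk (x + x) (\<lambda>a. \<not> bt c (w * (x + x) + a))"])
        (intro d1_intros d1f_mk d1_bt)+
    have btC: "bt (C w) a \<longleftrightarrow> a < x + x \<and> P a w" for w a
    proof -
      have "cod (\<lambda>a. \<not> bt (mk ((w + 1) * (x + x)) W) (w * (x + x) + a))" by (rule d1_cod) (intro d1_intros d1_bt)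
      from bt_mk[OF this, of "x + x"] have "bt (C w) a \<longleftrightarrow> a < x + x \<and> \<not> bt (mk ((w + 1) * (x + x)) W) (w * (x + x) + a)"
        unfolding C_def .
      moreover have "w * (x + x) + a < (w + 1) * (x + x) \<and> md (w * (x + x) + a) (x + x) = a \<and> dv (w * (x + x) + a) (x + x) = w" if "a < x + x"
        using md_eqI[OF refl that] dv_eqI[OF refl that] that by (simp add: distrib_right)
      ultimately show ?thesis unfolding bt_mk[OF s1_cod[OF sW]] W_def by auto
    qed
    have mono': "bt (C t') v" if "bt (C t) v" "t \<le> t'" for t t' v
    proof -
      have v: "v < x + x" "P v t" using that(1) unfolding btC by auto
      have "P v t'" unfolding P_def
      proof
        fix n
        have "cnt (pw n) (D v t n) \<le> cnt (pw n) (D v t' n)" by (intro cnt_mono cD incr[OF that(2)])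
        then show "5 * pw n \<le> 8 * cnt (pw n) (D v t' n)"
          using v(2) unfolding P_def emb_simps by (meson mult_left_mono order_trans zero_le_numeral)
      qed
      then show ?thesis unfolding btC using v by blast
    qed
    define F where "F = mk (x + x) (\<lambda>_. True)"
    have btF: "bt F v \<longleftrightarrow> v < x + x" for v unfolding F_def using bt_mk[OF cod_const] by simp
    have "\<exists>t. bt (C t) v" if "v < x + x" "bt F v" for v using big[OF that(1)] that(1) unfolding btC P_def by blast
    from exhaustion[of C "x + x" F 3, OF C _ this] mono'
    obtain t where t: "2 ^ 3 * cnt (x + x) (\<lambda>v. bt F v \<and> \<not> bt (C t) v) \<le> cnt (x + x) (bt F)" by blast
    have "cnt (x + x) (bt F) = cnt (x + x) (\<lambda>_. True)" by (rule cnt_cong) (simp add: btF)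
    moreover have "cnt (x + x) (bt F) = cnt (x + x) (\<lambda>v. bt F v \<and> bt (C t) v) + cnt (x + x) (\<lambda>v. bt F v \<and> \<not> bt (C t) v)"
      by (rule cnt_split[OF cod_bt cod_bt])
    moreover have "cnt (x + x) (\<lambda>v. bt F v \<and> bt (C t) v) = cnt (x + x) (bt (C t))"
      by (rule cnt_cong) (simp add: btF)
    ultimately have low: "14 * x \<le> 8 * cnt (x + x) (bt (C t))" using t unfolding emb_simps by (simp add: emb_simps)
    \<comment> \<open>A value \<open>b\<close> together with a string \<open>\<tau>\<close> of
      length \<open>t\<close> is coded as \<open>b * pw t + \<tau>\<close>, so all events live in a
      set of size \<open>x * pw t\<close>.\<close>
    define H where "H a v \<longleftrightarrow> bt (C t) a \<and> E a (dv v (pw t)) t t (md v (pw t))" for a v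
    have cH: "cod (H a)" "cod (\<lambda>v. \<exists>a<i. H a v)" for a i
      unfolding H_def E_def by (rule d1_cod, intro d1_intros d1_bt G' d1f_md d1f_pw d1f_dv)+
    \<comment> \<open>Suppose two indices shared a point. The smaller of their two witnessing pairs
      would fail \<open>G\<close> at length \<open>t\<close>, while the other event demands
      \<open>G\<close> for it at a length \<open>s < t\<close>, and \<open>G\<close>
      persists.\<close>
    have disj: "a = a'" if "H a v" "H a' v" for a a' v
    proof -
      define b where "b = dv v (pw t)"
      define \<tau> where "\<tau> = md v (pw t)"
      have no: False if "a1 < x + x" "E a b t t \<tau>" and 1: "u1 < t" "\<not> G t \<tau> a1 b u1" and 2: "u2 < t" "s2 < t"
        "\<forall>a'<x + x. \<forall>u'\<le>u2. (u' < u2 \<or> a' < a2) \<and> a' \<noteq> a2 \<longrightarrow> G s2 (md \<tau> (pw s2)) a' b u'"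
        "u1 < u2 \<or> u1 = u2 \<and> a1 < a2" "a1 \<noteq> a2" for a1 a2 u1 u2 s2
      proof -
        have "G s2 (md \<tau> (pw s2)) a1 b u1" using 2 that(1) by auto
        then have "G t \<tau> a1 b u1" by (rule mono[OF less_imp_le[OF 2(2)]])
        then show False using 1 by blast
      qed
      have ea: "E a b t t \<tau>" "E a' b t t \<tau>" "a < x + x" "a' < x + x"
        using that unfolding H_def b_def \<tau>_def btC by auto
      obtain u s where us: "u < t" "s < t" "\<not> G t \<tau> a b u"
        "\<forall>a'<x + x. \<forall>u'\<le>u. (u' < u \<or> a' < a) \<and> a' \<noteq> a \<longrightarrow> G s (md \<tau> (pw s)) a' b u'" using ea(1) unfolding E_def by blast
      obtain u' s' where us': "u' < t" "s' < t" "\<not> G t \<tau> a' b u'"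
        "\<forall>a''<x + x. \<forall>u''\<le>u'. (u'' < u' \<or> a'' < a') \<and> a'' \<noteq> a' \<longrightarrow> G s' (md \<tau> (pw s')) a'' b u''" using ea(2) unfolding E_def by blast
      show ?thesis
      proof (rule ccontr)
        assume ne: "a \<noteq> a'"
        then consider "u < u' \<or> u = u' \<and> a < a'" | "u' < u \<or> u' = u \<and> a' < a" by (metis linorder_neqE)
        then show False
        proof cases
          case 1 show False by (rule no[OF ea(3,1) us(1,3) us'(1,2,4) 1 ne])
        next
          case 2 show False by (rule no[OF ea(4,1) us'(1,3) us(1,2,4) 2 ne[symmetric]])
        qed
      qed
    qed
    have "i \<le> x + x \<longrightarrow> 5 * pw t * cnt i (bt (C t)) \<le> 8 * cnt (x * pw t) (\<lambda>v. \<exists>a<i. H a v)" for i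
    proof (induction i rule: d1_induct)
      case 1 show ?case unfolding H_def E_def by (intro d1_intros d1f_pw d1f_cnt d1_bt G' d1f_md d1f_dv)
    next
      case (3 i)
      show ?case
      proof
        assume "i + 1 \<le> x + x"
        then have i: "i < x + x" "i \<le> x + x" by (auto simp: parith_Suc_le)
        have IH: "5 * pw t * cnt i (bt (C t)) \<le> 8 * cnt (x * pw t) (\<lambda>v. \<exists>a<i. H a v)" using 3 i by blast
        have "cnt (x * pw t) (\<lambda>v. \<exists>a<i + 1. H a v) = cnt (x * pw t) (\<lambda>v. (\<exists>a<i. H a v) \<or> H i v)"
          by (rule cnt_cong) (auto simp: parith_less_Suc le_less)
        also have "\<dots> = cnt (x * pw t) (\<lambda>v. \<exists>a<i. H a v) + cnt (x * pw t) (H i)"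
          by (rule cnt_disjoint[OF cH(2,1)]) (use disj in blast)
        finally have eq: "cnt (x * pw t) (\<lambda>v. \<exists>a<i + 1. H a v) = cnt (x * pw t) (\<lambda>v. \<exists>a<i. H a v) + cnt (x * pw t) (H i)" .
        show "5 * pw t * cnt (i + 1) (bt (C t)) \<le> 8 * cnt (x * pw t) (\<lambda>v. \<exists>a<i + 1. H a v)"
        proof (cases "bt (C t) i")
          case False
          then show ?thesis using IH unfolding eq unfolding cnt_Suc[OF cod_bt] unfolding emb_simps
            using emb_nonneg[of "cnt (x * pw t) (H i)"] by (simp add: emb_simps)
        next
          case True
          then have "5 * pw t \<le> 8 * cnt (pw t) (D i t t)" unfolding btC P_def by blast
          moreover have "cnt (pw t) (D i t t) \<le> cnt (x * pw t) (H i)"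
          proof (rule cnt_image[OF _ cH(1) cD])
            show "d1f Z (\<lambda>e. md (e 0) (pw t))" by (intro d1f_md d1_intros)
            fix \<tau> assume \<tau>: "\<tau> < pw t" "D i t t \<tau>"
            then obtain b where b: "b < x" "E i b t t \<tau>" unfolding D_def by auto
            have "(b + 1) * pw t \<le> x * pw t" using b(1) by (intro mult_right_mono) (simp_all add: parith_Suc_le)
            then have "b * pw t + \<tau> < x * pw t" using \<tau>(1) unfolding emb_simps by (simp add: algebra_simps)
            then show "\<exists>v<x * pw t. H i v \<and> md v (pw t) = \<tau>"
              using b(2) True md_eqI[OF refl \<tau>(1)] dv_eqI[OF refl \<tau>(1)] unfolding H_def
              by (intro exI[of _ "b * pw t + \<tau>"]) simp
          qed
          ultimately show ?thesis using IH True unfolding eq unfolding cnt_Suc[OF cod_bt] unfolding emb_simps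
            by (simp add: emb_simps algebra_simps)
        qed
      qed
    qed simp
    from this[of "x + x"] have "5 * pw t * cnt (x + x) (bt (C t)) \<le> 8 * cnt (x * pw t) (\<lambda>v. \<exists>a<x + x. H a v)" by blast
    also have "\<dots> \<le> 8 * (x * pw t)" by (intro mult_left_mono cnt_le cH) simp
    finally have "pw t * (5 * cnt (x + x) (bt (C t))) \<le> pw t * (8 * x)" by (simp add: ac_simps)
    then have "5 * cnt (x + x) (bt (C t)) \<le> 8 * x" using pw_pos[of t] by (rule mult_left_le_imp_le)
    \<comment> \<open>At least \<open>7/4 * x\<close> disjoint events of measure \<open>5/8\<close>
      would need more than the available \<open>x\<close>.\<close>
    then have False using low x unfolding emb_simps by (simp add: emb_simps)
    then show ?thesis ..
  qed
qed

end

section \<open>Formulas and definability\<close>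

instance trm :: countable by countable_datatype
instance fm :: countable by countable_datatype

text \<open>Odd variables carry an enumeration of the model, so that elements of the model may be
used as parameters without any bookkeeping.\<close>

definition gd :: "(nat \<Rightarrow> 'a::parith) \<Rightarrow> bool" where
  "gd e \<longleftrightarrow> (\<forall>i. e (2 * i + 1) = from_nat i)"

text \<open>A predicate in \<open>d0\<close> is a function of infinitely many arguments; finite
  dependence is what supplies a fresh variable for a bounded quantifier in
  \<open>d0_formula\<close>.\<close>

definition depends_below :: "((nat \<Rightarrow> 'a) \<Rightarrow> 'b) \<Rightarrow> nat \<Rightarrow> bool" where
  "depends_below f N \<longleftrightarrow> (\<forall>e e'. (\<forall>i<N. e i = e' i) \<longrightarrow> f e = f e')"

lemma depends_belowD: "depends_below f N \<Longrightarrow> (\<And>i. i < N \<Longrightarrow> e i = e' i) \<Longrightarrow> f e = f e'"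
  unfolding depends_below_def by blast

lemma depends_below2:
  assumes "depends_below f N" "depends_below g M" shows "depends_below (\<lambda>e. h (f e) (g e)) (max N M)"
  unfolding depends_below_def
proof (intro allI impI)
  fix e e' :: "nat \<Rightarrow> 'a" assume *: "\<forall>i<max N M. e i = e' i"
  have "f e = f e'" by (rule depends_belowD[OF assms(1)]) (use * in auto)
  moreover have "g e = g e'" by (rule depends_belowD[OF assms(2)]) (use * in auto)
  ultimately show "h (f e) (g e) = h (f e') (g e')" by simp
qed

lemma tm_depends: "tm t \<Longrightarrow> \<exists>N. depends_below t N"
proof (induction rule: tm.induct)
  case (tm_var i)
  show ?case by (rule exI[of _ "Suc i"]) (simp add: depends_below_def)
next
  case (tm_const c)
  show ?case by (rule exI[of _ 0]) (simp add: depends_below_def)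
next
  case (tm_add s t)
  then obtain N M where "depends_below s N" "depends_below t M" by blast
  from depends_below2[OF this, of "(+)"] show ?case by blast
next
  case (tm_mult s t)
  then obtain N M where "depends_below s N" "depends_below t M" by blast
  from depends_below2[OF this, of "(*)"] show ?case by blast
qed

lemma d0_depends: "d0 Z P \<Longrightarrow> \<exists>N. depends_below P N"
proof (induction rule: d0.induct)
  case (d0_eq s t)
  then obtain N M where "depends_below s N" "depends_below t M" using tm_depends by blast
  from depends_below2[OF this, of "(=)"] show ?case by blast
next
  case (d0_less s t)
  then obtain N M where "depends_below s N" "depends_below t M" using tm_depends by blast
  from depends_below2[OF this, of "(<)"] show ?case by blast
next
  case (d0_mem t)
  then obtain N where "depends_below t N" using tm_depends by blast
  from depends_below2[OF this this, of "\<lambda>x y. x \<in> Z"] show ?case by blast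
next
  case (d0_neg P)
  then obtain N where "depends_below P N" by blast
  from depends_below2[OF this this, of "\<lambda>x y. \<not> x"] show ?case by blast
next
  case (d0_conj P Q)
  then obtain N M where "depends_below P N" "depends_below Q M" by blast
  from depends_below2[OF this, of "(\<and>)"] show ?case by blast
next
  case (d0_bex0 t P)
  then obtain N M where N: "depends_below t N" and M: "depends_below P M" using tm_depends by blast
  have "depends_below (\<lambda>e a. P (case_nat a e)) M"
    unfolding depends_below_def
  proof (intro allI impI ext)
    fix e e' :: "nat \<Rightarrow> 'a" and a assume *: "\<forall>i<M. e i = e' i"
    show "P (case_nat a e) = P (case_nat a e')"
      by (rule depends_belowD[OF M]) (use * in \<open>auto split: nat.split\<close>)
  qed
  from depends_below2[OF N this, of "\<lambda>x Q. \<exists>a<x. Q a"] show ?case by blast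
qed

lemma tm_trm:
  "tm t \<Longrightarrow> (\<And>i. even (g i)) \<Longrightarrow> \<exists>u. \<forall>e. gd e \<longrightarrow> ev SM e u = t (\<lambda>i. e (g i))"
proof (induction rule: tm.induct)
  case (tm_var i)
  show ?case by (rule exI[of _ "Var (g i)"]) simp
next
  case (tm_const c)
  obtain k :: nat where "from_nat k = c" by (metis from_nat_to_nat)
  then show ?case by (intro exI[of _ "Var (2 * k + 1)"]) (auto simp: gd_def)
next
  case (tm_add s t)
  then obtain u v where "\<forall>e. gd e \<longrightarrow> ev SM e u = s (\<lambda>i. e (g i))" "\<forall>e. gd e \<longrightarrow> ev SM e v = t (\<lambda>i. e (g i))" by blast
  then show ?case by (intro exI[of _ "Plus u v"]) simp
next
  case (tm_mult s t)
  then obtain u v where "\<forall>e. gd e \<longrightarrow> ev SM e u = s (\<lambda>i. e (g i))" "\<forall>e. gd e \<longrightarrow> ev SM e v = t (\<lambda>i. e (g i))" by blast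
  then show ?case by (intro exI[of _ "Times u v"]) simp
qed

text \<open>De Bruijn indices are sent to even variables, since the odd ones hold the parameters.
  The renaming \<open>g\<close> is kept general because a quantifier changes it to
  \<open>case_nat k g\<close>.\<close>

lemma d0_formula:
  "d0 Z P \<Longrightarrow> (\<And>i. even (g i)) \<Longrightarrow> \<exists>\<phi>. bounded \<phi> \<and> (\<forall>e. gd e \<longrightarrow> sat SM (\<lambda>_. Z) e \<phi> = P (\<lambda>i. e (g i)))"
proof (induction arbitrary: g rule: d0.induct)
  case (d0_eq s t)
  obtain u v where "\<forall>e. gd e \<longrightarrow> ev SM e u = s (\<lambda>i. e (g i))" "\<forall>e. gd e \<longrightarrow> ev SM e v = t (\<lambda>i. e (g i))"
    using tm_trm[where g=g, OF d0_eq(1,3)] tm_trm[where g=g, OF d0_eq(2,3)] by blast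
  then show ?case by (intro exI[of _ "Eq u v"]) simp
next
  case (d0_less s t)
  obtain u v where "\<forall>e. gd e \<longrightarrow> ev SM e u = s (\<lambda>i. e (g i))" "\<forall>e. gd e \<longrightarrow> ev SM e v = t (\<lambda>i. e (g i))"
    using tm_trm[where g=g, OF d0_less(1,3)] tm_trm[where g=g, OF d0_less(2,3)] by blast
  then show ?case by (intro exI[of _ "Less u v"]) simp
next
  case (d0_mem t)
  obtain u where "\<forall>e. gd e \<longrightarrow> ev SM e u = t (\<lambda>i. e (g i))" using tm_trm[where g=g, OF d0_mem(1,2)] by blast
  then show ?case by (intro exI[of _ "Mem u 0"]) simp
next
  case (d0_neg P)
  obtain \<phi> where "bounded \<phi>" "\<forall>e. gd e \<longrightarrow> sat SM (\<lambda>_. Z) e \<phi> = P (\<lambda>i. e (g i))" using d0_neg.IH[of g, OF d0_neg.prems] by blast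
  then show ?case by (intro exI[of _ "Neg \<phi>"]) simp
next
  case (d0_conj P Q)
  obtain \<phi> where \<phi>: "bounded \<phi>" "\<forall>e. gd e \<longrightarrow> sat SM (\<lambda>_. Z) e \<phi> = P (\<lambda>i. e (g i))" using d0_conj.IH(1)[of g, OF d0_conj.prems] by blast
  obtain \<psi> where \<psi>: "bounded \<psi>" "\<forall>e. gd e \<longrightarrow> sat SM (\<lambda>_. Z) e \<psi> = Q (\<lambda>i. e (g i))" using d0_conj.IH(2)[of g, OF d0_conj.prems] by blast
  show ?case using \<phi> \<psi> by (intro exI[of _ "Conj \<phi> \<psi>"]) simp
next
  case (d0_bex0 t P)
  obtain u where u: "\<And>e. gd e \<Longrightarrow> ev SM e u = t (\<lambda>i. e (g i))" using tm_trm[where g=g, OF d0_bex0(1,4)] by blast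
  obtain N where N: "depends_below P N" using d0_depends[OF d0_bex0(2)] by blast
  \<comment> \<open>Even, and larger than every variable \<open>g i\<close> with
    \<open>i < N\<close>.\<close>
  define k where "k = 2 * ((\<Sum>i<N. g i) + 1)"
  have k: "g i \<noteq> k" if "i < N" for i
    using member_le_sum[of i "{..<N}" g] that unfolding k_def by auto
  have ev: "even k" unfolding k_def by simp
  have "\<And>i. even (case_nat k g i)" using ev d0_bex0(4) by (auto split: nat.split)
  from d0_bex0.IH[of "case_nat k g", OF this] obtain \<phi> where \<phi>: "bounded \<phi>"
    "\<And>e. gd e \<Longrightarrow> sat SM (\<lambda>_. Z) e \<phi> = P (\<lambda>i. e (case_nat k g i))" by blast
  have "sat SM (\<lambda>_. Z) e (BEx k u \<phi>) = (\<exists>a<t (\<lambda>i. e (g i)). P (case_nat a (\<lambda>i. e (g i))))" if "gd e" for e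
  proof -
    have "gd (e(k := a))" for a using that ev unfolding gd_def by (auto simp: k_def) presburger
    then have "sat SM (\<lambda>_. Z) (e(k := a)) \<phi> = P (case_nat a (\<lambda>i. e (g i)))" for a
    proof (subst \<phi>(2), assumption, intro depends_belowD[OF N])
      fix i assume "i < N"
      then show "(e(k := a)) (case i of 0 \<Rightarrow> k | Suc j \<Rightarrow> g j) = (case i of 0 \<Rightarrow> a | Suc i \<Rightarrow> e (g i))"
        using k by (auto split: nat.split)
    qed
    then show ?thesis using u[OF that] by simp
  qed
  then show ?case using \<phi>(1) by (intro exI[of _ "BEx k u \<phi>"]) simp
qed

text \<open>Four working slots among the even variables: \<open>y\<close> for the innermost
  quantifier, the others for an outer quantifier and for arguments. The odd variables enumerate the
  model, as \<open>gd\<close> requires.\<close>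

definition env4 :: "'a::parith \<Rightarrow> 'a \<Rightarrow> 'a \<Rightarrow> 'a \<Rightarrow> nat \<Rightarrow> 'a" where
  "env4 y c a b = (\<lambda>j. if odd j then from_nat (j div 2) else if j = 0 then y else if j = 2 then c
     else if j = 4 then a else if j = 6 then b else 0)"

lemma gd_env4 [simp]: "gd (env4 y c a b)" by (simp add: gd_def env4_def)

lemma env4_upd: "(env4 y c a b)(0 := y') = env4 y' c a b" "(env4 y c a b)(2 := c') = env4 y c' a b"
  "(env4 y c a b)(4 := a') = env4 y c a' b" "(env4 y c a b)(6 := b') = env4 y c a b'"
  by (auto simp: env4_def)

lemma d0_formula4:
  assumes "d0 Z Q"
  shows "\<exists>\<phi>. bounded \<phi> \<and> (\<forall>y c a b. sat SM (\<lambda>_. Z) (env4 y c a b) \<phi> =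
     Q (case_nat y (case_nat c (case_nat a (case_nat b (\<lambda>_. 0))))))"
proof -
  obtain \<phi> where \<phi>: "bounded \<phi>" "\<And>e. gd e \<Longrightarrow> sat SM (\<lambda>_. Z) e \<phi> = Q (\<lambda>i. e (2 * i))"
    using d0_formula[OF assms, of "\<lambda>i. 2 * i"] by auto
  have "(\<lambda>i. env4 y c a b (2 * i)) = case_nat y (case_nat c (case_nat a (case_nat b (\<lambda>_. 0))))" for y c a b :: 'a
    by (rule ext) (auto simp: env4_def split: nat.split)
  then show ?thesis using \<phi> by (intro exI[of _ \<phi>]) simp
qed

section \<open>Induction and the pigeonhole principle for single members of the model\<close>

lemma ind1I:
  assumes "sigma1_induction SM S" "Z \<in> S" shows "ind1 Z"
proof
  fix P :: "'a \<Rightarrow> bool" and n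
  assume s: "s1 Z (\<lambda>e. P (e 0))" and 0: "P 0" and step: "\<And>n. P n \<Longrightarrow> P (n + 1)"
  obtain Q where Q: "d0 Z Q" "(\<lambda>e. P (e 0)) = (\<lambda>e. \<exists>a. Q (case_nat a e))" using s by (rule s1E)
  obtain \<phi> where \<phi>: "bounded \<phi>" "\<And>y c a b. sat SM (\<lambda>_. Z) (env4 y c a b) \<phi> =
     Q (case_nat y (case_nat c (case_nat a (case_nat b (\<lambda>_. 0)))))" using d0_formula4[OF Q(1)] by blast
  have sat: "sat SM (\<lambda>_. Z) ((env4 0 0 0 0)(2 := n)) (Ex 0 \<phi>) = P n" for n
    using fun_cong[OF Q(2), of "case_nat n (case_nat 0 (case_nat 0 (\<lambda>_. 0)))"] \<phi>(2) by (simp add: env4_upd)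
  have "Sigma 1 (Ex 0 \<phi>)" unfolding One_nat_def by (intro SigmaEx SigmaPi Pi0 \<phi>)
  with assms(1)[unfolded sigma1_induction_def, rule_format, of "Ex 0 \<phi>" "\<lambda>_. Z" "env4 0 0 0 0" 2 n] assms(2)
  show "P n" unfolding sat SM_simps using 0 step by blast
qed

lemma (in ind1) wphpI:
  assumes "wphp2 SM S" "Z \<in> S" shows "wphp Z"
proof
  fix R :: "'a \<Rightarrow> 'a \<Rightarrow> bool" and x
  assume R: "s2 Z (\<lambda>e. R (e 0) (e (Suc 0)))" and x: "1 \<le> x" and tot: "\<And>a. a < x + x \<Longrightarrow> \<exists>b<x. R a b"
    and sv: "\<And>a b b'. a < x + x \<Longrightarrow> R a b \<Longrightarrow> R a b' \<Longrightarrow> b = b'"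
    and inj: "\<And>a a' b. a < x + x \<Longrightarrow> a' < x + x \<Longrightarrow> R a b \<Longrightarrow> R a' b \<Longrightarrow> a = a'"
  obtain Q1 where Q1: "s1 Z Q1" "(\<lambda>e. R (e 0) (e (Suc 0))) = (\<lambda>e. \<exists>a. \<not> Q1 (case_nat a e))" using R by (rule s2E)
  obtain Q where Q: "d0 Z Q" "Q1 = (\<lambda>e. \<exists>a. Q (case_nat a e))" using Q1(1) by (rule s1E)
  obtain \<phi> where \<phi>: "bounded \<phi>" "\<And>y c a b. sat SM (\<lambda>_. Z) (env4 y c a b) \<phi> =
     Q (case_nat y (case_nat c (case_nat a (case_nat b (\<lambda>_. 0)))))" using d0_formula4[OF Q(1)] by blast
  let ?f = "Ex 2 (All 0 (Neg \<phi>))"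
  have sat: "sat SM (\<lambda>_. Z) ((env4 0 0 0 0)(4 := a, 6 := b)) ?f = R a b" for a b
    using fun_cong[OF Q1(2), of "case_nat a (case_nat b (\<lambda>_. 0))"] \<phi>(2) Q(2) by (simp add: env4_upd)
  have "Pi 1 (All 0 (Neg \<phi>))" unfolding One_nat_def by (rule PiAll, rule PiSigma, rule Sigma0) (simp add: \<phi>(1))
  then have "Pi (Suc 0) (All 0 (Neg \<phi>))" by simp
  then have "Sigma 2 ?f" unfolding numeral_2_eq_2 by (intro SigmaEx SigmaPi)
  moreover have "le SM (sone SM) x" using x unfolding le_def by auto
  ultimately have "\<exists>\<phi> V e i j x. Sigma 2 \<phi> \<and> i \<noteq> j \<and> (\<forall>k. V k \<in> S) \<and> le SM (sone SM) x \<and>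
          (let R = (\<lambda>a b. sat SM V (e(i := a, j := b)) \<phi>); x2 = sadd SM x x in
            (\<forall>a. sless SM a x2 \<longrightarrow> (\<exists>b. sless SM b x \<and> R a b)) \<and>
            (\<forall>a b b'. sless SM a x2 \<longrightarrow> R a b \<longrightarrow> R a b' \<longrightarrow> b = b') \<and>
            (\<forall>a a' b. sless SM a x2 \<longrightarrow> sless SM a' x2 \<longrightarrow> R a b \<longrightarrow> R a' b \<longrightarrow> a = a'))"
    using assms(2) tot sv inj
    by (intro exI[of _ ?f] exI[of _ "\<lambda>_. Z"] exI[of _ "env4 0 0 0 0"] exI[of _ 4] exI[of _ 6] exI[of _ x])
      (simp only: sat Let_def SM_simps, auto)
  then show False using assms(1) unfolding wphp2_def by blast
qed

text \<open>A workable form of \<open>turing_le\<close>: by \<open>turing_rec\<close> and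
  \<open>rec_turing\<close> the two agree for oracles with induction.\<close>

definition rec :: "'a::parith set \<Rightarrow> 'a set \<Rightarrow> bool" where
  "rec Y V \<longleftrightarrow> d1 Y (\<lambda>e. e 0 \<in> V)"

context ind1
begin

lemma d1_rec: "rec Z V \<Longrightarrow> d1f Z f \<Longrightarrow> d1 Z (\<lambda>e. f e \<in> V)"
  unfolding rec_def by (rule d1_rel1[of Z "\<lambda>a. a \<in> V"])

lemma rec_refl: "rec Z Z" unfolding rec_def by (intro d1_intros)
lemma rec_empty: "rec Z {}" unfolding rec_def using d1_c[of Z False] by simp

text \<open>Replacing an oracle by a Delta_1 definition leaves bounded quantifiers over a Delta_1
  matrix; that this stays Delta_1 is an effect of collection.\<close>

lemma d0_rec_d1: "d0 Z' P \<Longrightarrow> rec Z Z' \<Longrightarrow> d1 Z P"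
proof (induction rule: d0.induct)
  case (d0_bex0 t P)
  then show ?case by (intro d1_bex d1f_tm) (simp_all add: case_nat_shift)
qed (auto intro!: d1_intros d1f_tm d1_rec)

lemma s1_rec_s1: assumes "s1 Z' P" "rec Z Z'" shows "s1 Z P"
proof -
  obtain Q where Q: "d0 Z' Q" "P = (\<lambda>e. \<exists>a. Q (case_nat a e))" using assms(1) by (rule s1E)
  show ?thesis unfolding Q(2)
    by (intro s1_ex) (simp add: case_nat_shift d1_s1[OF d0_rec_d1[OF Q(1) assms(2)]])
qed

lemma s2_rec_s2: assumes "s2 Z' P" "rec Z Z'" shows "s2 Z P"
proof -
  obtain Q where Q: "s1 Z' Q" "P = (\<lambda>e. \<exists>a. \<not> Q (case_nat a e))" using assms(1) by (rule s2E)
  show ?thesis unfolding Q(2)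
    by (intro s2I) (simp add: case_nat_shift s1_rec_s1[OF Q(1) assms(2)])
qed

lemma d1_rec_d1: "d1 Z' P \<Longrightarrow> rec Z Z' \<Longrightarrow> d1 Z P"
  unfolding d1_def using s1_rec_s1[of Z' P] s1_rec_s1[of Z' "\<lambda>e. \<not> P e"] by simp

lemma rec_trans: "rec Z Z' \<Longrightarrow> rec Z' V \<Longrightarrow> rec Z V"
  unfolding rec_def[of _ V] using d1_rec_d1 by blast

lemma z2_rec_z2: "z2 Z' f \<Longrightarrow> rec Z Z' \<Longrightarrow> z2 Z f"
  unfolding z2_def d1f_def using s2_rec_s2 s1_rec_s1 by blast

end

lemma tm_ev: "tm (\<lambda>e. ev SM e t)"
  by (induction t) (auto intro: tm.intros)

lemma tm_upd_shift: "tm (\<lambda>e. ((\<lambda>i. e (Suc i))(x := e 0)) i)"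
  by (cases "i = x") (auto intro: tm.intros)

context ind1
begin

lemma sat_bounded_d1:
  "bounded \<phi> \<Longrightarrow> (\<And>i. rec Z (V i)) \<Longrightarrow> d1 Z (\<lambda>e. sat SM V e \<phi>)"
proof (induction \<phi>)
  case (BEx x t \<phi>)
  then have "d1 Z (\<lambda>e. sat SM V e \<phi>)" by simp
  from d1_subst[OF this, of "\<lambda>e. (\<lambda>i. e (Suc i))(x := e 0)", OF tm_upd_shift]
  show ?case using d1_bex[OF d1f_tm[OF tm_ev[of t]]] by simp
next
  case (BAll x t \<phi>)
  then have "d1 Z (\<lambda>e. sat SM V e \<phi>)" by simp
  from d1_subst[OF this, of "\<lambda>e. (\<lambda>i. e (Suc i))(x := e 0)", OF tm_upd_shift]
  show ?case using d1_ball[OF d1f_tm[OF tm_ev[of t]]] by simp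
qed (auto intro!: d1_eq d1_less d1_rec d1_neg d1_conj d1_disj d1_imp d1f_tm tm_ev)

lemma sat_Sigma_Pi:
  assumes "\<And>i. rec Z (V i)"
  shows "Sigma n \<phi> \<Longrightarrow> (n = 0 \<longrightarrow> bounded \<phi>) \<and> (n = 1 \<longrightarrow> s1 Z (\<lambda>e. sat SM V e \<phi>)) \<and> (n = 2 \<longrightarrow> s2 Z (\<lambda>e. sat SM V e \<phi>))"
    "Pi n \<phi> \<Longrightarrow> (n = 0 \<longrightarrow> bounded \<phi>) \<and> (n = 1 \<longrightarrow> s1 Z (\<lambda>e. \<not> sat SM V e \<phi>)) \<and> (n = 2 \<longrightarrow> s2 Z (\<lambda>e. \<not> sat SM V e \<phi>))"
proof (induction rule: Sigma_Pi.inducts)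
  case (SigmaPi n \<phi>)
  then show ?case
    using d1_s1[OF sat_bounded_d1[OF _ assms]] s2_p1[of Z "\<lambda>e. sat SM V e \<phi>"] by auto
next
  case (PiSigma n \<phi>)
  then show ?case
    using d1_s1_neg[OF sat_bounded_d1[OF _ assms]] s2_p1[of Z "\<lambda>e. \<not> sat SM V e \<phi>"] by auto
next
  case (SigmaEx n \<phi> x)
  have 1: "s1 Z (\<lambda>e. sat SM V e (Ex x \<phi>))" if "s1 Z (\<lambda>e. sat SM V e \<phi>)"
    using s1_ex[where P="\<lambda>e a. sat SM V (e(x := a)) \<phi>"] s1_subst[OF that, of "\<lambda>e. (\<lambda>i. e (Suc i))(x := e 0)", OF tm_upd_shift] by simp
  have 2: "s2 Z (\<lambda>e. sat SM V e (Ex x \<phi>))" if "s2 Z (\<lambda>e. sat SM V e \<phi>)"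
    using s2_ex[where P="\<lambda>e a. sat SM V (e(x := a)) \<phi>"] s2_subst[OF that, of "\<lambda>e. (\<lambda>i. e (Suc i))(x := e 0)", OF tm_upd_shift] by simp
  show ?case using SigmaEx 1 2 by auto
next
  case (PiAll n \<phi> x)
  have 1: "s1 Z (\<lambda>e. \<not> sat SM V e (All x \<phi>))" if "s1 Z (\<lambda>e. \<not> sat SM V e \<phi>)"
    using s1_ex[where P="\<lambda>e a. \<not> sat SM V (e(x := a)) \<phi>"] s1_subst[OF that, of "\<lambda>e. (\<lambda>i. e (Suc i))(x := e 0)", OF tm_upd_shift] by simp
  have 2: "s2 Z (\<lambda>e. \<not> sat SM V e (All x \<phi>))" if "s2 Z (\<lambda>e. \<not> sat SM V e \<phi>)"
    using s2_ex[where P="\<lambda>e a. \<not> sat SM V (e(x := a)) \<phi>"] s2_subst[OF that, of "\<lambda>e. (\<lambda>i. e (Suc i))(x := e 0)", OF tm_upd_shift] by simp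
  show ?case using PiAll 1 2 by auto
qed auto

lemma sat_Sigma1: "Sigma 1 \<phi> \<Longrightarrow> (\<And>i. rec Z (V i)) \<Longrightarrow> s1 Z (\<lambda>e. sat SM V e \<phi>)"
  and sat_Pi1: "Pi 1 \<phi> \<Longrightarrow> (\<And>i. rec Z (V i)) \<Longrightarrow> s1 Z (\<lambda>e. \<not> sat SM V e \<phi>)"
  and sat_Sigma2: "Sigma 2 \<phi> \<Longrightarrow> (\<And>i. rec Z (V i)) \<Longrightarrow> s2 Z (\<lambda>e. sat SM V e \<phi>)"
  and sat_Pi2: "Pi 2 \<phi> \<Longrightarrow> (\<And>i. rec Z (V i)) \<Longrightarrow> s2 Z (\<lambda>e. \<not> sat SM V e \<phi>)"
  using sat_Sigma_Pi by blast+

section \<open>The coding notions of the statement in terms of \<open>bf\<close>, \<open>pw\<close>,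
  \<open>bt\<close> and \<open>cn\<close>\<close>

lemma beta_iff: "beta SM a b i r \<longleftrightarrow> r = bf a b (i::'a)"
proof -
  have m: "0 < 1 + (i + 1) * b" by (simp add: add_nonneg_eq_0_iff)
  have "beta SM a b i r \<longleftrightarrow> r < 1 + (i + 1) * b \<and> (\<exists>q. a = q * (1 + (i + 1) * b) + r)"
    unfolding beta_def Let_def by simp
  moreover have "\<dots> \<longleftrightarrow> r = md a (1 + (i + 1) * b)"
    using dvmd[OF m, of a] md_eqI[of a _ "1 + (i + 1) * b" r] by metis
  ultimately show ?thesis unfolding bf_def by simp
qed

lemma prec_iff:
  fixes n :: 'a
  assumes "d1f Z (\<lambda>e. G (e 0) (e (Suc 0)))"
  shows "(\<exists>a b. bf a b 0 = z \<and> (\<forall>i<n. bf a b (i + 1) = G i (bf a b i)) \<and> y = bf a b n) \<longleftrightarrow> y = prec z G n"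
proof
  show "y = prec z G n" if "\<exists>a b. bf a b 0 = z \<and> (\<forall>i<n. bf a b (i + 1) = G i (bf a b i)) \<and> y = bf a b n"
    using that prec_eqI[of _ _ z n G] by auto
  assume y: "y = prec z G n"
  obtain a b where ab: "bf a b 0 = z" "\<forall>i<n. bf a b (i + 1) = G i (bf a b i)" using prec_ex[OF assms] by blast
  show "\<exists>a b. bf a b 0 = z \<and> (\<forall>i<n. bf a b (i + 1) = G i (bf a b i)) \<and> y = bf a b n"
    unfolding y prec_eqI[where G=G, OF ab] using ab by blast
qed

lemma pow2_iff: "pow2 SM v y \<longleftrightarrow> y = pw (v::'a)"
proof -
  have d: "d1f Z (\<lambda>e. e (Suc 0) + e (Suc 0))" by (intro d1_intros)
  have "pow2 SM v y \<longleftrightarrow> (\<exists>a b. 1 = bf a b 0 \<and> (\<forall>i<v. bf a b i + bf a b i = bf a b (i + 1)) \<and> y = bf a b v)"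
    unfolding pow2_def beta_iff by simp
  then have "pow2 SM v y \<longleftrightarrow> (\<exists>a b. bf a b 0 = 1 \<and> (\<forall>i<v. bf a b (i + 1) = bf a b i + bf a b i) \<and> y = bf a b v)"
    unfolding eq_commute[of 1] eq_commute[of "bf _ _ _ + bf _ _ _"] .
  then show ?thesis using prec_iff[where G="\<lambda>i r. r + r", OF d] unfolding pw_def by simp
qed

lemma bit_iff: "bit SM c v \<longleftrightarrow> bt c (v::'a)"
proof -
  have "bit SM c v \<longleftrightarrow> (\<exists>q r. c = q * pw v + r \<and> r < pw v \<and> od q)"
    unfolding bit_def pow2_iff od_def by auto
  then show ?thesis unfolding bt_def using dvmd[OF pw_pos, of c v] dv_eqI[of c _ "pw v"] by metis
qed

lemma mcard_iff: "mcard SM c k \<longleftrightarrow> k = cn c (c::'a)"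
proof -
  let ?G = "\<lambda>i r. if bt c i then r + 1 else r"
  have d: "d1f Z (\<lambda>e. ?G (e 0) (e (Suc 0)))" by (intro d1_intros d1_bt)
  have "mcard SM c k \<longleftrightarrow> (\<exists>a b. 0 = bf a b 0 \<and> (\<forall>i<c. ?G i (bf a b i) = bf a b (i + 1)) \<and> k = bf a b c)"
    unfolding mcard_def beta_iff bit_iff by simp
  then have "mcard SM c k \<longleftrightarrow> (\<exists>a b. bf a b 0 = 0 \<and> (\<forall>i<c. bf a b (i + 1) = ?G i (bf a b i)) \<and> k = bf a b c)"
    unfolding eq_commute[of 0] eq_commute[of "If _ _ _"] .
  then show ?thesis using prec_iff[where G="?G", OF d] unfolding cn_def by simp
qed

lemma strlen_iff: "strlen SM s n \<longleftrightarrow> pw n \<le> s \<and> s < pw n + pw (n::'a)"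
  unfolding strlen_def pow2_iff le_def by auto

lemma strlen_string: "\<tau> < pw n \<Longrightarrow> strlen SM (pw n + \<tau>) (n::'a)"
  unfolding strlen_iff by simp

lemma strlenE: fixes n :: 'a assumes "strlen SM s n" obtains \<tau> where "\<tau> < pw n" "s = pw n + \<tau>"
proof -
  have *: "pw n \<le> s" "s < pw n + pw n" using assms unfolding strlen_iff by auto
  obtain \<tau> where \<tau>: "s = pw n + \<tau>" using parith_le_ex[OF *(1)] by blast
  show thesis by (rule that[OF _ \<tau>]) (use * \<tau> in simp)
qed

lemma bt_string: "\<tau> < pw n \<Longrightarrow> i < n \<Longrightarrow> bt (pw n + \<tau>) i \<longleftrightarrow> bt \<tau> (i::'a)"
  using bt_split[of \<tau> n 1 i] by simp

lemma prefix_string: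
  assumes "\<tau> < pw n" "m \<le> n" shows "prefix_of SM (pw m + md \<tau> (pw m)) (pw n + (\<tau>::'a))"
  unfolding prefix_of_def
proof (intro exI conjI)
  show "strlen SM (pw m + md \<tau> (pw m)) m" "strlen SM (pw n + \<tau>) n" by (intro strlen_string assms md_pw_less)+
  show "le SM m n" using assms(2) unfolding le_def by auto
  show "\<forall>i. sless SM i m \<longrightarrow> bit SM (pw m + md \<tau> (pw m)) i = bit SM (pw n + \<tau>) i"
    using assms bt_string[of "md \<tau> (pw m)" m] bt_string[OF assms(1)] by (auto simp: bit_iff bt_md dest: less_le_trans)
qed

lemma restr_code_iff: "restr_code SM V n c \<longleftrightarrow> (\<forall>v. bt c v \<longleftrightarrow> v < n \<and> v \<in> (V::'a set))"
  unfolding restr_code_def bit_iff by simp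

text \<open>Membership of \<open>v\<close> is read off a code of \<open>V\<close> restricted to
  \<open>v + 1\<close>. Such a code exists and its digits are determined, so both answers are
  Sigma_1.\<close>

lemma turing_rec:
  assumes "turing_le SM V W" "rec Z W" shows "rec Z V"
proof -
  obtain \<phi> e x y where \<phi>: "\<And>n. \<exists>c. restr_code SM V n c" "x \<noteq> y" "Sigma 1 \<phi>"
    "\<And>n c. sat SM (\<lambda>_. W) (e(x := n, y := c)) \<phi> \<longleftrightarrow> restr_code SM V n c"
    using assms(1) unfolding turing_le_def by blast
  have s: "s1 Z (\<lambda>e. sat SM (\<lambda>_. W) e \<phi>)" by (rule sat_Sigma1[OF \<phi>(3) assms(2)])
  have "tm (\<lambda>e'. (e(x := e' 0, y := e' (Suc 0))) i)" for i by (cases "i = y"; cases "i = x") (auto intro: tm.intros)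
  from s1_subst[OF s, of "\<lambda>e'. e(x := e' 0, y := e' (Suc 0))", OF this]
  have r: "s1 Z (\<lambda>e. restr_code SM V (e 0) (e (Suc 0)))" unfolding \<phi>(4) .
  have b: "bt c v \<longleftrightarrow> v \<in> V" if "restr_code SM V (v + 1) c" for c v
    using that less_add_one[of v] unfolding restr_code_iff by blast
  have "v \<in> V \<longleftrightarrow> (\<exists>c. restr_code SM V (v + 1) c \<and> bt c v)" for v
    using \<phi>(1)[of "v + 1"] b by blast
  moreover have "v \<notin> V \<longleftrightarrow> (\<exists>c. restr_code SM V (v + 1) c \<and> \<not> bt c v)" for v
    using \<phi>(1)[of "v + 1"] b by blast
  moreover have "s1 Z (\<lambda>e. \<exists>c. restr_code SM V (e 0 + 1) c \<and> bt c (e 0))"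
    by (intro s1_ex s1_conj s1_rel2[OF r] d1_intros; intro d1_s1 d1_bt d1_intros)
  moreover have "s1 Z (\<lambda>e. \<exists>c. restr_code SM V (e 0 + 1) c \<and> \<not> bt c (e 0))"
    by (intro s1_ex s1_conj s1_rel2[OF r] d1_intros; intro d1_s1 d1_neg d1_bt d1_intros)
  ultimately show ?thesis unfolding rec_def d1_def by simp
qed

lemma s1_formula2:
  assumes "s1 Z (\<lambda>e. R (e 0) (e (Suc 0)))"
  shows "\<exists>\<phi>. bounded \<phi> \<and> (\<forall>a b. sat SM (\<lambda>_. Z) ((env4 0 0 0 0)(2 := a, 4 := b)) (Ex 0 \<phi>) \<longleftrightarrow> R a b)"
proof -
  obtain Q where Q: "d0 Z Q" "(\<lambda>e. R (e 0) (e (Suc 0))) = (\<lambda>e. \<exists>a. Q (case_nat a e))" using assms by (rule s1E)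
  obtain \<phi> where \<phi>: "bounded \<phi>" "\<And>y c a b. sat SM (\<lambda>_. Z) (env4 y c a b) \<phi> =
     Q (case_nat y (case_nat c (case_nat a (case_nat b (\<lambda>_. 0)))))" using d0_formula4[OF Q(1)] by blast
  have "sat SM (\<lambda>_. Z) ((env4 0 0 0 0)(2 := a, 4 := b)) (Ex 0 \<phi>) \<longleftrightarrow> R a b" for a b
    using fun_cong[OF Q(2), of "case_nat a (case_nat b (case_nat 0 (\<lambda>_. 0)))"] \<phi>(2) by (simp add: env4_upd)
  then show ?thesis using \<phi>(1) by blast
qed

lemma rec_turing: assumes "rec Z V" shows "turing_le SM V Z"
proof -
  have cod: "cod (\<lambda>v. v \<in> V)" using assms unfolding rec_def by (rule d1_cod)
  have r: "restr_code SM V n c \<longleftrightarrow> c = mk n (\<lambda>v. v \<in> V)" for n c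
    unfolding restr_code_iff using mk_eqI bt_mk[OF cod] by metis
  have g: "d1 Z (\<lambda>e. e (Suc 0) = mk (e 0) (\<lambda>v. v \<in> V))"
    by (intro d1_eq d1f_mk d1_intros d1_rec[OF assms])
  obtain \<phi> where \<phi>: "bounded \<phi>" "\<And>a b. sat SM (\<lambda>_. Z) ((env4 0 0 0 0)(2 := a, 4 := b)) (Ex 0 \<phi>) \<longleftrightarrow> b = mk a (\<lambda>v. v \<in> V)"
    using s1_formula2[OF d1_s1[OF g]] by blast
  obtain \<psi> where \<psi>: "bounded \<psi>" "\<And>a b. sat SM (\<lambda>_. Z) ((env4 0 0 0 0)(2 := a, 4 := b)) (Ex 0 \<psi>) \<longleftrightarrow> b \<noteq> mk a (\<lambda>v. v \<in> V)"
    using s1_formula2[OF d1_s1_neg[OF g]] by blast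
  have all: "sat SM (\<lambda>_. Z) ((env4 0 0 0 0)(2 := a, 4 := b)) (All 0 (Neg \<psi>)) \<longleftrightarrow> b = mk a (\<lambda>v. v \<in> V)" for a b
    using \<psi>(2)[of a b] by (simp only: sat.simps) blast
  have sig: "Sigma 1 (Ex 0 \<phi>)" unfolding One_nat_def by (intro SigmaEx SigmaPi Pi0 \<phi>)
  have pi: "Pi 1 (All 0 (Neg \<psi>))" unfolding One_nat_def by (rule PiAll, rule PiSigma, rule Sigma0) (simp add: \<psi>(1))
  show ?thesis unfolding turing_le_def r
    by (rule conjI, blast, rule exI[of _ "Ex 0 \<phi>"], rule exI[of _ "All 0 (Neg \<psi>)"], rule exI[of _ "env4 0 0 0 0"],
        rule exI[of _ 2], rule exI[of _ 4], intro conjI allI, simp, rule sig, rule pi, rule \<phi>(2), rule all)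
qed

end

section \<open>The generic path\<close>

lemma mem_join: "t \<in> join SM Z X \<longleftrightarrow> (\<exists>y\<le>t. t = y + y \<and> y \<in> Z) \<or> (\<exists>y\<le>t. t = y + y + 1 \<and> y \<in> X)"
  for t :: "'a::parith"
proof -
  have 1: "y \<le> y + y" for y :: 'a using emb_nonneg[of y] unfolding emb_simps by linarith
  have 2: "y \<le> y + y + 1" for y :: 'a using emb_nonneg[of y] unfolding emb_simps by linarith
  show ?thesis unfolding join_def using 1 2 by auto
qed

text \<open>An upper bound for the elements whose membership in \<open>X\<close> is queried when a bounded formula
is evaluated in \<open>join SM Z X\<close>.\<close>

fun bd :: "fm \<Rightarrow> (nat \<Rightarrow> 'a::parith) \<Rightarrow> 'a" where
  "bd (Eq s t) e = 0"
| "bd (Less s t) e = 0"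
| "bd (Mem t i) e = ev SM e t + 1"
| "bd (Neg \<phi>) e = bd \<phi> e"
| "bd (Conj \<phi> \<psi>) e = bd \<phi> e + bd \<psi> e"
| "bd (Disj \<phi> \<psi>) e = bd \<phi> e + bd \<psi> e"
| "bd (Imp \<phi> \<psi>) e = bd \<phi> e + bd \<psi> e"
| "bd (Ex x \<phi>) e = 0"
| "bd (All x \<phi>) e = 0"
| "bd (BEx x t \<phi>) e = bd \<phi> (e(x := ev SM e t))"
| "bd (BAll x t \<phi>) e = bd \<phi> (e(x := ev SM e t))"

lemma ev_mono: "(\<And>i. e i \<le> e' i) \<Longrightarrow> ev SM e t \<le> ev SM e' (t::trm)"
  by (induction t) (auto intro: add_mono mult_mono)

lemma bd_mono: "(\<And>i. e i \<le> e' i) \<Longrightarrow> bd \<phi> e \<le> bd \<phi> e'"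
proof (induction \<phi> arbitrary: e e')
  case (BEx x t \<phi>)
  then show ?case using ev_mono[where t=t and e=e and e'=e', OF BEx.prems] by auto
next
  case (BAll x t \<phi>)
  then show ?case using ev_mono[where t=t and e=e and e'=e', OF BAll.prems] by auto
qed (auto intro: add_mono ev_mono)

lemma sat_agree:
  "bounded \<phi> \<Longrightarrow> (\<And>v. v < bd \<phi> e \<Longrightarrow> v \<in> X \<longleftrightarrow> v \<in> X') \<Longrightarrow>
    sat SM (\<lambda>_. join SM Z X) e \<phi> = sat SM (\<lambda>_. join SM Z X') e \<phi>"
proof (induction \<phi> arbitrary: e)
  case (Mem t i)
  then have "\<And>y. y \<le> ev SM e t \<Longrightarrow> y \<in> X \<longleftrightarrow> y \<in> X'" by (simp add: parith_less_Suc)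
  then show ?case by (auto simp: mem_join)
next
  case (Conj \<phi> \<psi>)
  have "v < bd \<phi> e + bd \<psi> e" if "v < bd \<phi> e \<or> v < bd \<psi> e" for v
    using that emb_nonneg[of "bd \<phi> e"] emb_nonneg[of "bd \<psi> e"] unfolding emb_simps by linarith
  then show ?case using Conj by auto
next
  case (Disj \<phi> \<psi>)
  have "v < bd \<phi> e + bd \<psi> e" if "v < bd \<phi> e \<or> v < bd \<psi> e" for v
    using that emb_nonneg[of "bd \<phi> e"] emb_nonneg[of "bd \<psi> e"] unfolding emb_simps by linarith
  then show ?case using Disj by auto
next
  case (Imp \<phi> \<psi>)
  have "v < bd \<phi> e + bd \<psi> e" if "v < bd \<phi> e \<or> v < bd \<psi> e" for v
    using that emb_nonneg[of "bd \<phi> e"] emb_nonneg[of "bd \<psi> e"] unfolding emb_simps by linarith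
  then show ?case using Imp by auto
next
  case (BEx x t \<phi>)
  have "sat SM (\<lambda>_. join SM Z X) (e(x := a)) \<phi> = sat SM (\<lambda>_. join SM Z X') (e(x := a)) \<phi>" if "a < ev SM e t" for a
  proof (rule BEx.IH)
    fix v assume "v < bd \<phi> (e(x := a))"
    also have "\<dots> \<le> bd \<phi> (e(x := ev SM e t))" by (rule bd_mono) (use that in auto)
    finally show "v \<in> X \<longleftrightarrow> v \<in> X'" using BEx.prems(2) by simp
  qed (use BEx in simp)
  then show ?case by auto
next
  case (BAll x t \<phi>)
  have "sat SM (\<lambda>_. join SM Z X) (e(x := a)) \<phi> = sat SM (\<lambda>_. join SM Z X') (e(x := a)) \<phi>" if "a < ev SM e t" for a
  proof (rule BAll.IH)
    fix v assume "v < bd \<phi> (e(x := a))"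
    also have "\<dots> \<le> bd \<phi> (e(x := ev SM e t))" by (rule bd_mono) (use that in auto)
    finally show "v \<in> X \<longleftrightarrow> v \<in> X'" using BAll.prems(2) by simp
  qed (use BAll in simp)
  then show ?case by auto
qed auto

lemma tm_if: "tm f \<Longrightarrow> tm g \<Longrightarrow> tm (\<lambda>e. if p then f e else g e)"
  by (cases p) simp_all

lemma tm_bd: "tm (\<lambda>e. bd \<phi> e)"
proof (induction \<phi>)
  case (BEx x t \<phi>)
  have "tm (\<lambda>e. (e(x := ev SM e t)) i)" for i by (cases "i = x") (auto intro: tm.intros tm_ev)
  from tm_subst[OF BEx, of "\<lambda>e. e(x := ev SM e t)", OF this] show ?case by (simp add: fun_upd_def)
next
  case (BAll x t \<phi>)
  have "tm (\<lambda>e. (e(x := ev SM e t)) i)" for i by (cases "i = x") (auto intro: tm.intros tm_ev)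
  from tm_subst[OF BAll, of "\<lambda>e. e(x := ev SM e t)", OF this] show ?case by (simp add: fun_upd_def)
qed (auto intro: tm.intros tm_ev)

text \<open>The string \<open>\<tau>\<close> of length \<open>n\<close> suffices to verify the \<open>\<Sigma>\<^sup>0\<^sub>1\<close> formula with matrix \<open>\<phi>\<close> at \<open>(c, a, b)\<close>.\<close>

definition Gt :: "'a::parith set \<Rightarrow> fm \<Rightarrow> 'a \<Rightarrow> 'a \<Rightarrow> 'a \<Rightarrow> 'a \<Rightarrow> 'a \<Rightarrow> bool" where
  "Gt Z \<phi> n \<tau> c a b \<longleftrightarrow> (\<exists>y<n. bd \<phi> (env4 y c a b) \<le> n \<and>
     sat SM (\<lambda>_. join SM Z (Collect (bt \<tau>))) (env4 y c a b) \<phi>)"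

definition code_path :: "('a::parith \<Rightarrow> 'a) \<Rightarrow> bool" where
  "code_path x \<longleftrightarrow> (\<forall>n. x n < pw n) \<and> (\<forall>m n. m \<le> n \<longrightarrow> md (x n) (pw m) = x m)"

definition set_of :: "('a::parith \<Rightarrow> 'a) \<Rightarrow> 'a set" where
  "set_of x = {v. bt (x (v + 1)) v}"

lemma tm_env4: "tm f \<Longrightarrow> tm g \<Longrightarrow> tm h \<Longrightarrow> tm k \<Longrightarrow> tm (\<lambda>e. env4 (f e) (g e) (h e) (k e) j)"
  unfolding env4_def by (cases "odd j"; cases "j = 0"; cases "j = 2"; cases "j = 4"; cases "j = 6") (auto intro: tm.intros)

context ind1
begin

lemma string_truth_d1:
  "bounded \<phi> \<Longrightarrow> d1 Z (\<lambda>e. sat SM (\<lambda>_. join SM Z (Collect (bt (e 0)))) (\<lambda>i. e (Suc i)) \<phi>)"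
proof (induction \<phi>)
  case (Mem t i)
  have t: "d1f Z (\<lambda>e. ev SM (\<lambda>i. e (Suc i)) t)" "d1f Z (\<lambda>e. ev SM (\<lambda>i. e (Suc (Suc i))) t)"
    by (rule d1f_tm, rule tm_subst[OF tm_ev], rule tm_var)+
  show ?case unfolding sat.simps mem_join mem_Collect_eq by (intro d1_intros d1_bt t)
next
  case (BEx x t \<phi>)
  then have 1: "d1 Z (\<lambda>e. sat SM (\<lambda>_. join SM Z (Collect (bt (e 0)))) (\<lambda>i. e (Suc i)) \<phi>)" by simp
  have t: "d1f Z (\<lambda>e. ev SM (\<lambda>i. e (Suc i)) t)" by (rule d1f_tm, rule tm_subst[OF tm_ev], rule tm_var)
  have "tm (\<lambda>e. case_nat (e (Suc 0)) ((\<lambda>i. e (Suc (Suc i)))(x := e 0)) i)" for i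
    by (rule tm_case_nat) (auto intro: tm_var tm_if)
  from d1_subst[OF 1, of "\<lambda>e. case_nat (e (Suc 0)) ((\<lambda>i. e (Suc (Suc i)))(x := e 0))", OF this]
  show ?case using d1_bex[OF t, where P="\<lambda>e a. sat SM (\<lambda>_. join SM Z (Collect (bt (e 0)))) ((\<lambda>i. e (Suc i))(x := a)) \<phi>"]
    by (simp add: fun_upd_def)
next
  case (BAll x t \<phi>)
  then have 1: "d1 Z (\<lambda>e. sat SM (\<lambda>_. join SM Z (Collect (bt (e 0)))) (\<lambda>i. e (Suc i)) \<phi>)" by simp
  have t: "d1f Z (\<lambda>e. ev SM (\<lambda>i. e (Suc i)) t)" by (rule d1f_tm, rule tm_subst[OF tm_ev], rule tm_var)
  have "tm (\<lambda>e. case_nat (e (Suc 0)) ((\<lambda>i. e (Suc (Suc i)))(x := e 0)) i)" for i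
    by (rule tm_case_nat) (auto intro: tm_var tm_if)
  from d1_subst[OF 1, of "\<lambda>e. case_nat (e (Suc 0)) ((\<lambda>i. e (Suc (Suc i)))(x := e 0))", OF this]
  show ?case using d1_ball[OF t, where P="\<lambda>e a. sat SM (\<lambda>_. join SM Z (Collect (bt (e 0)))) ((\<lambda>i. e (Suc i))(x := a)) \<phi>"]
    by (simp add: fun_upd_def)
next
  case (Eq s t)
  show ?case unfolding sat.simps by (intro d1_eq; rule d1f_tm, rule tm_subst[OF tm_ev], rule tm_var)
next
  case (Less s t)
  show ?case unfolding sat.simps SM_simps by (intro d1_less; rule d1f_tm, rule tm_subst[OF tm_ev], rule tm_var)
qed (auto intro!: d1_neg d1_conj d1_disj d1_imp)

lemma d1_Gt:
  assumes "bounded \<phi>"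
  shows "d1 Z (\<lambda>e. Gt Z \<phi> (e 0) (e (Suc 0)) (e (Suc (Suc 0))) (e (Suc (Suc (Suc 0)))) (e (Suc (Suc (Suc (Suc 0))))))"
proof -
  let ?E = "\<lambda>e :: nat \<Rightarrow> 'a. env4 (e 0) (e (Suc (Suc (Suc 0)))) (e (Suc (Suc (Suc (Suc 0))))) (e (Suc (Suc (Suc (Suc (Suc 0))))))"
  have "tm (\<lambda>e. case_nat (e (Suc (Suc 0))) (?E e) i)" for i
    by (intro tm_case_nat tm_env4 tm.intros)
  from d1_subst[OF string_truth_d1[OF assms], of "\<lambda>e. case_nat (e (Suc (Suc 0))) (?E e)", OF this]
  have 1: "d1 Z (\<lambda>e. sat SM (\<lambda>_. join SM Z (Collect (bt (e (Suc (Suc 0)))))) (?E e) \<phi>)" by simp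
  have 2: "d1f Z (\<lambda>e. bd \<phi> (?E e))" by (rule d1f_tm, rule tm_subst[OF tm_bd], intro tm_env4 tm.intros)
  show ?thesis unfolding Gt_def by (intro d1_bex d1_conj d1_le 2 1 d1_intros)
qed

text \<open>Only digits below \<open>bd\<close> are consulted, and these belong to the shorter
  string already.\<close>

lemma Gt_mono:
  assumes "bounded \<phi>" "m \<le> n" "Gt Z' \<phi> m (md \<rho> (pw m)) c a b" shows "Gt Z' \<phi> n \<rho> c a (b::'a)"
proof -
  obtain y where y: "y < m" "bd \<phi> (env4 y c a b) \<le> m"
    "sat SM (\<lambda>_. join SM Z' (Collect (bt (md \<rho> (pw m))))) (env4 y c a b) \<phi>" using assms(3) unfolding Gt_def by blast
  have "sat SM (\<lambda>_. join SM Z' (Collect (bt \<rho>))) (env4 y c a b) \<phi>"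
    using y(3) sat_agree[OF assms(1), of "env4 y c a b" "Collect (bt (md \<rho> (pw m)))" "Collect (bt \<rho>)" Z'] y(2)
    by (auto simp: bt_md dest: less_le_trans)
  then show ?thesis unfolding Gt_def using y(1,2) assms(2) by (meson less_le_trans order_trans)
qed

lemma bt_path: "code_path x \<Longrightarrow> bt (x n) v \<longleftrightarrow> v < n \<and> v \<in> set_of (x :: 'a \<Rightarrow> 'a)"
proof -
  assume x: "code_path x"
  show ?thesis
  proof (cases "v < n")
    case True
    then have "md (x n) (pw (v + 1)) = x (v + 1)" using x unfolding code_path_def by (simp add: parith_Suc_le)
    then show ?thesis using True bt_md[of "x n" "v + 1" v] less_add_one[of v] unfolding set_of_def by simp
  next
    case False
    then show ?thesis using x bt_bound[of "x n" n v] unfolding code_path_def by blast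
  qed
qed

lemma sat_path:
  assumes "bounded \<phi>" "code_path x" "bd \<phi> e \<le> (n::'a)"
  shows "sat SM (\<lambda>_. join SM Z' (Collect (bt (x n)))) e \<phi> = sat SM (\<lambda>_. join SM Z' (set_of x)) e \<phi>"
  by (rule sat_agree[OF assms(1)]) (use assms(3) in \<open>auto simp: bt_path[OF assms(2)]\<close>)

lemma Gt_sound:
  assumes "bounded \<phi>" "code_path x" "Gt Z' \<phi> n (x n) c a (b::'a)"
  shows "\<exists>y. sat SM (\<lambda>_. join SM Z' (set_of x)) (env4 y c a b) \<phi>"
  using assms(3) sat_path[OF assms(1,2)] unfolding Gt_def by blast

lemma Gt_complete:
  assumes "bounded \<phi>" "code_path x" "sat SM (\<lambda>_. join SM Z' (set_of x)) (env4 y c a b) \<phi>" "y < n" "bd \<phi> (env4 y c a b) \<le> n"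
  shows "Gt Z' \<phi> n (x n) c a (b::'a)"
  using assms(3-5) sat_path[OF assms(1,2)] unfolding Gt_def by blast

end

text \<open>On the segment up to \<open>a\<close>, whatever is ever verified along the path is
  verified by one length \<open>s\<close>; there a Sigma_1 set relative to the path becomes Delta_1
  in \<open>Z\<close> with the parameter \<open>x s\<close>.\<close>

definition meets_ind :: "'a::parith set \<Rightarrow> fm \<Rightarrow> 'a \<Rightarrow> ('a \<Rightarrow> 'a) \<Rightarrow> bool" where
  "meets_ind Z \<phi> a x \<longleftrightarrow> (\<exists>s. \<forall>n\<ge>s. \<forall>i<a + 1. Gt Z \<phi> n (x n) i 0 0 \<longrightarrow> Gt Z \<phi> s (x s) i 0 0)"

text \<open>The relation attacked is \<open>f(a0) = b\<close> iff for some \<open>u\<close> no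
  length verifies \<open>Gt\<close> at \<open>(u, a0, b)\<close>. For the chosen \<open>a0\<close>,
  each candidate witness \<open>u\<close> of each value \<open>b\<close> is either refuted or
  preceded by a rival pair that is not yet refuted at length \<open>m + s\<close>. The offset
  \<open>m\<close> is the length of the stem at which the requirement was met.\<close>

definition meets_wphp :: "'a::parith set \<Rightarrow> fm \<Rightarrow> 'a \<Rightarrow> ('a \<Rightarrow> 'a) \<Rightarrow> bool" where
  "meets_wphp Z \<phi> a x \<longleftrightarrow> (1 \<le> a \<longrightarrow> (\<exists>m. \<exists>a0<a + a. \<forall>w. \<exists>n\<ge>w. \<forall>b<a. \<forall>u<w. \<forall>s<w.
     Gt Z \<phi> (m + n) (x (m + n)) u a0 b \<or>
     (\<exists>a'<a + a. \<exists>u'\<le>u. (u' < u \<or> a' < a0) \<and> a' \<noteq> a0 \<and> \<not> Gt Z \<phi> (m + s) (x (m + s)) u' a' b)))"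

text \<open>A condition \<open>(m, \<sigma>, U)\<close> stands for the tree of all strings extending \<open>\<sigma>\<close>, of length \<open>m\<close>, by
a string in \<open>U\<close>.\<close>

type_synonym 'a cond = "'a \<times> 'a \<times> ('a \<Rightarrow> 'a)"

fun inC :: "'a::parith cond \<Rightarrow> ('a \<Rightarrow> 'a) \<Rightarrow> bool" where
  "inC (m, \<sigma>, U) x \<longleftrightarrow> (\<forall>k. \<exists>\<rho>. bt (U k) \<rho> \<and> x (m + k) = \<sigma> + pw m * \<rho>)"

fun leC :: "'a::parith cond \<Rightarrow> 'a cond \<Rightarrow> bool" where
  "leC (m', \<sigma>', U') (m, \<sigma>, U) \<longleftrightarrow> (\<exists>j. m' = m + j \<and>
     (\<forall>k \<rho>. bt (U' k) \<rho> \<longrightarrow> (\<exists>\<rho>0. bt (U (j + k)) \<rho>0 \<and> \<sigma>' + pw m' * \<rho> = \<sigma> + pw m * \<rho>0)))"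

lemma leC_refl: "leC c c"
proof (cases c)
  case (fields m \<sigma> U)
  show ?thesis unfolding fields leC.simps by (rule exI[of _ 0]) auto
qed

lemma leC_trans: assumes "leC c d" "leC d e" shows "leC c e"
proof (cases c, cases d, cases e)
  fix m1 s1 U1 m2 s2 U2 m3 s3 U3
  assume c: "c = (m1, s1, U1)" and d: "d = (m2, s2, U2)" and e: "e = (m3, s3, U3)"
  obtain j where j: "m1 = m2 + j" "\<And>k \<rho>. bt (U1 k) \<rho> \<Longrightarrow> \<exists>\<rho>0. bt (U2 (j + k)) \<rho>0 \<and> s1 + pw m1 * \<rho> = s2 + pw m2 * \<rho>0"
    using assms(1) unfolding c d by auto
  obtain i where i: "m2 = m3 + i" "\<And>k \<rho>. bt (U2 k) \<rho> \<Longrightarrow> \<exists>\<rho>0. bt (U3 (i + k)) \<rho>0 \<and> s2 + pw m2 * \<rho> = s3 + pw m3 * \<rho>0"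
    using assms(2) unfolding d e by auto
  have "\<exists>\<rho>0. bt (U3 (i + j + k)) \<rho>0 \<and> s1 + pw m1 * \<rho> = s3 + pw m3 * \<rho>0" if "bt (U1 k) \<rho>" for k \<rho>
    using j(2)[OF that] i(2)[of "j + k"] by (metis add.assoc)
  then show "leC c e" unfolding c e leC.simps using i(1) j(1) by (intro exI[of _ "i + j"]) (simp add: add.assoc)
qed

text \<open>The second-order part enters the forcing as a collection of oracles directed under
  \<open>rec\<close>.\<close>

locale ideal =
  fixes S :: "'a::parith set set"
  assumes wphp: "Z \<in> S \<Longrightarrow> wphp Z"
    and upper: "Z1 \<in> S \<Longrightarrow> Z2 \<in> S \<Longrightarrow> \<exists>Z\<in>S. rec Z Z1 \<and> rec Z Z2"
    and nonempty: "S \<noteq> {}"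
begin

definition cond :: "'a cond \<Rightarrow> bool" where
  "cond c \<longleftrightarrow> (case c of (m, \<sigma>, U) \<Rightarrow> \<sigma> < pw m \<and> tree U \<and> dense 1 16 U \<and> (\<exists>Z\<in>S. z2 Z U))"

lemma ind1: "Z \<in> S \<Longrightarrow> ind1 Z"
  using wphp wphp.axioms(1) by blast

lemma inC_leC:
  assumes "cond c" "leC c' c" "inC c' x" "code_path x" shows "inC c x"
proof (cases c, cases c')
  fix m s U m' s' U'
  assume c: "c = (m, s, U)" and c': "c' = (m', s', U')"
  obtain Z where "Z \<in> S" using nonempty by blast
  then interpret ind1 Z by (rule ind1)
  obtain j where j: "m' = m + j" "\<And>k \<rho>. bt (U' k) \<rho> \<Longrightarrow> \<exists>\<rho>0. bt (U (j + k)) \<rho>0 \<and> s' + pw m' * \<rho> = s + pw m * \<rho>0"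
    using assms(2) unfolding c c' by auto
  have hi: "\<exists>\<rho>. bt (U (j + k)) \<rho> \<and> x (m + (j + k)) = s + pw m * \<rho>" for k
    using assms(3) j(2) unfolding c' inC.simps j(1) by (metis add.assoc)
  have U: "s < pw m" "tree U" using assms(1) unfolding cond_def c by auto
  have "\<exists>\<rho>. bt (U k) \<rho> \<and> x (m + k) = s + pw m * \<rho>" for k
  proof -
    obtain \<rho> where \<rho>: "bt (U (j + k)) \<rho>" "x (m + (j + k)) = s + pw m * \<rho>" using hi by blast
    have "x (m + k) = md (x (m + (j + k))) (pw (m + k))" using assms(4) unfolding code_path_def by simp
    also have "\<dots> = s + pw m * md \<rho> (pw k)" unfolding \<rho>(2) by (rule md_sect[OF U(1)])
    finally show ?thesis using treeD(2)[OF U(2) \<rho>(1), of k] by auto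
  qed
  then show "inC c x" unfolding c by simp
qed

text \<open>A density point above level \<open>l\<close> becomes the new stem: this restores density
  \<open>3/4\<close> and makes the stem long.\<close>

lemma extend_step:
  assumes "cond (m, \<sigma>, U)"
  shows "\<exists>n \<rho>. l \<le> m + n \<and> cond (m + n, \<sigma> + pw m * \<rho>, sect U n \<rho>) \<and> dense 3 4 (sect U n \<rho>) \<and>
    leC (m + n, \<sigma> + pw m * \<rho>, sect U n \<rho>) (m, \<sigma>, U)"
proof -
  have c: "\<sigma> < pw m" "tree U" "dense 1 16 U" using assms unfolding cond_def by auto
  obtain Z where Z: "Z \<in> S" "z2 Z U" using assms unfolding cond_def by auto
  interpret wphp Z using Z(1) by (rule wphp)
  obtain n \<rho> where n: "l \<le> n" "\<rho> < pw n" "bt (U n) \<rho>" "dense 3 4 (sect U n \<rho>)"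
    using density_point[OF Z(2) c(2,3), of l] by blast
  have "dense 1 16 (sect U n \<rho>)"
    unfolding dense_def
  proof
    fix k
    have "3 * pw k \<le> 4 * cnt (pw k) (bt (sect U n \<rho> k))" using n(4) unfolding dense_def by blast
    then show "1 * pw k \<le> 16 * cnt (pw k) (bt (sect U n \<rho> k))"
      using emb_nonneg[of "pw k"] unfolding emb_simps by (simp add: emb_simps)
  qed
  then have "cond (m + n, \<sigma> + pw m * \<rho>, sect U n \<rho>)"
    unfolding cond_def using sect_less[OF c(1) n(2)] tree_sect[OF c(2) n(2)] z2_sect[OF Z(2)] Z(1) by auto
  moreover have "leC (m + n, \<sigma> + pw m * \<rho>, sect U n \<rho>) (m, \<sigma>, U)"
    unfolding leC.simps bt_sect pw_add
  proof (rule exI[of _ n], intro conjI allI impI refl)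
    fix k \<rho>' assume *: "\<rho>' < pw k \<and> bt (U (n + k)) (\<rho> + pw n * \<rho>')"
    have "\<sigma> + pw m * \<rho> + pw m * pw n * \<rho>' = \<sigma> + pw m * (\<rho> + pw n * \<rho>')" by (simp add: algebra_simps)
    then show "\<exists>\<rho>0. bt (U (n + k)) \<rho>0 \<and> \<sigma> + pw m * \<rho> + pw m * pw n * \<rho>' = \<sigma> + pw m * \<rho>0" using * by blast
  qed
  moreover have "l \<le> m + n" using n(1) by (rule order_trans) simp
  ultimately show ?thesis using n(4) by blast
qed

lemma restrict_leC: "(\<forall>n \<tau>. bt (U' n) \<tau> \<longrightarrow> bt (U n) \<tau>) \<Longrightarrow> leC (m, \<sigma>, U') (m, \<sigma>, U)"
  unfolding leC.simps by (rule exI[of _ 0]) auto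

lemma ind_step:
  assumes c: "cond (m, \<sigma>, U)" "dense 3 4 U" and Z: "Z \<in> S" and \<phi>: "bounded \<phi>"
  shows "\<exists>U'. cond (m, \<sigma>, U') \<and> leC (m, \<sigma>, U') (m, \<sigma>, U) \<and>
    (\<forall>x. code_path x \<longrightarrow> inC (m, \<sigma>, U') x \<longrightarrow> meets_ind Z \<phi> a x)"
proof -
  have c': "\<sigma> < pw m" "tree U" using c unfolding cond_def by auto
  obtain Z0 where Z0: "Z0 \<in> S" "z2 Z0 U" using c unfolding cond_def by auto
  \<comment> \<open>One oracle that computes both the set in the formula and the oracle of the
    tree.\<close>
  obtain Z1 where Z1: "Z1 \<in> S" "rec Z1 Z" "rec Z1 Z0" using upper[OF Z Z0(1)] by blast
  interpret wphp Z1 using Z1(1) by (rule wphp)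
  note G = d1_rec_d1[OF ind1.d1_Gt[OF ind1[OF Z] \<phi>] Z1(2)]
  define G' where "G' n \<rho> i = Gt Z \<phi> (m + n) (\<sigma> + pw m * \<rho>) i 0 0" for n \<rho> i
  have dG: "d1 Z1 (\<lambda>e. G' (e 0) (e (Suc 0)) (e (Suc (Suc 0))))" unfolding G'_def by (intro d1_rel5[OF G] d1_intros)
  have mono: "G' n \<rho> i" if "k \<le> n" "G' k (md \<rho> (pw k)) i" for n k \<rho> i
    using Gt_mono[OF \<phi>, of "m + k" "m + n" Z "\<sigma> + pw m * \<rho>"] that unfolding G'_def md_sect[OF c'(1)] by simp
  have "0 < a + 1" by simp
  from decide_bounded_step[of G', OF dG _ z2_rec_z2[OF Z0(2) Z1(3)] c'(2) c(2) this] mono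
  obtain U' s where U': "z2 Z1 U'" "tree U'" "dense 1 16 U'" "\<forall>n \<tau>. bt (U' n) \<tau> \<longrightarrow> bt (U n) \<tau>"
    "\<forall>n\<ge>s. \<forall>\<tau>. bt (U' n) \<tau> \<longrightarrow> (\<forall>i<a + 1. G' n \<tau> i \<longrightarrow> G' s (md \<tau> (pw s)) i)" by blast
  have "cond (m, \<sigma>, U')" unfolding cond_def using U'(1-3) c'(1) Z1(1) by auto
  moreover have "meets_ind Z \<phi> a x" if x: "code_path x" "inC (m, \<sigma>, U') x" for x
    unfolding meets_ind_def
  proof (rule exI[of _ "m + s"], intro allI impI)
    fix n i assume n: "m + s \<le> n" and i: "i < a + 1" and g: "Gt Z \<phi> n (x n) i 0 0"
    obtain d where d: "n = m + s + d" using parith_le_ex[OF n] by blast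
    then have n': "n = m + (s + d)" by (simp add: add.assoc)
    obtain \<rho> where \<rho>: "bt (U' (s + d)) \<rho>" "x n = \<sigma> + pw m * \<rho>" using x(2) unfolding inC.simps n' by blast
    have "G' s (md \<rho> (pw s)) i" using U'(5)[rule_format, of "s + d" \<rho> i] \<rho> i g unfolding G'_def n'[symmetric] by simp
    moreover have "\<sigma> + pw m * md \<rho> (pw s) = x (m + s)"
      using md_sect[OF c'(1), of \<rho> s] x(1) n unfolding \<rho>(2)[symmetric] code_path_def by simp
    ultimately show "Gt Z \<phi> (m + s) (x (m + s)) i 0 0" unfolding G'_def by simp
  qed
  ultimately show ?thesis using restrict_leC[OF U'(4)] by blast
qed

lemma wphp_step:
  assumes c: "cond (m, \<sigma>, U)" "dense 3 4 U" and Z: "Z \<in> S" and \<phi>: "bounded \<phi>"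
  shows "\<exists>U'. cond (m, \<sigma>, U') \<and> leC (m, \<sigma>, U') (m, \<sigma>, U) \<and>
    (\<forall>x. code_path x \<longrightarrow> inC (m, \<sigma>, U') x \<longrightarrow> meets_wphp Z \<phi> a x)"
proof (cases "1 \<le> a")
  case False
  then show ?thesis using c(1) leC_refl unfolding meets_wphp_def by blast
next
  case True
  have c': "\<sigma> < pw m" "tree U" using c unfolding cond_def by auto
  obtain Z0 where Z0: "Z0 \<in> S" "z2 Z0 U" using c unfolding cond_def by auto
  obtain Z1 where Z1: "Z1 \<in> S" "rec Z1 Z" "rec Z1 Z0" using upper[OF Z Z0(1)] by blast
  interpret wphp Z1 using Z1(1) by (rule wphp)
  note G = d1_rec_d1[OF ind1.d1_Gt[OF ind1[OF Z] \<phi>] Z1(2)]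
  define G' where "G' n \<rho> a b u = Gt Z \<phi> (m + n) (\<sigma> + pw m * \<rho>) u a b" for n \<rho> a b u
  have dG: "d1 Z1 (\<lambda>e. G' (e 0) (e (Suc 0)) (e (Suc (Suc 0))) (e (Suc (Suc (Suc 0)))) (e (Suc (Suc (Suc (Suc 0))))))"
    unfolding G'_def by (intro d1_rel5[OF G] d1_intros)
  have mono: "G' n \<rho> a b u" if "k \<le> n" "G' k (md \<rho> (pw k)) a b u" for n k \<rho> a b u
    using Gt_mono[OF \<phi>, of "m + k" "m + n" Z "\<sigma> + pw m * \<rho>"] that unfolding G'_def md_sect[OF c'(1)] by simp
  from defeat_injection_step[of G', OF dG _ z2_rec_z2[OF Z0(2) Z1(3)] c'(2) c(2) True] mono
  obtain U' where U': "z2 Z1 U'" "tree U'" "dense 1 16 U'" "\<forall>n \<tau>. bt (U' n) \<tau> \<longrightarrow> bt (U n) \<tau>"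
    "\<exists>a0<a + a. \<forall>w. \<exists>n\<ge>w. \<forall>\<tau>. bt (U' n) \<tau> \<longrightarrow> \<not> (\<exists>b<a. \<exists>u<w. \<exists>s<w. \<not> G' n \<tau> a0 b u \<and>
      (\<forall>a'<a + a. \<forall>u'\<le>u. (u' < u \<or> a' < a0) \<and> a' \<noteq> a0 \<longrightarrow> G' s (md \<tau> (pw s)) a' b u'))" by blast
  then obtain a0 where a0: "a0 < a + a" "\<And>w. \<exists>n\<ge>w. \<forall>\<tau>. bt (U' n) \<tau> \<longrightarrow> \<not> (\<exists>b<a. \<exists>u<w. \<exists>s<w. \<not> G' n \<tau> a0 b u \<and>
      (\<forall>a'<a + a. \<forall>u'\<le>u. (u' < u \<or> a' < a0) \<and> a' \<noteq> a0 \<longrightarrow> G' s (md \<tau> (pw s)) a' b u'))" by blast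
  have "cond (m, \<sigma>, U')" unfolding cond_def using U'(1-3) c'(1) Z1(1) by auto
  moreover have "meets_wphp Z \<phi> a x" if x: "code_path x" "inC (m, \<sigma>, U') x" for x
    unfolding meets_wphp_def
  proof (rule impI, rule exI[of _ m], rule exI[of _ a0], rule conjI, rule a0(1), rule allI)
    fix w
    obtain n where n: "w \<le> n" "\<And>\<tau>. bt (U' n) \<tau> \<Longrightarrow> \<not> (\<exists>b<a. \<exists>u<w. \<exists>s<w. \<not> G' n \<tau> a0 b u \<and>
      (\<forall>a'<a + a. \<forall>u'\<le>u. (u' < u \<or> a' < a0) \<and> a' \<noteq> a0 \<longrightarrow> G' s (md \<tau> (pw s)) a' b u'))" using a0(2) by blast
    obtain \<rho> where \<rho>: "bt (U' n) \<rho>" "x (m + n) = \<sigma> + pw m * \<rho>" using x(2) unfolding inC.simps by blast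
    have xs: "\<sigma> + pw m * md \<rho> (pw s) = x (m + s)" if "s < w" for s
    proof -
      have "m + s \<le> m + n" using that n(1) by (simp add: less_imp_le[OF less_le_trans])
      then show ?thesis using md_sect[OF c'(1), of \<rho> s] x(1) unfolding \<rho>(2)[symmetric] code_path_def by simp
    qed
    show "\<exists>n\<ge>w. \<forall>b<a. \<forall>u<w. \<forall>s<w. Gt Z \<phi> (m + n) (x (m + n)) u a0 b \<or>
      (\<exists>a'<a + a. \<exists>u'\<le>u. (u' < u \<or> a' < a0) \<and> a' \<noteq> a0 \<and> \<not> Gt Z \<phi> (m + s) (x (m + s)) u' a' b)"
    proof (rule exI[of _ n], intro conjI n(1) allI impI)
      fix b u s assume h: "b < a" "u < w" "s < w"
      have "G' n \<rho> a0 b u \<or> \<not> (\<forall>a'<a + a. \<forall>u'\<le>u. (u' < u \<or> a' < a0) \<and> a' \<noteq> a0 \<longrightarrow> G' s (md \<rho> (pw s)) a' b u')"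
        using n(2)[OF \<rho>(1)] h by blast
      then show "Gt Z \<phi> (m + n) (x (m + n)) u a0 b \<or>
        (\<exists>a'<a + a. \<exists>u'\<le>u. (u' < u \<or> a' < a0) \<and> a' \<noteq> a0 \<and> \<not> Gt Z \<phi> (m + s) (x (m + s)) u' a' b)"
        unfolding G'_def \<rho>(2)[symmetric] xs[OF h(3)] by blast
    qed
  qed
  ultimately show ?thesis using restrict_leC[OF U'(4)] by blast
qed

text \<open>Each thinning consumes density \<open>3/4\<close> and guarantees only
  \<open>1/16\<close>, so a density point is taken before each of the two. The parameter
  \<open>a\<close> also serves as the length to be reached.\<close>

lemma requirement_step:
  assumes c: "cond c" and Z: "Z \<in> S"
  shows "\<exists>c'. cond c' \<and> leC c' c \<and> a \<le> fst c' \<and>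
    (bounded \<phi> \<longrightarrow> (\<forall>x. code_path x \<longrightarrow> inC c' x \<longrightarrow> meets_ind Z \<phi> a x \<and> meets_wphp Z \<phi> a x))"
proof -
  obtain m \<sigma> U where c0: "c = (m, \<sigma>, U)" by (cases c)
  obtain m1 \<sigma>1 U1 where 1: "a \<le> m1" "cond (m1, \<sigma>1, U1)" "dense 3 4 U1" "leC (m1, \<sigma>1, U1) c"
    using extend_step[OF c[unfolded c0], of a] unfolding c0 by blast
  show ?thesis
  proof (cases "bounded \<phi>")
    case False
    then show ?thesis using 1 by (intro exI[of _ "(m1, \<sigma>1, U1)"]) simp
  next
    case True
    obtain U2 where 2: "cond (m1, \<sigma>1, U2)" "leC (m1, \<sigma>1, U2) (m1, \<sigma>1, U1)"
      "\<forall>x. code_path x \<longrightarrow> inC (m1, \<sigma>1, U2) x \<longrightarrow> meets_ind Z \<phi> a x"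
      using ind_step[OF 1(2,3) Z True, of a] by blast
    obtain m3 \<sigma>3 U3 where 3: "m1 \<le> m3" "cond (m3, \<sigma>3, U3)" "dense 3 4 U3" "leC (m3, \<sigma>3, U3) (m1, \<sigma>1, U2)"
      using extend_step[OF 2(1), of m1] by blast
    obtain U4 where 4: "cond (m3, \<sigma>3, U4)" "leC (m3, \<sigma>3, U4) (m3, \<sigma>3, U3)"
      "\<forall>x. code_path x \<longrightarrow> inC (m3, \<sigma>3, U4) x \<longrightarrow> meets_wphp Z \<phi> a x"
      using wphp_step[OF 3(2,3) Z True, of a] by blast
    have l: "leC (m3, \<sigma>3, U4) (m1, \<sigma>1, U2)" using leC_trans[OF 4(2) 3(4)] .
    have "meets_ind Z \<phi> a x" if "code_path x" "inC (m3, \<sigma>3, U4) x" for x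
      using inC_leC[OF 2(1) l that(2,1)] 2(3) that(1) by blast
    moreover have "leC (m3, \<sigma>3, U4) c" using leC_trans[OF leC_trans[OF l 2(2)] 1(4)] .
    moreover have "a \<le> m3" using 1(1) 3(1) by (rule order_trans)
    ultimately show ?thesis using 4(1,3) by (intro exI[of _ "(m3, \<sigma>3, U4)"]) simp
  qed
qed

lemma generic_path:
  assumes "countable S" and c: "cond c"
  shows "\<exists>x. code_path x \<and> inC c x \<and>
    (\<forall>Z\<in>S. \<forall>\<phi> a. bounded \<phi> \<longrightarrow> meets_ind Z \<phi> a x \<and> meets_wphp Z \<phi> a x)"
proof -
  obtain Z0 where Z0: "Z0 \<in> S" using nonempty by blast
  interpret ind1 Z0 using Z0 by (rule ind1)
  \<comment> \<open>Since \<open>S\<close>, the formulas and the model are countable, an external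
    sequence lists all requirements.\<close>
  define r :: "nat \<Rightarrow> nat \<times> fm \<times> 'a" where "r = from_nat"
  define ZZ where "ZZ = from_nat_into S"
  have ZZ: "ZZ i \<in> S" for i unfolding ZZ_def using nonempty by (rule from_nat_into)
  define met where "met j d \<longleftrightarrow> snd (snd (r j)) \<le> fst d \<and> (bounded (fst (snd (r j))) \<longrightarrow> (\<forall>x. code_path x \<longrightarrow> inC d x \<longrightarrow>
      meets_ind (ZZ (fst (r j))) (fst (snd (r j))) (snd (snd (r j))) x \<and>
      meets_wphp (ZZ (fst (r j))) (fst (snd (r j))) (snd (snd (r j))) x))" for j and d :: "'a cond"
  define step where "step j d = (SOME d'. cond d' \<and> leC d' d \<and> met j d')" for j d
  have step: "cond (step j d) \<and> leC (step j d) d \<and> met j (step j d)" if "cond d" for j d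
    unfolding step_def met_def by (rule someI_ex) (rule requirement_step[OF that ZZ])
  define f where "f = rec_nat c step"
  have f0: "f 0 = c" and fS: "f (Suc j) = step j (f j)" for j unfolding f_def by simp_all
  have cf: "cond (f j)" for j
  proof (induction j)
    case 0 show ?case unfolding f0 by (rule c)
  next
    case (Suc j) then show ?case unfolding fS using step by blast
  qed
  have lf: "leC (f (Suc j)) (f j)" for j unfolding fS using step[OF cf] by blast
  have mf: "met j (f (Suc j))" for j unfolding fS using step[OF cf] by blast
  have big: "snd (snd (r j)) \<le> fst (f (Suc j))" for j using mf unfolding met_def by blast
  have lf': "leC (f j) (f i)" if "i \<le> j" for i j
    using that by (induction rule: dec_induct) (auto intro: leC_refl leC_trans lf)
  define m where "m j = fst (f j)" for j
  define \<sigma> where "\<sigma> j = fst (snd (f j))" for j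
  define U where "U j = snd (snd (f j))" for j
  have f: "f j = (m j, \<sigma> j, U j)" for j unfolding m_def \<sigma>_def U_def by simp
  have c\<sigma>: "\<sigma> j < pw (m j)" "tree (U j)" for j using cf[of j] unfolding cond_def f by auto
  \<comment> \<open>The empty string lies in every tree of positive density, so the stem of a later
    condition is itself a node of each earlier one.\<close>
  have U0: "bt (U j 0) 0" for j
  proof -
    have "dense 1 16 (U j)" using cf[of j] unfolding cond_def f by auto
    then have "1 * pw 0 \<le> 16 * cnt (pw 0) (bt (U j 0))" unfolding dense_def by blast
    then have "cnt (pw 0) (bt (U j 0)) \<noteq> 0" by auto
    then obtain v where "v < pw 0" "bt (U j 0) v" using cnt_posD by blast
    then show ?thesis using parith_less_Suc[of v 0] by auto
  qed
  have node: "\<exists>k \<rho>. m j = m i + k \<and> bt (U i k) \<rho> \<and> \<sigma> j = \<sigma> i + pw (m i) * \<rho>" if ij: "i \<le> j" for i j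
  proof -
    obtain k where k: "m j = m i + k" "\<And>l \<rho>. bt (U j l) \<rho> \<Longrightarrow> \<exists>\<rho>0. bt (U i (k + l)) \<rho>0 \<and> \<sigma> j + pw (m j) * \<rho> = \<sigma> i + pw (m i) * \<rho>0"
      using lf'[OF ij] unfolding f by auto
    show ?thesis using k(2)[OF U0] k(1) by auto
  qed
  have coh: "md (\<sigma> j) (pw (m i)) = \<sigma> i" if "i \<le> j" for i j
    using node[OF that] dvmd_sect(1)[OF c\<sigma>(1)[of i]] by auto
  have mono: "m i \<le> m j" if "i \<le> j" for i j using node[OF that] by auto
  \<comment> \<open>Every element of the model occurs as the parameter of a requirement, so the
    stems exceed all lengths, nonstandard ones included.\<close>
  have cofinal: "\<exists>j. n \<le> m j" for n
  proof -
    obtain j where "r j = (0, Eq Zero Zero, n)" unfolding r_def by (metis from_nat_to_nat)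
    then show ?thesis using big[of j] unfolding m_def by auto
  qed
  define x where "x n = md (\<sigma> (SOME j. n \<le> m j)) (pw n)" for n
  have x: "x n = md (\<sigma> j) (pw n)" if n: "n \<le> m j" for n j
  proof -
    define i where "i = (SOME j. n \<le> m j)"
    have i: "n \<le> m i" unfolding i_def using n by (rule someI)
    have "md (\<sigma> i) (pw n) = md (\<sigma> j) (pw n)" if "i \<le> j" "n \<le> m i" for i j
      using coh[OF that(1)] md_md[OF that(2), of "\<sigma> j"] by simp
    then show ?thesis unfolding x_def i_def[symmetric] using i n by (metis linear)
  qed
  have path: "code_path x"
    unfolding code_path_def
  proof (intro conjI allI impI)
    fix n k :: 'a
    show "x n < pw n" unfolding x_def by simp
    assume k: "k \<le> n"
    obtain j where j: "n \<le> m j" using cofinal by blast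
    show "md (x n) (pw k) = x k" using x[OF j] x[OF order_trans[OF k j]] md_md[OF k, of "\<sigma> j"] by simp
  qed
  have inf: "inC (f i) x" for i
    unfolding f inC.simps
  proof
    fix k
    obtain j0 where j0: "m i + k \<le> m j0" using cofinal by blast
    define j where "j = max i j0"
    have j: "i \<le> j" "m i + k \<le> m j" using j0 mono[of j0 j] unfolding j_def by (auto intro: order_trans)
    obtain l \<rho> where \<rho>: "m j = m i + l" "bt (U i l) \<rho>" "\<sigma> j = \<sigma> i + pw (m i) * \<rho>" using node[OF j(1)] by blast
    have "k \<le> l" using j(2) \<rho>(1) by simp
    then have "bt (U i k) (md \<rho> (pw k))" by (rule treeD(2)[OF c\<sigma>(2) \<rho>(2)])
    moreover have "x (m i + k) = \<sigma> i + pw (m i) * md \<rho> (pw k)"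
      using x[OF j(2)] md_sect[OF c\<sigma>(1)[of i], of \<rho> k] unfolding \<rho>(3) by simp
    ultimately show "\<exists>\<rho>. bt (U i k) \<rho> \<and> x (m i + k) = \<sigma> i + pw (m i) * \<rho>" by blast
  qed
  have "meets_ind Z \<phi> a x \<and> meets_wphp Z \<phi> a x" if Z: "Z \<in> S" and \<phi>: "bounded \<phi>" for Z \<phi> a
  proof -
    obtain i where i: "ZZ i = Z" unfolding ZZ_def using from_nat_into_surj[OF assms(1) Z] by blast
    obtain j where "r j = (i, \<phi>, a)" unfolding r_def by (metis from_nat_to_nat)
    then show ?thesis using mf[of j] path inf[of "Suc j"] \<phi> i unfolding met_def by simp
  qed
  then show ?thesis using path inf[of 0] f0 by (intro exI[of _ x]) simp
qed

end

section \<open>The extended model\<close>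

fun svb :: "fm \<Rightarrow> nat" where
  "svb (Eq s t) = 0"
| "svb (Less s t) = 0"
| "svb (Mem t i) = Suc i"
| "svb (Neg \<phi>) = svb \<phi>"
| "svb (Conj \<phi> \<psi>) = max (svb \<phi>) (svb \<psi>)"
| "svb (Disj \<phi> \<psi>) = max (svb \<phi>) (svb \<psi>)"
| "svb (Imp \<phi> \<psi>) = max (svb \<phi>) (svb \<psi>)"
| "svb (Ex x \<phi>) = svb \<phi>"
| "svb (All x \<phi>) = svb \<phi>"
| "svb (BEx x t \<phi>) = svb \<phi>"
| "svb (BAll x t \<phi>) = svb \<phi>"

text \<open>A formula mentions finitely many sets, so a single oracle can be found for all of its
  set parameters.\<close>

lemma sat_cong_sets: "(\<And>i. i < svb \<phi> \<Longrightarrow> V i = V' i) \<Longrightarrow> sat A V e \<phi> = sat A V' e \<phi>"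
  by (induction \<phi> arbitrary: e) auto

context ind1
begin

lemma double_inj: "a + a = b + b \<longleftrightarrow> a = (b::'a)"
proof
  assume "a + a = b + b"
  then show "a = b" unfolding emb_simps by simp
qed simp

lemma join_left: "n + n \<in> join SM Z1 Z2 \<longleftrightarrow> (n::'a) \<in> Z1"
  unfolding join_def using even_neq_odd by (auto simp: double_inj)

lemma join_right: "n + n + 1 \<in> join SM Z1 Z2 \<longleftrightarrow> (n::'a) \<in> Z2"
  unfolding join_def using even_neq_odd[symmetric] by (auto simp: double_inj)

lemma rec_join_left: "rec (join SM Z1 Z2) (Z1::'a set)"
proof -
  have "d1 (join SM Z1 Z2) (\<lambda>e. e 0 + e 0 \<in> join SM Z1 Z2)" by (intro d1_mem d1f_add d1f_v)
  then show ?thesis unfolding rec_def join_left .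
qed

lemma rec_join_right: "rec (join SM Z1 Z2) (Z2::'a set)"
proof -
  have "d1 (join SM Z1 Z2) (\<lambda>e. e 0 + e 0 + 1 \<in> join SM Z1 Z2)" by (intro d1_mem d1f_add d1f_v d1f_c)
  then show ?thesis unfolding rec_def join_right .
qed

lemma rec_join: "rec Z Z1 \<Longrightarrow> rec Z Z2 \<Longrightarrow> rec Z (join SM Z1 Z2)"
  unfolding rec_def[of _ "join SM Z1 Z2"] mem_join by (intro d1_intros d1_rec)

lemma collection:
  assumes R: "s1 Z (\<lambda>e. R (e 0) (e (Suc 0)))" and ex: "\<And>a. a < n \<Longrightarrow> \<exists>b. R a b"
  shows "\<exists>c. \<forall>a<n. \<exists>b<c. R a b"
proof -
  have "\<exists>c. m \<le> n \<longrightarrow> (\<forall>a<m. \<exists>b<c. R a b)" for m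
  proof (induction m rule: s1_induct)
    case 1
    show ?case by (intro s1_ex s1_imp s1_ball s1_conj s1_rel2[OF R] d1_intros; intro d1_s1 d1_intros)
  next
    case (3 m)
    then obtain c where c: "m \<le> n \<longrightarrow> (\<forall>a<m. \<exists>b<c. R a b)" by blast
    show ?case
    proof (cases "m < n")
      case True
      obtain b where b: "R m b" using ex[OF True] by blast
      have "\<forall>a<m. \<exists>b<c. R a b" using c True by simp
      from collect_step[OF this b] show ?thesis by blast
    next
      case False
      then show ?thesis by (auto simp: parith_Suc_le)
    qed
  qed simp
  then show ?thesis by blast
qed

end

text \<open>Used twice: for the given collection and for its extension by the path.\<close>

locale directed =
  fixes B :: "'a::parith set set"
  assumes base_ind1: "Y \<in> B \<Longrightarrow> ind1 Y"
    and base_upper: "Y1 \<in> B \<Longrightarrow> Y2 \<in> B \<Longrightarrow> \<exists>Y\<in>B. rec Y Y1 \<and> rec Y Y2"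
    and base_nonempty: "B \<noteq> {}"
begin

definition downset :: "'a set set" where "downset = {V. \<exists>Y\<in>B. rec Y V}"

lemma common_oracle:
  fixes N :: nat
  assumes "\<And>k. k < N \<Longrightarrow> V k \<in> downset"
  shows "\<exists>Y\<in>B. \<forall>k<N. rec Y (V k)"
  using assms
proof (induction N)
  case 0
  then show ?case using base_nonempty by blast
next
  case (Suc N)
  then obtain Y1 where Y1: "Y1 \<in> B" "\<forall>k<N. rec Y1 (V k)" by auto
  obtain Y2 where Y2: "Y2 \<in> B" "rec Y2 (V N)" using Suc.prems[of N] unfolding downset_def by auto
  obtain Y where Y: "Y \<in> B" "rec Y Y1" "rec Y Y2" using base_upper[OF Y1(1) Y2(1)] by blast
  interpret ind1 Y using Y(1) by (rule base_ind1)
  have "rec Y (V k)" if "k < Suc N" for k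
    using that rec_trans[OF Y(2)] rec_trans[OF Y(3)] Y1(2) Y2(2) by (cases "k = N") auto
  then show ?case using Y(1) by blast
qed

lemma formula_oracle:
  assumes "\<And>k. V k \<in> downset"
  shows "\<exists>Y\<in>B. \<exists>V'. (\<forall>k. rec Y (V' k)) \<and> (\<forall>e. sat SM V e \<phi> = sat SM V' e \<phi>)"
proof -
  obtain Y where Y: "Y \<in> B" "\<forall>k<svb \<phi>. rec Y (V k)" using common_oracle assms by blast
  interpret ind1 Y using Y(1) by (rule base_ind1)
  let ?V = "\<lambda>k. if k < svb \<phi> then V k else {}"
  have "\<forall>k. rec Y (?V k)" using Y(2) rec_empty by simp
  moreover have "\<forall>e. sat SM V e \<phi> = sat SM ?V e \<phi>" by (intro allI sat_cong_sets) simp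
  ultimately show ?thesis using Y(1) by (intro bexI[of _ Y] exI[of _ ?V] conjI)
qed

lemma sigma1_induction_downset: "sigma1_induction SM downset"
  unfolding sigma1_induction_def
proof (intro allI impI, elim conjE)
  fix \<phi> and V :: "nat \<Rightarrow> 'a set" and e x n
  assume \<phi>: "Sigma 1 \<phi>" and V: "\<forall>i. V i \<in> downset" and 0: "sat SM V (e(x := szero SM)) \<phi>"
    and step: "\<forall>n. sat SM V (e(x := n)) \<phi> \<longrightarrow> sat SM V (e(x := sadd SM n (sone SM))) \<phi>"
  obtain Y V' where Y: "Y \<in> B" "\<forall>k. rec Y (V' k)" "\<forall>e. sat SM V e \<phi> = sat SM V' e \<phi>"
    using formula_oracle V by blast
  interpret ind1 Y using Y(1) by (rule base_ind1)
  have "tm (\<lambda>e'. (e(x := e' 0)) i)" for i by (cases "i = x") (auto intro: tm.intros)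
  from s1_subst[OF sat_Sigma1[OF \<phi>, of V'], of "\<lambda>e'. e(x := e' 0)", OF _ this]
  have s: "s1 Y (\<lambda>e'. sat SM V (e(x := e' 0)) \<phi>)" using Y(2,3) by simp
  show "sat SM V (e(x := n)) \<phi>"
    by (rule s1_induct[where P="\<lambda>n. sat SM V (e(x := n)) \<phi>", OF s]) (use 0 step in simp_all)
qed

lemma delta1_comprehension_downset: "delta1_comprehension SM downset"
  unfolding delta1_comprehension_def
proof (intro allI impI)
  fix \<phi> \<psi> and V :: "nat \<Rightarrow> 'a set" and e x
  assume \<phi>: "Sigma 1 \<phi>" and \<psi>: "Pi 1 \<psi>" and V: "\<forall>i. V i \<in> downset"
    and eq: "\<forall>n. sat SM V (e(x := n)) \<phi> = sat SM V (e(x := n)) \<psi>"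
  obtain Y V' where Y: "Y \<in> B" "\<forall>k. rec Y (V' k)" "\<forall>e. sat SM V e (Conj \<phi> \<psi>) = sat SM V' e (Conj \<phi> \<psi>)"
    using formula_oracle[of V "Conj \<phi> \<psi>"] V by blast
  obtain Y1 V1 where Y1: "Y1 \<in> B" "\<forall>k. rec Y1 (V1 k)" "\<forall>e. sat SM V e \<phi> = sat SM V1 e \<phi>"
    using formula_oracle[of V \<phi>] V by blast
  obtain Y2 V2 where Y2: "Y2 \<in> B" "\<forall>k. rec Y2 (V2 k)" "\<forall>e. sat SM V e \<psi> = sat SM V2 e \<psi>"
    using formula_oracle[of V \<psi>] V by blast
  obtain Y where Y: "Y \<in> B" "rec Y Y1" "rec Y Y2" using base_upper[OF Y1(1) Y2(1)] by blast
  interpret ind1 Y using Y(1) by (rule base_ind1)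
  have r1: "rec Y (V1 k)" and r2: "rec Y (V2 k)" for k using rec_trans Y(2,3) Y1(2) Y2(2) by blast+
  have t: "tm (\<lambda>e'. (e(x := e' 0)) i)" for i by (cases "i = x") (auto intro: tm.intros)
  have "s1 Y (\<lambda>e'. sat SM V (e(x := e' 0)) \<phi>)"
    using s1_subst[OF sat_Sigma1[OF \<phi> r1], of "\<lambda>e'. e(x := e' 0)", OF t] Y1(3) by simp
  moreover have "s1 Y (\<lambda>e'. \<not> sat SM V (e(x := e' 0)) \<phi>)"
    using s1_subst[OF sat_Pi1[OF \<psi> r2], of "\<lambda>e'. e(x := e' 0)", OF t] Y2(3) eq by simp
  ultimately have "rec Y {n. sat SM V (e(x := n)) \<phi>}" unfolding rec_def d1_def by simp
  then show "{n. sat SM V (e(x := n)) \<phi>} \<in> downset" unfolding downset_def using Y(1) by blast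
qed

lemma rca0_downset: "rca0 SM downset"
proof -
  have "basic_axioms (SM :: 'a struc)"
    unfolding basic_axioms_def by (auto simp: parith_less_Suc le_less algebra_simps)
  then show ?thesis unfolding rca0_def using sigma1_induction_downset delta1_comprehension_downset by blast
qed

end

lemma ideal_of_model:
  fixes S :: "'a::parith set set"
  assumes "rca0 SM S" "wphp2 SM S" "S \<noteq> {}" shows "ideal S"
proof (rule ideal.intro)
  have ind: "ind1 Z" if "Z \<in> S" for Z using ind1I[OF _ that] assms(1) unfolding rca0_def by blast
  show "wphp Z" if "Z \<in> S" for Z using ind1.wphpI[OF ind[OF that] assms(2) that] .
  show "S \<noteq> {}" by fact
  fix Z1 Z2 assume Z: "Z1 \<in> S" "Z2 \<in> S"
  let ?V = "\<lambda>i::nat. if i = 0 then Z1 else Z2"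
  \<comment> \<open>A bounded formula for the join; being both Sigma_1 and Pi_1, it puts the join
    into \<open>S\<close> by comprehension.\<close>
  let ?f = "Disj (BEx 1 (Plus (Var 0) One) (Conj (Eq (Var 0) (Plus (Var 1) (Var 1))) (Mem (Var 1) 0)))
    (BEx 1 (Plus (Var 0) One) (Conj (Eq (Var 0) (Plus (Plus (Var 1) (Var 1)) One)) (Mem (Var 1) 1)))"
  have b: "bounded ?f" by simp
  have s: "Sigma 1 ?f" unfolding One_nat_def by (rule SigmaPi, rule Pi0) simp
  have p: "Pi 1 ?f" unfolding One_nat_def by (rule PiSigma, rule Sigma0) simp
  have "delta1_comprehension SM S" using assms(1) unfolding rca0_def by blast
  from this[unfolded delta1_comprehension_def, rule_format, OF s p, of ?V "\<lambda>_. 0" 0]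
  have "{n. sat SM ?V ((\<lambda>_. 0)(0 := n)) ?f} \<in> S" using Z by simp
  moreover have "{n. sat SM ?V ((\<lambda>_. 0)(0 := n)) ?f} = join SM Z1 Z2"
    by (rule set_eqI) (auto simp: mem_join parith_less_Suc)
  ultimately have J: "join SM Z1 Z2 \<in> S" by simp
  interpret ind1 "join SM Z1 Z2" using J by (rule ind)
  show "\<exists>Z\<in>S. rec Z Z1 \<and> rec Z Z2" using J rec_join_left rec_join_right by blast
qed

context ideal
begin

sublocale directed S
  by (rule directed.intro) (fact ind1 upper nonempty)+

definition good_path :: "('a \<Rightarrow> 'a) \<Rightarrow> bool" where
  "good_path x \<longleftrightarrow> code_path x \<and> (\<forall>Z\<in>S. \<forall>\<phi> a. bounded \<phi> \<longrightarrow> meets_ind Z \<phi> a x \<and> meets_wphp Z \<phi> a x)"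

text \<open>On the segment up to \<open>n\<close> the requirement freezes the Sigma_1 predicate at
  one string \<open>x s\<close>, where it is Delta_1 in \<open>Z\<close>; induction for
  \<open>Z\<close> then suffices.\<close>

lemma good_path_ind1:
  assumes x: "good_path x" and Z: "Z \<in> S" shows "ind1 (join SM Z (set_of x))"
proof
  let ?Y = "join SM Z (set_of x)"
  interpret ind1 Z using Z by (rule ind1)
  have path: "code_path x" using x unfolding good_path_def by blast
  fix P :: "'a \<Rightarrow> bool" and n
  assume s: "s1 ?Y (\<lambda>e. P (e 0))" and 0: "P 0" and step: "\<And>n. P n \<Longrightarrow> P (n + 1)"
  obtain Q where Q: "d0 ?Y Q" "(\<lambda>e. P (e 0)) = (\<lambda>e. \<exists>a. Q (case_nat a e))" using s by (rule s1E)
  obtain \<phi> where \<phi>: "bounded \<phi>" "\<And>y c a b. sat SM (\<lambda>_. ?Y) (env4 y c a b) \<phi> =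
     Q (case_nat y (case_nat c (case_nat a (case_nat b (\<lambda>_. 0)))))" using d0_formula4[OF Q(1)] by blast
  have P: "P i \<longleftrightarrow> (\<exists>y. sat SM (\<lambda>_. ?Y) (env4 y i 0 0) \<phi>)" for i
    using fun_cong[OF Q(2), of "case_nat i (case_nat 0 (case_nat 0 (\<lambda>_. 0)))"] \<phi>(2) by simp
  obtain s where s: "\<And>k i. s \<le> k \<Longrightarrow> i < n + 1 \<Longrightarrow> Gt Z \<phi> k (x k) i 0 0 \<Longrightarrow> Gt Z \<phi> s (x s) i 0 0"
    using x Z \<phi>(1) unfolding good_path_def meets_ind_def by blast
  have PG: "P i \<longleftrightarrow> Gt Z \<phi> s (x s) i 0 0" if i: "i < n + 1" for i
  proof
    assume "P i"
    then obtain y where y: "sat SM (\<lambda>_. ?Y) (env4 y i 0 0) \<phi>" unfolding P by blast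
    \<comment> \<open>A length beyond the freezing stage \<open>s\<close>, the witness
      \<open>y\<close> and all digits consulted.\<close>
    let ?k = "s + (y + 1) + bd \<phi> (env4 y i 0 0)"
    have k: "s \<le> ?k" "y < ?k" "bd \<phi> (env4 y i 0 0) \<le> ?k"
      using emb_nonneg[of s] emb_nonneg[of y] emb_nonneg[of "bd \<phi> (env4 y i 0 0)"] unfolding emb_simps by linarith+
    show "Gt Z \<phi> s (x s) i 0 0" by (rule s[OF k(1) i Gt_complete[OF \<phi>(1) path y k(2,3)]])
  next
    show "Gt Z \<phi> s (x s) i 0 0 \<Longrightarrow> P i" unfolding P by (rule Gt_sound[OF \<phi>(1) path])
  qed
  have "i < n + 1 \<longrightarrow> Gt Z \<phi> s (x s) i 0 0" for i
  proof (induction i rule: d1_induct)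
    case 1 show ?case by (intro d1_intros d1_rel5[OF d1_Gt[OF \<phi>(1)]])
  next
    case 2 show ?case using PG[of 0] 0 by simp
  next
    case (3 i)
    show ?case
    proof
      assume i: "i + 1 < n + 1"
      then have "i < n + 1" using less_add_one[of i] by (rule less_trans[rotated])
      then have "P i" using 3 PG by blast
      then show "Gt Z \<phi> s (x s) (i + 1) 0 0" using step PG[OF i] by blast
    qed
  qed
  then show "P n" using PG[of n] by simp
qed

lemma good_path_directed: assumes "good_path x" shows "directed {join SM Z (set_of x) |Z. Z \<in> S}"
proof (rule directed.intro)
  let ?B = "{join SM Z (set_of x) |Z. Z \<in> S}"
  show "ind1 Y" if "Y \<in> ?B" for Y using that good_path_ind1[OF assms] by blast
  show "?B \<noteq> {}" using nonempty by blast
  fix Y1 Y2 assume "Y1 \<in> ?B" "Y2 \<in> ?B"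
  then obtain Z1 Z2 where Z12: "Z1 \<in> S" "Z2 \<in> S" "Y1 = join SM Z1 (set_of x)" "Y2 = join SM Z2 (set_of x)" by blast
  obtain Z where Z: "Z \<in> S" "rec Z Z1" "rec Z Z2" using upper[OF Z12(1,2)] by blast
  interpret ind1 "join SM Z (set_of x)" using good_path_ind1[OF assms Z(1)] .
  have "rec (join SM Z (set_of x)) Z1" "rec (join SM Z (set_of x)) Z2"
    using rec_trans[OF rec_join_left] Z(2,3) by blast+
  then show "\<exists>Y\<in>?B. rec Y Y1 \<and> rec Y Y2"
    unfolding Z12(3,4) using rec_join[OF _ rec_join_right] Z(1) by blast
qed

lemma extend_downset:
  assumes "good_path x" shows "extend SM S (set_of x) = directed.downset {join SM Z (set_of x) |Z. Z \<in> S}"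
proof -
  have "turing_le SM V (join SM Z (set_of x)) \<longleftrightarrow> rec (join SM Z (set_of x)) V" if "Z \<in> S" for V Z
  proof -
    interpret ind1 "join SM Z (set_of x)" using good_path_ind1[OF assms that] .
    show ?thesis using turing_rec[OF _ rec_refl] rec_turing by blast
  qed
  then show ?thesis unfolding extend_def directed.downset_def[OF good_path_directed[OF assms]] by blast
qed

text \<open>Let \<open>a0\<close> be the argument singled out by the requirement, \<open>b\<close>
  its value and \<open>c\<close> a witness of \<open>R a0 b\<close>. By injectivity no other
  argument has the value \<open>b\<close>, so all rival witnesses up to \<open>c\<close> are
  refuted, and by collection they are refuted by a common length. The requirement then refutes
  \<open>c\<close> as well, a contradiction.\<close>

lemma good_path_wphp2:
  assumes x: "good_path x" shows "wphp2 SM (extend SM S (set_of x))"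
  unfolding wphp2_def
proof (rule notI, elim exE conjE)
  fix \<phi>0 and V :: "nat \<Rightarrow> 'a set" and e i j k
  let ?X = "set_of x"
  interpret D: directed "{join SM Z ?X |Z. Z \<in> S}" using good_path_directed[OF x] .
  assume \<phi>0: "Sigma 2 \<phi>0" and ij: "i \<noteq> j" and V: "\<forall>i. V i \<in> extend SM S ?X" and k: "le SM (sone SM) k"
    and R0: "let R = (\<lambda>a b. sat SM V (e(i := a, j := b)) \<phi>0); x2 = sadd SM k k in
            (\<forall>a. sless SM a x2 \<longrightarrow> (\<exists>b. sless SM b k \<and> R a b)) \<and>
            (\<forall>a b b'. sless SM a x2 \<longrightarrow> R a b \<longrightarrow> R a b' \<longrightarrow> b = b') \<and>
            (\<forall>a a' b. sless SM a x2 \<longrightarrow> sless SM a' x2 \<longrightarrow> R a b \<longrightarrow> R a' b \<longrightarrow> a = a')"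
  define R where "R a b = sat SM V (e(i := a, j := b)) \<phi>0" for a b
  have tot: "\<And>a. a < k + k \<Longrightarrow> \<exists>b<k. R a b"
    and inj: "\<And>a a' b. a < k + k \<Longrightarrow> a' < k + k \<Longrightarrow> R a b \<Longrightarrow> R a' b \<Longrightarrow> a = a'"
    using R0 unfolding R_def Let_def SM_simps by blast+
  have k1: "1 \<le> k" using k unfolding le_def by auto
  have path: "code_path x" using x unfolding good_path_def by blast
  obtain Y V' where Y: "Y \<in> {join SM Z ?X |Z. Z \<in> S}" "\<forall>k. rec Y (V' k)" "\<forall>e. sat SM V e \<phi>0 = sat SM V' e \<phi>0"
    using D.formula_oracle[of V \<phi>0] V unfolding extend_downset[OF x] by blast
  obtain Z where Z: "Z \<in> S" "Y = join SM Z ?X" using Y(1) by blast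
  interpret ind1 Y using Y(1) by (rule D.base_ind1)
  have "tm (\<lambda>e'. (e(i := e' 0, j := e' (Suc 0))) l)" for l by (cases "l = j"; cases "l = i") (auto intro: tm.intros)
  from s2_subst[OF sat_Sigma2[OF \<phi>0, of V'], of "\<lambda>e'. e(i := e' 0, j := e' (Suc 0))", OF _ this]
  have "s2 Y (\<lambda>e'. R (e' 0) (e' (Suc 0)))" unfolding R_def using Y(2,3) by simp
  then obtain Q1 where Q1: "s1 Y Q1" "(\<lambda>e. R (e 0) (e (Suc 0))) = (\<lambda>e. \<exists>a. \<not> Q1 (case_nat a e))" by (rule s2E)
  obtain Q where Q: "d0 Y Q" "Q1 = (\<lambda>e. \<exists>a. Q (case_nat a e))" using Q1(1) by (rule s1E)
  obtain \<phi> where \<phi>: "bounded \<phi>" "\<And>y c a b. sat SM (\<lambda>_. Y) (env4 y c a b) \<phi> =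
     Q (case_nat y (case_nat c (case_nat a (case_nat b (\<lambda>_. 0)))))" using d0_formula4[OF Q(1)] by blast
  have R: "R a b \<longleftrightarrow> (\<exists>c. \<forall>y. \<not> sat SM (\<lambda>_. Y) (env4 y c a b) \<phi>)" for a b
    using fun_cong[OF Q1(2), of "case_nat a (case_nat b (\<lambda>_. 0))"] \<phi>(2) Q(2) by simp
  have "meets_wphp Z \<phi> k x" using x Z(1) \<phi>(1) unfolding good_path_def by blast
  then obtain m a0 where a0: "a0 < k + k" and sp: "\<And>w. \<exists>n\<ge>w. \<forall>b<k. \<forall>u<w. \<forall>s<w.
     Gt Z \<phi> (m + n) (x (m + n)) u a0 b \<or>
     (\<exists>a'<k + k. \<exists>u'\<le>u. (u' < u \<or> a' < a0) \<and> a' \<noteq> a0 \<and> \<not> Gt Z \<phi> (m + s) (x (m + s)) u' a' b)"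
    using k1 unfolding meets_wphp_def by blast
  obtain b where b: "b < k" "R a0 b" using tot[OF a0] by blast
  obtain c where c: "\<And>y. \<not> sat SM (\<lambda>_. Y) (env4 y c a0 b) \<phi>" using b(2) unfolding R by blast
  have ex: "\<exists>y. sat SM (\<lambda>_. Y) (env4 y u a' b) \<phi>" if "a' < k + k" "a' \<noteq> a0" for a' u
    using inj[OF that(1) a0 _ b(2)] that(2) unfolding R[of a' b] by blast
  have dsat: "d1 Y (\<lambda>e. sat SM (\<lambda>_. Y) (env4 (e 0) (e (Suc 0)) (e (Suc (Suc 0))) b) \<phi>)"
    using d1_subst[OF sat_bounded_d1[OF \<phi>(1), of "\<lambda>_. Y"], of "\<lambda>e. env4 (e 0) (e (Suc 0)) (e (Suc (Suc 0))) b"]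
    by (simp add: rec_refl tm_env4 tm.intros)
  note dsat' = d1_rel3[where R="\<lambda>y u a. sat SM (\<lambda>_. Y) (env4 y u a b) \<phi>", OF dsat]
  \<comment> \<open>Collection is applied twice: over all \<open>u \<le> c\<close> for fixed
    \<open>a'\<close>, and then over all \<open>a'\<close>.\<close>
  have 1: "\<exists>D. \<forall>u<c + 1. a' \<noteq> a0 \<longrightarrow> (\<exists>y<D. sat SM (\<lambda>_. Y) (env4 y u a' b) \<phi>)" if "a' < k + k" for a'
  proof (cases "a' = a0")
    case False
    have "s1 Y (\<lambda>e. sat SM (\<lambda>_. Y) (env4 (e (Suc 0)) (e 0) a' b) \<phi>)" by (intro d1_s1 dsat' d1_intros)
    from collection[where R="\<lambda>u y. sat SM (\<lambda>_. Y) (env4 y u a' b) \<phi>" and n="c + 1", OF this ex[OF that False]]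
    show ?thesis by blast
  qed simp
  have "s1 Y (\<lambda>e. \<forall>u<c + 1. e 0 \<noteq> a0 \<longrightarrow> (\<exists>y<e (Suc 0). sat SM (\<lambda>_. Y) (env4 y u (e 0) b) \<phi>))"
    by (intro d1_s1 d1_intros dsat')
  from collection[where R="\<lambda>a' D. \<forall>u<c + 1. a' \<noteq> a0 \<longrightarrow> (\<exists>y<D. sat SM (\<lambda>_. Y) (env4 y u a' b) \<phi>)" and n="k + k", OF this 1]
  obtain D where D: "\<forall>a'<k + k. \<exists>D'<D. \<forall>u<c + 1. a' \<noteq> a0 \<longrightarrow> (\<exists>y<D'. sat SM (\<lambda>_. Y) (env4 y u a' b) \<phi>)" by blast
  \<comment> \<open>\<open>D\<close> bounds the refuting witnesses, and by monotonicity of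
    \<open>bd\<close> the second summand bounds the digits consulted by all instances.\<close>
  define s where "s = D + bd \<phi> (env4 D c (k + k) b)"
  have G: "Gt Z \<phi> (m + s) (x (m + s)) u a' b" if a': "a' < k + k" "a' \<noteq> a0" "u \<le> c" for a' u
  proof -
    have u: "u < c + 1" using a'(3) by (auto simp: parith_less_Suc)
    obtain D' where D': "D' < D" "\<forall>u<c + 1. a' \<noteq> a0 \<longrightarrow> (\<exists>y<D'. sat SM (\<lambda>_. Y) (env4 y u a' b) \<phi>)"
      using D a'(1) by blast
    obtain y where y: "D' < D" "y < D'" "sat SM (\<lambda>_. Y) (env4 y u a' b) \<phi>" using D' u a'(2) by blast
    have yD: "y < D" using y(2,1) by (rule less_trans)
    have "bd \<phi> (env4 y u a' b) \<le> bd \<phi> (env4 D c (k + k) b)"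
      by (rule bd_mono) (use yD a' in \<open>auto simp: env4_def\<close>)
    then have 2: "bd \<phi> (env4 y u a' b) \<le> m + s" unfolding s_def using emb_nonneg[of D] emb_nonneg[of m] unfolding emb_simps by linarith
    have 1: "y < m + s" unfolding s_def
      using yD emb_nonneg[of "bd \<phi> (env4 D c (k + k) b)"] emb_nonneg[of m] unfolding emb_simps by linarith
    show ?thesis by (rule Gt_complete[OF \<phi>(1) path _ 1 2]) (use y(3) Z(2) in simp)
  qed
  define w where "w = max c s + 1"
  have w: "c < w" "s < w" unfolding w_def by (simp_all add: parith_less_Suc)
  obtain n where n: "Gt Z \<phi> (m + n) (x (m + n)) c a0 b \<or>
     (\<exists>a'<k + k. \<exists>u'\<le>c. (u' < c \<or> a' < a0) \<and> a' \<noteq> a0 \<and> \<not> Gt Z \<phi> (m + s) (x (m + s)) u' a' b)"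
    using sp[of w] b(1) w by blast
  then have "Gt Z \<phi> (m + n) (x (m + n)) c a0 b" using G by blast
  from Gt_sound[OF \<phi>(1) path this] show False using c Z(2) by blast
qed

text \<open>\<open>T\<close> is Pi_2, so membership is a conjunction over \<open>u\<close> of
  Sigma_1 statements \<open>B u s\<close>. Imposing only those with \<open>u \<le> n\<close> at
  level \<open>n\<close> gives a tree that contains \<open>T\<close> level by level, whose paths
  satisfy all of them, and whose levels come from coded segments of a Sigma_1 set.\<close>

lemma initial_condition:
  assumes \<psi>: "Pi 2 \<psi>" and V: "\<And>i. V i \<in> S" and T: "\<And>s. s \<in> T \<longleftrightarrow> sat SM V (e(x := s)) \<psi>"
    and tree: "is_tree SM T" and q: "0 < q" and mu: "mu_ge SM T (q + (p + p)) (q + q)"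
  shows "\<exists>U. cond (0, 0, U) \<and> (\<forall>x. code_path x \<longrightarrow> inC (0, 0, U) x \<longrightarrow> in_paths SM T (set_of x))"
proof -
  have "V i \<in> downset" for i unfolding downset_def using V ind1.rec_refl ind1 by blast
  then obtain Z V' where Z: "Z \<in> S" "\<forall>k. rec Z (V' k)" "\<forall>e. sat SM V e \<psi> = sat SM V' e \<psi>"
    using formula_oracle by blast
  interpret ind1 Z using Z(1) by (rule ind1)
  have "tm (\<lambda>e'. (e(x := e' 0)) i)" for i by (cases "i = x") (auto intro: tm.intros)
  from s2_subst[OF sat_Pi2[OF \<psi>, of V'], of "\<lambda>e'. e(x := e' 0)", OF _ this]
  have "s2 Z (\<lambda>e. e 0 \<notin> T)" using Z(2,3) by (simp add: T)
  then obtain Q where Q: "s1 Z Q" "(\<lambda>e. e 0 \<notin> T) = (\<lambda>e. \<exists>a. \<not> Q (case_nat a e))" by (rule s2E)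
  define B where "B u s = Q (case_nat u (case_nat s (\<lambda>_. 0)))" for u s
  have TB: "s \<notin> T \<longleftrightarrow> (\<exists>u. \<not> B u s)" for s using fun_cong[OF Q(2), of "case_nat s (\<lambda>_. 0)"] unfolding B_def by simp
  have sB: "s1 Z (\<lambda>e. B (e 0) (e (Suc 0)))" unfolding B_def
    by (rule s1_subst[OF Q(1)]) (intro tm_case_nat tm.intros)
  define W where "W v \<longleftrightarrow> (\<exists>u s. v = pr u s \<and> B u s)" for v
  have sW: "s1 Z (\<lambda>e. W (e 0))" unfolding W_def by (intro s1_ex s1_conj s1_rel2[OF sB] d1_intros; intro d1_s1 d1_intros d1f_pr)
  have W: "W (pr u s) \<longleftrightarrow> B u s" for u s unfolding W_def by (auto simp: pr_inj)
  \<comment> \<open>A bound for \<open>u\<close> and for the codes of all strings of length at most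
    \<open>n\<close>, leading digit included.\<close>
  define N where "N n = n + (pw n + pw n)" for n :: 'a
  define H where "H n c \<tau> \<longleftrightarrow> (\<forall>i\<le>n. \<forall>u\<le>n. bt c (pr u (pw i + md \<tau> (pw i))))" for n c \<tau> :: 'a
  define U where "U n = mk (pw n) (H n (mk (pr (N n) (N n) + 1) W))" for n :: 'a
  have dH: "d1 Z (\<lambda>e. H (e (Suc 0)) (e (Suc (Suc 0))) (e 0))"
    unfolding H_def by (intro d1_intros d1_bt d1f_pr d1f_pw d1f_md)
  have codH: "cod (H n c)" for n c :: 'a unfolding H_def by (rule d1_cod) (intro d1_intros d1_bt d1f_pr d1f_pw d1f_md)
  have btU: "bt (U n) \<tau> \<longleftrightarrow> \<tau> < pw n \<and> (\<forall>i\<le>n. \<forall>u\<le>n. B u (pw i + md \<tau> (pw i)))" for n \<tau> :: 'a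
  proof -
    have "pr u (pw i + md \<tau> (pw i)) < pr (N n) (N n) + 1" if "i \<le> n" "u \<le> n" for i u
    proof (rule pr_mono)
      show "u \<le> N n" unfolding N_def using that(2) by (rule order_trans) simp
      have "pw i + md \<tau> (pw i) \<le> pw n + pw n"
        using pw_mono[OF that(1)] md_pw_less[of \<tau> i] unfolding emb_simps by linarith
      then show "pw i + md \<tau> (pw i) \<le> N n" unfolding N_def by (rule order_trans) simp
    qed
    then show ?thesis unfolding U_def bt_mk[OF codH] H_def bt_mk[OF s1_cod[OF sW]] W by blast
  qed
  have dG: "d1f Z (\<lambda>e. mk (pw (e 0)) (H (e 0) (e (Suc 0))))"
    by (rule d1f_mk[where n="\<lambda>e. pw (e 0)" and P="\<lambda>e. H (e 0) (e (Suc 0))"]) (intro d1f_pw d1_intros, rule dH)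
  have "z2 Z U" unfolding U_def
    by (rule z2_code[OF sW, where \<beta>="\<lambda>n. pr (N n) (N n) + 1" and G="\<lambda>n c. mk (pw n) (H n c)"])
      (unfold N_def, intro d1f_pr d1_intros d1f_pw, rule dG)
  moreover have "tree U"
    unfolding tree_def btU
  proof (intro allI impI conjI)
    fix n \<tau> m i u assume *: "\<tau> < pw n \<and> (\<forall>i\<le>n. \<forall>u\<le>n. B u (pw i + md \<tau> (pw i)))" and m: "m \<le> n" "i \<le> m" "u \<le> m"
    show "B u (pw i + md (md \<tau> (pw m)) (pw i))" unfolding md_md[OF m(2)] using * m by (meson order_trans)
  qed auto
  moreover have "dense 1 16 U"
    unfolding dense_def
  proof
    fix n :: 'a
    obtain c k y where c: "coded SM c \<subseteq> {s \<in> T. strlen SM s n}" "mcard SM c k" "pow2 SM n y"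
      "le SM (smul SM (q + (p + p)) y) (smul SM k (q + q))" using mu unfolding mu_ge_def by blast
    have k: "k = cnt c (bt c)" using c(2) unfolding mcard_iff by (simp add: cnt_code)
    have y: "y = pw n" using c(3) unfolding pow2_iff .
    have sub: "s \<in> T \<and> strlen SM s n" if "bt c s" for s using c(1) that unfolding coded_def bit_iff by blast
    have "k \<le> cnt (pw n) (bt (U n))" unfolding k
    proof (rule cnt_image[OF _ cod_bt cod_bt])
      show "d1f Z (\<lambda>e. pw n + e 0)" by (intro d1_intros)
      fix s assume "bt c s"
      then have s: "s \<in> T" "strlen SM s n" using sub by auto
      obtain \<tau> where \<tau>: "\<tau> < pw n" "s = pw n + \<tau>" using strlenE[OF s(2)] by blast
      have "B u (pw i + md \<tau> (pw i))" if "i \<le> n" for i u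
      proof -
        have "pw i + md \<tau> (pw i) \<in> T" using tree s(1) prefix_string[OF \<tau>(1) that] unfolding is_tree_def \<tau>(2) by blast
        then show ?thesis using TB by blast
      qed
      then show "\<exists>v<pw n. bt (U n) v \<and> pw n + v = s" using \<tau> unfolding btU by blast
    qed
    \<comment> \<open>The fraction of \<open>q + 2p\<close> over \<open>2q\<close> is
      \<open>1/2\<close> plus the surplus \<open>p / q\<close>; half of all strings is already more
      than the \<open>1/16\<close> demanded.\<close>
    moreover have "(q + (p + p)) * pw n \<le> k * (q + q)" using c(4) unfolding y le_def by auto
    then have "q * pw n \<le> q * (2 * k)"
      using mult_nonneg_nonneg[OF emb_nonneg[of p] emb_nonneg[of "pw n"]] unfolding emb_simps by (simp add: emb_simps algebra_simps)
    then have "pw n \<le> 2 * k" using q by (rule mult_left_le_imp_le)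
    ultimately show "1 * pw n \<le> 16 * cnt (pw n) (bt (U n))"
      using emb_nonneg[of "cnt (pw n) (bt (U n))"] unfolding emb_simps by (simp add: emb_simps)
  qed
  ultimately have "cond (0, 0, U)" unfolding cond_def using Z(1) by auto
  moreover have "in_paths SM T (set_of x)" if x: "code_path x" "inC (0, 0, U) x" for x
    unfolding in_paths_def
  proof
    fix n :: 'a
    have xU: "bt (U k) (x k)" for k using x(2) by auto
    have xl: "x n < pw n" using x(1) unfolding code_path_def by blast
    have "pw n + x n \<in> T"
    proof (rule ccontr)
      assume "pw n + x n \<notin> T"
      \<comment> \<open>Failure of membership has a witness \<open>u\<close>, which the tree takes
        into account from level \<open>u\<close> on.\<close>
      then obtain u where u: "\<not> B u (pw n + x n)" using TB by blast
      have "B u (pw n + md (x (max n u)) (pw n))" using xU[of "max n u"] unfolding btU by simp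
      moreover have "md (x (max n u)) (pw n) = x n" using x(1) unfolding code_path_def by simp
      ultimately show False using u by simp
    qed
    moreover have "\<forall>i. sless SM i n \<longrightarrow> bit SM (pw n + x n) i = (i \<in> set_of x)"
      using bt_string[OF xl] bt_path[OF x(1), of n] by (simp add: bit_iff)
    ultimately show "\<exists>s\<in>T. strlen SM s n \<and> (\<forall>i. sless SM i n \<longrightarrow> bit SM s i = (i \<in> set_of x))"
      using strlen_string[OF xl] by blast
  qed
  ultimately show ?thesis by blast
qed

end

theorem parith_random_extension:
  fixes S :: "'a::parith set set"
  assumes "countable S" "rca0 SM S" "wphp2 SM S" "is_tree SM T" "delta02 SM S T"
    "0 < q" "mu_ge SM T (q + (p + p)) (q + q)"
  shows "\<exists>X. in_paths SM T X \<and> rca0 SM (extend SM S X) \<and> wphp2 SM (extend SM S X)"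
proof -
  obtain \<psi> V e x where \<psi>: "Pi 2 \<psi>" "\<And>i. V i \<in> S" "\<And>s. s \<in> T \<longleftrightarrow> sat SM V (e(x := s)) \<psi>"
    using assms(5) unfolding delta02_def by blast
  interpret ideal S using ideal_of_model[OF assms(2,3)] \<psi>(2) by blast
  obtain U where U: "cond (0, 0, U)" "\<And>x. code_path x \<Longrightarrow> inC (0, 0, U) x \<Longrightarrow> in_paths SM T (set_of x)"
    using initial_condition[OF \<psi> assms(4,6,7)] by blast
  obtain x where x: "code_path x" "inC (0, 0, U) x" "good_path x"
    using generic_path[OF assms(1) U(1)] unfolding good_path_def by blast
  interpret D: directed "{join SM Z (set_of x) |Z. Z \<in> S}" using good_path_directed[OF x(3)] .
  show ?thesis
    using U(2)[OF x(1,2)] good_path_wphp2[OF x(3)] D.rca0_downset unfolding extend_downset[OF x(3), symmetric]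
    by blast
qed

section \<open>Transport along isomorphisms\<close>

definition struc_rel :: "('a \<Rightarrow> 'b \<Rightarrow> bool) \<Rightarrow> 'a struc \<Rightarrow> 'b struc \<Rightarrow> bool" where
  "struc_rel R A B \<longleftrightarrow> R (szero A) (szero B) \<and> R (sone A) (sone B) \<and>
     rel_fun R (rel_fun R R) (sadd A) (sadd B) \<and> rel_fun R (rel_fun R R) (smul A) (smul B) \<and>
     rel_fun R (rel_fun R (=)) (sless A) (sless B)"

text \<open>A statement about the structure alone, so that it can be moved along isomorphisms and
  tested on one representative.\<close>

definition extension_property :: "'m struc \<Rightarrow> bool" where
  "extension_property A \<longleftrightarrow> (\<forall>S T p q. countable S \<longrightarrow> rca0 A S \<longrightarrow> wphp2 A S \<longrightarrow> is_tree A T \<longrightarrow>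
     delta02 A S T \<longrightarrow> sless A (sadd A p p) q \<longrightarrow> mu_ge A T (sadd A q (sadd A p p)) (sadd A q q) \<longrightarrow>
     (\<exists>X. in_paths A T X \<and> rca0 A (extend A S X) \<and> wphp2 A (extend A S X)))"

section \<open>Invariance of the notions of the statement under isomorphism\<close>

context
  includes lifting_syntax
  fixes R :: "'a \<Rightarrow> 'b \<Rightarrow> bool"
  assumes R [transfer_rule]: "bi_unique R" "bi_total R"
begin

lemma struc_rel_ops [transfer_rule]:
  "(struc_rel R ===> R) szero szero" "(struc_rel R ===> R) sone sone"
  "(struc_rel R ===> R ===> R ===> R) sadd sadd" "(struc_rel R ===> R ===> R ===> R) smul smul"
  "(struc_rel R ===> R ===> R ===> (=)) sless sless"
  unfolding struc_rel_def rel_fun_def by blast+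

lemma ev_transfer [transfer_rule]: "(struc_rel R ===> ((=) ===> R) ===> (=) ===> R) ev ev"
proof (intro rel_funI)
  fix A B and e :: "nat \<Rightarrow> 'a" and e' :: "nat \<Rightarrow> 'b" and t t' :: trm
  assume A [transfer_rule]: "struc_rel R A B" and e: "((=) ===> R) e e'" and t: "t = t'"
  have "R (ev A e t) (ev B e' t)"
  proof (induction t)
    case (Plus s t)
    note [transfer_rule] = Plus.IH
    show ?case unfolding ev.simps by transfer_prover
  next
    case (Times s t)
    note [transfer_rule] = Times.IH
    show ?case unfolding ev.simps by transfer_prover
  qed (use A e in \<open>simp_all add: struc_rel_def rel_fun_def\<close>)
  then show "R (ev A e t) (ev B e' t')" using t by simp
qed

lemma sat_transfer [transfer_rule]: "(struc_rel R ===> ((=) ===> rel_set R) ===> ((=) ===> R) ===> (=) ===> (=)) sat sat"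
proof (intro rel_funI)
  fix A B and V :: "nat \<Rightarrow> 'a set" and V' :: "nat \<Rightarrow> 'b set"
    and e :: "nat \<Rightarrow> 'a" and e' :: "nat \<Rightarrow> 'b" and \<phi> \<phi>' :: fm
  assume A [transfer_rule]: "struc_rel R A B" and V [transfer_rule]: "((=) ===> rel_set R) V V'"
    and "((=) ===> R) e e'" and "\<phi> = \<phi>'"
  moreover have "sat A V e \<phi> = sat B V' e' \<phi>" using \<open>((=) ===> R) e e'\<close>
  proof (induction \<phi> arbitrary: e e')
    case (Eq s t)
    note [transfer_rule] = Eq.prems
    show ?case unfolding sat.simps by transfer_prover
  next
    case (Less s t)
    note [transfer_rule] = Less.prems
    show ?case unfolding sat.simps by transfer_prover
  next
    case (Mem s t)
    note [transfer_rule] = Mem.prems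
    show ?case unfolding sat.simps by transfer_prover
  next
    case (Ex x \<phi>)
    have s: "sat A V (e(x := a)) \<phi> = sat B V' (e'(x := b)) \<phi>" if "R a b" for a b
      by (rule Ex.IH) (use Ex.prems that in \<open>simp add: rel_fun_def\<close>)
    show ?case unfolding sat.simps
      by (rule rel_funD[OF Ex_transfer[OF R(2)]], rule rel_funI) (simp add: s)
  next
    case (All x \<phi>)
    have s: "sat A V (e(x := a)) \<phi> = sat B V' (e'(x := b)) \<phi>" if "R a b" for a b
      by (rule All.IH) (use All.prems that in \<open>simp add: rel_fun_def\<close>)
    show ?case unfolding sat.simps
      by (rule rel_funD[OF All_transfer[OF R(2)]], rule rel_funI) (simp add: s)
  next
    case (BEx x t \<phi>)
    have s: "sat A V (e(x := a)) \<phi> = sat B V' (e'(x := b)) \<phi>" if "R a b" for a b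
      by (rule BEx.IH) (use BEx.prems that in \<open>simp add: rel_fun_def\<close>)
    note [transfer_rule] = BEx.prems
    have l: "(R ===> (=)) (\<lambda>a. sless A a (ev A e t)) (\<lambda>b. sless B b (ev B e' t))" by transfer_prover
    show ?case unfolding sat.simps
      by (rule rel_funD[OF Ex_transfer[OF R(2)]], rule rel_funI) (simp add: s rel_funD[OF l])
  next
    case (BAll x t \<phi>)
    have s: "sat A V (e(x := a)) \<phi> = sat B V' (e'(x := b)) \<phi>" if "R a b" for a b
      by (rule BAll.IH) (use BAll.prems that in \<open>simp add: rel_fun_def\<close>)
    note [transfer_rule] = BAll.prems
    have l: "(R ===> (=)) (\<lambda>a. sless A a (ev A e t)) (\<lambda>b. sless B b (ev B e' t))" by transfer_prover
    show ?case unfolding sat.simps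
      by (rule rel_funD[OF All_transfer[OF R(2)]], rule rel_funI) (simp add: s rel_funD[OF l])
  qed simp_all
  ultimately show "sat A V e \<phi> = sat B V' e' \<phi>'" by simp
qed

text \<open>A bi-unique relation between collections is the graph of a bijection.\<close>

lemma countable_transfer [transfer_rule]: "(rel_set (rel_set R) ===> (=)) countable countable"
proof
  fix S S' assume "rel_set (rel_set R) S S'"
  moreover have "bi_unique (rel_set R)" using R(1) by (rule bi_unique_rel_set)
  ultimately obtain f where "S' = f ` S" "inj_on f S" using bi_unique_rel_set_lemma by metis
  then show "countable S = countable S'" by (simp add: countable_image_inj_eq)
qed

lemma le_transfer [transfer_rule]: "(struc_rel R ===> R ===> R ===> (=)) le le"
  unfolding le_def by transfer_prover

lemma basic_axioms_transfer [transfer_rule]: "(struc_rel R ===> (=)) basic_axioms basic_axioms"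
  unfolding basic_axioms_def by transfer_prover

lemma sigma1_induction_transfer [transfer_rule]:
  "(struc_rel R ===> rel_set (rel_set R) ===> (=)) sigma1_induction sigma1_induction"
  unfolding sigma1_induction_def by transfer_prover

lemma delta1_comprehension_transfer [transfer_rule]:
  "(struc_rel R ===> rel_set (rel_set R) ===> (=)) delta1_comprehension delta1_comprehension"
  unfolding delta1_comprehension_def by transfer_prover

lemma rca0_transfer [transfer_rule]: "(struc_rel R ===> rel_set (rel_set R) ===> (=)) rca0 rca0"
  unfolding rca0_def by transfer_prover

lemma wphp2_transfer [transfer_rule]: "(struc_rel R ===> rel_set (rel_set R) ===> (=)) wphp2 wphp2"
  unfolding wphp2_def by transfer_prover

lemma beta_transfer [transfer_rule]: "(struc_rel R ===> R ===> R ===> R ===> R ===> (=)) beta beta"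
  unfolding beta_def by transfer_prover

lemma pow2_transfer [transfer_rule]: "(struc_rel R ===> R ===> R ===> (=)) pow2 pow2"
  unfolding pow2_def by transfer_prover

lemma bit_transfer [transfer_rule]: "(struc_rel R ===> R ===> R ===> (=)) bit bit"
  unfolding bit_def by transfer_prover

lemma coded_transfer [transfer_rule]: "(struc_rel R ===> R ===> rel_set R) coded coded"
  unfolding coded_def by transfer_prover

lemma mcard_transfer [transfer_rule]: "(struc_rel R ===> R ===> R ===> (=)) mcard mcard"
  unfolding mcard_def by transfer_prover

lemma strlen_transfer [transfer_rule]: "(struc_rel R ===> R ===> R ===> (=)) strlen strlen"
  unfolding strlen_def by transfer_prover

lemma prefix_of_transfer [transfer_rule]: "(struc_rel R ===> R ===> R ===> (=)) prefix_of prefix_of"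
  unfolding prefix_of_def by transfer_prover

lemma is_tree_transfer [transfer_rule]: "(struc_rel R ===> rel_set R ===> (=)) is_tree is_tree"
  unfolding is_tree_def by transfer_prover

lemma delta02_transfer [transfer_rule]:
  "(struc_rel R ===> rel_set (rel_set R) ===> rel_set R ===> (=)) delta02 delta02"
  unfolding delta02_def by transfer_prover

lemma in_paths_transfer [transfer_rule]: "(struc_rel R ===> rel_set R ===> rel_set R ===> (=)) in_paths in_paths"
  unfolding in_paths_def by transfer_prover

lemma mu_ge_transfer [transfer_rule]: "(struc_rel R ===> rel_set R ===> R ===> R ===> (=)) mu_ge mu_ge"
  unfolding mu_ge_def by transfer_prover

lemma restr_code_transfer [transfer_rule]:
  "(struc_rel R ===> rel_set R ===> R ===> R ===> (=)) restr_code restr_code"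
  unfolding restr_code_def by transfer_prover

lemma turing_le_transfer [transfer_rule]:
  "(struc_rel R ===> rel_set R ===> rel_set R ===> (=)) turing_le turing_le"
  unfolding turing_le_def by transfer_prover

lemma join_transfer [transfer_rule]: "(struc_rel R ===> rel_set R ===> rel_set R ===> rel_set R) join join"
  unfolding join_def by transfer_prover

lemma extend_transfer [transfer_rule]:
  "(struc_rel R ===> rel_set (rel_set R) ===> rel_set R ===> rel_set (rel_set R)) extend extend"
  unfolding extend_def by transfer_prover

lemma extension_property_transfer [transfer_rule]: "(struc_rel R ===> (=)) extension_property extension_property"
  unfolding extension_property_def by transfer_prover

end

text \<open>Enough for the laws of an ordered semiring. The collection \<open>{{}}\<close> restricts
  Sigma_1 induction to the empty set as set parameter, so it is inherited from any model whose
  collection contains that set.\<close>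

definition weak_arith :: "'m struc \<Rightarrow> bool" where
  "weak_arith A \<longleftrightarrow> basic_axioms A \<and> sigma1_induction A {{}}"

lemma weak_arith_transfer [transfer_rule]:
  assumes [transfer_rule]: "bi_unique R" "bi_total R"
  shows "rel_fun (struc_rel R) (=) weak_arith weak_arith"
  unfolding weak_arith_def by transfer_prover

text \<open>A type cannot depend on the structure given in the theorem, so the theorem is proved on one type
whose structure is a counterexample on the natural numbers if there is any.\<close>

definition candidate :: "nat struc" where
  "candidate = (SOME A. weak_arith A \<and>
     ((\<exists>B::nat struc. weak_arith B \<and> \<not> extension_property B) \<longrightarrow> \<not> extension_property A))"

text \<open>The standard model guarantees that the choice of \<open>candidate\<close> is satisfiable
  even when there is no counterexample.\<close>

lemma weak_arith_nat: "weak_arith \<lparr>szero = 0::nat, sone = 1, sadd = (+), smul = (*), sless = (<)\<rparr>"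
  unfolding weak_arith_def
proof
  let ?N = "\<lparr>szero = 0::nat, sone = 1, sadd = (+), smul = (*), sless = (<)\<rparr>"
  show "basic_axioms ?N" unfolding basic_axioms_def by (auto simp: less_Suc_eq)
  show "sigma1_induction ?N {{}}"
    unfolding sigma1_induction_def
  proof (intro allI impI, elim conjE)
    fix \<phi> and V :: "nat \<Rightarrow> nat set" and e x n
    assume "sat ?N V (e(x := szero ?N)) \<phi>"
      and "\<forall>n. sat ?N V (e(x := n)) \<phi> \<longrightarrow> sat ?N V (e(x := sadd ?N n (sone ?N))) \<phi>"
    then show "sat ?N V (e(x := n)) \<phi>" by (induction n) auto
  qed
qed

lemma weak_arith_candidate: "weak_arith candidate"
  and candidate_counterexample:
    "weak_arith (B :: nat struc) \<Longrightarrow> extension_property candidate \<Longrightarrow> extension_property B"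
proof -
  have "\<exists>A::nat struc. weak_arith A \<and>
     ((\<exists>B::nat struc. weak_arith B \<and> \<not> extension_property B) \<longrightarrow> \<not> extension_property A)"
  proof (cases "\<exists>B::nat struc. weak_arith B \<and> \<not> extension_property B")
    case False
    then show ?thesis by (intro exI[of _ "\<lparr>szero = 0::nat, sone = 1, sadd = (+), smul = (*), sless = (<)\<rparr>"] conjI weak_arith_nat impI) blast
  qed blast
  from someI_ex[OF this] have *: "weak_arith candidate \<and>
     ((\<exists>B::nat struc. weak_arith B \<and> \<not> extension_property B) \<longrightarrow> \<not> extension_property candidate)"
    unfolding candidate_def .
  show "weak_arith candidate" using * by blast
  show "weak_arith (B :: nat struc) \<Longrightarrow> extension_property candidate \<Longrightarrow> extension_property B" using * by blast
qed

text \<open>A copy of the natural numbers free of their class instances, so that it can carry the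
  operations of \<open>candidate\<close>.\<close>

datatype element = Element (index: nat)

instantiation element :: "{zero, one, plus, times, ord}"
begin
definition "0 = Element (szero candidate)"
definition "1 = Element (sone candidate)"
definition "x + y = Element (sadd candidate (index x) (index y))"
definition "x * y = Element (smul candidate (index x) (index y))"
definition "x < y \<longleftrightarrow> sless candidate (index x) (index y)"
definition "x \<le> y \<longleftrightarrow> x < y \<or> x = (y::element)"
instance ..
end

definition element_struc :: "element struc" where
  "element_struc = \<lparr>szero = 0, sone = 1, sadd = (+), smul = (*), sless = (<)\<rparr>"

lemma element_struc_simps [simp]:
  "szero element_struc = 0" "sone element_struc = 1" "sadd element_struc = (+)"
  "smul element_struc = (*)" "sless element_struc = (<)"
  by (simp_all add: element_struc_def)

lemma element_rel: "bi_unique (\<lambda>x y. y = Element x)" "bi_total (\<lambda>x y. y = Element x)"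
  "struc_rel (\<lambda>x y. y = Element x) candidate element_struc"
proof -
  show "bi_total (\<lambda>x y. y = Element x)" unfolding bi_total_def by (auto intro: element.exhaust)
qed (simp_all add: bi_unique_def struc_rel_def rel_fun_def zero_element_def one_element_def
    plus_element_def times_element_def less_element_def)

lemma weak_arith_element: "weak_arith element_struc"
  using rel_funD[OF weak_arith_transfer[OF element_rel(1,2)] element_rel(3)] weak_arith_candidate by simp

section \<open>The laws of an ordered semiring from Sigma_1 induction\<close>

lemma element_axioms:
  "n + 1 \<noteq> (0::element)" "m + 1 = n + 1 \<Longrightarrow> m = n" "m + 0 = m" "m + (n + 1) = m + n + 1"
  "m * 0 = 0" "m * (n + 1) = m * n + m" "\<not> m < 0" "m < n + 1 \<longleftrightarrow> m < n \<or> m = n" for m n :: element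
  using weak_arith_element unfolding weak_arith_def basic_axioms_def by simp_all

text \<open>The predicate is tied explicitly to a formula, in which variable \<open>0\<close> is the
  induction variable and \<open>e\<close> supplies the parameters.\<close>

lemma element_induct1:
  assumes "Sigma 1 \<phi>" and P: "\<And>n. P n \<longleftrightarrow> sat element_struc (\<lambda>_. {}) (e(0 := n)) \<phi>"
    and "P 0" and "\<And>n. P n \<Longrightarrow> P (n + 1)"
  shows "P n"
proof -
  have "sigma1_induction element_struc {{}}" using weak_arith_element unfolding weak_arith_def by blast
  from this[unfolded sigma1_induction_def, rule_format, OF assms(1), of "\<lambda>_. {}" e 0 n]
  show ?thesis using assms(3,4) unfolding P element_struc_simps by blast
qed

lemma element_induct:
  assumes "bounded \<phi>" and "\<And>n. P n \<longleftrightarrow> sat element_struc (\<lambda>_. {}) (e(0 := n)) \<phi>"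
    and "P 0" and "\<And>n. P n \<Longrightarrow> P (n + 1)"
  shows "P n"
proof -
  have "Sigma 1 \<phi>" unfolding One_nat_def by (intro SigmaPi Pi0 assms(1))
  then show ?thesis using assms(2-4) by (rule element_induct1)
qed

lemma element_zero_add: "0 + n = n" for n :: element
  by (induct n rule: element_induct[where \<phi>="Eq (Plus Zero (Var 0)) (Var 0)" and e="\<lambda>_. 0"])
    (simp, simp, metis element_axioms(3), metis element_axioms(4))

lemma element_succ_add: "m + 1 + n = m + n + 1" for m n :: element
  by (induct n rule: element_induct[where \<phi>="Eq (Plus (Plus (Var 1) One) (Var 0)) (Plus (Plus (Var 1) (Var 0)) One)" and e="\<lambda>_. m"])
    (simp, simp, metis element_axioms(3), metis element_axioms(4))

lemma element_add_comm: "m + n = n + m" for m n :: element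
  by (induct n rule: element_induct[where \<phi>="Eq (Plus (Var 1) (Var 0)) (Plus (Var 0) (Var 1))" and e="\<lambda>_. m"])
    (simp, simp, metis element_axioms(3) element_zero_add, metis element_axioms(4) element_succ_add)

lemma element_add_ass: "a + b + n = a + (b + n)" for a b n :: element
  by (induct n rule: element_induct[where \<phi>="Eq (Plus (Plus (Var 1) (Var 2)) (Var 0)) (Plus (Var 1) (Plus (Var 2) (Var 0)))" and e="(\<lambda>_. a)(2 := b)"])
    (simp, simp, metis element_axioms(3), metis element_axioms(4))

lemma element_add_lcomm: "a + (b + c) = b + (a + c)" for a b c :: element
  by (metis element_add_comm element_add_ass)

lemma element_zero_mul: "0 * n = 0" for n :: element
  by (induct n rule: element_induct[where \<phi>="Eq (Times Zero (Var 0)) Zero" and e="\<lambda>_. 0"])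
    (simp, simp, metis element_axioms(5), metis element_axioms(3,6))

lemma element_succ_mul: "(m + 1) * n = m * n + n" for m n :: element
  by (induct n rule: element_induct[where \<phi>="Eq (Times (Plus (Var 1) One) (Var 0)) (Plus (Times (Var 1) (Var 0)) (Var 0))" and e="\<lambda>_. m"])
    (simp, simp, metis element_axioms(3,5), metis element_axioms(6) element_add_ass element_add_lcomm element_add_comm)

lemma element_mul_comm: "m * n = n * m" for m n :: element
  by (induct n rule: element_induct[where \<phi>="Eq (Times (Var 1) (Var 0)) (Times (Var 0) (Var 1))" and e="\<lambda>_. m"])
    (simp, simp, metis element_axioms(5) element_zero_mul, metis element_axioms(6) element_succ_mul)

lemma element_distrib: "(a + b) * n = a * n + b * n" for a b n :: element
  by (induct n rule: element_induct[where \<phi>="Eq (Times (Plus (Var 1) (Var 2)) (Var 0)) (Plus (Times (Var 1) (Var 0)) (Times (Var 2) (Var 0)))" and e="(\<lambda>_. a)(2 := b)"])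
    (simp, simp, metis element_axioms(3,5), metis element_axioms(6) element_add_ass element_add_lcomm element_add_comm)

lemma element_distrib_left: "n * (a + b) = n * a + n * b" for a b n :: element
  by (metis element_distrib element_mul_comm)

lemma element_mul_ass: "a * b * n = a * (b * n)" for a b n :: element
  by (induct n rule: element_induct[where \<phi>="Eq (Times (Times (Var 1) (Var 2)) (Var 0)) (Times (Var 1) (Times (Var 2) (Var 0)))" and e="(\<lambda>_. a)(2 := b)"])
    (simp, simp, metis element_axioms(5), metis element_axioms(6) element_distrib_left)

lemma element_one_mul: "1 * n = n" for n :: element
  by (metis element_succ_mul element_zero_mul element_zero_add)

lemma element_cancel: "a + n = b + n \<longrightarrow> a = b" for a b n :: element
  by (induct n rule: element_induct[where \<phi>="Imp (Eq (Plus (Var 1) (Var 0)) (Plus (Var 2) (Var 0))) (Eq (Var 1) (Var 2))" and e="(\<lambda>_. a)(2 := b)"])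
    (simp, simp, metis element_axioms(3), metis element_axioms(2,4))

lemma element_less_add: "x < x + (d + 1)" for x d :: element
  by (induct d rule: element_induct[where \<phi>="Less (Var 1) (Plus (Var 1) (Plus (Var 0) One))" and e="\<lambda>_. x"])
    (simp, simp, metis element_axioms(8) element_zero_add, metis element_axioms(4,8))

text \<open>The existential quantifier is moved in front of the implication to obtain a Sigma_1
  formula.\<close>

lemma element_less_ex: "x < y \<longrightarrow> (\<exists>d. y = x + (d + 1))" for x y :: element
proof (rule element_induct1[where P="\<lambda>y. x < y \<longrightarrow> (\<exists>d. y = x + (d + 1))" and e="\<lambda>_. x"
      and \<phi>="Ex 2 (Imp (Less (Var 1) (Var 0)) (Eq (Var 0) (Plus (Var 1) (Plus (Var 2) One))))"])
  show "Sigma 1 (Ex 2 (Imp (Less (Var 1) (Var 0)) (Eq (Var 0) (Plus (Var 1) (Plus (Var 2) One)))))"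
    unfolding One_nat_def by (intro SigmaEx SigmaPi Pi0) simp
  fix n assume n: "x < n \<longrightarrow> (\<exists>d. n = x + (d + 1))"
  show "x < n + 1 \<longrightarrow> (\<exists>d. n + 1 = x + (d + 1))"
  proof
    assume "x < n + 1"
    then consider "x < n" | "n = x" unfolding element_axioms by blast
    then show "\<exists>d. n + 1 = x + (d + 1)"
    proof cases
      case 1
      then obtain d where "n = x + (d + 1)" using n by blast
      then have "n + 1 = x + ((d + 1) + 1)" using element_axioms(4) by simp
      then show ?thesis by blast
    next
      case 2
      then have "n + 1 = x + (0 + 1)" by (simp add: element_zero_add)
      then show ?thesis by blast
    qed
  qed
qed (simp_all add: element_axioms)

lemma element_less_iff: "x < y \<longleftrightarrow> (\<exists>d. y = x + (d + 1))" for x y :: element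
  using element_less_ex element_less_add by blast

lemma element_zero_or_succ: "n = 0 \<or> (\<exists>d. n = d + 1)" for n :: element
proof -
  have "n = 0 \<or> 0 < n"
    by (induct n rule: element_induct[where \<phi>="Disj (Eq (Var 0) Zero) (Less Zero (Var 0))" and e="\<lambda>_. 0"])
      (auto simp: element_axioms)
  then show ?thesis unfolding element_less_iff by (auto simp: element_zero_add)
qed

lemma element_trichotomy: "x < y \<or> x = y \<or> y < x" for x y :: element
proof (rule element_induct[where \<phi>="Disj (Less (Var 0) (Var 1)) (Disj (Eq (Var 0) (Var 1)) (Less (Var 1) (Var 0)))" and e="\<lambda>_. y" and P="\<lambda>x. x < y \<or> x = y \<or> y < x"])
  show "0 < y \<or> 0 = y \<or> y < 0" using element_zero_or_succ[of y] unfolding element_less_iff by (auto simp: element_zero_add)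
  fix n assume "n < y \<or> n = y \<or> y < n"
  moreover have "n + 1 < y \<or> n + 1 = y" if n: "n < y"
  proof -
    obtain d where d: "y = n + (d + 1)" using n unfolding element_less_iff by blast
    then have "y = n + 1 + d" using element_succ_add[of n d] element_axioms(4)[of n d] by simp
    then show ?thesis using element_zero_or_succ[of d] unfolding element_less_iff by (auto simp: element_axioms)
  qed
  ultimately show "n + 1 < y \<or> n + 1 = y \<or> y < n + 1" by (auto simp: element_axioms)
qed simp_all

lemma element_irrefl: "\<not> x < x" for x :: element
proof
  assume "x < x"
  then obtain d where "x = x + (d + 1)" unfolding element_less_iff by blast
  then have "0 + x = (d + 1) + x" by (simp add: element_zero_add element_add_comm)
  then have "0 = d + 1" using element_cancel by blast
  then show False using element_axioms(1)[of d] by simp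
qed

lemma element_trans: "x < y \<Longrightarrow> y < z \<Longrightarrow> x < z" for x y z :: element
proof -
  assume "x < y" "y < z"
  then obtain d d' where "y = x + (d + 1)" "z = y + (d' + 1)" unfolding element_less_iff by blast
  then have "z = x + ((d + 1 + d') + 1)" by (simp add: element_add_ass)
  then show "x < z" unfolding element_less_iff by blast
qed

lemma element_mul_less: "a < b \<Longrightarrow> 0 < c \<Longrightarrow> c * a < c * b" for a b c :: element
proof -
  assume "a < b" "0 < c"
  then obtain d c' where d: "b = a + (d + 1)" and c: "c = c' + 1" unfolding element_less_iff by (auto simp: element_zero_add)
  have "c * b = c * a + (c * d + c)" unfolding d element_distrib_left[of c a] element_axioms(6) ..
  also have "c * d + c = (c * d + c') + 1" unfolding c by (simp add: element_axioms)
  finally show "c * a < c * b" unfolding element_less_iff by blast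
qed

lemma element_add_less: "a < b \<Longrightarrow> c + a < c + b" for a b c :: element
  unfolding element_less_iff by (metis element_add_ass)

lemma element_less_or_add: "a < b \<or> (\<exists>d. a = b + d)" for a b :: element
  using element_trichotomy[of a b] element_axioms(3)[of b] unfolding element_less_iff by metis

instantiation element :: minus
begin
text \<open>Truncated subtraction, as \<open>linordered_semidom\<close> demands: the value is
  \<open>0\<close> where no difference exists.\<close>

definition "x - y = (if \<exists>d. x = y + d then THE d. x = y + d else (0::element))"
instance ..
end

lemma element_add_diff: "b + d - b = d" for b d :: element
proof -
  have "e = d" if "b + d = b + e" for e using element_cancel[of d b e] that by (simp add: element_add_comm)
  then have "(THE e. b + d = b + e) = d" by blast
  then show ?thesis unfolding minus_element_def by auto
qed

lemma element_less_diff: "a < b \<Longrightarrow> a - b = 0" for a b :: element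
proof -
  assume ab: "a < b"
  have False if "a = b + d" for d
  proof -
    obtain c where "b = a + (c + 1)" using ab unfolding element_less_iff by blast
    then have "a = a + ((c + d) + 1)" using that by (metis element_add_ass element_add_comm)
    then have "a < a" unfolding element_less_iff by blast
    then show False using element_irrefl[of a] by contradiction
  qed
  then show ?thesis unfolding minus_element_def by auto
qed

instance element :: linordered_semidom
proof
  fix a b c :: element
  show "a + b + c = a + (b + c)" by (rule element_add_ass)
  show "a + b = b + a" by (rule element_add_comm)
  show "0 + a = a" by (rule element_zero_add)
  show "a * b * c = a * (b * c)" by (rule element_mul_ass)
  show "a * b = b * a" by (rule element_mul_comm)
  show "1 * a = a" by (rule element_one_mul)
  show "(a + b) * c = a * c + b * c" by (rule element_distrib)
  show "a * (b + c) = a * b + a * c" by (rule element_distrib_left)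
  show "0 * a = 0" by (rule element_zero_mul)
  show "a * 0 = 0" by (rule element_axioms)
  show "a + b - a = b" by (rule element_add_diff)
  show "a - b - c = a - (b + c)"
  proof (cases "a < b")
    case True
    have "b < b + c \<or> b = b + c" using element_zero_or_succ[of c] unfolding element_less_iff by (auto simp: element_axioms)
    then have "a < b + c" using True element_trans by metis
    moreover have "0 - c = 0" using element_zero_or_succ[of c] element_less_diff[of 0 c] element_add_diff[of 0 0] unfolding element_less_iff
      by (auto simp: element_zero_add)
    ultimately show ?thesis using True by (simp add: element_less_diff)
  next
    case False
    then obtain d where d: "a = b + d" using element_less_or_add by blast
    show ?thesis
    proof (cases "d < c")
      case True
      then show ?thesis using element_add_less[OF True, of b] unfolding d by (simp add: element_add_diff element_less_diff)
    next
      case False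
      then obtain e where "d = c + e" using element_less_or_add by blast
      then show ?thesis unfolding d using element_add_diff[of "b + c" e] by (simp add: element_add_diff element_add_ass)
    qed
  qed
  show "a * (b - c) = a * b - a * c"
  proof (cases "b < c")
    case True
    show ?thesis
    proof (cases "a = 0")
      case True
      then show ?thesis using element_add_diff[of 0 0] by (simp add: element_zero_mul element_zero_add)
    next
      case False
      then have "0 < a" using element_trichotomy[of 0 a] element_axioms(7)[of a] by blast
      then show ?thesis using element_mul_less[OF \<open>b < c\<close>] \<open>b < c\<close> by (simp add: element_less_diff element_axioms)
    qed
  next
    case False
    then obtain d where "b = c + d" using element_less_or_add by blast
    then show ?thesis by (simp add: element_distrib_left element_add_diff)
  qed
  show "(0::element) \<noteq> 1" using element_axioms(1)[of 0] by (simp add: element_zero_add)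
  show "(0::element) < 1" unfolding element_less_iff by (metis element_zero_add)
  show "a * b \<noteq> 0" if "a \<noteq> 0" "b \<noteq> 0"
  proof -
    have "0 < a" "0 < b" using that element_trichotomy[of 0] element_axioms(7) by metis+
    then show ?thesis using element_mul_less[of 0 b a] element_irrefl by (metis element_axioms(5))
  qed
  show "a < b \<longleftrightarrow> a \<le> b \<and> \<not> b \<le> a" unfolding less_eq_element_def using element_trans[of a b a] element_irrefl[of a] by blast
  show "a \<le> a" unfolding less_eq_element_def by simp
  show "a \<le> b \<Longrightarrow> b \<le> c \<Longrightarrow> a \<le> c" unfolding less_eq_element_def using element_trans[of a b c] by blast
  show "a \<le> b \<Longrightarrow> b \<le> a \<Longrightarrow> a = b" unfolding less_eq_element_def using element_trans[of a b a] element_irrefl[of a] by blast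
  show "a \<le> b \<or> b \<le> a" unfolding less_eq_element_def using element_trichotomy[of a b] by blast
  show "a \<le> b \<Longrightarrow> c + a \<le> c + b" unfolding less_eq_element_def using element_add_less[of a b c] by blast
  show "a < b \<Longrightarrow> 0 < c \<Longrightarrow> c * a < c * b" by (rule element_mul_less)
  show "b \<le> a \<Longrightarrow> a - b + b = a"
  proof -
    assume "b \<le> a"
    then obtain d where "a = b + d" unfolding less_eq_element_def element_less_iff using element_axioms(3)[of b] by metis
    then show ?thesis by (simp add: element_add_diff element_add_comm)
  qed
qed

instance element :: parith
proof
  show "\<exists>f. inj (f :: element \<Rightarrow> nat)" by (rule exI[of _ index]) (auto simp: inj_def intro: element.expand)
  fix x y :: element
  show "0 \<le> x" using element_axioms(7)[of x] not_less by blast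
  show "x + 1 \<le> y" if "x < y"
  proof (rule ccontr)
    assume "\<not> ?thesis"
    then have "y < x + 1" by simp
    then show False using that element_axioms(8)[of y x] by auto
  qed
qed

lemma element_struc_eq: "element_struc = SM"
  unfolding element_struc_def SM_def ..

lemma extension_property_candidate: "extension_property candidate"
proof -
  have "extension_property (SM :: element struc)"
    unfolding extension_property_def SM_simps
  proof (intro allI impI)
    fix S T and p q :: element
    assume "countable S" "rca0 SM S" "wphp2 SM S" "is_tree SM T" "delta02 SM S T" "p + p < q"
      "mu_ge SM T (q + (p + p)) (q + q)"
    then show "\<exists>X. in_paths SM T X \<and> rca0 SM (extend SM S X) \<and> wphp2 SM (extend SM S X)"
      by (intro parith_random_extension[of S T q p]) (auto intro: le_less_trans[OF parith_nonneg])
  qed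
  then show ?thesis
    using rel_funD[OF extension_property_transfer[OF element_rel(1,2)] element_rel(3)] element_struc_eq by simp
qed

section \<open>Reduction of an arbitrary countable model to \<open>candidate\<close>\<close>

lemma struc_isomorphic_nat:
  assumes "bij (f :: 'm \<Rightarrow> nat)"
  obtains B where "struc_rel (\<lambda>x y. y = f x) A B"
proof
  let ?g = "inv f"
  have [simp]: "?g (f x) = x" for x using assms by (simp add: bij_is_inj)
  show "struc_rel (\<lambda>x y. y = f x) A \<lparr>szero = f (szero A), sone = f (sone A), sadd = \<lambda>x y. f (sadd A (?g x) (?g y)),
    smul = \<lambda>x y. f (smul A (?g x) (?g y)), sless = \<lambda>x y. sless A (?g x) (?g y)\<rparr>"
    unfolding struc_rel_def rel_fun_def by simp
qed

text \<open>On a finite universe the injective successor function would be surjective and reach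
  zero.\<close>

lemma infinite_basic_axioms:
  fixes A :: "'m struc"
  assumes "basic_axioms A" shows "infinite (UNIV :: 'm set)"
proof
  assume "finite (UNIV :: 'm set)"
  moreover have "inj (\<lambda>n. sadd A n (sone A))" using assms unfolding basic_axioms_def inj_def by blast
  ultimately have "surj (\<lambda>n. sadd A n (sone A))" by (rule finite_UNIV_inj_surj)
  then obtain n where "szero A = sadd A n (sone A)" by (rule surjE)
  then show False using assms unfolding basic_axioms_def by metis
qed

lemma sigma1_induction_subset:
  assumes "sigma1_induction A S" "S' \<subseteq> S" shows "sigma1_induction A S'"
  unfolding sigma1_induction_def
proof (intro allI impI)
  fix \<phi> V e x n assume "Sigma 1 \<phi>" "\<forall>i. V i \<in> S'"
    "sat A V (e(x := szero A)) \<phi> \<and> (\<forall>n. sat A V (e(x := n)) \<phi> \<longrightarrow> sat A V (e(x := sadd A n (sone A))) \<phi>)"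
  then show "sat A V (e(x := n)) \<phi>"
    using assms(1)[unfolded sigma1_induction_def, rule_format, of \<phi> V e x n] assms(2) by blast
qed

lemma rca0_empty: assumes "rca0 A S" "V \<in> S" shows "{} \<in> S"
proof -
  have "Sigma 1 (Less Zero Zero)" "Pi 1 (Less Zero Zero)" unfolding One_nat_def
    by (rule SigmaPi, rule Pi0, simp) (rule PiSigma, rule Sigma0, simp)
  note * = this
  have "delta1_comprehension A S" using assms(1) unfolding rca0_def by blast
  from this[unfolded delta1_comprehension_def, rule_format, OF *, of "\<lambda>_. V" "\<lambda>_. szero A" 0]
  have "{n. sat A (\<lambda>_. V) ((\<lambda>_. szero A)(0 := n)) (Less Zero Zero)} \<in> S" using assms(2) by simp
  moreover have "\<not> sless A (szero A) (szero A)" using assms(1) unfolding rca0_def basic_axioms_def by blast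
  ultimately show ?thesis by simp
qed

theorem theorem4p3:
  fixes A :: "'m struc" and S :: "'m set set" and T :: "'m set" and p q :: 'm
  assumes "countable (UNIV :: 'm set)" and "countable S"
    and "principal A S" and "rca0 A S" and "wphp2 A S"
    and "is_tree A T" and "delta02 A S T" and "regular A T"
    and "sless A (szero A) p" and "sless A (sadd A p p) q"
    and "mu_ge A T (sadd A q (sadd A p p)) (sadd A q q)"
  shows "\<exists>X. in_paths A T X \<and> rca0 A (extend A S X) \<and> wphp2 A (extend A S X)"
proof -
  have ax: "basic_axioms A" using assms(4) unfolding rca0_def by blast
  \<comment> \<open>The set parameters in the definition of \<open>T\<close> show that
    \<open>S\<close> is not empty.\<close>
  obtain V where "V \<in> S" using assms(7) unfolding delta02_def by blast
  then have "{} \<in> S" using rca0_empty[OF assms(4)] by blast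
  moreover have "sigma1_induction A S" using assms(4) unfolding rca0_def by blast
  ultimately have "sigma1_induction A {{}}" using sigma1_induction_subset[of A S "{{}}"] by blast
  then have A: "weak_arith A" using ax unfolding weak_arith_def by blast
  obtain f :: "'m \<Rightarrow> nat" where f: "bij f"
    using countableE_infinite[OF assms(1) infinite_basic_axioms[OF ax]] by blast
  obtain B where B: "struc_rel (\<lambda>x y. y = f x) A B" using struc_isomorphic_nat[OF f] .
  have bi: "bi_unique (\<lambda>x y. y = f x)" "bi_total (\<lambda>x y. y = f x)"
    using f unfolding bi_unique_def bi_total_def by (auto dest: bij_is_inj injD bij_is_surj elim: surjE)
  have "weak_arith B" using rel_funD[OF weak_arith_transfer[OF bi] B] A by simp
  \<comment> \<open>If any structure on the natural numbers were a counterexample,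
    \<open>candidate\<close> would be one.\<close>
  then have "extension_property B" by (rule candidate_counterexample[OF _ extension_property_candidate])
  then have "extension_property A" using rel_funD[OF extension_property_transfer[OF bi] B] by simp
  then show ?thesis using assms(2,4-7,10,11) unfolding extension_property_def by blast
qed

end
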